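(* For any $\epsilon>0$, for integers $l\ge1$ and $k$ with $2k\ge12$, $k\equiv0\pmod 2$ and $l\ll k^2$, we have $$\sum_{f\in H_{2k}(1)}\omega_f\,\lambda_f(l)\,L_f(1/2)^2=\frac{2\tau(l)}{\sqrt l}\big(2\log k-\log l-2\log 2\pi+2\gamma\big)+O\Big(\frac{l^{1/2+\epsilon}}{\sqrt k}\Big).$$
   Context: $H_{2k}(1)$ is the set of primitive forms (normalized holomorphic Hecke cusp eigenforms) of level $1$ and weight $2k\ge12$; $f(z)=\sum_{n\ge1}\lambda_f(n)n^{(2k-1)/2}e(nz)$, $e(x)=\exp(2\pi ix)$, $\lambda_f(1)=1$. $L_f(s)=\sum_{n\ge1}\lambda_f(n)n^{-s}$ for $\Re s>1$, continued analytically to $\mathbf C$. The harmonic weight is $\omega_f=\frac{\Gamma(2k-1)}{(4\pi)^{2k-1}\langle f,f\rangle_1}$, where $\langle\cdot,\cdot\rangle_1$ is the Petersson inner product on level $1$ forms, $\langle f,f\rangle_1=\int_{SL_2(\mathbf Z)\backslash\mathbf H}|f(z)|^2y^{2k}\frac{dx\,dy}{y^2}$. $\tau(n)$ is the number of divisors of $n$ and $\gamma$ is Euler's constant. The condition $l\ll k^2$ means $l\le Ck^2$ for a fixed constant $C$; the implied constant in $O$ depends only on $\epsilon$ and $C$. *)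

theory Defs
  imports "HOL-Complex_Analysis.Complex_Analysis"
begin

definition upper_half_plane :: "complex set" where
  "upper_half_plane = {z. Im z > 0}"

definition e :: "complex \<Rightarrow> complex" where
  "e x = exp (2 * of_real pi * \<i> * x)"

definition has_fourier_expansion :: "(complex \<Rightarrow> complex) \<Rightarrow> (nat \<Rightarrow> complex) \<Rightarrow> bool" where
  "has_fourier_expansion f a \<longleftrightarrow>
     (\<forall>z\<in>upper_half_plane. (\<lambda>n. a n * e (of_nat n * z)) sums f z)"

definition fourier_coeff :: "(complex \<Rightarrow> complex) \<Rightarrow> nat \<Rightarrow> complex" where
  "fourier_coeff f = (THE a. has_fourier_expansion f a)"

text \<open>
  Cusp forms of weight \<open>w\<close> for the full modular group. A form is a function on the upper
  half-plane, represented here by its extension by zero to the complex plane; without this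
  convention a form would correspond to infinitely many functions of type
  \<open>complex \<Rightarrow> complex\<close>, and sums over forms would degenerate.
\<close>
definition cusp_form :: "nat \<Rightarrow> (complex \<Rightarrow> complex) \<Rightarrow> bool" where
  "cusp_form w f \<longleftrightarrow>
     f holomorphic_on upper_half_plane \<and>
     (\<forall>z. z \<notin> upper_half_plane \<longrightarrow> f z = 0) \<and>
     (\<forall>a b c d :: int. a * d - b * c = 1 \<longrightarrow>
        (\<forall>z\<in>upper_half_plane.
           f ((of_int a * z + of_int b) / (of_int c * z + of_int d)) =
           (of_int c * z + of_int d) ^ w * f z)) \<and>
     (\<exists>a. has_fourier_expansion f a \<and> a 0 = 0)"

text \<open>
  The \<open>n\<close>-th Hecke operator in weight \<open>w\<close>,
  \<open>n^(w-1) \<Sum>_{ad = n} \<Sum>_{0 \<le> b < d} d^(-w) f ((a z + b) / d)\<close>.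
\<close>
definition hecke_operator :: "nat \<Rightarrow> nat \<Rightarrow> (complex \<Rightarrow> complex) \<Rightarrow> complex \<Rightarrow> complex" where
  "hecke_operator w n f z =
     of_nat n powi (int w - 1) *
     (\<Sum>d | d dvd n. \<Sum>b<d.
        f ((of_nat (n div d) * z + of_nat b) / of_nat d) / of_nat d ^ w)"

definition primitive_forms :: "nat \<Rightarrow> (complex \<Rightarrow> complex) set" where
  "primitive_forms w =
     {f. cusp_form w f \<and> fourier_coeff f 1 = 1 \<and>
         (\<forall>n\<ge>1. \<exists>\<mu>. \<forall>z\<in>upper_half_plane. hecke_operator w n f z = \<mu> * f z)}"

definition hecke_coeff :: "nat \<Rightarrow> (complex \<Rightarrow> complex) \<Rightarrow> nat \<Rightarrow> complex" where
  "hecke_coeff w f n = fourier_coeff f n / of_real (real n powr ((real w - 1) / 2))"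

text \<open>The entire function continuing the Dirichlet series of the normalised coefficients.\<close>
definition L_function :: "nat \<Rightarrow> (complex \<Rightarrow> complex) \<Rightarrow> complex \<Rightarrow> complex" where
  "L_function w f =
     (THE L. L holomorphic_on UNIV \<and>
        (\<forall>s. Re s > 1 \<longrightarrow>
           (\<lambda>n. hecke_coeff w f (Suc n) * of_nat (Suc n) powr (- s)) sums L s))"

text \<open>
  The standard fundamental domain for \<open>SL_2(\<int>)\<close>; its boundary is a null set, so
  including all of it does not affect integrals.
\<close>
definition fundamental_domain :: "complex set" where
  "fundamental_domain = {z\<in>upper_half_plane. \<bar>Re z\<bar> \<le> 1 / 2 \<and> norm z \<ge> 1}"

definition petersson :: "nat \<Rightarrow> (complex \<Rightarrow> complex) \<Rightarrow> (complex \<Rightarrow> complex) \<Rightarrow> complex" where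
  "petersson w f g =
     (LINT z:fundamental_domain|lborel. f z * cnj (g z) * of_real (Im z ^ w / (Im z)\<^sup>2))"

definition harmonic_weight :: "nat \<Rightarrow> (complex \<Rightarrow> complex) \<Rightarrow> complex" where
  "harmonic_weight w f =
     of_real (Gamma (real w - 1)) / (of_real ((4 * pi) powr (real w - 1)) * petersson w f f)"

definition divisor_count :: "nat \<Rightarrow> nat" where
  "divisor_count n = card {d. d dvd n}"

end

theory Submission
  imports Defs "HOL-Computational_Algebra.Fundamental_Theorem_Algebra" "HOL-Probability.Sinc_Integral"
begin

text \<open>
  Let \<open>h(z, z')\<close> be the sum of \<open>(c z z' + d z' + a z + b) ^ (- 2 k)\<close> over all integral matrices of
  determinant \<open>l\<close>. For fixed \<open>z'\<close> it is a cusp form in \<open>z\<close>, and by unfolding and the Lipschitz formula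
  its Petersson product with a cusp form \<open>F\<close> is a multiple of the value of \<open>T\<^sub>l F\<close> at \<open>- cnj z'\<close>. The Hecke
  operators are commuting self-adjoint operators on a finite-dimensional space, so the primitive forms
  are an orthogonal basis and \<open>l ^ (2 k - 1) h(z, z')\<close> is a constant times
  \<open>\<Sum>f. a\<^sub>f(l) f(z) f(z') / \<langle>f, f\<rangle>\<close>.

  Integrating over both imaginary half-axes against \<open>(y y') ^ (k - 1)\<close> turns \<open>f(z) f(z')\<close> into the square of
  the completed central value. On the kernel side the inner integral of each term is a beta integral,
  which leaves the exact formula
  \<open>l powr (k - 1/2) \<i>^k / 2 * \<integral> y ^ (k - 1) \<Sum> (a \<i> y + b) ^ (- k) (c \<i> y + d) ^ (- k) dy\<close>
  for the moment. The matrices with a zero entry have an elementary antiderivative and give the main term,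
  with the harmonic number \<open>H (k - 1)\<close> in place of \<open>ln k + \<gamma>\<close>. For the others the modulus of the integrand
  is dominated by the derivative of an arctangent, and the divisor bound sums these estimates to
  \<open>O(l powr (1/2 + \<epsilon>) / sqrt k)\<close>. Neither Kloosterman sums nor Bessel functions occur.
\<close>

text \<open>The order of the two integrations shapes the argument. In the second variable the kernel
  may be integrated term by term; afterwards a matrix with a zero entry leaves a term that decays
  only like \<open>1 / y\<close> at an end of the half-axis and is not integrable by itself. Such
  terms are first summed over their free entry by the Lipschitz formula, and the
  \<open>1 / y\<close> tails then cancel inside each group. Integrability of this whole part is
  inferred by subtraction: the full integrand is a finite combination of cusp forms on the axis, and
  the part from matrices without zero entries is integrable. The error term has two sources. A
  matrix of determinant \<open>l\<close> without zero entries has \<open>|ad| + |bc| >= l\<close>,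
  and the power \<open>k - 1\<close> of this quantity absorbs \<open>l powr (k - 1/2)\<close> down
  to about the square root of \<open>l\<close>; the width of the peak of the integrand in
  \<open>y\<close> gives \<open>1 / sqrt k\<close>. Modularity and self-adjointness of the Hecke
  operators and the spectral expansion are read off from one kernel; finite dimension comes from a
  bound on the number of leading Fourier coefficients that can vanish.\<close>

abbreviation ipos :: "real \<Rightarrow> 'a::zero_neq_one" where "ipos \<equiv> indicator {0<..}"

section \<open>Fourier expansions\<close>

abbreviation HH :: "complex set" where "HH \<equiv> upper_half_plane"

lemma HH_iff [simp]: "z \<in> HH \<longleftrightarrow> Im z > 0"
  by (simp add: upper_half_plane_def)

lemma open_HH [simp]: "open HH"
  unfolding upper_half_plane_def by (rule open_halfspace_Im_gt)

lemma convex_HH: "convex HH"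
  unfolding upper_half_plane_def by (rule convex_halfspace_Im_gt)

lemma norm_e: "norm (e z) = exp (- 2 * pi * Im z)"
  by (simp add: e_def)

lemma e_add: "e (a + b) = e a * e b"
  by (simp add: e_def ring_distribs exp_add)

lemma e_0 [simp]: "e 0 = 1" by (simp add: e_def)

lemma e_of_int [simp]: "e (of_int n) = 1"
  using exp_integer_2pi[of "of_int n"] by (simp add: e_def mult_ac)

lemma e_of_nat [simp]: "e (of_nat n) = 1"
  using e_of_int[of "int n"] by simp

lemma e_of_nat_mult: "e (of_nat n * z) = e z ^ n"
  by (simp add: e_def exp_of_nat_mult[symmetric] mult_ac)

lemma e_nonzero [simp]: "e z \<noteq> 0" by (simp add: e_def)

lemma e_eq_iff: "e a = e b \<longleftrightarrow> (\<exists>n::int. a = b + of_int n)"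
proof -
  have "(2 * of_real pi * \<i> * a = 2 * of_real pi * \<i> * b + (of_int (2 * n) * pi) * \<i>)
        \<longleftrightarrow> a = b + of_int n" for n
  proof -
    have "2 * of_real pi * \<i> * b + (of_int (2 * n) * pi) * \<i> = 2 * of_real pi * \<i> * (b + of_int n)"
      by (simp add: algebra_simps)
    thus ?thesis by simp
  qed
  thus ?thesis unfolding e_def exp_eq by simp
qed

lemma holomorphic_e [holomorphic_intros]: "f holomorphic_on A \<Longrightarrow> (\<lambda>z. e (f z)) holomorphic_on A"
  unfolding e_def by (intro holomorphic_intros)

lemma continuous_on_e [continuous_intros]: "continuous_on A f \<Longrightarrow> continuous_on A (\<lambda>z. e (f z))"
  unfolding e_def by (intro continuous_intros)

text \<open>A right inverse of \<open>e\<close> on the punctured plane. The principal logarithm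
  jumps along the negative axis, but after the division the jump is 1, which periodic functions do
  not see.\<close>

definition logq :: "complex \<Rightarrow> complex" where "logq q = Ln q / (2 * of_real pi * \<i>)"

lemma e_logq [simp]: "q \<noteq> 0 \<Longrightarrow> e (logq q) = q"
  by (simp add: logq_def e_def)

lemma Im_logq: "q \<noteq> 0 \<Longrightarrow> Im (logq q) = - ln (norm q) / (2 * pi)"
  by (simp add: logq_def Im_divide power2_eq_square)

lemma logq_in_HH: "q \<noteq> 0 \<Longrightarrow> norm q < 1 \<Longrightarrow> logq q \<in> HH"
  by (simp add: Im_logq divide_neg_pos)

text \<open>Since \<open>e\<close> maps the half-plane onto the punctured unit disc, this is the
  uniqueness theorem for power series in \<open>q = e z\<close>; the centre, which \<open>e\<close>
  misses, is recovered as a limit.\<close>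

lemma fourier_zero:
  assumes "\<And>z. z \<in> HH \<Longrightarrow> (\<lambda>n. c n * e (of_nat n * z)) sums 0"
  shows "c n = 0"
proof -
  have s: "(\<lambda>n. c n * q ^ n) sums 0" if "q \<noteq> 0" "norm q < 1" for q
    using assms[OF logq_in_HH[OF that]] that by (simp add: e_of_nat_mult)
  have "((\<lambda>_. 0) \<longlongrightarrow> c 0) (at (0::complex))"
    by (rule powser_limit_0_strong[of 1]) (use s in auto)
  hence c0: "c 0 = 0" using LIM_const_eq by metis
  have s': "(\<lambda>n. c n * (q-0) ^ n) sums 0" if "norm (q-0) < 1" for q
    using s[of q] that c0 by (cases "q = 0") auto
  show ?thesis
  proof (rule ccontr)
    assume "c n \<noteq> 0"
    with c0 have "n > 0" by (cases n) auto
    show False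
    proof (rule powser_0_nonzero[of 1 "0::complex" c "\<lambda>_. 0" n])
      fix r :: real assume "0 < r" and r: "\<And>z::complex. z \<in> cball 0 r - {0} \<Longrightarrow> (0::complex) \<noteq> 0"
      with r[of "complex_of_real r"] show False by auto
    qed (use s' \<open>c n \<noteq> 0\<close> \<open>n > 0\<close> in auto)
  qed
qed

lemma fourier_unique:
  assumes "has_fourier_expansion f a" "has_fourier_expansion f b"
  shows "a = b"
proof
  fix n
  have "a n - b n = 0"
  proof (rule fourier_zero[of "\<lambda>n. a n - b n"])
    fix z assume "z \<in> HH"
    hence "(\<lambda>n. a n * e (of_nat n * z) - b n * e (of_nat n * z)) sums (f z - f z)"
      using assms unfolding has_fourier_expansion_def by (intro sums_diff) auto
    thus "(\<lambda>n. (a n - b n) * e (of_nat n * z)) sums 0" by (simp add: algebra_simps)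
  qed
  thus "a n = b n" by simp
qed

lemma fourier_coeff_eq: "has_fourier_expansion f a \<Longrightarrow> fourier_coeff f = a"
  unfolding fourier_coeff_def using fourier_unique by blast

text \<open>A periodic function descends to the punctured disc in \<open>q = e z\<close>. Decay at
  the cusp makes \<open>q = 0\<close> a removable singularity with value 0, and the Taylor series
  there is the wanted expansion.\<close>

lemma fourier_exists:
  assumes hol: "f holomorphic_on HH" and per: "\<And>z. z \<in> HH \<Longrightarrow> f (z + 1) = f z"
    and lim: "\<And>\<epsilon>. \<epsilon> > 0 \<Longrightarrow> \<exists>Y. \<forall>z. \<bar>Re z\<bar> \<le> 1 \<and> Im z \<ge> Y \<longrightarrow> norm (f z) < \<epsilon>"
  obtains a where "has_fourier_expansion f a" "a 0 = 0"
proof -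
  have per_nat: "f (z + of_nat n) = f z" if "z \<in> HH" for z n
  proof (induction n)
    case (Suc n)
    have "z + of_nat (Suc n) = z + of_nat n + 1" by simp
    moreover have "z + of_nat n \<in> HH" using that by simp
    ultimately show ?case using per Suc.IH by metis
  qed simp
  have per_int: "f (z + of_int n) = f z" if "z \<in> HH" for z n
  proof (cases "n \<ge> 0")
    case True
    thus ?thesis using per_nat[OF that, of "nat n"] by simp
  next
    case False
    have "z + of_int n \<in> HH" using that by simp
    from per_nat[OF this, of "nat (-n)"] False show ?thesis by simp
  qed
  have f_eq: "f a = f b" if "e a = e b" "b \<in> HH" for a b
    using that per_int unfolding e_eq_iff by blast
  define g where "g q = f (logq q)" for q
  \<comment> \<open>\<open>logq\<close> may be discontinuous near \<open>q\<close>. A holomorphic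
    logarithm on a small disc around \<open>q\<close> differs from it by integers only, and
    periodicity makes the two compositions with \<open>f\<close> equal.\<close>
  have "g field_differentiable (at q)" if q: "q \<in> ball 0 1 - {0}" for q
  proof -
    define r where "r = min (norm q) (1 - norm q)"
    have r: "r > 0" using q by (auto simp: r_def)
    have nz: "x \<noteq> 0" "norm x < 1" if "x \<in> ball q r" for x
      using that norm_triangle_ineq2[of q x] norm_triangle_ineq2[of x q]
      by (auto simp: r_def dist_norm norm_minus_commute)
    obtain L where L: "L holomorphic_on ball q r" "\<And>x. x \<in> ball q r \<Longrightarrow> x = exp (L x)"
      using contractible_imp_holomorphic_log[of "\<lambda>x. x" "ball q r"] nz
      by (metis convex_ball convex_imp_contractible holomorphic_on_ident)
    define l where "l x = L x / (2 * of_real pi * \<i>)" for x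
    have el: "e (l x) = x" if "x \<in> ball q r" for x
      using L(2)[OF that] by (simp add: l_def e_def)
    have lH: "l x \<in> HH" if "x \<in> ball q r" for x
      using norm_e[of "l x"] el[OF that] nz[OF that]
      by (simp add: mult_less_0_iff zero_less_mult_iff)
    have "(\<lambda>x. f (l x)) holomorphic_on ball q r"
      by (rule holomorphic_on_compose_gen[OF _ hol, unfolded o_def])
         (use lH in \<open>auto simp: l_def intro!: holomorphic_intros L\<close>)
    also have "?this \<longleftrightarrow> g holomorphic_on ball q r"
    proof (rule holomorphic_cong[OF refl])
      fix x assume x: "x \<in> ball q r"
      show "f (l x) = g x" unfolding g_def
        by (rule f_eq) (use x nz el logq_in_HH in auto)
    qed
    finally show ?thesis using r by (metis at_within_open centre_in_ball holomorphic_on_def open_ball)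
  qed
  hence holg: "g holomorphic_on ball 0 1 - {0}"
    by (intro holomorphic_onI) (auto intro: field_differentiable_at_within)
  have limg: "g \<midarrow>0\<rightarrow> 0"
  proof (rule LIM_I)
    fix \<epsilon> :: real assume "\<epsilon> > 0"
    then obtain Y where Y: "\<And>z. \<bar>Re z\<bar> \<le> 1 \<Longrightarrow> Im z \<ge> Y \<Longrightarrow> norm (f z) < \<epsilon>" using lim by blast
    show "\<exists>s>0. \<forall>x. x \<noteq> 0 \<and> norm (x - 0) < s \<longrightarrow> norm (g x - 0) < \<epsilon>"
    proof (intro exI[of _ "exp (- 2 * pi * Y)"] conjI allI impI)
      fix x :: complex assume x: "x \<noteq> 0 \<and> norm (x - 0) < exp (- 2 * pi * Y)"
      hence "ln (norm x) < - 2 * pi * Y" by (metis diff_zero exp_gt_zero ln_exp ln_less_cancel_iff zero_less_norm_iff)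
      hence "Im (logq x) \<ge> Y" using x by (simp add: Im_logq field_simps)
      moreover have "\<bar>Re (logq x)\<bar> \<le> 1"
      proof -
        have "Re (logq x) = Im (Ln x) / (2 * pi)" by (simp add: logq_def Re_divide power2_eq_square)
        moreover have "\<bar>Im (Ln x)\<bar> \<le> pi" using Im_Ln_le_pi[of x] mpi_less_Im_Ln[of x] x by auto
        ultimately have "\<bar>Re (logq x)\<bar> \<le> pi / (2 * pi)"
          by (simp add: abs_divide divide_right_mono)
        thus ?thesis by simp
      qed
      ultimately show "norm (g x - 0) < \<epsilon>" using Y unfolding g_def by simp
    qed simp
  qed
  define G where "G q = (if q = 0 then 0 else g q)" for q
  have holG: "G holomorphic_on ball 0 1"
    unfolding G_def by (rule removable_singularity[OF holg _ limg]) simp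
  define a where "a n = (deriv ^^ n) G 0 / fact n" for n
  have sG: "(\<lambda>n. a n * q ^ n) sums G q" if "norm q < 1" for q
    using holomorphic_power_series[OF holG, of q] that by (simp add: a_def)
  show ?thesis
  proof (rule that[of a])
    show "has_fourier_expansion f a" unfolding has_fourier_expansion_def
    proof
      fix z assume z: "z \<in> HH"
      have n: "norm (e z) < 1" using z by (simp add: norm_e)
      have "g (e z) = f z" unfolding g_def
        by (rule f_eq) (use z in auto)
      with sG[OF n] show "(\<lambda>n. a n * e (of_nat n * z)) sums f z"
        by (simp add: e_of_nat_mult G_def)
    qed
    show "a 0 = 0" by (simp add: a_def G_def)
  qed
qed

section \<open>Integral matrices and the fundamental domain\<close>

type_synonym mat2 = "int \<times> int \<times> int \<times> int"

fun mnum :: "mat2 \<Rightarrow> complex \<Rightarrow> complex" where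
  "mnum (a, b, c, d) z = of_int a * z + of_int b"

fun mden :: "mat2 \<Rightarrow> complex \<Rightarrow> complex" where
  "mden (a, b, c, d) z = of_int c * z + of_int d"

definition mob :: "mat2 \<Rightarrow> complex \<Rightarrow> complex" where
  "mob M z = mnum M z / mden M z"

fun mmul :: "mat2 \<Rightarrow> mat2 \<Rightarrow> mat2" where
  "mmul (a, b, c, d) (a', b', c', d') = (a*a' + b*c', a*b' + b*d', c*a' + d*c', c*b' + d*d')"

fun mdet :: "mat2 \<Rightarrow> int" where "mdet (a, b, c, d) = a * d - b * c"

fun madj :: "mat2 \<Rightarrow> mat2" where "madj (a, b, c, d) = (d, -b, -c, a)"

definition mats :: "int \<Rightarrow> mat2 set" where "mats l = {M. mdet M = l}"

lemma mats_iff [simp]: "M \<in> mats l \<longleftrightarrow> mdet M = l"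
  by (simp add: mats_def)

lemma mdet_mmul [simp]: "mdet (mmul M N) = mdet M * mdet N"
  by (cases M; cases N) (simp add: algebra_simps)

lemma mdet_madj [simp]: "mdet (madj M) = mdet M"
  by (cases M) (simp add: algebra_simps)

lemma mmul_assoc: "mmul (mmul A B) C = mmul A (mmul B C)"
  by (cases A; cases B; cases C) (simp add: algebra_simps)

lemma mmul_madj: "mmul M (madj M) = (mdet M, 0, 0, mdet M)" "mmul (madj M) M = (mdet M, 0, 0, mdet M)"
  by (cases M; simp add: algebra_simps)+

lemma mmul_one [simp]: "mmul (1, 0, 0, 1) M = M" "mmul M (1, 0, 0, 1) = M"
  by (cases M; simp)+

lemma mden_nonzero:
  assumes "mdet M \<noteq> 0" "z \<in> HH" shows "mden M z \<noteq> 0"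
proof -
  obtain a b c d where M: "M = (a, b, c, d)" by (cases M)
  show ?thesis
  proof
    assume 0: "mden M z = 0"
    hence "Im (mden M z) = 0" by simp
    hence "c = 0" using assms by (simp add: M)
    with 0 assms show False by (simp add: M)
  qed
qed

lemma Im_mob:
  assumes "mdet M \<noteq> 0" "z \<in> HH"
  shows "Im (mob M z) = of_int (mdet M) * Im z / norm (mden M z) ^ 2"
proof -
  obtain a b c d where M: "M = (a, b, c, d)" by (cases M)
  have "norm (mden M z) ^ 2 = (Re (mden M z))^2 + (Im (mden M z))^2" by (simp add: cmod_power2)
  thus ?thesis
    by (simp add: mob_def M Im_divide) (simp add: algebra_simps)
qed

lemma mob_in_HH: "mdet M > 0 \<Longrightarrow> z \<in> HH \<Longrightarrow> mob M z \<in> HH"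
  using mden_nonzero[of M z] by (simp add: Im_mob)

lemma mnum_mmul:
  assumes "mden N z \<noteq> 0"
  shows "mnum (mmul M N) z = mnum M (mob N z) * mden N z"
    and "mden (mmul M N) z = mden M (mob N z) * mden N z"
  using assms by (cases M; cases N; simp add: mob_def field_simps)+

lemma mob_mmul:
  assumes "mdet N \<noteq> 0" "z \<in> HH"
  shows "mob (mmul M N) z = mob M (mob N z)"
  using mnum_mmul[OF mden_nonzero[OF assms], of M] mden_nonzero[OF assms]
  by (simp add: mob_def[of "mmul M N"] mob_def[of M])

lemma mob_one [simp]: "mob (1, 0, 0, 1) z = z" by (simp add: mob_def)

lemma mob_madj: "mdet M = 1 \<Longrightarrow> z \<in> HH \<Longrightarrow> mob (madj M) (mob M z) = z"
  by (subst mob_mmul[symmetric]) (auto simp: mmul_madj)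

lemma mob_madj': "mdet M = 1 \<Longrightarrow> z \<in> HH \<Longrightarrow> mob M (mob (madj M) z) = z"
  by (subst mob_mmul[symmetric]) (auto simp: mmul_madj)

lemma mden_lower_c: "Im z > 0 \<Longrightarrow> \<bar>of_int c\<bar> * Im z \<le> norm (of_int c * z + of_int d)"
  using abs_Im_le_cmod[of "of_int c * z + of_int d"] by (simp add: abs_mult)

lemma mden_lower_d:
  assumes "Im z > 0"
  shows "\<bar>of_int d\<bar> \<le> norm (of_int c * z + of_int d) * (1 + norm z / Im z)"
proof -
  have "\<bar>of_int d\<bar> = norm ((of_int c * z + of_int d) - of_int c * z :: complex)" by simp
  also have "... \<le> norm (of_int c * z + of_int d) + \<bar>of_int c\<bar> * norm z"
    using norm_triangle_ineq4 by (metis norm_mult norm_of_int)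
  also have "\<bar>of_int c\<bar> * norm z = \<bar>of_int c\<bar> * Im z * (norm z / Im z)" using assms by simp
  also have "... \<le> norm (of_int c * z + of_int d) * (norm z / Im z)"
    by (intro mult_right_mono mden_lower_c) (use assms in auto)
  finally show ?thesis by (simp add: algebra_simps)
qed

text \<open>Only finitely many values \<open>|c z + d|\<close> are at most 1, so a least one exists;
  it belongs to a translate of largest imaginary part. An integral translation brings the real part
  into range without changing the denominator. The modulus is then at least 1, for otherwise the
  inversion would produce a smaller denominator.\<close>

lemma reduction:
  assumes z: "z \<in> HH"
  obtains M where "mdet M = 1" "mob M z \<in> fundamental_domain"
proof -
  define S where "S = {M. mdet M = 1 \<and> norm (mden M z) \<le> 1}"
  define P where "P = (\<lambda>M. norm (mden M z)) ` S"
  have fin: "finite P"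
  proof -
    define B where "B = \<lceil>1 / Im z + 1 + norm z / Im z\<rceil>"
    have "P \<subseteq> (\<lambda>(c,d). norm (of_int c * z + of_int d)) ` ({-B..B} \<times> {-B..B})"
    proof
      fix x assume "x \<in> P"
      then obtain a b c d where M: "mdet (a,b,c,d) = 1" "norm (of_int c * z + of_int d) \<le> 1"
          "x = norm (of_int c * z + of_int d)"
        by (auto simp: P_def S_def)
      have y: "Im z > 0" using z by simp
      have B: "1 / Im z + 1 + norm z / Im z \<le> of_int B" unfolding B_def by (rule le_of_int_ceiling)
      have "\<bar>of_int c\<bar> \<le> 1 / Im z" using mden_lower_c[OF y, of c d] M y by (simp add: field_simps)
      also have "... \<le> of_int B" using B y by (smt (verit) divide_nonneg_nonneg norm_ge_zero)
      finally have "\<bar>c\<bar> \<le> B" by linarith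
      moreover have "\<bar>of_int d\<bar> \<le> 1 * (1 + norm z / Im z)"
        by (rule order.trans[OF mden_lower_d[OF y, of d c]]) (use M y in \<open>intro mult_right_mono, auto\<close>)
      hence "\<bar>of_int d\<bar> \<le> real_of_int B" using B y by (smt (verit) divide_nonneg_nonneg)
      hence "\<bar>d\<bar> \<le> B" by linarith
      ultimately show "x \<in> (\<lambda>(c,d). norm (of_int c * z + of_int d)) ` ({-B..B} \<times> {-B..B})"
        using M by (intro image_eqI[of _ _ "(c,d)"]) auto
    qed
    thus ?thesis by (rule finite_subset) auto
  qed
  have "(1,0,0,1) \<in> S" by (simp add: S_def)
  hence ne: "P \<noteq> {}" by (auto simp: P_def)
  obtain M where M: "M \<in> S" "norm (mden M z) = Min P" using Min_in[OF fin ne] by (auto simp: P_def)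
  have min: "norm (mden M z) \<le> norm (mden N z)" if "mdet N = 1" for N
  proof (cases "N \<in> S")
    case True thus ?thesis using M fin by (auto simp: P_def)
  next
    case False thus ?thesis using that M by (auto simp: S_def)
  qed
  have dM: "mdet M = 1" using M by (simp add: S_def)
  define n where "n = round (Re (mob M z))"
  define N where "N = mmul (1, -n, 0, 1) M"
  have dN: "mdet N = 1" using dM by (simp add: N_def)
  have nz: "mden M z \<noteq> 0" using mden_nonzero dM z by simp
  have mN: "mob N z = mob M z - of_int n"
    unfolding N_def using dM z by (subst mob_mmul) (auto simp: mob_def[of "(1,-n,0,1)"])
  have jN: "mden N z = mden M z" unfolding N_def using nz by (subst mnum_mmul) auto
  have "\<bar>Re (mob N z)\<bar> \<le> 1/2" unfolding mN n_def
    using of_int_round_abs_le[of "Re (mob M z)"] by (simp add: abs_minus_commute)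
  moreover have "norm (mob N z) \<ge> 1"
  proof -
    have "norm (mden M z) \<le> norm (mden (mmul (0,-1,1,0) N) z)" using dN by (intro min) simp
    also have "mden (mmul (0,-1,1,0) N) z = mnum N z" by (cases N) simp
    also have "mnum N z = mob N z * mden M z" using nz by (simp add: mob_def jN)
    finally show ?thesis using nz by (simp add: norm_mult)
  qed
  ultimately show ?thesis using dN mob_in_HH[of N z] z
    by (intro that[of N]) (auto simp: fundamental_domain_def)
qed

text \<open>The bound 1/2 is a convenient weakening of half the square root of 3.\<close>

lemma fundamental_domain_Im:
  assumes "z \<in> fundamental_domain" shows "Im z \<ge> 1/2"
proof -
  have "1 \<le> (norm z)^2" using assms by (simp add: fundamental_domain_def)
  also have "... = (Re z)^2 + (Im z)^2" by (simp add: cmod_power2)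
  also have "(Re z)^2 \<le> (1/2)^2"
    using assms by (intro abs_le_square_iff[THEN iffD1]) (auto simp: fundamental_domain_def)
  finally have "(1/2)^2 \<le> (Im z)^2" by (simp add: power2_eq_square)
  moreover have "Im z > 0" using assms by (simp add: fundamental_domain_def)
  ultimately show ?thesis by (intro power2_le_imp_le[of "1/2" "Im z"]) auto
qed

section \<open>Decay and boundedness of cusp forms\<close>

context
  fixes w :: nat and f :: "complex \<Rightarrow> complex"
  assumes f: "cusp_form w f"
begin

lemma cusp_form_holomorphic: "f holomorphic_on HH"
  using f by (simp add: cusp_form_def)

lemma cusp_form_continuous: "continuous_on HH f"
  using cusp_form_holomorphic holomorphic_on_imp_continuous_on by blast

lemma cusp_form_outside: "z \<notin> HH \<Longrightarrow> f z = 0"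
  using f by (simp add: cusp_form_def)

lemma cusp_form_mob: "mdet M = 1 \<Longrightarrow> z \<in> HH \<Longrightarrow> f (mob M z) = mden M z ^ w * f z"
  using f by (cases M) (simp add: cusp_form_def mob_def)

lemma cusp_form_fourier: "has_fourier_expansion f (fourier_coeff f)"
  and cusp_form_coeff_0 [simp]: "fourier_coeff f 0 = 0"
proof -
  obtain a where "has_fourier_expansion f a" "a 0 = 0" using f unfolding cusp_form_def by blast
  moreover from this have "fourier_coeff f = a" by (simp add: fourier_coeff_eq)
  ultimately show "has_fourier_expansion f (fourier_coeff f)" "fourier_coeff f 0 = 0" by auto
qed

lemma cusp_form_shift: "z \<in> HH \<Longrightarrow> f (z + of_int n) = f z"
  using cusp_form_mob[of "(1, n, 0, 1)" z] by (simp add: mob_def)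

lemma cusp_form_inv: "z \<in> HH \<Longrightarrow> f (-1 / z) = z ^ w * f z"
  using cusp_form_mob[of "(0, -1, 1, 0)" z] by (simp add: mob_def)

end

lemma fourier_sums:
  "has_fourier_expansion f a \<Longrightarrow> z \<in> HH \<Longrightarrow> (\<lambda>n. a n * e (of_nat n * z)) sums f z"
  by (simp add: has_fourier_expansion_def)

text \<open>Convergence at height \<open>y / 2\<close> puts the point of height \<open>y\<close>
  strictly inside the disc of convergence of the power series in \<open>q\<close>.\<close>

lemma fourier_abs_summable:
  assumes "has_fourier_expansion f a" "y > 0"
  shows "summable (\<lambda>n. norm (a n) * exp (- 2 * pi * real n * y))"
proof -
  have "summable (\<lambda>n. a n * e (\<i> * of_real (y/2)) ^ n)"
    using sums_summable[OF fourier_sums[OF assms(1), of "\<i> * of_real (y/2)"]] assms(2)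
    unfolding e_of_nat_mult by simp
  hence "summable (\<lambda>n. norm (a n * e (\<i> * of_real y) ^ n))"
    by (rule powser_insidea) (use assms in \<open>simp add: norm_e\<close>)
  also have "(\<lambda>n. norm (a n * e (\<i> * of_real y) ^ n)) = (\<lambda>n. norm (a n) * exp (- 2 * pi * real n * y))"
    by (auto simp: norm_mult norm_power norm_e exp_of_nat_mult[symmetric] algebra_simps)
  finally show ?thesis .
qed

lemma norm_e_of_nat_mult: "norm (e (of_nat n * z)) = exp (- 2 * pi * real n * Im z)"
  by (simp add: norm_e)

lemma fourier_norm_le:
  assumes "has_fourier_expansion f a" "y > 0" "Im z = y"
  shows "norm (f z) \<le> (\<Sum>n. norm (a n) * exp (- 2 * pi * real n * y))"
proof -
  have "f z = (\<Sum>n. a n * e (of_nat n * z))"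
    using fourier_sums[OF assms(1), of z] assms by (simp add: sums_iff)
  also have "norm ... \<le> (\<Sum>n. norm (a n * e (of_nat n * z)))"
    by (rule summable_norm) (use fourier_abs_summable[OF assms(1,2)] assms(3) in \<open>simp add: norm_mult norm_e_of_nat_mult\<close>)
  finally show ?thesis using assms(3) by (simp add: norm_mult norm_e_of_nat_mult)
qed

text \<open>The constant coefficient vanishes, so passing from height \<open>y0\<close> up to
  \<open>Im z\<close> multiplies every surviving term by at most
  \<open>exp (- 2 * pi * (Im z - y0))\<close>.\<close>

lemma cusp_form_decay:
  assumes "cusp_form w f" "y0 > 0"
  obtains M where "M > 0" "\<And>z. Im z \<ge> y0 \<Longrightarrow> norm (f z) \<le> M * exp (- 2 * pi * Im z)"
proof -
  let ?a = "fourier_coeff f"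
  note F = cusp_form_fourier[OF assms(1)]
  define A where "A = (\<Sum>n. norm (?a n) * exp (- 2 * pi * real n * y0))"
  have sA: "summable (\<lambda>n. norm (?a n) * exp (- 2 * pi * real n * y0))"
    by (rule fourier_abs_summable[OF F assms(2)])
  have "A \<ge> 0" unfolding A_def by (rule suminf_nonneg[OF sA]) simp
  show ?thesis
  proof (rule that[of "(A + 1) * exp (2 * pi * y0)"])
    fix z assume z: "Im z \<ge> y0"
    have "norm (f z) \<le> (\<Sum>n. norm (?a n) * exp (- 2 * pi * real n * Im z))"
      by (rule fourier_norm_le[OF F]) (use assms z in auto)
    also have "... \<le> (\<Sum>n. exp (- 2 * pi * (Im z - y0)) * (norm (?a n) * exp (- 2 * pi * real n * y0)))"
    proof (rule suminf_le)
      fix n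
      show "norm (?a n) * exp (- 2 * pi * real n * Im z)
            \<le> exp (- 2 * pi * (Im z - y0)) * (norm (?a n) * exp (- 2 * pi * real n * y0))"
      proof (cases "n = 0")
        case False
        have "1 * (Im z - y0) \<le> real n * (Im z - y0)" by (rule mult_right_mono) (use False z in auto)
        hence "real n * (Im z - y0) * (2 * pi) \<ge> 1 * (Im z - y0) * (2 * pi)"
          by (rule mult_right_mono) auto
        hence "- 2 * pi * real n * Im z \<le> - 2 * pi * (Im z - y0) + - 2 * pi * real n * y0"
          by (simp add: algebra_simps)
        thus ?thesis by (simp add: mult.left_commute exp_add[symmetric] mult_left_mono)
      qed (use assms in \<open>simp add: cusp_form_coeff_0\<close>)
    qed (use fourier_abs_summable[OF F] assms z sA in \<open>auto intro!: summable_mult\<close>)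
    also have "... = exp (- 2 * pi * (Im z - y0)) * A"
      unfolding A_def by (rule suminf_mult[OF sA])
    also have "... \<le> exp (- 2 * pi * (Im z - y0)) * (A + 1)" by simp
    also have "... = (A + 1) * exp (2 * pi * y0) * exp (- 2 * pi * Im z)"
      by (simp add: exp_add[symmetric] algebra_simps)
    finally show "norm (f z) \<le> (A + 1) * exp (2 * pi * y0) * exp (- 2 * pi * Im z)" .
  qed (use \<open>A \<ge> 0\<close> in simp)
qed

lemma power_le_fact_exp: "x \<ge> 0 \<Longrightarrow> x ^ n \<le> fact n * exp (x::real)"
proof -
  assume x: "x \<ge> 0"
  have "x ^ n / fact n \<le> (\<Sum>m. x ^ m / fact m)"
    by (rule order.trans[OF _ sum_le_suminf[of _ "{n}"]])
       (use x summable_exp_generic[of x] in \<open>auto simp: field_simps scaleR_conv_of_real\<close>)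
  also have "... = exp x" by (simp add: exp_def field_simps)
  finally show ?thesis by (simp add: field_simps)
qed

lemma cusp_form_mob_norm:
  assumes "cusp_form (2 * k) f" "mdet M = 1" "z \<in> HH"
  shows "Im (mob M z) ^ k * norm (f (mob M z)) = Im z ^ k * norm (f z)"
  using mden_nonzero[of M z] assms
  by (simp add: Im_mob cusp_form_mob norm_mult norm_power power_divide power_mult)

text \<open>The quantity is invariant under the modular group, so it suffices to bound it on the
  fundamental domain; there the imaginary part stays above 1/2 and exponential decay beats the
  power.\<close>

lemma cusp_form_bounded:
  assumes "cusp_form (2 * k) f"
  obtains B where "B > 0" "\<And>z. z \<in> HH \<Longrightarrow> Im z ^ k * norm (f z) \<le> B"
proof -
  obtain M where M: "M > 0" "\<And>z. Im z \<ge> 1/2 \<Longrightarrow> norm (f z) \<le> M * exp (- 2 * pi * Im z)"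
    using cusp_form_decay[OF assms, of "1/2"] by auto
  show ?thesis
  proof (rule that[of "fact k * M"])
    fix z assume "z \<in> HH"
    then obtain N where N: "mdet N = 1" "mob N z \<in> fundamental_domain" using reduction by blast
    define v where "v = mob N z"
    have v: "Im v \<ge> 1/2" using fundamental_domain_Im N by (simp add: v_def)
    have "Im z ^ k * norm (f z) = Im v ^ k * norm (f v)"
      unfolding v_def using cusp_form_mob_norm[OF assms N(1) \<open>z \<in> HH\<close>] by simp
    also have "... \<le> (fact k * exp (Im v)) * (M * exp (- 2 * pi * Im v))"
      using v M by (intro mult_mono power_le_fact_exp) auto
    also have "... = fact k * M * exp (- (2 * pi - 1) * Im v)"
      by (simp add: exp_add[symmetric] algebra_simps)
    also have "... \<le> fact k * M * 1"
      using M v pi_gt3 by (intro mult_left_mono) (auto intro!: mult_nonpos_nonneg)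
    finally show "Im z ^ k * norm (f z) \<le> fact k * M" by simp
  qed (use M in simp)
qed

section \<open>Parseval and cusp forms with many vanishing coefficients\<close>

lemma has_integral_suminf_uniform:
  fixes g :: "nat \<Rightarrow> real \<Rightarrow> complex"
  assumes int: "\<And>n. (g n has_integral I n) {a..b}" and cont: "\<And>n. continuous_on {a..b} (g n)"
    and bound: "\<And>n x. x \<in> {a..b} \<Longrightarrow> norm (g n x) \<le> M n" and M: "summable M"
  shows "((\<lambda>x. \<Sum>n. g n x) has_integral (\<Sum>n. I n)) {a..b}" "summable I"
    "continuous_on {a..b} (\<lambda>x. \<Sum>n. g n x)"
proof -
  have u: "uniform_limit {a..b} (\<lambda>N x. \<Sum>n<N. g n x) (\<lambda>x. \<Sum>n. g n x) sequentially"
    by (rule Weierstrass_m_test) (use bound M in auto)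
  obtain J K where J: "\<And>N. ((\<lambda>x. \<Sum>n<N. g n x) has_integral J N) {a..b}"
      "((\<lambda>x. \<Sum>n. g n x) has_integral K) {a..b}" "J \<longlonglongrightarrow> K"
    by (rule uniform_limit_integral[OF u]) (auto intro!: continuous_intros cont)
  have "J N = (\<Sum>n<N. I n)" for N
    by (rule has_integral_unique[OF J(1)]) (intro has_integral_sum int, auto)
  hence "J = (\<lambda>N. \<Sum>n<N. I n)" by (rule ext)
  hence "I sums K" using J(3) by (simp add: sums_def)
  thus "((\<lambda>x. \<Sum>n. g n x) has_integral (\<Sum>n. I n)) {a..b}" "summable I"
    using J(2) by (auto simp: sums_iff)
  show "continuous_on {a..b} (\<lambda>x. \<Sum>n. g n x)"
    by (rule uniform_limit_theorem[OF _ u]) (auto intro!: always_eventually continuous_intros cont)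
qed

lemma e_orthogonality:
  "((\<lambda>x. e (of_int j * of_real x)) has_integral (if j = 0 then 1 else 0)) {0..1::real}"
proof (cases "j = 0")
  case True
  have "((\<lambda>x::real. 1::complex) has_integral (1 - 0) *\<^sub>R 1) {0..1}" by (rule has_integral_const_real[of 1 0 1, simplified, THEN has_integral_eq_rhs]) simp
  thus ?thesis using True by simp
next
  case False
  define F where "F z = e (of_int j * z) / (2 * of_real pi * \<i> * of_int j)" for z
  have D: "(F has_field_derivative e (of_int j * z)) (at z within S)" for z S
    unfolding F_def e_def using False by (auto intro!: derivative_eq_intros simp: field_simps)
  have "((\<lambda>x. e (of_int j * of_real x)) has_integral (F (of_real 1) - F (of_real 0))) {0..1}"
  proof (rule fundamental_theorem_of_calculus)
    fix x :: real
    show "((\<lambda>x. F (complex_of_real x)) has_vector_derivative e (of_int j * of_real x)) (at x within {0..1})"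
      by (rule has_vector_derivative_real_field) (rule D)
  qed simp
  also have "F (of_real 1) - F (of_real 0) = 0" using e_of_int[of j] by (simp add: F_def)
  finally show ?thesis using False by simp
qed

lemma norm_e_real [simp]: "norm (e (of_int j * of_real x)) = 1" "norm (e (of_nat n * of_real x)) = 1"
    "norm (e (- (of_nat n * of_real x))) = 1"
  by (simp_all add: norm_e)

lemma trig_series_coeff:
  assumes c: "summable (\<lambda>n. norm (c n :: complex))"
  shows "((\<lambda>x. (\<Sum>m. c m * e (of_nat m * of_real x)) * e (- (of_nat n * of_real x))) has_integral c n) {0..1}"
    and "continuous_on {0..1} (\<lambda>x::real. \<Sum>m. c m * e (of_nat m * of_real x))"
proof -
  let ?g = "\<lambda>m x. c m * e (of_int (int m - int n) * of_real x)"
  have I: "(?g m has_integral c m * (if int m - int n = 0 then 1 else 0)) {0..1}" for m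
    by (intro has_integral_mult_right e_orthogonality)
  note * = has_integral_suminf_uniform[of ?g _ 0 1 "\<lambda>m. norm (c m)", OF I]
  have "((\<lambda>x. \<Sum>m. ?g m x) has_integral (\<Sum>m. c m * (if int m - int n = 0 then 1 else 0))) {0..1}"
    by (rule *(1)) (auto intro!: continuous_intros c simp: norm_mult norm_e)
  also have "(\<Sum>m. c m * (if int m - int n = 0 then 1 else 0)) = (\<Sum>m\<in>{n}. c m * (if int m - int n = 0 then 1 else 0))"
    by (rule suminf_finite) auto
  also have "... = c n" by simp
  finally have "((\<lambda>x. \<Sum>m. ?g m x) has_integral c n) {0..1}" .
  also have "(\<lambda>x. \<Sum>m. ?g m x) = (\<lambda>x. (\<Sum>m. c m * e (of_nat m * of_real x)) * e (- (of_nat n * of_real x)))"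
  proof
    fix x :: real
    have "summable (\<lambda>m. norm (c m * e (of_nat m * of_real x)))" using c by (simp add: norm_mult)
    hence "summable (\<lambda>m. c m * e (of_nat m * of_real x))" by (rule summable_norm_cancel)
    note suminf_mult2[OF this, of "e (- (of_nat n * of_real x))"]
    thus "(\<Sum>m. ?g m x) = (\<Sum>m. c m * e (of_nat m * of_real x)) * e (- (of_nat n * of_real x))"
      by (simp add: mult.assoc e_add[symmetric] algebra_simps)
  qed
  finally show "((\<lambda>x. (\<Sum>m. c m * e (of_nat m * of_real x)) * e (- (of_nat n * of_real x))) has_integral c n) {0..1}" .
  show "continuous_on {0..1} (\<lambda>x::real. \<Sum>m. c m * e (of_nat m * of_real x))"
  proof -
    have I': "((\<lambda>x::real. c m * e (of_int (int m) * of_real x)) has_integral c m * (if int m = 0 then 1 else 0)) {0..1}" for m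
      by (intro has_integral_mult_right e_orthogonality)
    have "continuous_on {0..1} (\<lambda>x::real. \<Sum>m. c m * e (of_int (int m) * of_real x))"
      by (rule has_integral_suminf_uniform(3)[OF I', where M = "\<lambda>m. norm (c m)"])
         (auto intro!: continuous_intros c simp: norm_mult norm_e)
    thus ?thesis by simp
  qed
qed

text \<open>Stated bilinearly, without a conjugate, because it serves two pairs of sequences: a
  sequence with its own conjugate, which gives Bessel's inequality, and the coefficients of a cusp
  form with those of the Lipschitz formula.\<close>

lemma parseval:
  assumes c: "summable (\<lambda>n. norm (c n :: complex))" and d: "summable (\<lambda>n. norm (d n :: complex))"
  shows "((\<lambda>x. (\<Sum>m. c m * e (of_nat m * of_real x)) * (\<Sum>n. d n * e (- (of_nat n * of_real x))))
          has_integral (\<Sum>n. c n * d n)) {0..1}" (is "((\<lambda>x. ?C x * _) has_integral _) _")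
proof -
  note C = trig_series_coeff[OF c]
  have bound: "norm (?C x) \<le> (\<Sum>n. norm (c n))" for x :: real
    using summable_norm[of "\<lambda>n. c n * e (of_nat n * of_real x)"] c by (simp add: norm_mult)
  let ?g = "\<lambda>n x. d n * (?C x * e (- (of_nat n * of_real x)))"
  have "((\<lambda>x. \<Sum>n. ?g n x) has_integral (\<Sum>n. d n * c n)) {0..1}"
  proof (rule has_integral_suminf_uniform(1))
    show "norm (?g n x) \<le> norm (d n) * (\<Sum>n. norm (c n))" for n x
      using mult_left_mono[OF bound[of x], of "norm (d n)"] by (simp add: norm_mult)
  qed (auto intro!: has_integral_mult_right C continuous_intros summable_mult2 d)
  also have "(\<lambda>x. \<Sum>n. ?g n x) = (\<lambda>x. ?C x * (\<Sum>n. d n * e (- (of_nat n * of_real x))))"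
  proof
    fix x :: real
    have "summable (\<lambda>n. norm (d n * e (- (of_nat n * of_real x))))" using d by (simp add: norm_mult)
    hence "summable (\<lambda>n. d n * e (- (of_nat n * of_real x)))" by (rule summable_norm_cancel)
    from suminf_mult[OF this, of "?C x"]
    show "(\<Sum>n. ?g n x) = ?C x * (\<Sum>n. d n * e (- (of_nat n * of_real x)))"
      by (simp add: mult_ac)
  qed
  finally show ?thesis by (simp add: mult.commute)
qed

lemma fourier_Complex:
  assumes "has_fourier_expansion f a" "y > 0"
  shows "f (Complex x y) = (\<Sum>n. (a n * exp (- 2 * pi * real n * y)) * e (of_nat n * of_real x))"
    and "summable (\<lambda>n. norm (a n * exp (- 2 * pi * real n * y)))"
proof -
  have "e (of_nat n * Complex x y) = exp (- 2 * pi * real n * y) * e (of_nat n * of_real x)" for n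
  proof -
    have "e (of_nat n * Complex x y) = e (of_nat n * of_real x + of_nat n * (\<i> * of_real y))"
      by (simp add: Complex_eq algebra_simps)
    moreover have "e (of_nat n * (\<i> * of_real y)) = of_real (exp (- 2 * pi * real n * y))"
      by (simp add: e_def exp_of_real[symmetric] algebra_simps)
    ultimately show ?thesis by (simp add: e_add)
  qed
  with fourier_sums[OF assms(1), of "Complex x y"] assms(2)
  show "f (Complex x y) = (\<Sum>n. (a n * exp (- 2 * pi * real n * y)) * e (of_nat n * of_real x))"
    by (simp add: sums_iff mult.assoc)
  show "summable (\<lambda>n. norm (a n * exp (- 2 * pi * real n * y)))"
    using fourier_abs_summable[OF assms] by (simp add: norm_mult)
qed

lemma fourier_coeff_integral:
  assumes "has_fourier_expansion f a" "y > 0"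
  shows "((\<lambda>x. f (Complex x y) * e (- (of_nat n * of_real x))) has_integral a n * exp (- 2 * pi * real n * y)) {0..1}"
  using trig_series_coeff(1)[OF fourier_Complex(2)[OF assms]] fourier_Complex(1)[OF assms] by simp

lemma fourier_coeff_bound:
  assumes F: "has_fourier_expansion f a" and y: "y > 0" and B: "\<And>x. norm (f (Complex x y)) \<le> B"
  shows "norm (a n) \<le> B * exp (2 * pi * real n * y)"
proof -
  have "norm (a n * exp (- 2 * pi * real n * y)) \<le> B * measure lborel {0..1::real}"
    by (rule has_integral_bound_real[OF _ finite.emptyI fourier_coeff_integral[OF F y, of n]])
       (use B order.trans[OF norm_ge_zero B] in \<open>auto simp: norm_mult\<close>)
  thus ?thesis by (simp add: norm_mult norm_divide exp_minus field_simps)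
qed

lemma bessel:
  assumes F: "has_fourier_expansion f a" and y: "y > 0" and B: "\<And>x. norm (f (Complex x y)) \<le> B"
  shows "(\<Sum>n. (norm (a n))^2 * exp (- 4 * pi * real n * y)) \<le> B^2"
    and "summable (\<lambda>n. (norm (a n))^2 * exp (- 4 * pi * real n * y))"
proof -
  define c where "c n = a n * exp (- 2 * pi * real n * y)" for n
  have fc: "f (Complex x y) = (\<Sum>n. c n * e (of_nat n * of_real x))" for x
    unfolding c_def by (rule fourier_Complex(1)[OF F y])
  have sc: "summable (\<lambda>n. norm (c n))" unfolding c_def by (rule fourier_Complex(2)[OF F y])
  have "summable (\<lambda>n. c n * e (of_nat n * of_real x))" for x :: real
    using sc by (intro summable_norm_cancel[of "\<lambda>n. c n * e (of_nat n * of_real x)"]) (simp add: norm_mult)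
  hence cf: "cnj (f (Complex x y)) = (\<Sum>n. cnj (c n) * e (- (of_nat n * of_real x)))" for x
    unfolding fc by (subst bounded_linear.suminf[OF bounded_linear_cnj]) (auto simp: e_def exp_cnj)
  have c2: "c n * cnj (c n) = of_real ((norm (a n))^2 * exp (- 4 * pi * real n * y))" for n
  proof -
    have "c n * cnj (c n) = of_real ((norm (c n))^2)" by (rule complex_norm_square[symmetric])
    thus ?thesis by (simp add: c_def norm_mult power_mult_distrib exp_double[symmetric])
  qed
  have "bounded (range (\<lambda>n. norm (c n)))"
    using summable_imp_bounded sc by blast
  then obtain K where K: "\<And>n. norm (c n) \<le> K" by (auto simp: bounded_iff)
  have "summable (\<lambda>n. norm (c n) * K)" by (intro summable_mult2 sc)
  hence "summable (\<lambda>n. (norm (c n))^2)"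
    by (rule summable_comparison_test') (auto simp: power2_eq_square intro!: mult_left_mono K)
  thus s: "summable (\<lambda>n. (norm (a n))^2 * exp (- 4 * pi * real n * y))"
    by (simp add: c_def norm_mult power_mult_distrib exp_double[symmetric] mult.assoc)
  have I: "((\<lambda>x. f (Complex x y) * cnj (f (Complex x y))) has_integral (\<Sum>n. c n * cnj (c n))) {0..1}"
    unfolding cf using parseval[OF sc, of "\<lambda>n. cnj (c n)"] sc by (simp add: fc)
  have "norm (\<Sum>n. c n * cnj (c n)) \<le> B^2 * measure lborel {0..1::real}"
    by (rule has_integral_bound_real[OF _ finite.emptyI I])
       (auto simp: norm_mult power2_eq_square intro!: mult_mono B order.trans[OF norm_ge_zero B])
  also have "(\<Sum>n. c n * cnj (c n)) = of_real (\<Sum>n. (norm (a n))^2 * exp (- 4 * pi * real n * y))"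
    unfolding c2 by (rule suminf_of_real[OF s, symmetric])
  finally show "(\<Sum>n. (norm (a n))^2 * exp (- 4 * pi * real n * y)) \<le> B^2" by simp
qed

text \<open>The reason for finite dimension. Let \<open>B\<close> be the supremum of the invariant
  \<open>Im z ^ k * |f z|\<close>; it is nearly attained in the fundamental domain. If the first
  \<open>N\<close> coefficients vanish, the remaining ones, bounded through \<open>B\<close> at a
  lower height, make the value there at most \<open>B / 4\<close>, which forces
  \<open>B = 0\<close>.\<close>

lemma cusp_form_determined:
  obtains N where "\<And>f. cusp_form (2 * k) f \<Longrightarrow> (\<And>n. n < N \<Longrightarrow> fourier_coeff f n = 0) \<Longrightarrow> f = (\<lambda>_. 0)"
proof -
  \<comment> \<open>The final estimate loses \<open>2 * 4 ^ k * fact k\<close> and gains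
    \<open>exp (- N)\<close>; this \<open>N\<close>, together with \<open>N <= exp N\<close>, leaves
    \<open>B / 4\<close> against a value above \<open>B / 2\<close>.\<close>
  define N where "N = Suc (nat \<lceil>8 * 4 ^ k * fact k :: real\<rceil>)"
  have N: "real N \<ge> 8 * 4 ^ k * fact k" "N \<ge> 1" unfolding N_def by linarith+
  show ?thesis
  proof (rule that[of N])
    fix f assume f: "cusp_form (2 * k) f" and z: "\<And>n. n < N \<Longrightarrow> fourier_coeff f n = 0"
    let ?a = "fourier_coeff f"
    note F = cusp_form_fourier[OF f]
    obtain B' where B': "\<And>z. z \<in> HH \<Longrightarrow> Im z ^ k * norm (f z) \<le> B'" using cusp_form_bounded[OF f] by blast
    define B where "B = (SUP z\<in>HH. Im z ^ k * norm (f z))"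
    have bdd: "bdd_above ((\<lambda>z. Im z ^ k * norm (f z)) ` HH)" using B' by (rule bdd_aboveI2)
    have B: "Im z ^ k * norm (f z) \<le> B" if "z \<in> HH" for z
      unfolding B_def using that by (intro cSUP_upper bdd)
    have "B \<ge> 0" by (rule order.trans[OF _ B[of \<i>]]) auto
    have "\<not> B > 0"
    proof
      assume Bp: "B > 0"
      have "\<exists>z\<in>HH. B / 2 < Im z ^ k * norm (f z)"
        using less_cSUP_iff[of HH "\<lambda>z. Im z ^ k * norm (f z)" "B/2"] bdd Bp
        by (metis B_def HH_iff empty_iff field_sum_of_halves imaginary_unit.sel(2) less_add_same_cancel1 zero_less_divide_iff zero_less_numeral zero_less_one)
      then obtain z' where z': "z' \<in> HH" "B / 2 < Im z' ^ k * norm (f z')" by blast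
      obtain M where M: "mdet M = 1" "mob M z' \<in> fundamental_domain" using reduction[OF z'(1)] by blast
      define z where "z = mob M z'"
      define y where "y = Im z"
      have y: "y \<ge> 1/2" using fundamental_domain_Im M by (simp add: z_def y_def)
      have big: "B / 2 < y ^ k * norm (f z)"
        using z' cusp_form_mob_norm[OF f M(1) z'(1)] by (simp add: z_def y_def)
      define r where "r = exp (- (pi * y))"
      have r: "0 < r" "r \<le> 1/2"
      proof -
        have "r \<le> exp (-1)" using y pi_gt3 mult_mono[of 3 pi "1/2" y] by (simp add: r_def)
        also have "exp (-1::real) \<le> 1/2" using exp_ge_add_one_self[of 1] by (simp add: exp_minus field_simps)
        finally show "r \<le> 1/2" .
      qed (simp add: r_def)
      \<comment> \<open>The height 1/4 lies below the minimal height 1/2 of the fundamental domain,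
        so that moving up to \<open>y\<close> leaves a damping of at least
        \<open>exp (- pi * n * y)\<close>.\<close>
      have coeff: "norm (?a n) \<le> B * 4 ^ k * exp (2 * pi * real n * (1/4))" for n
      proof (rule fourier_coeff_bound[OF F])
        fix x
        show "norm (f (Complex x (1/4))) \<le> B * 4 ^ k"
          using B[of "Complex x (1/4)"] by (simp add: field_simps power_divide)
      qed simp
      have sm: "summable (\<lambda>n. norm (?a n) * exp (- 2 * pi * real n * y))"
        by (rule fourier_abs_summable[OF F]) (use y in simp)
      have tm: "norm (?a (n + N)) * exp (- 2 * pi * real (n + N) * y) \<le> B * 4 ^ k * r ^ N * r ^ n" for n
      proof -
        have "norm (?a (n + N)) * exp (- 2 * pi * real (n + N) * y)
              \<le> B * 4 ^ k * exp (2 * pi * real (n + N) * (1/4)) * exp (- 2 * pi * real (n + N) * y)"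
          by (intro mult_right_mono coeff) auto
        also have "... = B * 4 ^ k * exp (- (pi * real (n + N) * (2 * y - 1/2)))"
          by (simp add: mult.assoc exp_add[symmetric]) (simp add: algebra_simps)
        also have "... \<le> B * 4 ^ k * exp (- (pi * real (n + N) * y))"
          using y \<open>B \<ge> 0\<close> by (intro mult_left_mono) (auto intro!: mult_left_mono)
        also have "exp (- (pi * real (n + N) * y)) = r ^ (n + N)"
          by (simp add: r_def exp_of_nat_mult[symmetric] algebra_simps)
        finally show ?thesis by (simp add: power_add mult_ac)
      qed
      have "norm (f z) \<le> (\<Sum>n. norm (?a n) * exp (- 2 * pi * real n * y))"
        by (rule fourier_norm_le[OF F]) (use y in \<open>auto simp: y_def\<close>)
      also have "... = (\<Sum>n. norm (?a (n + N)) * exp (- 2 * pi * real (n + N) * y))"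
        using suminf_split_initial_segment[OF sm, of N] z by simp
      also have "... \<le> (\<Sum>n. B * 4 ^ k * r ^ N * r ^ n)"
      proof (rule suminf_le[OF tm])
        show "summable (\<lambda>n. norm (?a (n + N)) * exp (- 2 * pi * real (n + N) * y))"
          using summable_iff_shift[of "\<lambda>n. norm (?a n) * exp (- 2 * pi * real n * y)" N] sm by simp
        show "summable (\<lambda>n. B * 4 ^ k * r ^ N * r ^ n)" using r by (intro summable_mult summable_geometric) auto
      qed
      also have "... = B * 4 ^ k * r ^ N * (1 / (1 - r))"
        using r by (subst suminf_mult) (auto intro!: summable_geometric simp: suminf_geometric)
      also have "... \<le> B * 4 ^ k * r ^ N * 2"
        using r \<open>B \<ge> 0\<close> by (intro mult_left_mono) (auto simp: field_simps)
      finally have fz: "norm (f z) \<le> B * 4 ^ k * r ^ N * 2" .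
      have "y ^ k * norm (f z) \<le> (fact k * exp y) * (B * 4 ^ k * r ^ N * 2)"
        using fz y by (intro mult_mono power_le_fact_exp) auto
      also have "... = 2 * 4 ^ k * fact k * B * (exp y * r ^ N)" by simp
      also have "exp y * r ^ N \<le> exp (- real N)"
      proof -
        have "(pi * real N - 1) * y \<ge> (2 * real N) * (1/2)"
        proof (rule mult_mono)
          have "3 * real N \<le> pi * real N" using pi_gt3 by (intro mult_right_mono) auto
          thus "2 * real N \<le> pi * real N - 1" "0 \<le> pi * real N - 1" using N by linarith+
        qed (use y in auto)
        thus ?thesis by (simp add: r_def exp_of_nat_mult[symmetric] exp_add[symmetric] algebra_simps)
      qed
      also have "exp (- real N) \<le> 1 / (8 * 4 ^ k * fact k)"
      proof -
        have "8 * 4 ^ k * fact k \<le> exp (real N)" using N exp_ge_add_one_self[of "real N"] by linarith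
        thus ?thesis by (simp add: exp_minus field_simps)
      qed
      finally have "y ^ k * norm (f z) \<le> 2 * 4 ^ k * fact k * B * (1 / (8 * 4 ^ k * fact k))"
        using \<open>B \<ge> 0\<close> by (auto simp: mult_left_mono)
      also have "... = B / 4" by (simp add: field_simps)
      finally show False using big Bp by linarith
    qed
    show "f = (\<lambda>_. 0)"
    proof
      fix z
      show "f z = 0"
      proof (cases "z \<in> HH")
        case True
        hence "Im z ^ k * norm (f z) \<le> 0" using B[OF True] \<open>\<not> B > 0\<close> by linarith
        moreover have "Im z ^ k > 0" using True by simp
        ultimately show ?thesis
          by (metis linorder_not_less mult_pos_pos zero_less_norm_iff)
      qed (use cusp_form_outside[OF f] in auto)
    qed
  qed
qed

section \<open>Measure on the upper half-plane and unfolding\<close>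

lemma Complex_measurable [measurable]: "(\<lambda>(x, y). Complex x y) \<in> borel_measurable (lborel \<Otimes>\<^sub>M lborel)"
  unfolding Complex_eq by measurable

lemma box_Complex: "Complex x y \<in> box l u \<longleftrightarrow> x \<in> {Re l<..<Re u} \<and> y \<in> {Im l<..<Im u}"
  by (auto simp: in_box_complex_iff)

lemma lborel_complex_prod: "lborel = distr (lborel \<Otimes>\<^sub>M lborel) borel (\<lambda>(x, y). Complex x y)"
proof (rule lborel_eqI)
  fix l u :: complex assume le: "\<And>b. b \<in> Basis \<Longrightarrow> l \<bullet> b \<le> u \<bullet> b"
  hence le': "Re l \<le> Re u" "Im l \<le> Im u" using le[of 1] le[of \<i>] by (auto simp: Basis_complex_def inner_complex_def)
  have "emeasure (distr (lborel \<Otimes>\<^sub>M lborel) borel (\<lambda>(x, y). Complex x y)) (box l u)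
        = emeasure (lborel \<Otimes>\<^sub>M lborel) ({Re l<..<Re u} \<times> {Im l<..<Im u})"
    by (subst emeasure_distr) (auto intro!: arg_cong2[of _ _ _ _ emeasure] simp: box_Complex space_pair_measure)
  also have "... = ennreal ((Re u - Re l) * (Im u - Im l))"
    using le' by (subst lborel.emeasure_pair_measure_Times) (auto simp: ennreal_mult)
  also have "(Re u - Re l) * (Im u - Im l) = (\<Prod>b\<in>Basis. (u - l) \<bullet> b)"
    by (simp add: Basis_complex_def inner_complex_def)
  finally show "emeasure (distr (lborel \<Otimes>\<^sub>M lborel) borel (\<lambda>(x, y). Complex x y)) (box l u) =
      ennreal (\<Prod>b\<in>Basis. (u - l) \<bullet> b)" .
qed simp

text \<open>The identification with \<open>real ^ 2\<close> carries integrals over the plane to the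
  setting of Jacobian determinants and of the change of variables for absolutely integrable
  functions.\<close>

definition vec_cplx :: "real ^ 2 \<Rightarrow> complex" where "vec_cplx v = Complex (v $ 1) (v $ 2)"
definition cplx_vec :: "complex \<Rightarrow> real ^ 2" where "cplx_vec z = vector [Re z, Im z]"

lemma vec_cplx_inverse [simp]: "vec_cplx (cplx_vec z) = z" "cplx_vec (vec_cplx v) = v"
  by (auto simp: vec_cplx_def cplx_vec_def vec_eq_iff forall_2)

lemma bounded_linear_vec_cplx: "bounded_linear vec_cplx"
  by (rule linear_conv_bounded_linear[THEN iffD1], rule linearI)
     (auto simp: vec_cplx_def complex_eq_iff)

lemma bounded_linear_cplx_vec: "bounded_linear cplx_vec"
  by (rule linear_conv_bounded_linear[THEN iffD1], rule linearI)
     (auto simp: cplx_vec_def vec_eq_iff forall_2)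

lemma cplx_vec_scaleR [simp]: "cplx_vec (c *\<^sub>R z) = c *\<^sub>R cplx_vec z"
  and cplx_vec_0 [simp]: "cplx_vec 0 = 0"
  by (auto simp: cplx_vec_def vec_eq_iff forall_2)

lemma cplx_vec_measurable [measurable]: "cplx_vec \<in> borel_measurable borel"
  by (intro borel_measurable_continuous_onI linear_continuous_on bounded_linear_cplx_vec)

lemma vec_cplx_measurable [measurable]: "vec_cplx \<in> borel_measurable borel"
  by (intro borel_measurable_continuous_onI linear_continuous_on bounded_linear_vec_cplx)

lemma lborel_complex_vec: "lborel = distr lborel borel vec_cplx"
proof (rule lborel_eqI)
  fix l u :: complex assume le: "\<And>b. b \<in> Basis \<Longrightarrow> l \<bullet> b \<le> u \<bullet> b"
  hence le': "Re l \<le> Re u" "Im l \<le> Im u" using le[of 1] le[of \<i>] by (auto simp: Basis_complex_def inner_complex_def)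
  have "vec_cplx -` box l u = box (cplx_vec l) (cplx_vec u)"
    by (auto simp: vec_cplx_def cplx_vec_def box_Complex mem_box_cart forall_2)
  hence "emeasure (distr lborel borel vec_cplx) (box l u) = emeasure lborel (box (cplx_vec l) (cplx_vec u))"
    by (subst emeasure_distr) auto
  also have "... = ennreal (\<Prod>b\<in>Basis. (cplx_vec u - cplx_vec l) \<bullet> b)"
      proof (intro emeasure_lborel_box)
    fix b :: "real ^ 2" assume "b \<in> Basis"
    then obtain i where "b = axis i 1" by (auto simp: Basis_vec_def)
    with exhaust_2[of i] le' show "cplx_vec l \<bullet> b \<le> cplx_vec u \<bullet> b"
      by (auto simp: inner_axis cplx_vec_def)
  qed
  also have "(\<Prod>b\<in>Basis. (cplx_vec u - cplx_vec l) \<bullet> b) = (\<Prod>i\<in>UNIV. (cplx_vec u - cplx_vec l) $ i)"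
    by (simp add: Basis_vec_def inner_axis prod.UNION_disjoint axis_eq_axis)
  also have "... = (\<Prod>b\<in>Basis. (u - l) \<bullet> b)"
    by (simp add: Basis_complex_def inner_complex_def UNIV_2 cplx_vec_def)
  finally show "emeasure (distr lborel borel vec_cplx) (box l u) = ennreal (\<Prod>b\<in>Basis. (u - l) \<bullet> b)" .
qed simp

lemma set_integral_vec_cplx:
  fixes g :: "complex \<Rightarrow> complex"
  assumes B: "B \<in> sets borel" and m: "set_borel_measurable borel B g"
  shows "set_integrable lborel B g \<longleftrightarrow> (cplx_vec \<circ> g \<circ> vec_cplx) absolutely_integrable_on (vec_cplx -` B)"
    and "set_integrable lborel B g \<Longrightarrow>
      integral (vec_cplx -` B) (cplx_vec \<circ> g \<circ> vec_cplx) = cplx_vec (LINT z:B|lborel. g z)"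
proof -
  let ?X = "\<lambda>z. indicator B z *\<^sub>R g z"
  have mX [measurable]: "?X \<in> borel_measurable borel" using m by (simp add: set_borel_measurable_def)
  let ?Y = "\<lambda>v. indicator (vec_cplx -` B) v *\<^sub>R (cplx_vec \<circ> g \<circ> vec_cplx) v"
  have Y: "?Y = (\<lambda>v. cplx_vec (?X (vec_cplx v)))"
    by (simp add: fun_eq_iff indicator_def)
  have mY: "?Y \<in> borel_measurable lborel"
    unfolding Y by measurable
  have "set_integrable lborel B g \<longleftrightarrow> integrable (distr lborel borel vec_cplx) ?X"
    unfolding set_integrable_def by (subst lborel_complex_vec) (rule refl)
  also have "... \<longleftrightarrow> integrable lborel (\<lambda>v. ?X (vec_cplx v))"
    by (subst integrable_distr_eq) auto
  also have "... \<longleftrightarrow> integrable lborel ?Y"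
    unfolding Y
  proof
    assume "integrable lborel (\<lambda>v. ?X (vec_cplx v))"
    thus "integrable lborel (\<lambda>v. cplx_vec (?X (vec_cplx v)))"
      by (rule integrable_bounded_linear[OF bounded_linear_cplx_vec])
  next
    assume "integrable lborel (\<lambda>v. cplx_vec (?X (vec_cplx v)))"
    from integrable_bounded_linear[OF bounded_linear_vec_cplx this]
    show "integrable lborel (\<lambda>v. ?X (vec_cplx v))" unfolding vec_cplx_inverse .
  qed
  also have "... \<longleftrightarrow> integrable lebesgue ?Y" using integrable_completion[OF mY] by simp
  finally show *: "set_integrable lborel B g \<longleftrightarrow> (cplx_vec \<circ> g \<circ> vec_cplx) absolutely_integrable_on (vec_cplx -` B)"
    by (simp add: set_integrable_def)
  assume int: "set_integrable lborel B g"
  have "(LINT z:B|lborel. g z) = integral\<^sup>L (distr lborel borel vec_cplx) ?X"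
    unfolding set_lebesgue_integral_def by (subst lborel_complex_vec) (rule refl)
  also have "... = (LBINT v. ?X (vec_cplx v))" by (subst integral_distr) auto
  finally have "cplx_vec (LINT z:B|lborel. g z) = cplx_vec (LBINT v. ?X (vec_cplx v))" by simp
  also have "... = integral\<^sup>L lborel ?Y" unfolding Y
  proof (rule integral_bounded_linear[OF bounded_linear_cplx_vec, symmetric])
    show "integrable lborel (\<lambda>v. ?X (vec_cplx v))"
      using int unfolding set_integrable_def
      by (subst (asm) lborel_complex_vec, subst (asm) integrable_distr_eq) auto
  qed
  also have "... = integral\<^sup>L lebesgue ?Y" using integral_completion[OF mY] by simp
  also have "... = integral (vec_cplx -` B) (cplx_vec \<circ> g \<circ> vec_cplx)"
    using set_lebesgue_integral_eq_integral(2)[OF *[THEN iffD1, OF int]]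
    by (simp add: set_lebesgue_integral_def)
  finally show "integral (vec_cplx -` B) (cplx_vec \<circ> g \<circ> vec_cplx) = cplx_vec (LINT z:B|lborel. g z)" by simp
qed

text \<open>The real derivative of a holomorphic map is multiplication by the complex number
  \<open>g' z\<close>, whose matrix has determinant \<open>|g' z|^2\<close>.\<close>

lemma holomorphic_change_of_variables:
  fixes g g' \<phi> :: "complex \<Rightarrow> complex"
  assumes A: "A \<in> sets borel" and gA: "g ` A \<in> sets borel" and inj: "inj_on g A"
    and der: "\<And>z. z \<in> A \<Longrightarrow> (g has_field_derivative g' z) (at z within A)"
    and m: "set_borel_measurable borel A (\<lambda>z. (norm (g' z))^2 *\<^sub>R \<phi> (g z))"
    and int: "set_integrable lborel (g ` A) \<phi>"
  shows "set_integrable lborel A (\<lambda>z. (norm (g' z))^2 *\<^sub>R \<phi> (g z))"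
    and "(LINT z:A|lborel. (norm (g' z))^2 *\<^sub>R \<phi> (g z)) = (LINT z:g ` A|lborel. \<phi> z)"
proof -
  define S where "S = vec_cplx -` A"
  define G where "G = cplx_vec \<circ> g \<circ> vec_cplx"
  define G' where "G' v = cplx_vec \<circ> (\<lambda>h. g' (vec_cplx v) * h) \<circ> vec_cplx" for v
  define F where "F = cplx_vec \<circ> \<phi> \<circ> vec_cplx"
  have S: "S \<in> sets lebesgue"
    unfolding S_def using measurable_sets[OF vec_cplx_measurable A] by simp
  have GS: "G ` S = vec_cplx -` (g ` A)"
  proof (intro equalityI subsetI)
    fix v assume "v \<in> vec_cplx -` (g ` A)"
    then obtain z where "z \<in> A" "vec_cplx v = g z" by auto
    hence "cplx_vec z \<in> S" "v = G (cplx_vec z)" unfolding S_def G_def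
      using vec_cplx_inverse by (auto simp flip: \<open>vec_cplx v = g z\<close>)
    thus "v \<in> G ` S" by blast
  qed (auto simp: S_def G_def)
  have der': "(G has_derivative G' v) (at v within S)" if v: "v \<in> S" for v
  proof -
    have 1: "(vec_cplx has_derivative vec_cplx) (at v within S)"
      by (rule bounded_linear_imp_has_derivative[OF bounded_linear_vec_cplx])
    have 2: "(g has_derivative (\<lambda>h. g' (vec_cplx v) * h)) (at (vec_cplx v) within vec_cplx ` S)"
      using der[of "vec_cplx v"] v unfolding has_field_derivative_def S_def
      by (auto intro: has_derivative_subset)
    have 3: "((g \<circ> vec_cplx) has_derivative (\<lambda>h. g' (vec_cplx v) * h) \<circ> vec_cplx) (at v within S)"
      by (rule diff_chain_within[OF 1 2])
    have "((cplx_vec \<circ> (g \<circ> vec_cplx)) has_derivative cplx_vec \<circ> ((\<lambda>h. g' (vec_cplx v) * h) \<circ> vec_cplx)) (at v within S)"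
      by (rule diff_chain_within[OF 3 bounded_linear_imp_has_derivative[OF bounded_linear_cplx_vec]])
    thus ?thesis by (simp add: G_def G'_def o_assoc)
  qed
  have injG: "inj_on G S"
    using inj unfolding inj_on_def G_def S_def by (metis comp_apply vec_cplx_inverse vimage_eq)
  have det: "\<bar>det (matrix (G' v))\<bar> = (norm (g' (vec_cplx v)))^2" for v
  proof -
    have ax: "vec_cplx (axis 1 1) = 1" "vec_cplx (axis 2 1) = \<i>"
      by (auto simp: vec_cplx_def axis_def complex_eq_iff)
    have "det (matrix (G' v)) = (Re (g' (vec_cplx v)))^2 + (Im (g' (vec_cplx v)))^2"
      by (simp add: det_2 matrix_def G'_def ax cplx_vec_def power2_eq_square)
    thus ?thesis by (simp add: cmod_power2)
  qed
  have m\<phi>: "set_borel_measurable borel (g ` A) \<phi>"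
    using int by (auto simp: set_integrable_def set_borel_measurable_def dest: borel_measurable_integrable)
  have "F absolutely_integrable_on (G ` S) \<and> integral (G ` S) F = cplx_vec (LINT z:g ` A|lborel. \<phi> z)"
    unfolding GS F_def using set_integral_vec_cplx[OF gA m\<phi>] int by auto
  hence *: "(\<lambda>v. \<bar>det (matrix (G' v))\<bar> *\<^sub>R F (G v)) absolutely_integrable_on S \<and>
        integral S (\<lambda>v. \<bar>det (matrix (G' v))\<bar> *\<^sub>R F (G v)) = cplx_vec (LINT z:g ` A|lborel. \<phi> z)"
    using has_absolute_integral_change_of_variables[OF S der' injG] by blast
  have eq: "(\<lambda>v. \<bar>det (matrix (G' v))\<bar> *\<^sub>R F (G v)) = cplx_vec \<circ> (\<lambda>z. (norm (g' z))^2 *\<^sub>R \<phi> (g z)) \<circ> vec_cplx"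
    unfolding det by (auto simp: F_def G_def)
  show int': "set_integrable lborel A (\<lambda>z. (norm (g' z))^2 *\<^sub>R \<phi> (g z))"
    using set_integral_vec_cplx(1)[OF A m] * unfolding eq S_def by blast
  have "cplx_vec (LINT z:A|lborel. (norm (g' z))^2 *\<^sub>R \<phi> (g z)) = cplx_vec (LINT z:g ` A|lborel. \<phi> z)"
    using set_integral_vec_cplx(2)[OF A m int'] * unfolding eq S_def by simp
  thus "(LINT z:A|lborel. (norm (g' z))^2 *\<^sub>R \<phi> (g z)) = (LINT z:g ` A|lborel. \<phi> z)"
    by (metis vec_cplx_inverse(1))
qed

lemma infsum_suminf: fixes f :: "nat \<Rightarrow> 'a::banach" assumes "summable (\<lambda>n. norm (f n))" shows "infsum f UNIV = suminf f"
  using norm_summable_imp_has_sum[OF assms] assms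
  by (metis infsumI summable_norm_cancel summable_sums)

text \<open>Reduced to series by enumerating the index set. Summability of the norms is asked at
  every point, so that the unordered sum agrees with the series everywhere; summability of the
  integrated norms licenses the interchange.\<close>

lemma integral_infsum:
  fixes f :: "'i \<Rightarrow> 'a \<Rightarrow> 'b :: {banach, second_countable_topology}"
  assumes I: "countable I" and int: "\<And>i. i \<in> I \<Longrightarrow> integrable M (f i)"
    and pt: "\<And>x. x \<in> space M \<Longrightarrow> (\<lambda>i. norm (f i x)) summable_on I"
    and sm: "(\<lambda>i. \<integral>x. norm (f i x) \<partial>M) summable_on I"
  shows "integrable M (\<lambda>x. \<Sum>\<^sub>\<infinity>i\<in>I. f i x)"
    and "((\<lambda>i. \<integral>x. f i x \<partial>M) has_sum (\<integral>x. (\<Sum>\<^sub>\<infinity>i\<in>I. f i x) \<partial>M)) I"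
proof -
  let ?S = "\<lambda>x. \<Sum>\<^sub>\<infinity>i\<in>I. f i x"
  have "integrable M (\<lambda>x. ?S x) \<and> ((\<lambda>i. \<integral>x. f i x \<partial>M) has_sum (\<integral>x. (?S x) \<partial>M)) I"
  proof (cases "finite I")
    case True
    thus ?thesis using int by (auto intro!: has_sum_finiteI simp: Bochner_Integration.integral_sum)
  next
    case False
    define b where "b = from_nat_into I"
    have b: "bij_betw b UNIV I" unfolding b_def using I False by (rule bij_betw_from_nat_into)
    have bI: "b n \<in> I" for n using b by (auto simp: bij_betw_def)
    have pt': "summable (\<lambda>n. norm (f (b n) x))" if "x \<in> space M" for x
      using pt[OF that] summable_on_reindex_bij_betw[OF b, of "\<lambda>i. norm (f i x)"]
      by (simp add: summable_on_UNIV_nonneg_real_iff)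
    have sm': "summable (\<lambda>n. \<integral>x. norm (f (b n) x) \<partial>M)"
      using sm summable_on_reindex_bij_betw[OF b, of "\<lambda>i. \<integral>x. norm (f i x) \<partial>M"]
      by (simp add: summable_on_UNIV_nonneg_real_iff)
    have eq: "(?S x) = (\<Sum>n. f (b n) x)" if "x \<in> space M" for x
      using infsum_reindex_bij_betw[OF b, of "\<lambda>i. f i x"] infsum_suminf[OF pt'[OF that]] by simp
    have AE: "AE x in M. summable (\<lambda>n. norm (f (b n) x))" using pt' by auto
    note * = integrable_suminf[OF int[OF bI] AE sm'] sums_integral[OF int[OF bI] AE sm']
    have n: "summable (\<lambda>n. norm (\<integral>x. f (b n) x \<partial>M))"
      by (rule summable_comparison_test'[OF sm']) (use int bI in auto)
    have "((\<lambda>n. \<integral>x. f (b n) x \<partial>M) has_sum (\<integral>x. (\<Sum>n. f (b n) x) \<partial>M)) UNIV"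
      by (rule norm_summable_imp_has_sum[OF n *(2)])
    hence "((\<lambda>i. \<integral>x. f i x \<partial>M) has_sum (\<integral>x. (\<Sum>n. f (b n) x) \<partial>M)) I"
      using has_sum_reindex_bij_betw[OF b, of "\<lambda>i. \<integral>x. f i x \<partial>M"] by simp
    moreover have "(\<integral>x. (\<Sum>n. f (b n) x) \<partial>M) = (\<integral>x. (?S x) \<partial>M)"
      by (rule Bochner_Integration.integral_cong) (use eq in auto)
    moreover have "integrable M (\<lambda>x. \<Sum>n. f (b n) x) \<longleftrightarrow> integrable M (\<lambda>x. ?S x)"
      by (rule Bochner_Integration.integrable_cong) (use eq in auto)
    ultimately show ?thesis using *(1) by simp
  qed
  thus "integrable M (\<lambda>x. ?S x)"
    and "((\<lambda>i. \<integral>x. f i x \<partial>M) has_sum (\<integral>x. (?S x) \<partial>M)) I" by auto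
qed

section \<open>The tiling by translates of the open fundamental domain\<close>

definition F0 :: "complex set" where
  "F0 = {z. Im z > 0 \<and> \<bar>Re z\<bar> < 1/2 \<and> norm z > 1}"

lemma F0_subset: "F0 \<subseteq> fundamental_domain" "F0 \<subseteq> HH"
  by (auto simp: F0_def fundamental_domain_def)

lemma fundamental_domain_subset: "fundamental_domain \<subseteq> HH"
  by (auto simp: fundamental_domain_def)

lemma open_F0: "open F0"
  unfolding F0_def by (intro open_Collect_conj open_Collect_less continuous_intros)

lemma borel_F0 [measurable]: "F0 \<in> sets borel"
  using open_F0 by (rule borel_open)

lemma borel_HH [measurable]: "HH \<in> sets borel"
  by (rule borel_open) simp

lemma borel_fundamental_domain [measurable]: "fundamental_domain \<in> sets borel"
  unfolding fundamental_domain_def upper_half_plane_def by measurable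

lemma null_fd_F0: "fundamental_domain - F0 \<in> null_sets lborel"
proof -
  have h: "negligible {z::complex. Re z = c}" for c
    using negligible_hyperplane[of "1::complex" c] by simp
  have "negligible (sphere (0::complex) 1)" by (rule negligible_sphere)
  hence "negligible ({z. Re z = 1/2} \<union> {z. Re z = -1/2} \<union> sphere (0::complex) 1)"
    using h[of "1/2"] h[of "-1/2"] by (intro negligible_Un)
  hence "negligible (fundamental_domain - F0)"
    by (rule negligible_subset) (auto simp: fundamental_domain_def F0_def)
  thus ?thesis by (auto simp: negligible_iff_null_sets null_sets_completion_iff)
qed

lemma int_quadratic_ge:
  fixes c d :: int assumes "c \<noteq> 0 \<or> d \<noteq> 0" shows "c^2 + d^2 - \<bar>c * d\<bar> \<ge> 1"
proof -
  have *: "4 * (c^2 + d^2 - \<bar>c * d\<bar>) = (2 * \<bar>c\<bar> - \<bar>d\<bar>)^2 + 3 * d^2"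
    by (simp add: power2_eq_square abs_mult algebra_simps)
  show ?thesis
  proof (cases "d = 0")
    case True
    thus ?thesis using assms by (simp add: power2_eq_square) (metis not_less zero_less_mult_iff int_one_le_iff_zero_less linorder_neqE)
  next
    case False
    hence "d^2 > 0" by simp
    hence "4 * (c^2 + d^2 - \<bar>c * d\<bar>) > 0" unfolding * by (smt (verit) zero_le_power2)
    hence "c^2 + d^2 - \<bar>c * d\<bar> > 0" by (simp only: zero_less_mult_iff) simp
    thus ?thesis by simp
  qed
qed

text \<open>From \<open>|z| >= 1\<close> and \<open>|Re z| <= 1/2\<close> follows
  \<open>|c z + d|^2 >= c^2 - |c d| + d^2\<close>, a positive integer. The inequality is strict once
  \<open>|z| > 1\<close> and \<open>c\<close> is non-zero.\<close>

lemma norm_mden_ge: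
  assumes z: "z \<in> fundamental_domain" and cd: "c \<noteq> 0 \<or> d \<noteq> 0"
  shows "norm (of_int c * z + of_int d) \<ge> 1"
    and "c \<noteq> 0 \<Longrightarrow> z \<in> F0 \<Longrightarrow> norm (of_int c * z + of_int d) > 1"
proof -
  have zz: "1 \<le> (Re z)^2 + (Im z)^2" "\<bar>Re z\<bar> \<le> 1/2"
    using z by (auto simp: fundamental_domain_def cmod_power2[symmetric])
  have n: "(norm (of_int c * z + of_int d))^2 =
     of_int c^2 * ((Re z)^2 + (Im z)^2) + 2 * (of_int (c * d) * Re z) + of_int d^2"
    unfolding cmod_power2 by (simp add: power2_eq_square algebra_simps)
  have "\<bar>of_int (c * d) * Re z\<bar> = of_int \<bar>c * d\<bar> * \<bar>Re z\<bar>"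
    by (simp add: abs_mult)
  also have "... \<le> of_int \<bar>c * d\<bar> * (1/2)" by (intro mult_left_mono zz) auto
  finally have "\<bar>of_int (c * d) * Re z\<bar> \<le> of_int \<bar>c * d\<bar> * (1/2)" .
  hence x: "2 * (of_int (c * d) * Re z) \<ge> - of_int \<bar>c * d\<bar>" by linarith
  have q: "real_of_int (c^2) + of_int (d^2) - of_int \<bar>c * d\<bar> \<ge> 1"
    using int_quadratic_ge[OF cd] by linarith
  have "of_int c^2 * 1 \<le> of_int c^2 * ((Re z)^2 + (Im z)^2)"
    by (intro mult_left_mono zz) auto
  hence "(norm (of_int c * z + of_int d))^2 \<ge> 1^2" using n x q by simp
  thus "norm (of_int c * z + of_int d) \<ge> 1" by (rule power2_le_imp_le) simp
  assume c: "c \<noteq> 0" and "z \<in> F0"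
  hence "1^2 < (norm z)^2" by (intro power_strict_mono) (auto simp: F0_def)
  hence "1 < (Re z)^2 + (Im z)^2" by (simp add: cmod_power2)
  hence "of_int c^2 * 1 < of_int c^2 * ((Re z)^2 + (Im z)^2)"
    using c by (intro mult_strict_left_mono) auto
  hence "(norm (of_int c * z + of_int d))^2 > 1^2" using n x q by simp
  thus "norm (of_int c * z + of_int d) > 1" by (rule power2_less_imp_less) simp
qed

text \<open>If \<open>c\<close> were non-zero, \<open>M\<close> would strictly lower the imaginary
  part of \<open>z\<close>, and its inverse, whose lower left entry is \<open>- c\<close>, would
  strictly lower it again on the way back to \<open>z\<close>. With \<open>c = 0\<close> the map is
  a translation by an integer of modulus less than 1. On the boundary, where opposite sides are
  identified, the claim would fail; hence the open domain.\<close>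

lemma F0_unique:
  assumes z: "z \<in> F0" and M: "mdet M = 1" and m: "mob M z \<in> F0"
  shows "M = (1, 0, 0, 1) \<or> M = (-1, 0, 0, -1)"
proof -
  obtain a b c d where Md: "M = (a, b, c, d)" by (cases M)
  have zH: "z \<in> HH" "mob M z \<in> HH" using z m F0_subset by auto
  have less: "Im (mob N v) < Im v" if "v \<in> F0" "mdet N = 1" "N = (a', b', c', d')" "c' \<noteq> 0" for N v a' b' c' d'
  proof -
    have vH: "v \<in> HH" using that F0_subset by auto
    have "norm (mden N v) > 1" using norm_mden_ge(2)[of v c' d'] that F0_subset by auto
    hence "norm (mden N v)^2 > 1" by (simp add: one_less_power)
    hence "Im v / norm (mden N v)^2 < Im v / 1"
      using vH by (intro divide_strict_left_mono) auto
    thus ?thesis using that vH by (simp add: Im_mob)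
  qed
  have "c = 0"
  proof (rule ccontr)
    assume c: "c \<noteq> 0"
    have "Im (mob M z) < Im z" by (rule less[OF z M Md c])
    moreover have "Im (mob (madj M) (mob M z)) < Im (mob M z)"
      by (rule less[OF m, of _ d "-b" "-c" a]) (use M Md c in \<open>auto simp: mult.commute\<close>)
    ultimately show False using mob_madj[OF M zH(1)] by simp
  qed
  with M have "a * d = 1" by (simp add: Md)
  hence ad': "a = 1 \<and> d = 1 \<or> a = -1 \<and> d = -1" by (simp add: zmult_eq_1_iff)
  have "mob M z = z + of_int (b * d)"
    using ad' \<open>c = 0\<close> by (auto simp: Md mob_def)
  hence "\<bar>Re z + of_int (b * d)\<bar> < 1/2" "\<bar>Re z\<bar> < 1/2" using m z by (auto simp: F0_def)
  hence "\<bar>real_of_int (b * d)\<bar> < 1" by linarith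
  hence "b * d = 0" by linarith
  thus ?thesis using ad' \<open>c = 0\<close> by (auto simp: Md)
qed

lemma mob_image:
  assumes M: "mdet M = 1" and A: "A \<subseteq> HH"
  shows "mob M ` A = {z \<in> HH. mob (madj M) z \<in> A}"
proof (intro equalityI subsetI)
  fix z assume "z \<in> mob M ` A"
  then obtain v where "v \<in> A" "z = mob M v" by auto
  thus "z \<in> {z \<in> HH. mob (madj M) z \<in> A}"
    using mob_madj[OF M, of v] mob_in_HH[of M v] M A by auto
next
  fix z assume z: "z \<in> {z \<in> HH. mob (madj M) z \<in> A}"
  hence "z = mob M (mob (madj M) z)" using mob_madj'[OF M] by auto
  thus "z \<in> mob M ` A" using z by blast
qed

lemma mob_inj: "mdet M = 1 \<Longrightarrow> inj_on (mob M) HH"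
  by (rule inj_on_inverseI[of _ "mob (madj M)"]) (rule mob_madj)

lemma mob_deriv:
  assumes "mdet M = 1" "z \<in> HH"
  shows "(mob M has_field_derivative (1 / mden M z ^ 2)) (at z within A)"
proof -
  obtain a b c d where M: "M = (a, b, c, d)" by (cases M)
  have nz: "of_int c * z + of_int d \<noteq> 0" using mden_nonzero[of M z] assms by (simp add: M)
  have "((\<lambda>z. (of_int a * z + of_int b) / (of_int c * z + of_int d)) has_field_derivative
     (of_int a * (of_int c * z + of_int d) - (of_int a * z + of_int b) * of_int c) / (of_int c * z + of_int d)^2) (at z within A)"
    using nz by (auto intro!: derivative_eq_intros simp: power2_eq_square)
  also have "of_int a * (of_int c * z + of_int d) - (of_int a * z + of_int b) * of_int c = 1"
    using arg_cong[OF assms(1)[unfolded M mdet.simps], of "of_int :: int \<Rightarrow> complex"]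
    by (simp add: algebra_simps)
  finally show ?thesis by (simp add: mob_def[abs_def] M)
qed

lemma mden_measurable [measurable]: "mden M \<in> borel_measurable borel"
  and mnum_measurable [measurable]: "mnum M \<in> borel_measurable borel"
  by (cases M; simp add: mden.simps[abs_def] mnum.simps[abs_def])+

lemma mob_measurable [measurable]: "mob M \<in> borel_measurable borel"
  unfolding mob_def[abs_def] by measurable

lemma mob_image_borel: "mdet M = 1 \<Longrightarrow> A \<subseteq> HH \<Longrightarrow> A \<in> sets borel \<Longrightarrow> mob M ` A \<in> sets borel"
proof -
  assume a: "mdet M = 1" "A \<subseteq> HH" and [measurable]: "A \<in> sets borel"
  have "{z \<in> space borel. z \<in> HH \<and> mob (madj M) z \<in> A} \<in> sets borel" by measurable
  thus ?thesis by (simp add: mob_image[OF a(1,2)])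
qed

lemma mats_countable [simp]: "countable (mats l)"
  by (rule countable_subset[OF subset_UNIV]) simp

text \<open>The matrices \<open>P\<close> and \<open>- P\<close> act alike, so a tile is counted
  exactly twice; this is the source of the factor 2 in the unfolding.\<close>

lemma tiles_mult:
  assumes "z \<in> mob P ` F0" "mdet P = 1"
  shows "{M \<in> mats 1. z \<in> mob M ` F0} = {P, mmul P (-1, 0, 0, -1)}"
    and "P \<noteq> mmul P (-1, 0, 0, -1)"
proof -
  obtain v where v: "v \<in> F0" "z = mob P v" using assms by auto
  have vH: "v \<in> HH" using v F0_subset by auto
  have m1: "mob (mmul P (-1, 0, 0, -1)) v = mob P v"
    using vH by (subst mob_mmul) (auto simp: mob_def[of "(-1,0,0,-1)"])
  show "{M \<in> mats 1. z \<in> mob M ` F0} = {P, mmul P (-1, 0, 0, -1)}"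
  proof (intro equalityI subsetI)
    fix R assume "R \<in> {M \<in> mats 1. z \<in> mob M ` F0}"
    then obtain u where R: "mdet R = 1" "u \<in> F0" "z = mob R u" by auto
    have uH: "u \<in> HH" using R F0_subset by auto
    have "mob (mmul (madj P) R) u = v"
      using uH R v mob_madj[OF assms(2) vH] by (subst mob_mmul) auto
    hence "mmul (madj P) R = (1,0,0,1) \<or> mmul (madj P) R = (-1,0,0,-1)"
      using F0_unique[OF R(2), of "mmul (madj P) R"] R v assms by simp
    hence "mmul P (mmul (madj P) R) = P \<or> mmul P (mmul (madj P) R) = mmul P (-1,0,0,-1)"
      by (metis mmul_one(2))
    thus "R \<in> {P, mmul P (-1, 0, 0, -1)}"
      using assms by (simp add: mmul_assoc[symmetric] mmul_madj)
  next
    fix R assume "R \<in> {P, mmul P (-1, 0, 0, -1)}"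
    thus "R \<in> {M \<in> mats 1. z \<in> mob M ` F0}"
      using v assms m1 by (auto simp: image_iff) (metis m1)
  qed
  show "P \<noteq> mmul P (-1, 0, 0, -1)"
    using assms(2) by (cases P) auto
qed

lemma tiles_finite: "finite {M \<in> mats 1. z \<in> mob M ` F0}" "card {M \<in> mats 1. z \<in> mob M ` F0} \<le> 2"
proof -
  have "finite {M \<in> mats 1. z \<in> mob M ` F0} \<and> card {M \<in> mats 1. z \<in> mob M ` F0} \<le> 2"
  proof (cases "\<exists>P. mdet P = 1 \<and> z \<in> mob P ` F0")
    case True
    then obtain P where P: "mdet P = 1" "z \<in> mob P ` F0" by blast
    show ?thesis unfolding tiles_mult(1)[OF P(2,1)] by (simp add: card_insert_if)
  next
    case False
    hence "{M \<in> mats 1. z \<in> mob M ` F0} = {}" by auto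
    thus ?thesis by (simp only: card.empty finite.emptyI) simp
  qed
  thus "finite {M \<in> mats 1. z \<in> mob M ` F0}" "card {M \<in> mats 1. z \<in> mob M ` F0} \<le> 2" by auto
qed

text \<open>A point that meets no tile is equivalent to a boundary point of the fundamental domain.
  These points form a countable union of smooth images of a null set.\<close>

lemma tiles_AE: "AE z in lborel. z \<in> HH \<longrightarrow> card {M \<in> mats 1. z \<in> mob M ` F0} = 2"
proof -
  define N where "N = (\<Union>M\<in>mats 1. mob M ` (fundamental_domain - F0))"
  have neg: "negligible (mob M ` (fundamental_domain - F0))" if "mdet M = 1" for M
  proof (rule negligible_differentiable_image_negligible[OF order_refl])
    show "negligible (fundamental_domain - F0)"
      using null_fd_F0 by (auto simp: negligible_iff_null_sets intro: null_sets_completionI)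
    show "mob M differentiable_on (fundamental_domain - F0)"
      using mob_deriv[OF that] fundamental_domain_subset unfolding differentiable_on_def
      by (meson DiffD1 field_differentiable_def field_differentiable_imp_differentiable subsetD)
  qed
  have "negligible N"
    unfolding N_def by (subst negligible_iff_null_sets, rule null_sets_UN')
      (auto simp: negligible_iff_null_sets[symmetric] neg)
  then obtain N' where N': "N' \<in> null_sets lborel" "N \<subseteq> N'"
    by (auto simp: negligible_iff_null_sets null_sets_completion_iff2)
  show ?thesis
  proof (rule AE_I'[OF N'(1)], rule subsetI)
    fix z assume "z \<in> {x \<in> space lborel. \<not> (x \<in> HH \<longrightarrow> card {M \<in> mats 1. x \<in> mob M ` F0} = 2)}"
    hence z: "z \<in> HH" "card {M \<in> mats 1. z \<in> mob M ` F0} \<noteq> 2" by auto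
    obtain M where M: "mdet M = 1" "mob M z \<in> fundamental_domain" using reduction[OF z(1)] by blast
    have zM: "z = mob (madj M) (mob M z)" using mob_madj[OF M(1) z(1)] by simp
    have "mob M z \<notin> F0"
    proof
      assume "mob M z \<in> F0"
      hence "z \<in> mob (madj M) ` F0" using zM by blast
      from tiles_mult[OF this] M z(2) show False by simp
    qed
    hence "z \<in> mob (madj M) ` (fundamental_domain - F0)" using zM M by blast
    hence "z \<in> N" using M by (auto simp: N_def)
    thus "z \<in> N'" using N' by blast
  qed
qed

lemma mob_integral:
  fixes \<phi> :: "complex \<Rightarrow> complex"
  assumes M: "mdet M = 1" and A: "A \<in> sets borel" "A \<subseteq> HH" and int: "set_integrable lborel (mob M ` A) \<phi>"
  shows "set_integrable lborel A (\<lambda>z. (1 / norm (mden M z) ^ 4) *\<^sub>R \<phi> (mob M z))"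
    and "(LINT z:A|lborel. (1 / norm (mden M z) ^ 4) *\<^sub>R \<phi> (mob M z)) = (LINT z:mob M ` A|lborel. \<phi> z)"
proof -
  have eq: "(norm (1 / mden M z ^ 2))^2 = 1 / norm (mden M z) ^ 4" for z
    by (simp add: norm_divide norm_power power_divide power_mult[symmetric])
  have gA: "mob M ` A \<in> sets borel" by (rule mob_image_borel[OF M A(2,1)])
  have [measurable]: "(\<lambda>z. indicator (mob M ` A) z *\<^sub>R \<phi> z) \<in> borel_measurable borel"
    using int by (auto simp: set_integrable_def dest: borel_measurable_integrable)
  have "(\<lambda>z. indicator A z *\<^sub>R (1 / norm (mden M z) ^ 4) *\<^sub>R (indicator (mob M ` A) (mob M z) *\<^sub>R \<phi> (mob M z)))
          \<in> borel_measurable borel"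
    using A(1) by measurable
  also have "(\<lambda>z. indicator A z *\<^sub>R (1 / norm (mden M z) ^ 4) *\<^sub>R (indicator (mob M ` A) (mob M z) *\<^sub>R \<phi> (mob M z)))
     = (\<lambda>z. indicator A z *\<^sub>R ((norm (1 / mden M z ^ 2))^2 *\<^sub>R \<phi> (mob M z)))"
    unfolding eq by (auto simp: fun_eq_iff indicator_def)
  finally have m: "set_borel_measurable borel A (\<lambda>z. (norm (1 / mden M z ^ 2))^2 *\<^sub>R \<phi> (mob M z))"
    by (simp add: set_borel_measurable_def)
  note * = holomorphic_change_of_variables[OF A(1) gA inj_on_subset[OF mob_inj[OF M] A(2)] _ m int, unfolded eq]
  show "set_integrable lborel A (\<lambda>z. (1 / norm (mden M z) ^ 4) *\<^sub>R \<phi> (mob M z))"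
    by (rule *(1)) (use mob_deriv[OF M] A in auto)
  show "(LINT z:A|lborel. (1 / norm (mden M z) ^ 4) *\<^sub>R \<phi> (mob M z)) = (LINT z:mob M ` A|lborel. \<phi> z)"
    by (rule *(2)) (use mob_deriv[OF M] A in auto)
qed

text \<open>Each summand is the integral of \<open>\<phi>\<close> over one tile, pulled back to
  \<open>F0\<close> with Jacobian \<open>|c z + d|^(-4)\<close>. Almost every point of the
  half-plane lies in the two tiles belonging to \<open>M\<close> and \<open>- M\<close>, whence the
  factor 2.\<close>

lemma unfolding_tiles:
  fixes \<phi> :: "complex \<Rightarrow> complex"
  assumes int: "set_integrable lborel HH \<phi>"
  shows "((\<lambda>M. LINT z:F0|lborel. (1 / norm (mden M z) ^ 4) *\<^sub>R \<phi> (mob M z)) has_sum (2 * (LINT z:HH|lborel. \<phi> z))) (mats 1)"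
    and "M \<in> mats 1 \<Longrightarrow> set_integrable lborel F0 (\<lambda>z. (1 / norm (mden M z) ^ 4) *\<^sub>R \<phi> (mob M z))"
proof -
  let ?S = "\<lambda>(f::mat2 \<Rightarrow> complex \<Rightarrow> complex) z. \<Sum>\<^sub>\<infinity>M\<in>mats 1. f M z"
  let ?p = "\<lambda>z. indicator HH z *\<^sub>R \<phi> z"
  have sub: "mob M ` F0 \<subseteq> HH" if "M \<in> mats 1" for M
    using that F0_subset mob_in_HH[of M] by auto
  have bor: "mob M ` F0 \<in> sets borel" if "M \<in> mats 1" for M
    using that F0_subset by (intro mob_image_borel) auto
  have intM: "set_integrable lborel (mob M ` F0) \<phi>" if "M \<in> mats 1" for M
    by (rule set_integrable_subset[OF int]) (use sub[OF that] bor[OF that] in auto)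
  have mi: "set_integrable lborel F0 (\<lambda>z. (1 / norm (mden M z) ^ 4) *\<^sub>R \<phi> (mob M z))"
    "(LINT z:F0|lborel. (1 / norm (mden M z) ^ 4) *\<^sub>R \<phi> (mob M z)) = (LINT z:mob M ` F0|lborel. \<phi> z)"
    if "M \<in> mats 1" for M
    using mob_integral[OF _ borel_F0 F0_subset(2) intM[OF that]] that by auto
  show "M \<in> mats 1 \<Longrightarrow> set_integrable lborel F0 (\<lambda>z. (1 / norm (mden M z) ^ 4) *\<^sub>R \<phi> (mob M z))" by (rule mi)
  define f where "f M z = indicator (mob M ` F0) z *\<^sub>R \<phi> z" for M z
  have fint: "integrable lborel (f M)" if "M \<in> mats 1" for M
    using intM[OF that] unfolding f_def set_integrable_def .
  have out: "f M z = 0" if "M \<in> mats 1 - {M \<in> mats 1. z \<in> mob M ` F0}" for M z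
    using that by (auto simp: f_def)
  have sumf: "(?S f z) = of_nat (card {M \<in> mats 1. z \<in> mob M ` F0}) * \<phi> z" for z
  proof -
    have "(?S f z) = (\<Sum>\<^sub>\<infinity>M\<in>{M \<in> mats 1. z \<in> mob M ` F0}. f M z)"
      by (rule infsum_cong_neutral) (use out in auto)
    also have "... = (\<Sum>M\<in>{M \<in> mats 1. z \<in> mob M ` F0}. f M z)" by (rule infsum_finite[OF tiles_finite(1)])
    also have "... = (\<Sum>M\<in>{M \<in> mats 1. z \<in> mob M ` F0}. \<phi> z)" by (rule sum.cong) (auto simp: f_def)
    finally show ?thesis by simp
  qed
  have pt: "(\<lambda>M. norm (f M z)) summable_on mats 1" for z
      by (rule summable_on_cong_neutral[THEN iffD1, OF _ _ _ summable_on_finite[OF tiles_finite(1)[of z]]])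
         (use out in auto)
  have sm: "(\<lambda>M. LBINT z. norm (f M z)) summable_on mats 1"
    proof (rule nonneg_bdd_above_summable_on)
      show "bdd_above (sum (\<lambda>M. LBINT z. norm (f M z)) ` {F. F \<subseteq> mats 1 \<and> finite F})"
      proof (rule bdd_aboveI2)
        fix F assume F: "F \<in> {F. F \<subseteq> mats 1 \<and> finite F}"
        have "(\<Sum>M\<in>F. LBINT z. norm (f M z)) = (LBINT z. (\<Sum>M\<in>F. norm (f M z)))"
          using F fint by (subst Bochner_Integration.integral_sum) auto
        also have "... \<le> (LBINT z. 2 * norm (?p z))"
        proof (rule integral_mono)
          show "integrable lborel (\<lambda>z. \<Sum>M\<in>F. norm (f M z))" using F fint by (intro Bochner_Integration.integrable_sum) auto
          show "integrable lborel (\<lambda>z. 2 * norm (?p z))"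
            using int unfolding set_integrable_def by (intro integrable_mult_right integrable_norm)
          fix z
          have "(\<Sum>M\<in>F. norm (f M z)) = (\<Sum>M\<in>F. if z \<in> mob M ` F0 then norm (?p z) else 0)"
          proof (rule sum.cong)
            fix M assume "M \<in> F"
            hence "z \<in> HH" if "z \<in> mob M ` F0" using F sub that by blast
            thus "norm (f M z) = (if z \<in> mob M ` F0 then norm (?p z) else 0)"
              by (cases "z \<in> mob M ` F0") (simp_all add: f_def)
          qed simp
          also have "... = real (card {M\<in>F. z \<in> mob M ` F0}) * norm (?p z)"
            using F by (simp add: sum.If_cases Int_def conj_commute)
          also have "card {M\<in>F. z \<in> mob M ` F0} \<le> card {M\<in>mats 1. z \<in> mob M ` F0}"
            using F by (intro card_mono tiles_finite) auto
          hence "real (card {M\<in>F. z \<in> mob M ` F0}) * norm (?p z) \<le> 2 * norm (?p z)"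
            using tiles_finite(2)[of z] by (intro mult_right_mono) auto
          finally show "(\<Sum>M\<in>F. norm (f M z)) \<le> 2 * norm (?p z)" .
        qed
        finally show "(\<Sum>M\<in>F. LBINT z. norm (f M z)) \<le> (LBINT z. 2 * norm (?p z))" .
      qed
    qed simp
  have "((\<lambda>M. LBINT z. f M z) has_sum (LBINT z. (?S f z))) (mats 1)"
    by (rule integral_infsum(2)[OF mats_countable fint pt sm])
  also have "(LBINT z. (?S f z)) = (LBINT z. 2 * (?p z))"
  proof (rule integral_cong_AE)
    show "(\<lambda>z. ?S f z) \<in> borel_measurable lborel"
      by (rule borel_measurable_integrable, rule integral_infsum(1)[OF mats_countable fint pt sm])
    show "(\<lambda>z. 2 * (?p z)) \<in> borel_measurable lborel"
      using int unfolding set_integrable_def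
      by (intro borel_measurable_times borel_measurable_const borel_measurable_integrable)
    show "AE z in lborel. (?S f z) = 2 * (?p z)"
      using tiles_AE
    proof eventually_elim
      case (elim z)
      show ?case
      proof (cases "z \<in> HH")
        case True thus ?thesis using elim sumf[of z] by simp
      next
        case False
        have "f M z = 0" if "M \<in> mats 1" for M
        proof -
          have "z \<notin> mob M ` F0" using sub[OF that] False by blast
          thus ?thesis by (simp add: f_def)
        qed
        hence "(?S f z) = 0" by (intro infsum_0) auto
        thus ?thesis using False by (simp add: indicator_def)
      qed
    qed
  qed
  also have "... = 2 * (LINT z:HH|lborel. \<phi> z)"
    unfolding set_lebesgue_integral_def by (rule integral_mult_right_zero)
  finally have "((\<lambda>M. LBINT z. f M z) has_sum (2 * (LINT z:HH|lborel. \<phi> z))) (mats 1)" .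
  also have "?this \<longleftrightarrow> ((\<lambda>M. LINT z:F0|lborel. (1 / norm (mden M z) ^ 4) *\<^sub>R \<phi> (mob M z)) has_sum (2 * (LINT z:HH|lborel. \<phi> z))) (mats 1)"
    by (rule has_sum_cong) (use mi(2) in \<open>auto simp: f_def set_lebesgue_integral_def\<close>)
  finally show "((\<lambda>M. LINT z:F0|lborel. (1 / norm (mden M z) ^ 4) *\<^sub>R \<phi> (mob M z)) has_sum (2 * (LINT z:HH|lborel. \<phi> z))) (mats 1)" .
qed

section \<open>The Lipschitz formula\<close>

lemma inverse_square_int_summable: "(\<lambda>b::int. 1 / (1 + \<bar>real_of_int b\<bar>)^2) summable_on UNIV"
proof -
  have s: "(\<lambda>n::nat. 1 / (1 + real n)^2) summable_on UNIV"
  proof (subst summable_on_UNIV_nonneg_real_iff)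
    have "summable (\<lambda>n. 1 / (real (Suc n))^2)"
      by (subst summable_Suc_iff) (use inverse_power_summable[of 2, where 'a = real] in \<open>simp add: field_simps\<close>)
    thus "summable (\<lambda>n. 1 / (1 + real n)^2)" by simp
  qed simp
  have "(\<lambda>b::int. 1 / (1 + \<bar>real_of_int b\<bar>)^2) summable_on (range int \<union> range (\<lambda>n. - int n))"
  proof (rule summable_on_union)
    show "(\<lambda>b::int. 1 / (1 + \<bar>real_of_int b\<bar>)^2) summable_on range int"
      by (subst summable_on_reindex) (use s in \<open>auto simp: o_def inj_on_def\<close>)
    show "(\<lambda>b::int. 1 / (1 + \<bar>real_of_int b\<bar>)^2) summable_on range (\<lambda>n. - int n)"
      by (subst summable_on_reindex) (use s in \<open>auto simp: o_def inj_on_def\<close>)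
  qed
  also have "range int \<union> range (\<lambda>n. - int n) = UNIV"
    by (auto simp: image_iff) (metis int_cases2)
  finally show ?thesis .
qed

lemma norm_add_int_lower:
  assumes "Im z > 0"
  shows "1 + \<bar>real_of_int b\<bar> \<le> (1 / Im z + 1 + norm z / Im z) * norm (z + of_int b)"
proof -
  have "Im z \<le> norm (z + of_int b)" using abs_Im_le_cmod[of "z + of_int b"] by simp
  hence "1 \<le> 1 / Im z * norm (z + of_int b)" using assms by (simp add: field_simps)
  moreover have "\<bar>real_of_int b\<bar> \<le> norm (z + of_int b) * (1 + norm z / Im z)"
    using mden_lower_d[of z b 1] assms by simp
  ultimately show ?thesis by (simp add: algebra_simps)
qed

lemma add_int_power_summable:
  assumes "Im z > 0" "m \<ge> 2"
  shows "(\<lambda>b::int. norm (1 / (z + of_int b)^m)) summable_on UNIV"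
proof -
  define K where "K = 1 / Im z + 1 + norm z / Im z"
  have K: "K > 0" using assms unfolding K_def by (smt (verit) divide_nonneg_pos norm_ge_zero zero_less_divide_1_iff)
  have "(\<lambda>b::int. K ^ m * (1 / (1 + \<bar>real_of_int b\<bar>)^2)) summable_on UNIV"
    by (intro summable_on_cmult_right inverse_square_int_summable)
  thus ?thesis
  proof (rule summable_on_comparison_test)
    fix b :: int
    have l: "1 + \<bar>real_of_int b\<bar> \<le> K * norm (z + of_int b)" unfolding K_def by (rule norm_add_int_lower[OF assms(1)])
    hence "0 < K * norm (z + of_int b)" by linarith
    hence pos: "norm (z + of_int b) > 0" using K by (simp add: zero_less_mult_iff)
    have "(1 + \<bar>real_of_int b\<bar>)^2 \<le> (1 + \<bar>real_of_int b\<bar>)^m"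
      using assms(2) by (intro power_increasing) auto
    also have "... \<le> (K * norm (z + of_int b))^m" using l by (intro power_mono) auto
    finally show "norm (1 / (z + of_int b)^m) \<le> K ^ m * (1 / (1 + \<bar>real_of_int b\<bar>)^2)"
      using pos K by (simp add: norm_divide norm_power power_mult_distrib field_simps)
  qed auto
qed

lemma not_Ints_HH: "Im z > 0 \<Longrightarrow> z \<notin> \<int>" "Im z > 0 \<Longrightarrow> 1 - z \<notin> \<int>"
  by (auto elim!: Ints_cases simp: complex_eq_iff)

lemma npow_summable:
  fixes x :: "'a :: {real_normed_field, banach}"
  assumes "norm x < 1" shows "summable (\<lambda>n. of_nat n ^ j * x ^ n)"
  using assms
proof (induction j arbitrary: x)
  case 0
  thus ?case by (simp add: summable_geometric)
next
  case (Suc j)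
  have "summable (\<lambda>n. diffs (\<lambda>n. of_nat n ^ j) n * x ^ n)"
    by (rule termdiff_converges[OF Suc.prems]) (rule Suc.IH)
  hence "summable (\<lambda>n. x * (diffs (\<lambda>n. of_nat n ^ j) n * x ^ n))" by (rule summable_mult)
  also have "(\<lambda>n. x * (diffs (\<lambda>n. of_nat n ^ j) n * x ^ n)) = (\<lambda>n. of_nat (Suc n) ^ Suc j * x ^ Suc n)"
    by (simp add: diffs_def mult_ac)
  finally show ?case by (subst (asm) summable_Suc_iff)
qed

text \<open>The operator \<open>x d/dx\<close> multiplies the n-th coefficient by \<open>n\<close>.
  It drives both the induction on the order of the polygamma function and, later, the derivative of
  \<open>psum\<close>.\<close>

lemma deriv_npow_series:
  fixes x :: "'a :: {real_normed_field, banach}"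
  assumes x: "norm x < 1" "x \<noteq> 0"
  shows "((\<lambda>x. \<Sum>n. of_nat n ^ j * x ^ n) has_field_derivative (\<Sum>n. of_nat n ^ Suc j * x ^ n) / x) (at x)"
proof -
  have "((\<lambda>x. \<Sum>n. of_nat n ^ j * x ^ n) has_field_derivative (\<Sum>n. diffs (\<lambda>n. of_nat n ^ j) n * x ^ n)) (at x)"
    by (rule termdiffs_strong'[of 1]) (use x npow_summable in auto)
  moreover have "x * (\<Sum>n. diffs (\<lambda>n. of_nat n ^ j) n * x ^ n) = (\<Sum>n. of_nat n ^ Suc j * x ^ n)"
  proof -
    have "x * (\<Sum>n. diffs (\<lambda>n. of_nat n ^ j) n * x ^ n) = (\<Sum>n. x * (diffs (\<lambda>n. of_nat n ^ j) n * x ^ n))"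
      by (rule suminf_mult[symmetric], rule termdiff_converges[OF x(1)]) (rule npow_summable)
    also have "... = (\<Sum>n. of_nat (Suc n) ^ Suc j * x ^ Suc n)" by (simp add: diffs_def mult_ac)
    also have "... = (\<Sum>n. of_nat n ^ Suc j * x ^ n)"
      using suminf_split_head[OF npow_summable[OF x(1), of "Suc j"]] by simp
    finally show ?thesis .
  qed
  hence "(\<Sum>n. diffs (\<lambda>n. of_nat n ^ j) n * x ^ n) = (\<Sum>n. of_nat n ^ Suc j * x ^ n) / x"
    using x(2) by (metis nonzero_mult_div_cancel_left)
  ultimately show ?thesis by metis
qed

text \<open>For \<open>j = 0\<close> this is the logarithmic derivative of the reflection formula:
  \<open>pi cot (pi z)\<close> expanded as a geometric series in \<open>e z\<close>. Every further
  derivative in \<open>z\<close> brings down \<open>2 pi \<i> n\<close>, and the first one removes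
  the constant \<open>pi \<i>\<close>.\<close>

lemma polygamma_q_series:
  assumes "z \<in> HH"
  shows "(-1)^j * Polygamma j (1 - z) - Polygamma j z
    = (if j = 0 then of_real pi * \<i> else 0) - (2 * of_real pi * \<i>)^(j+1) * (\<Sum>n. of_nat n ^ j * e z ^ n)"
  using assms
proof (induction j arbitrary: z)
  case 0
  have z: "z \<notin> \<int>\<^sub>\<le>\<^sub>0" "1 - z \<notin> \<int>\<^sub>\<le>\<^sub>0" if "z \<in> HH" for z
    using not_Ints_HH[of z] that nonpos_Ints_Int by auto
  define p :: complex where "p = of_real pi"
  have p: "p \<noteq> 0" by (simp add: p_def)
  have s0: "sin (p * z) \<noteq> 0"
  proof
    assume "sin (p * z) = 0"
    then obtain n :: int where "p * z = of_real (of_int n * pi)" unfolding sin_eq_0 p_def by auto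
    hence "z = of_int n" using p by (simp add: p_def field_simps)
    thus False using 0 by simp
  qed
  \<comment> \<open>The reflection formula makes this product the constant \<open>pi\<close> on the
    half-plane, so its derivative by the product rule must vanish.\<close>
  have "((\<lambda>z. sin (p * z) * (Gamma z * Gamma (1 - z))) has_field_derivative
      (p * cos (p * z) * (Gamma z * Gamma (1 - z)) +
       sin (p * z) * (Gamma z * Digamma z * Gamma (1 - z) - Gamma z * (Gamma (1 - z) * Digamma (1 - z))))) (at z)"
    using z[OF 0] by (auto intro!: derivative_eq_intros simp: algebra_simps)
  moreover have "((\<lambda>z. sin (p * z) * (Gamma z * Gamma (1 - z))) has_field_derivative 0) (at z)"
  proof (rule has_field_derivative_transform_within_open[OF DERIV_const[of p] open_HH 0])
    fix v assume v: "v \<in> HH"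
    show "p = sin (p * v) * (Gamma v * Gamma (1 - v))"
    proof (cases "sin (p * v) = 0")
      case True
      then obtain n :: int where "p * v = of_real (of_int n * pi)" unfolding sin_eq_0 p_def by auto
      hence "v = of_int n" using p by (simp add: p_def field_simps)
      thus ?thesis using v by simp
    qed (use Gamma_reflection_complex[of v] in \<open>simp add: p_def\<close>)
  qed
  ultimately have "p * cos (p * z) * (Gamma z * Gamma (1 - z)) +
       sin (p * z) * (Gamma z * Digamma z * Gamma (1 - z) - Gamma z * (Gamma (1 - z) * Digamma (1 - z))) = 0"
    by (rule DERIV_unique)
  hence "(Gamma z * Gamma (1 - z)) * (p * cos (p * z) + sin (p * z) * (Digamma z - Digamma (1 - z))) = 0"
    by (simp add: algebra_simps)
  moreover have "Gamma z * Gamma (1 - z) \<noteq> 0" using z[OF 0] by (auto simp: Gamma_eq_zero_iff)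
  ultimately have "p * cos (p * z) + sin (p * z) * (Digamma z - Digamma (1 - z)) = 0" by simp
  hence D: "Digamma (1 - z) - Digamma z = p * cos (p * z) / sin (p * z)"
    using s0 by (simp add: field_simps)
  define q where "q = e z"
  have q1: "norm q < 1" using 0 by (simp add: q_def norm_e)
  hence q1': "q \<noteq> 1" by auto
  define u where "u = exp (\<i> * (p * z))"
  have u0: "u \<noteq> 0" by (simp add: u_def)
  have qu: "q = u * u" by (simp add: q_def u_def e_def p_def exp_add[symmetric] algebra_simps)
  have s: "sin (p * z) = (u - 1 / u) / (2 * \<i>)" "cos (p * z) = (u + 1 / u) / 2"
    by (simp_all add: sin_exp_eq cos_exp_eq u_def exp_minus field_simps)
  have "p * cos (p * z) / sin (p * z) = p * \<i> * (q + 1) / (q - 1)"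
    using u0 q1' unfolding s qu by (simp add: field_simps)
  also have "... = p * \<i> - (2 * p * \<i>) * (1 / (1 - q))"
    using q1' by (simp add: field_simps)
  also have "1 / (1 - q) = (\<Sum>n. of_nat n ^ 0 * e z ^ n)"
    using suminf_geometric[OF q1] by (simp add: q_def)
  finally show ?case using D by (simp add: p_def)
next
  case (Suc j)
  have z: "z \<notin> \<int>\<^sub>\<le>\<^sub>0" "1 - z \<notin> \<int>\<^sub>\<le>\<^sub>0"
    using not_Ints_HH[of z] Suc.prems nonpos_Ints_Int by auto
  define p :: complex where "p = 2 * of_real pi * \<i>"
  have q: "norm (e z) < 1" using Suc.prems by (simp add: norm_e)
  have "((\<lambda>z. (-1)^j * Polygamma j (1 - z) - Polygamma j z) has_field_derivative
     ((-1)^j * (- Polygamma (Suc j) (1 - z)) - Polygamma (Suc j) z)) (at z)"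
    using z by (auto intro!: derivative_eq_intros)
  moreover have "((\<lambda>z. (-1)^j * Polygamma j (1 - z) - Polygamma j z) has_field_derivative
     (0 - p^(j+1) * (((\<Sum>n. of_nat n ^ Suc j * e z ^ n) / e z) * (e z * p)))) (at z)"
  proof (rule has_field_derivative_transform_within_open[OF _ open_HH Suc.prems])
    have e': "(e has_field_derivative (e z * p)) (at z)"
      unfolding e_def[abs_def] p_def by (auto intro!: derivative_eq_intros simp: mult_ac)
    show "((\<lambda>z. (if j = 0 then of_real pi * \<i> else 0) - p^(j+1) * (\<Sum>n. of_nat n ^ j * e z ^ n)) has_field_derivative
     (0 - p^(j+1) * (((\<Sum>n. of_nat n ^ Suc j * e z ^ n) / e z) * (e z * p)))) (at z)"
      by (intro DERIV_diff DERIV_const DERIV_cmult DERIV_chain2[OF deriv_npow_series e'] q e_nonzero)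
  qed (use Suc.IH in \<open>simp add: p_def\<close>)
  ultimately have "(-1)^j * (- Polygamma (Suc j) (1 - z)) - Polygamma (Suc j) z
     = 0 - p^(j+1) * (((\<Sum>n. of_nat n ^ Suc j * e z ^ n) / e z) * (e z * p))" by (rule DERIV_unique)
  also have "... = - (p^(Suc j + 1) * (\<Sum>n. of_nat n ^ Suc j * e z ^ n))" by (simp add: mult_ac)
  finally show ?case by (simp add: p_def)
qed

text \<open>Up to sign and factorial, the sum over \<open>b >= 0\<close> is a polygamma value at
  \<open>z\<close> and the sum over \<open>b < 0\<close> one at \<open>1 - z\<close>. The order is
  \<open>m - 1\<close>, and \<open>m >= 2\<close> makes both halves absolutely convergent.\<close>

lemma lipschitz_formula:
  assumes z: "z \<in> HH" and m: "m \<ge> 2"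
  shows "((\<lambda>b::int. 1 / (z + of_int b)^m) has_sum
    ((- 2 * of_real pi * \<i>)^m / fact (m - 1) * (\<Sum>n. of_nat n ^ (m - 1) * e (of_nat n * z)))) UNIV"
proof -
  define g where "g b = 1 / (z + of_int b)^m" for b :: int
  have sg: "(\<lambda>b. norm (g b)) summable_on A" for A
    using add_int_power_summable[of z m] z m unfolding g_def by (auto intro: summable_on_subset_banach)
  have sg': "g summable_on A" for A using sg by (rule abs_summable_summable)
  have U: "(UNIV :: int set) = range int \<union> range (\<lambda>n. - int (Suc n))"
  proof -
    have "b \<in> range int \<union> range (\<lambda>n. - int (Suc n))" for b by (cases b rule: int_cases) blast+
    thus ?thesis by blast
  qed
  have sn: "summable (\<lambda>n. norm (g (int n)))"
    using sg[of "range int"] by (subst (asm) summable_on_reindex)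
      (auto simp: o_def inj_on_def summable_on_UNIV_nonneg_real_iff)
  have sn': "summable (\<lambda>n. norm (g (- int (Suc n))))"
    using sg[of "range (\<lambda>n. - int (Suc n))"] by (subst (asm) summable_on_reindex)
      (auto simp: o_def inj_on_def summable_on_UNIV_nonneg_real_iff)
  have "infsum g UNIV = infsum g (range int) + infsum g (range (\<lambda>n. - int (Suc n)))"
    unfolding U by (rule infsum_Un_disjoint[OF sg' sg']) auto
  also have "infsum g (range int) = (\<Sum>n. g (int n))"
    by (subst infsum_reindex) (auto simp: inj_on_def o_def intro!: infsum_suminf sn)
  also have "infsum g (range (\<lambda>n. - int (Suc n))) = (\<Sum>n. g (- int (Suc n)))"
    by (subst infsum_reindex) (use infsum_suminf[OF sn'] in \<open>auto simp: inj_on_def o_def\<close>)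
  finally have g: "infsum g UNIV = (\<Sum>n. g (int n)) + (\<Sum>n. g (- int (Suc n)))" .
  obtain j where j: "m = Suc j" "j \<ge> 1" using m by (cases m) auto
  have P1: "Polygamma j z = (-1)^Suc j * fact j * (\<Sum>n. g (int n))"
    using j by (simp add: Polygamma_def g_def inverse_eq_divide)
  have P2: "Polygamma j (1 - z) = fact j * (\<Sum>n. g (- int (Suc n)))"
  proof -
    have "inverse ((1 - z + of_nat n)^Suc j) = (-1)^Suc j * g (- int (Suc n))" for n
    proof -
      have eq: "1 - z + of_nat n = - (z + of_int (- int (Suc n)))" by simp
      have "(1 - z + of_nat n)^Suc j = (-1)^Suc j * (z + of_int (- int (Suc n)))^Suc j"
        unfolding eq by (rule power_minus)
      hence "inverse ((1 - z + of_nat n)^Suc j) = inverse ((-1)^Suc j) * inverse ((z + of_int (- int (Suc n)))^Suc j)"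
        by (simp only: inverse_mult_distrib)
      also have "inverse ((-1 :: complex)^Suc j) = (-1)^Suc j" by (simp flip: power_inverse)
      finally show ?thesis by (simp only: g_def j inverse_eq_divide)
    qed
    hence "Polygamma j (1 - z) = (-1)^Suc j * fact j * (\<Sum>n. (-1)^Suc j * g (- int (Suc n)))"
      using j by (simp add: Polygamma_def)
    also have "(\<Sum>n. (-1)^Suc j * g (- int (Suc n))) = (-1)^Suc j * (\<Sum>n. g (- int (Suc n)))"
      by (rule suminf_mult[OF summable_norm_cancel[OF sn']])
    finally show ?thesis by (simp add: power_add[symmetric] flip: mult.assoc power_mult_distrib)
  qed
  have "(-1)^j * fact j * infsum g UNIV = (-1)^j * Polygamma j (1 - z) - Polygamma j z"
    unfolding P1 P2 g by (simp add: algebra_simps)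
  also have "... = - ((2 * of_real pi * \<i>)^(j+1) * (\<Sum>n. of_nat n ^ j * e z ^ n))"
    using polygamma_q_series[OF z, of j] j by simp
  finally have "(-1)^j * ((-1)^j * fact j * infsum g UNIV) = (-1)^j * (- ((2 * of_real pi * \<i>)^(j+1) * (\<Sum>n. of_nat n ^ j * e z ^ n)))"
    by simp
  also have "(-1)^j * ((-1)^j * fact j * infsum g UNIV) = fact j * infsum g UNIV"
    by (simp flip: mult.assoc power_mult_distrib)
  also have "(-1)^j * (- ((2 * of_real pi * \<i>)^(j+1) * (\<Sum>n. of_nat n ^ j * e z ^ n)))
      = (- 2 * of_real pi * \<i>)^(j+1) * (\<Sum>n. of_nat n ^ j * e z ^ n)"
    using power_mult_distrib[of "-1 :: complex" "2 * of_real pi * \<i>" "j+1"] by simp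
  finally have "infsum g UNIV = (- 2 * of_real pi * \<i>)^m / fact (m - 1) * (\<Sum>n. of_nat n ^ (m - 1) * e z ^ n)"
    by (simp add: j field_simps)
  with has_sum_infsum[OF sg'[of UNIV]] show ?thesis by (simp add: g_def[abs_def] e_of_nat_mult)
qed

section \<open>The kernel of determinant l\<close>

text \<open>Equals \<open>(c z + d) (z' + M z)\<close> where \<open>M z\<close> is the Moebius
  image. The plus sign makes the kernel holomorphic in both variables and free of zeros on the
  product of two half-planes when the determinant is positive.\<close>

definition kern :: "mat2 \<Rightarrow> complex \<Rightarrow> complex \<Rightarrow> complex" where
  "kern M z z' = mden M z * z' + mnum M z"

text \<open>Chosen such that \<open>|c| + |d| <= kap z * |c z + d|\<close>. It is continuous in
  \<open>z\<close>, which makes the estimates built on it locally uniform.\<close>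

definition kap :: "complex \<Rightarrow> real" where "kap z = 1 / Im z + 1 + norm z / Im z"

text \<open>A product of four convergent series in the separate entries. It is summable over all
  integral quadruples, so the determinant condition can be forgotten when convergence is
  checked.\<close>

definition wt :: "mat2 \<Rightarrow> real" where
  "wt = (\<lambda>(a, b, c, d). (1 / (1 + \<bar>real_of_int a\<bar>)^2 * (1 / (1 + \<bar>real_of_int b\<bar>)^2)) *
                        (1 / (1 + \<bar>real_of_int c\<bar>)^2 * (1 / (1 + \<bar>real_of_int d\<bar>)^2)))"

lemma summable_on_prod_nonneg:
  fixes f :: "'a \<Rightarrow> real" and g :: "'b \<Rightarrow> real"
  assumes "f summable_on A" "g summable_on B" "\<And>x. f x \<ge> 0" "\<And>x. g x \<ge> 0"
  shows "(\<lambda>(x, y). f x * g y) summable_on (A \<times> B)"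
proof (rule summable_on_SigmaI[where g = "\<lambda>x. f x * infsum g B"])
  fix x assume "x \<in> A"
  show "((\<lambda>y. case (x, y) of (x, y) \<Rightarrow> f x * g y) has_sum f x * infsum g B) B"
    using has_sum_cmult_right[OF has_sum_infsum[OF assms(2)], of "f x"] by simp
next
  show "(\<lambda>x. f x * infsum g B) summable_on A"
    by (intro summable_on_cmult_left assms)
qed (use assms in auto)

lemma wt_summable: "wt summable_on A"
proof -
  define s where "s b = 1 / (1 + \<bar>real_of_int b\<bar>)^2" for b
  have s: "s summable_on UNIV" unfolding s_def[abs_def] by (rule inverse_square_int_summable)
  have s0: "s b \<ge> 0" for b by (simp add: s_def)
  have "(\<lambda>(a, b, c, d). s a * (s b * (s c * s d))) summable_on (UNIV \<times> (UNIV \<times> (UNIV \<times> UNIV)))"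
  proof -
    have 1: "(\<lambda>(c, d). s c * s d) summable_on (UNIV \<times> UNIV)" by (intro summable_on_prod_nonneg s s0)
    have 2: "(\<lambda>(b, q). s b * (case q of (c, d) \<Rightarrow> s c * s d)) summable_on (UNIV \<times> (UNIV \<times> UNIV))"
      by (rule summable_on_prod_nonneg[OF s 1 s0]) (auto simp: s0)
    have 3: "(\<lambda>(a, q). s a * (case q of (b, q) \<Rightarrow> s b * (case q of (c, d) \<Rightarrow> s c * s d))) summable_on (UNIV \<times> (UNIV \<times> (UNIV \<times> UNIV)))"
      by (rule summable_on_prod_nonneg[OF s 2 s0]) (auto simp: s0)
    thus ?thesis by (simp add: case_prod_unfold)
  qed
  hence "wt summable_on UNIV" unfolding wt_def s_def by (simp add: case_prod_unfold mult.assoc)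
  thus ?thesis by (rule summable_on_subset_banach) auto
qed

lemma wt_nonneg [simp]: "wt M \<ge> 0"
  by (cases M) (simp add: wt_def)

lemma kap_ge_1: "z \<in> HH \<Longrightarrow> kap z \<ge> 1"
  by (simp add: kap_def)

lemma kap_bounds: "z \<in> HH \<Longrightarrow> 1 / Im z \<le> kap z" "z \<in> HH \<Longrightarrow> 1 + norm z / Im z \<le> kap z"
  by (auto simp: kap_def)

lemma pair_lower:
  assumes z: "z \<in> HH" and cd: "c \<noteq> 0 \<or> d \<noteq> 0"
  shows "1 \<le> kap z * norm (of_int c * z + of_int d)"
    and "(1 + \<bar>real_of_int c\<bar>)^2 * (1 + \<bar>real_of_int d\<bar>)^2 \<le> 16 * (kap z * norm (of_int c * z + of_int d))^4"
proof -
  define s where "s = \<bar>real_of_int c\<bar> + \<bar>real_of_int d\<bar>"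
  have s1: "s \<ge> 1" using cd unfolding s_def by linarith
  have y: "Im z > 0" using z by simp
  have "\<bar>real_of_int c\<bar> \<le> 1 / Im z * norm (of_int c * z + of_int d)"
    using mden_lower_c[OF y, of c d] y by (simp add: field_simps)
  moreover note mden_lower_d[OF y, of d c]
  ultimately have s2: "s \<le> kap z * norm (of_int c * z + of_int d)"
    unfolding s_def kap_def by (simp add: algebra_simps)
  show "1 \<le> kap z * norm (of_int c * z + of_int d)" using s1 s2 by linarith
  have "(1 + \<bar>real_of_int c\<bar>)^2 * (1 + \<bar>real_of_int d\<bar>)^2 \<le> (2 * s)^2 * (2 * s)^2"
    using s1 unfolding s_def by (intro mult_mono power_mono) auto
  also have "... = 16 * s^4" by (simp add: power_mult_distrib power_add[symmetric])
  also have "... \<le> 16 * (kap z * norm (of_int c * z + of_int d))^4"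
    using s1 s2 by (intro mult_left_mono power_mono) auto
  finally show "(1 + \<bar>real_of_int c\<bar>)^2 * (1 + \<bar>real_of_int d\<bar>)^2 \<le> 16 * (kap z * norm (of_int c * z + of_int d))^4" .
qed

text \<open>Each row pays for its two factors in \<open>wt\<close> with a fourth power of its linear
  form, and 256 is \<open>16 * 16\<close>. Consequently the kernel needs an exponent of at least 8,
  and a product of k-th powers of the two rows needs \<open>k >= 4\<close>.\<close>

lemma mat_lower:
  assumes z: "z \<in> HH" and M: "mdet M \<noteq> 0"
  shows "1 \<le> kap z * norm (mden M z)" "1 \<le> kap z * norm (mnum M z)"
    and "1 \<le> 256 * (kap z * norm (mnum M z))^4 * (kap z * norm (mden M z))^4 * wt M"
proof -
  obtain a b c d where Md: "M = (a, b, c, d)" by (cases M)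
  have cd: "c \<noteq> 0 \<or> d \<noteq> 0" "a \<noteq> 0 \<or> b \<noteq> 0" using M by (auto simp: Md)
  note 1 = pair_lower[OF z cd(1)] and 2 = pair_lower[OF z cd(2)]
  show "1 \<le> kap z * norm (mden M z)" "1 \<le> kap z * norm (mnum M z)" using 1 2 by (auto simp: Md)
  have "1 = ((1 + \<bar>real_of_int a\<bar>)^2 * (1 + \<bar>real_of_int b\<bar>)^2) * ((1 + \<bar>real_of_int c\<bar>)^2 * (1 + \<bar>real_of_int d\<bar>)^2) * wt M"
  proof -
    have "1 + \<bar>real_of_int x\<bar> \<noteq> 0" for x by linarith
    thus ?thesis by (simp add: Md wt_def field_simps)
  qed
  also have "... \<le> (16 * (kap z * norm (mnum M z))^4) * (16 * (kap z * norm (mden M z))^4) * wt M"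
    using mult_mono[OF 2(2) 1(2)] by (intro mult_right_mono) (auto simp: Md)
  finally show "1 \<le> 256 * (kap z * norm (mnum M z))^4 * (kap z * norm (mden M z))^4 * wt M" by (simp add: mult_ac)
qed

lemma kern_eq: "mdet M > 0 \<Longrightarrow> z \<in> HH \<Longrightarrow> kern M z z' = mden M z * (z' + mob M z)"
  using mden_nonzero[of M z] by (simp add: kern_def mob_def field_simps)

lemma kern_lower:
  assumes z: "z \<in> HH" "z' \<in> HH" and M: "mdet M > 0"
  shows "norm (mden M z) \<le> kap z' * norm (kern M z z')" "norm (mnum M z) \<le> kap z' * norm (kern M z z')"
    "kern M z z' \<noteq> 0"
proof -
  have y: "Im z' > 0" using z by simp
  have "norm (mden M z) * Im z' \<le> norm (mden M z) * norm (z' + mob M z)"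
    using abs_Im_le_cmod[of "z' + mob M z"] mob_in_HH[OF M z(1)] y by (intro mult_left_mono) auto
  also have "... = norm (kern M z z')" using kern_eq[OF M z(1)] by (simp add: norm_mult)
  finally have 1: "norm (mden M z) \<le> 1 / Im z' * norm (kern M z z')" using y by (simp add: field_simps)
  also have "... \<le> kap z' * norm (kern M z z')" using kap_bounds z by (intro mult_right_mono) auto
  finally show "norm (mden M z) \<le> kap z' * norm (kern M z z')" .
  have "norm (mnum M z) = norm (kern M z z' - mden M z * z')" by (simp add: kern_def)
  also have "... \<le> norm (kern M z z') + norm (mden M z) * norm z'"
    using norm_triangle_ineq4 by (metis norm_mult)
  also have "... \<le> norm (kern M z z') + 1 / Im z' * norm (kern M z z') * norm z'"
    using 1 by (intro add_left_mono mult_right_mono) auto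
  also have "... = (1 + norm z' / Im z') * norm (kern M z z')" by (simp add: field_simps)
  also have "... \<le> kap z' * norm (kern M z z')" using kap_bounds z by (intro mult_right_mono) auto
  finally show "norm (mnum M z) \<le> kap z' * norm (kern M z z')" .
  show "kern M z z' \<noteq> 0"
    using 1 mden_nonzero[of M z] z M by auto
qed

lemma kern_bound:
  assumes z: "z \<in> HH" "z' \<in> HH" and M: "mdet M > 0" and n: "n \<ge> 8"
  shows "norm (1 / kern M z z' ^ n) \<le> 256 * (kap z * kap z') ^ n * wt M"
proof -
  define A where "A = kap z * kap z' * norm (kern M z z')"
  have k0: "kap z > 0" "kap z' > 0" using kap_ge_1 z by (smt (verit))+
  have M0: "mdet M \<noteq> 0" using M by simp
  have mA: "kap z * norm (mden M z) \<le> A" "kap z * norm (mnum M z) \<le> A"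
    using kern_lower(1,2)[OF z M] k0 by (auto simp: A_def mult.assoc)
  have A1: "A \<ge> 1" using mat_lower(1)[OF z(1) M0] mA by linarith
  have "1 \<le> 256 * (kap z * norm (mnum M z))^4 * (kap z * norm (mden M z))^4 * wt M"
    by (rule mat_lower(3)[OF z(1) M0])
  also have "... \<le> 256 * A^4 * A^4 * wt M"
    using mA k0 A1 by (intro mult_right_mono mult_mono power_mono) auto
  also have "... = 256 * A^8 * wt M" by (simp add: power_add[symmetric])
  also have "... \<le> 256 * A^n * wt M"
    using A1 n by (intro mult_right_mono mult_left_mono power_increasing) auto
  finally have "1 \<le> 256 * (kap z * kap z')^n * norm (kern M z z')^n * wt M" by (simp add: A_def power_mult_distrib mult_ac)
  moreover have "norm (kern M z z')^n > 0" using kern_lower(3)[OF z M] by simp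
  ultimately show ?thesis by (simp add: norm_divide norm_power field_simps)
qed

lemma half_bound:
  assumes z: "z \<in> HH" and M: "mdet M > 0" and k: "k \<ge> 4"
  shows "norm (1 / (mnum M z ^ k * mden M z ^ k)) \<le> 256 * kap z ^ (2 * k) * wt M"
proof -
  have M0: "mdet M \<noteq> 0" using M by simp
  note 1 = mat_lower[OF z M0]
  have "1 \<le> 256 * (kap z * norm (mnum M z))^4 * (kap z * norm (mden M z))^4 * wt M" by (rule 1)
  also have "... \<le> 256 * (kap z * norm (mnum M z))^k * (kap z * norm (mden M z))^k * wt M"
    using 1(1,2) k by (intro mult_right_mono mult_mono power_increasing) auto
  also have "... = 256 * kap z^(2*k) * (norm (mnum M z) ^ k * norm (mden M z) ^ k) * wt M"
  proof -
    have "kap z ^ (2 * k) = kap z ^ k * kap z ^ k" by (metis mult_2 power_add)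
    thus ?thesis by (simp only: power_mult_distrib mult_ac)
  qed
  finally have *: "1 \<le> 256 * kap z^(2*k) * (norm (mnum M z) ^ k * norm (mden M z) ^ k) * wt M" .
  have "norm (mnum M z) > 0" "norm (mden M z) > 0" using 1(1,2) by auto
  hence "norm (mnum M z) ^ k * norm (mden M z) ^ k > 0" by simp
  thus ?thesis using * by (simp add: norm_divide norm_power norm_mult field_simps)
qed

lemma kern_abs_summable:
  assumes "z \<in> HH" "z' \<in> HH" "l > 0" "n \<ge> 8"
  shows "(\<lambda>M. norm (1 / kern M z z' ^ n)) summable_on mats l"
  by (rule summable_on_comparison_test[OF summable_on_cmult_right[OF wt_summable]])
     (use kern_bound assms in auto)

lemma kern_summable:
  assumes "z \<in> HH" "z' \<in> HH" "l > 0" "n \<ge> 8"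
  shows "(\<lambda>M. 1 / kern M z z' ^ n) summable_on mats l"
  using kern_abs_summable[OF assms] by (rule abs_summable_summable)

lemma half_abs_summable:
  assumes "z \<in> HH" "l > 0" "k \<ge> 4"
  shows "(\<lambda>M. norm (1 / (mnum M z ^ k * mden M z ^ k))) summable_on mats l"
  by (rule summable_on_comparison_test[OF summable_on_cmult_right[OF wt_summable]])
     (use half_bound assms in auto)

definition hker :: "nat \<Rightarrow> int \<Rightarrow> complex \<Rightarrow> complex \<Rightarrow> complex" where
  "hker w l z z' = (\<Sum>\<^sub>\<infinity>M\<in>mats l. 1 / kern M z z' ^ w)"

text \<open>Exchanging \<open>z\<close> and \<open>z'\<close> in
  \<open>c z z' + d z' + a z + b\<close> amounts to exchanging \<open>a\<close> and
  \<open>d\<close>, which preserves the determinant. Every property in the first variable thus holds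
  in the second.\<close>

lemma hker_swap: "hker w l z z' = hker w l z' z"
  unfolding hker_def
  by (rule infsum_reindex_bij_witness[of _ "\<lambda>(a,b,c,d). (d,b,c,a)" "\<lambda>(a,b,c,d). (d,b,c,a)"])
     (auto simp: kern_def algebra_simps)

lemma mats_right_bij:
  assumes "mdet N = 1" shows "bij_betw (\<lambda>M. mmul M N) (mats l) (mats l)"
  by (rule bij_betw_byWitness[where f' = "\<lambda>M. mmul M (madj N)"])
     (auto simp: mmul_assoc mmul_madj assms)

lemma kern_mob:
  assumes "mden N z \<noteq> 0"
  shows "kern (mmul M N) z z' = kern M (mob N z) z' * mden N z"
  unfolding kern_def using mnum_mmul[OF assms] by (simp add: algebra_simps)

lemma hker_mob:
  assumes N: "mdet N = 1" and z: "z \<in> HH"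
  shows "hker w l (mob N z) z' = mden N z ^ w * hker w l z z'"
proof -
  have nz: "mden N z \<noteq> 0" using mden_nonzero[of N z] N z by simp
  have "hker w l z z' = (\<Sum>\<^sub>\<infinity>M\<in>mats l. 1 / kern (mmul M N) z z' ^ w)"
    unfolding hker_def by (rule infsum_reindex_bij_betw[OF mats_right_bij[OF N], symmetric])
  also have "... = (\<Sum>\<^sub>\<infinity>M\<in>mats l. (1 / mden N z ^ w) * (1 / kern M (mob N z) z' ^ w))"
    by (simp add: kern_mob[OF nz] power_mult_distrib mult.commute)
  also have "... = (1 / mden N z ^ w) * hker w l (mob N z) z'"
    unfolding hker_def by (rule infsum_cmult_right')
  finally show ?thesis using nz by simp
qed

lemma hker_mob': "mdet N = 1 \<Longrightarrow> z' \<in> HH \<Longrightarrow> hker w l z (mob N z') = mden N z' ^ w * hker w l z z'"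
  using hker_mob[of N z' w l z] by (simp add: hker_swap[of w l z])

lemma hker_holomorphic:
  assumes z': "z' \<in> HH" and l: "l > 0" and w: "w \<ge> 8"
  shows "(\<lambda>z. hker w l z z') holomorphic_on HH"
proof -
  let ?S = "\<lambda>F z. \<Sum>M\<in>F. 1 / kern M z z' ^ w"
  have *: "\<exists>r>0. (\<lambda>z. hker w l z z') holomorphic_on ball z0 r" if z0: "z0 \<in> HH" for z0
  proof -
    obtain r where r: "r > 0" "cball z0 r \<subseteq> HH"
      using open_HH z0 open_contains_cball by blast
    have "continuous_on (cball z0 r) kap"
    proof -
      have "Im z \<noteq> 0" if "z \<in> cball z0 r" for z
        using subsetD[OF r(2) that] by simp
      thus ?thesis unfolding kap_def[abs_def] by (intro continuous_intros) blast+
    qed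
    hence "bounded (kap ` cball z0 r)"
      by (rule compact_imp_bounded[OF compact_continuous_image[OF _ compact_cball]])
    then obtain K where "\<forall>z\<in>cball z0 r. \<bar>kap z\<bar> \<le> K" by (auto simp: bounded_iff)
    hence K: "\<bar>kap z\<bar> \<le> K" if "z \<in> cball z0 r" for z using that by blast
    have u: "uniform_limit (cball z0 r) (\<lambda>F z. ?S F z) (\<lambda>z. hker w l z z') (finite_subsets_at_top (mats l))"
      unfolding hker_def
    proof (rule Weierstrass_m_test_general)
      fix M z assume M: "M \<in> mats l" and z: "z \<in> cball z0 r"
      have zH: "z \<in> HH" using r z by blast
      have "norm (1 / kern M z z' ^ w) \<le> 256 * (kap z * kap z')^w * wt M"
        by (rule kern_bound) (use zH z' M l w in auto)
      also have "... \<le> 256 * (K * kap z')^w * wt M"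

      proof -
        have "kap z * kap z' \<le> K * kap z'"
          by (rule mult_right_mono) (use K[OF z] kap_ge_1[OF z'] in linarith)+
        hence "(kap z * kap z')^w \<le> (K * kap z')^w"
          by (rule power_mono) (use kap_ge_1[OF zH] kap_ge_1[OF z'] in simp)
        thus ?thesis by (intro mult_right_mono mult_left_mono wt_nonneg) simp_all
      qed
      finally show "norm (1 / kern M z z' ^ w) \<le> 256 * (K * kap z')^w * wt M" .
    next
      show "(\<lambda>M. 256 * (K * kap z')^w * wt M) summable_on mats l"
        by (intro summable_on_cmult_right wt_summable)
    qed
    have hol: "(\<lambda>z. ?S F z) holomorphic_on HH" if "finite F" "F \<subseteq> mats l" for F
    proof (intro holomorphic_intros)
      fix M assume "M \<in> F"
      hence "mdet M > 0" using that l by auto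
      show "(\<lambda>z. kern M z z') holomorphic_on HH"
        by (cases M) (simp add: kern_def, intro holomorphic_intros)
      fix z assume "z \<in> HH" thus "kern M z z' ^ w \<noteq> 0" using kern_lower(3)[of z z' M] z' \<open>mdet M > 0\<close> by simp
    qed
    have ev: "\<forall>\<^sub>F F in finite_subsets_at_top (mats l). finite F \<and> F \<subseteq> mats l"
      by (simp add: eventually_finite_subsets_at_top_weakI)
    have "(\<lambda>z. hker w l z z') holomorphic_on ball z0 r"
    proof (rule holomorphic_uniform_limit[OF _ u])
      show "\<forall>\<^sub>F F in finite_subsets_at_top (mats l). continuous_on (cball z0 r) (\<lambda>z. ?S F z) \<and>
          (\<lambda>z. ?S F z) holomorphic_on ball z0 r"
        using ev
      proof eventually_elim
        case (elim F)
        hence "(\<lambda>z. ?S F z) holomorphic_on HH" by (intro hol) auto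
        hence "(\<lambda>z. ?S F z) holomorphic_on cball z0 r"
          by (rule holomorphic_on_subset[OF _ r(2)])
        thus ?case
          by (intro conjI holomorphic_on_imp_continuous_on holomorphic_on_subset[OF _ ball_subset_cball])
      qed
    qed auto
    thus ?thesis using r(1) by (intro exI[of _ r] conjI)
  qed
  show ?thesis
  proof (rule holomorphic_onI)
    fix z0 assume "z0 \<in> HH"
    from *[OF this] obtain r where "r > 0" "(\<lambda>z. hker w l z z') holomorphic_on ball z0 r"
      by (elim exE conjE)
    hence "(\<lambda>z. hker w l z z') field_differentiable at z0"
      by (intro holomorphic_on_imp_differentiable_at[OF _ open_ball]) auto
    thus "(\<lambda>z. hker w l z z') field_differentiable at z0 within HH"
      by (rule field_differentiable_at_within)
  qed
qed

text \<open>One factor of the kernel is set aside and the other \<open>w - 1 >= 8\<close> suffice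
  for convergence. As \<open>a\<close> and \<open>c\<close> are not both zero, one of the rows has
  modulus at least \<open>Im z\<close>, so the spare factor contributes \<open>1 / Im z\<close>. The
  restriction on \<open>Re z\<close> keeps \<open>kap z\<close> below 4.\<close>

lemma hker_decay:
  assumes z': "z' \<in> HH" and l: "l > 0" and w: "w \<ge> 9" and \<epsilon>: "\<epsilon> > 0"
  shows "\<exists>Y. \<forall>z. \<bar>Re z\<bar> \<le> 1 \<and> Im z \<ge> Y \<longrightarrow> norm (hker w l z z') < \<epsilon>"
proof -
  define D where "D = (\<Sum>\<^sub>\<infinity>M\<in>mats l. kap z' * (256 * (4 * kap z')^(w - 1)) * wt M)"
  have k': "kap z' \<ge> 1" by (rule kap_ge_1[OF z'])
  have D0: "D \<ge> 0" unfolding D_def using k' by (intro infsum_nonneg mult_nonneg_nonneg) auto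
  have bound: "norm (hker w l z z') \<le> D / Im z" if z: "\<bar>Re z\<bar> \<le> 1" "Im z \<ge> 1" for z
  proof -
    have zH: "z \<in> HH" using z by simp
    have "norm z \<le> 1 + Im z" using cmod_le[of z] z by linarith
    hence "norm z / Im z \<le> 2" using z by (simp add: field_simps)
    moreover have "1 / Im z \<le> 1" using z by simp
    ultimately have kz: "kap z \<le> 4" by (simp add: kap_def)
    have term_bound: "norm (1 / kern M z z' ^ w) \<le> (1 / Im z) * (kap z' * (256 * (4 * kap z')^(w - 1)) * wt M)" if M: "M \<in> mats l" for M
    proof -
      have Mp: "mdet M > 0" using M l by simp
      obtain a b c d where Md: "M = (a, b, c, d)" by (cases M)
      note lo = kern_lower[OF zH z' Mp]
      have ac: "a \<noteq> 0 \<or> c \<noteq> 0" using Mp by (auto simp: Md)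
      have "Im z \<le> kap z' * norm (kern M z z')"
      proof (cases "c = 0")
        case True
        hence "1 \<le> \<bar>real_of_int a\<bar>" using ac by linarith
        hence "1 * Im z \<le> \<bar>real_of_int a\<bar> * Im z" using z by (intro mult_right_mono) auto
        also have "... \<le> norm (mnum M z)" using mden_lower_c[of z a b] z by (simp add: Md)
        finally show ?thesis using lo by linarith
      next
        case False
        hence "1 \<le> \<bar>real_of_int c\<bar>" by linarith
        hence "1 * Im z \<le> \<bar>real_of_int c\<bar> * Im z" using z by (intro mult_right_mono) auto
        also have "... \<le> norm (mden M z)" using mden_lower_c[of z c d] z by (simp add: Md)
        finally show ?thesis using lo by linarith
      qed
      hence 1: "1 / norm (kern M z z') \<le> kap z' / Im z" using lo(3) z by (simp add: field_simps)
      have 2: "norm (1 / kern M z z' ^ (w - 1)) \<le> 256 * (kap z * kap z')^(w - 1) * wt M"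
        by (rule kern_bound) (use zH z' Mp w in auto)
      also have "... \<le> 256 * (4 * kap z')^(w - 1) * wt M"
        using kz k' kap_ge_1[OF zH] by (intro mult_right_mono mult_left_mono power_mono) auto
      finally have 3: "norm (1 / kern M z z' ^ (w - 1)) \<le> 256 * (4 * kap z')^(w - 1) * wt M" .
      have "norm (1 / kern M z z' ^ w) = 1 / norm (kern M z z') * norm (1 / kern M z z' ^ (w - 1))"
        using w by (cases w) (auto simp: norm_divide norm_mult norm_power)
      also have "... \<le> kap z' / Im z * (256 * (4 * kap z')^(w - 1) * wt M)"
        using 1 3 k' z by (intro mult_mono) auto
      finally show ?thesis by (simp add: field_simps)
    qed
    have "norm (hker w l z z') \<le> (\<Sum>\<^sub>\<infinity>M\<in>mats l. (1 / Im z) * (kap z' * (256 * (4 * kap z')^(w - 1)) * wt M))"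
      unfolding hker_def
    proof (rule norm_infsum_le[OF has_sum_infsum has_sum_infsum term_bound])
      show "(\<lambda>M. 1 / kern M z z' ^ w) summable_on mats l"
        by (rule kern_summable) (use zH z' l w in auto)
      show "(\<lambda>M. (1 / Im z) * (kap z' * (256 * (4 * kap z')^(w - 1)) * wt M)) summable_on mats l"
        by (intro summable_on_cmult_right wt_summable)
    qed
    also have "... = D / Im z" unfolding D_def by (subst infsum_cmult_right') simp
    finally show ?thesis .
  qed
  show ?thesis
  proof (intro exI[of _ "D / \<epsilon> + 1"] allI impI)
    fix z assume z: "\<bar>Re z\<bar> \<le> 1 \<and> D / \<epsilon> + 1 \<le> Im z"
    hence y: "Im z \<ge> 1" using D0 \<epsilon> by (smt (verit) divide_nonneg_pos)
    have "norm (hker w l z z') \<le> D / Im z" using bound z y by auto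
    also have "D / Im z < \<epsilon>"
    proof -
      have "D / \<epsilon> < Im z" using z by linarith
      hence "D < Im z * \<epsilon>" using \<epsilon> by (simp add: pos_divide_less_eq)
      thus ?thesis using y by (simp add: pos_divide_less_eq mult.commute)
    qed
    finally show "norm (hker w l z z') < \<epsilon>" .
  qed
qed

definition hform :: "nat \<Rightarrow> int \<Rightarrow> complex \<Rightarrow> complex \<Rightarrow> complex" where
  "hform w l z' = (\<lambda>z. if z \<in> HH then hker w l z z' else 0)"

lemma hform_eq [simp]: "z \<in> HH \<Longrightarrow> hform w l z' z = hker w l z z'"
  by (simp add: hform_def)

lemma cusp_form_hform:
  assumes "z' \<in> HH" "l > 0" "w \<ge> 9"
  shows "cusp_form w (hform w l z')"
proof -
  have hol: "hform w l z' holomorphic_on HH"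
    by (rule holomorphic_transform[OF hker_holomorphic[of z' l w]]) (use assms in auto)
  have md: "hform w l z' (mob M z) = mden M z ^ w * hform w l z' z" if "mdet M = 1" "z \<in> HH" for M z
    using that mob_in_HH[of M z] hker_mob[OF that] by simp
  obtain a where "has_fourier_expansion (hform w l z') a" "a 0 = 0"
  proof (rule fourier_exists[OF hol])
    show "hform w l z' (z + 1) = hform w l z' z" if "z \<in> HH" for z
      using md[of "(1,1,0,1)" z] that by (simp add: mob_def)
    fix \<epsilon> :: real assume "\<epsilon> > 0"
    then obtain Y where "\<forall>z. \<bar>Re z\<bar> \<le> 1 \<and> Im z \<ge> Y \<longrightarrow> norm (hker w l z z') < \<epsilon>"
      using hker_decay[OF assms] by blast
    thus "\<exists>Y. \<forall>z. \<bar>Re z\<bar> \<le> 1 \<and> Y \<le> Im z \<longrightarrow> norm (hform w l z' z) < \<epsilon>"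
      using \<open>\<epsilon> > 0\<close> by (intro exI[of _ Y]) (auto simp: hform_def)
  qed
  moreover have "hform w l z' z = 0" if "z \<notin> HH" for z using that by (simp add: hform_def)
  moreover have "hform w l z' ((of_int a * z + of_int b) / (of_int c * z + of_int d)) =
      (of_int c * z + of_int d) ^ w * hform w l z' z" if "a * d - b * c = 1" "z \<in> HH" for a b c d z
    using md[of "(a, b, c, d)" z] that by (simp add: mob_def del: hform_eq)
  ultimately show ?thesis unfolding cusp_form_def using hol by (intro conjI allI impI ballI exI[of _ a])
qed

section \<open>Common eigenvectors of commuting self-adjoint operators\<close>

text \<open>Gaussian elimination: an unknown with a non-zero entry in the last equation is solved
  for and removed from the others. The unknowns carry an arbitrary index type because later they are
  indexed by functions as well as by numbers.\<close>

lemma underdetermined: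
  fixes m :: "nat \<Rightarrow> 'j \<Rightarrow> complex"
  assumes "finite J" "card J > N"
  shows "\<exists>c. (\<exists>j\<in>J. c j \<noteq> 0) \<and> (\<forall>i<N. (\<Sum>j\<in>J. m i j * c j) = 0)"
  using assms
proof (induction N arbitrary: J m)
  case 0
  hence "J \<noteq> {}" by auto
  thus ?case by (intro exI[of _ "\<lambda>_. 1"]) auto
next
  case (Suc N)
  show ?case
  proof (cases "\<forall>j\<in>J. m N j = 0")
    case True
    from Suc.IH[of J m] Suc.prems obtain c where "\<exists>j\<in>J. c j \<noteq> 0" "\<forall>i<N. (\<Sum>j\<in>J. m i j * c j) = 0" by auto
    thus ?thesis using True by (intro exI[of _ c]) (auto simp: less_Suc_eq)
  next
    case False
    then obtain p where p: "p \<in> J" "m N p \<noteq> 0" by auto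
    define m' where "m' i j = m i j - m i p * m N j / m N p" for i j
    have "finite (J - {p})" "card (J - {p}) > N" using Suc.prems p by auto
    from Suc.IH[OF this, of m'] obtain c where c: "\<exists>j\<in>J-{p}. c j \<noteq> 0" "\<forall>i<N. (\<Sum>j\<in>J-{p}. m' i j * c j) = 0" by auto
    define S where "S = (\<Sum>j\<in>J-{p}. m N j * c j)"
    define c' where "c' = c(p := - S / m N p)"
    have e: "(\<Sum>j\<in>J. m i j * c' j) = (\<Sum>j\<in>J-{p}. m i j * c j) - m i p * S / m N p" for i
    proof -
      have "(\<Sum>j\<in>J. m i j * c' j) = m i p * c' p + (\<Sum>j\<in>J-{p}. m i j * c' j)"
        using Suc.prems p by (intro sum.remove) auto
      also have "(\<Sum>j\<in>J-{p}. m i j * c' j) = (\<Sum>j\<in>J-{p}. m i j * c j)"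
        by (rule sum.cong) (auto simp: c'_def)
      finally show ?thesis by (simp add: c'_def)
    qed
    have "(\<Sum>j\<in>J. m i j * c' j) = 0" if "i < Suc N" for i
    proof (cases "i = N")
      case True thus ?thesis using p by (simp add: e S_def)
    next
      case False
      hence "i < N" using that by simp
      have "(\<Sum>j\<in>J. m i j * c' j) = (\<Sum>j\<in>J-{p}. m' i j * c j)"
        unfolding e S_def m'_def
        by (simp add: algebra_simps sum_subtractf sum_distrib_left sum_divide_distrib)
      thus ?thesis using c \<open>i < N\<close> by simp
    qed
    moreover have "\<exists>j\<in>J. c' j \<noteq> 0" using c by (auto simp: c'_def)
    ultimately show ?thesis by blast
  qed
qed

text \<open>Finite dimension is encoded by \<open>N\<close> linear functionals that separate the
  elements, without choosing a basis. For cusp forms the functionals are the first Fourier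
  coefficients and \<open>ip\<close> is the Petersson product.\<close>

locale fin_ip =
  fixes S :: "('a \<Rightarrow> complex) set" and ip :: "('a \<Rightarrow> complex) \<Rightarrow> ('a \<Rightarrow> complex) \<Rightarrow> complex"
    and \<phi> :: "nat \<Rightarrow> ('a \<Rightarrow> complex) \<Rightarrow> complex" and N :: nat
  assumes S_0: "(\<lambda>_. 0) \<in> S" and S_add: "\<And>f g. f \<in> S \<Longrightarrow> g \<in> S \<Longrightarrow> (\<lambda>x. f x + g x) \<in> S"
    and S_scale: "\<And>c f. f \<in> S \<Longrightarrow> (\<lambda>x. c * f x) \<in> S"
    and ip_add: "\<And>f g h. f \<in> S \<Longrightarrow> g \<in> S \<Longrightarrow> h \<in> S \<Longrightarrow> ip (\<lambda>x. f x + g x) h = ip f h + ip g h"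
    and ip_scale: "\<And>c f h. f \<in> S \<Longrightarrow> h \<in> S \<Longrightarrow> ip (\<lambda>x. c * f x) h = c * ip f h"
    and ip_cnj: "\<And>f g. f \<in> S \<Longrightarrow> g \<in> S \<Longrightarrow> ip g f = cnj (ip f g)"
    and ip_pos: "\<And>f. f \<in> S \<Longrightarrow> ip f f = 0 \<Longrightarrow> f = (\<lambda>_. 0)"
    and \<phi>_add: "\<And>n f g. f \<in> S \<Longrightarrow> g \<in> S \<Longrightarrow> \<phi> n (\<lambda>x. f x + g x) = \<phi> n f + \<phi> n g"
    and \<phi>_scale: "\<And>n c f. f \<in> S \<Longrightarrow> \<phi> n (\<lambda>x. c * f x) = c * \<phi> n f"
    and \<phi>_inj: "\<And>f. f \<in> S \<Longrightarrow> (\<And>n. n < N \<Longrightarrow> \<phi> n f = 0) \<Longrightarrow> f = (\<lambda>_. 0)"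
begin

lemma S_sum: "finite J \<Longrightarrow> (\<And>j. j \<in> J \<Longrightarrow> v j \<in> S) \<Longrightarrow> (\<lambda>x. \<Sum>j\<in>J. c j * v j x) \<in> S"
proof (induction J rule: finite_induct)
  case (insert j J)
  have "(\<lambda>x. c j * v j x + (\<Sum>j\<in>J. c j * v j x)) \<in> S"
    by (intro S_add[of "\<lambda>x. c j * v j x"] S_scale) (use insert in auto)
  thus ?case using insert by simp
qed (simp add: S_0)

lemma ip_0 [simp]: "h \<in> S \<Longrightarrow> ip (\<lambda>_. 0) h = 0"
  using ip_scale[of "\<lambda>_. 0" h 0] S_0 by simp

lemma ip_sum:
  "finite J \<Longrightarrow> (\<And>j. j \<in> J \<Longrightarrow> v j \<in> S) \<Longrightarrow> h \<in> S \<Longrightarrow> ip (\<lambda>x. \<Sum>j\<in>J. c j * v j x) h = (\<Sum>j\<in>J. c j * ip (v j) h)"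
proof (induction J rule: finite_induct)
  case (insert j J)
  have "ip (\<lambda>x. c j * v j x + (\<Sum>j\<in>J. c j * v j x)) h = ip (\<lambda>x. c j * v j x) h + ip (\<lambda>x. \<Sum>j\<in>J. c j * v j x) h"
    by (intro ip_add S_scale S_sum) (use insert in auto)
  thus ?case using insert by (simp add: ip_scale)
qed simp

lemma \<phi>_0 [simp]: "\<phi> n (\<lambda>_. 0) = 0"
  using \<phi>_scale[of "\<lambda>_. 0" n 0] S_0 by simp

lemma \<phi>_sum:
  "finite J \<Longrightarrow> (\<And>j. j \<in> J \<Longrightarrow> v j \<in> S) \<Longrightarrow> \<phi> n (\<lambda>x. \<Sum>j\<in>J. c j * v j x) = (\<Sum>j\<in>J. c j * \<phi> n (v j))"
proof (induction J rule: finite_induct)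
  case (insert j J)
  have "\<phi> n (\<lambda>x. c j * v j x + (\<Sum>j\<in>J. c j * v j x)) = \<phi> n (\<lambda>x. c j * v j x) + \<phi> n (\<lambda>x. \<Sum>j\<in>J. c j * v j x)"
    by (intro \<phi>_add S_scale S_sum) (use insert in auto)
  thus ?case using insert by (simp add: \<phi>_scale)
qed simp

lemma dependent:
  assumes "finite J" "card J > N" "\<And>j. j \<in> J \<Longrightarrow> v j \<in> S"
  obtains c where "\<exists>j\<in>J. c j \<noteq> 0" "(\<lambda>x. \<Sum>j\<in>J. c j * v j x) = (\<lambda>_. 0)"
proof -
  obtain c where c: "\<exists>j\<in>J. c j \<noteq> 0" "\<forall>i<N. (\<Sum>j\<in>J. \<phi> i (v j) * c j) = 0"
    using underdetermined[OF assms(1,2), of "\<lambda>i j. \<phi> i (v j)"] by blast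
  have "(\<lambda>x. \<Sum>j\<in>J. c j * v j x) = (\<lambda>_. 0)"
  proof (rule \<phi>_inj)
    show "(\<lambda>x. \<Sum>j\<in>J. c j * v j x) \<in> S" by (rule S_sum) (use assms in auto)
    fix n assume "n < N"
    have "\<phi> n (\<lambda>x. \<Sum>j\<in>J. c j * v j x) = (\<Sum>j\<in>J. c j * \<phi> n (v j))"
      by (rule \<phi>_sum) (use assms in auto)
    thus "\<phi> n (\<lambda>x. \<Sum>j\<in>J. c j * v j x) = 0" using c(2) \<open>n < N\<close> by (simp add: mult.commute)
  qed
  thus ?thesis using c that by blast
qed

definition orth :: "('a \<Rightarrow> complex) set \<Rightarrow> bool" where
  "orth B \<longleftrightarrow> B \<subseteq> S \<and> (\<forall>f\<in>B. f \<noteq> (\<lambda>_. 0)) \<and> (\<forall>f\<in>B. \<forall>g\<in>B. f \<noteq> g \<longrightarrow> ip f g = 0)"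

text \<open>More than \<open>N\<close> elements satisfy a non-trivial linear relation. Pairing it
  with a member whose coefficient is non-zero leaves \<open>ip j j = 0\<close>, against
  definiteness.\<close>

lemma orth_card: "orth B \<Longrightarrow> finite B \<and> card B \<le> N"
proof -
  assume B: "orth B"
  have *: "card J \<le> N" if J: "finite J" "J \<subseteq> B" for J
  proof (rule ccontr)
    assume "\<not> card J \<le> N"
    hence cJ: "card J > N" by simp
    have JS: "j \<in> S" if "j \<in> J" for j using that J B by (auto simp: orth_def)
    obtain c where c: "\<exists>j\<in>J. c j \<noteq> 0" "(\<lambda>x. \<Sum>j\<in>J. c j * j x) = (\<lambda>_. 0)"
      by (rule dependent[OF J(1) cJ JS])
    then obtain j where j: "j \<in> J" "c j \<noteq> 0" by blast
    have jS: "j \<in> S" using j J B by (auto simp: orth_def)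
    have "0 = ip (\<lambda>x. \<Sum>j\<in>J. c j * j x) j" unfolding c(2) using jS by simp
    also have "... = (\<Sum>i\<in>J. c i * ip i j)" by (rule ip_sum) (use J JS jS in auto)
    also have "... = (\<Sum>i\<in>J. if i = j then c j * ip j j else 0)"
    proof (rule sum.cong)
      fix i assume "i \<in> J"
      hence "i \<noteq> j \<Longrightarrow> ip i j = 0" using J(2) B j(1) unfolding orth_def by blast
      thus "c i * ip i j = (if i = j then c j * ip j j else 0)" by simp
    qed simp
    also have "... = c j * ip j j" using J j by simp
    finally have "ip j j = 0" using j by simp
    hence "j = (\<lambda>_. 0)" by (rule ip_pos[OF jS])
    thus False using j(1) J(2) B unfolding orth_def by blast
  qed
  show ?thesis
  proof (cases "finite B")
    case False
    then obtain J where "finite J" "card J = Suc N" "J \<subseteq> B" by (meson infinite_arbitrarily_large)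
    thus ?thesis using *[of J] by simp
  qed (use *[of B] in auto)
qed

definition subsp :: "('a \<Rightarrow> complex) set \<Rightarrow> bool" where
  "subsp V \<longleftrightarrow> V \<subseteq> S \<and> (\<lambda>_. 0) \<in> V \<and> (\<forall>f\<in>V. \<forall>g\<in>V. (\<lambda>x. f x + g x) \<in> V) \<and> (\<forall>c. \<forall>f\<in>V. (\<lambda>x. c * f x) \<in> V)"

lemma subsp_S: "subsp S"
  using S_0 S_add S_scale by (auto simp: subsp_def)

lemma subsp_sum: "finite J \<Longrightarrow> subsp V \<Longrightarrow> (\<And>j. j \<in> J \<Longrightarrow> v j \<in> V) \<Longrightarrow> (\<lambda>x. \<Sum>j\<in>J. c j * v j x) \<in> V"
proof (induction J rule: finite_induct)
  case (insert j J)
  have "(\<lambda>x. c j * v j x + (\<Sum>j\<in>J. c j * v j x)) \<in> V"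
    using insert by (auto simp: subsp_def)
  thus ?case using insert by simp
qed (simp add: subsp_def)

text \<open>Plays the role of the dimension. The maximum is over a finite set of numbers by
  \<open>orth_card\<close>, and only its strict monotonicity on subspaces and the spanning property
  of maximal families are used.\<close>

definition odim :: "('a \<Rightarrow> complex) set \<Rightarrow> nat" where
  "odim V = Max (card ` {B. orth B \<and> B \<subseteq> V})"

lemma odim_ge: "orth B \<Longrightarrow> B \<subseteq> V \<Longrightarrow> card B \<le> odim V"
  and odim_attained: "\<exists>B. orth B \<and> B \<subseteq> V \<and> card B = odim V"
proof -
  have "card ` {B. orth B \<and> B \<subseteq> V} \<subseteq> {..N}" using orth_card by auto
  hence fin: "finite (card ` {B. orth B \<and> B \<subseteq> V})" by (rule finite_subset) simp
  show "orth B \<Longrightarrow> B \<subseteq> V \<Longrightarrow> card B \<le> odim V" unfolding odim_def using fin by auto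
  have "orth {}" by (simp add: orth_def)
  hence "card ` {B. orth B \<and> B \<subseteq> V} \<noteq> {}" by auto
  from Max_in[OF fin this] show "\<exists>B. orth B \<and> B \<subseteq> V \<and> card B = odim V" unfolding odim_def by auto
qed

lemma ip_self_nonzero: "f \<in> S \<Longrightarrow> f \<noteq> (\<lambda>_. 0) \<Longrightarrow> ip f f \<noteq> 0"
  using ip_pos by blast

lemma residual_orth:
  assumes B: "orth B" and F: "F \<in> S" and b: "b \<in> B"
  shows "ip (\<lambda>x. F x + (\<Sum>b\<in>B. (- ip F b / ip b b) * b x)) b = 0"
proof -
  let ?t = "\<lambda>B F x. \<Sum>b\<in>B. (- ip F b / ip b b) * b x"
  have fB: "finite B" and BS: "B \<subseteq> S" using orth_card[OF B] B by (auto simp: orth_def)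
  have "ip (\<lambda>x. F x + (?t B F x)) b = ip F b + (\<Sum>i\<in>B. (- ip F i / ip i i) * ip i b)"
  proof -
    have "ip (\<lambda>x. F x + (?t B F x)) b = ip F b + ip (\<lambda>x. ?t B F x) b"
      by (rule ip_add[OF F S_sum]) (use fB BS b in auto)
    also have "ip (\<lambda>x. ?t B F x) b = (\<Sum>i\<in>B. (- ip F i / ip i i) * ip i b)"
      by (rule ip_sum) (use fB BS b in auto)
    finally show ?thesis .
  qed
  also have "(\<Sum>i\<in>B. (- ip F i / ip i i) * ip i b) = (\<Sum>i\<in>B. if i = b then - ip F b else 0)"
  proof (rule sum.cong)
    fix i assume i: "i \<in> B"
    show "(- ip F i / ip i i) * ip i b = (if i = b then - ip F b else 0)"
    proof (cases "i = b")
      case True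
      have "ip b b \<noteq> 0" using B b BS ip_self_nonzero unfolding orth_def by blast
      thus ?thesis using True by simp
    next
      case False
      hence "ip i b = 0" using B i b unfolding orth_def by blast
      thus ?thesis using False by simp
    qed
  qed simp
  also have "... = - ip F b" using fB b by simp
  finally show ?thesis by simp
qed

text \<open>The residual of \<open>F\<close> after projection is orthogonal to \<open>B\<close>; if
  it were non-zero it would enlarge a family that is already of maximal size.\<close>

lemma orth_expansion:
  assumes V: "subsp V" and B: "orth B" "B \<subseteq> V" "card B = odim V" and F: "F \<in> V"
  shows "F = (\<lambda>x. \<Sum>b\<in>B. (ip F b / ip b b) * b x)"
proof -
  let ?t = "\<lambda>B F x. \<Sum>b\<in>B. (- ip F b / ip b b) * b x"
  define G where "G = (\<lambda>x. F x + (?t B F x))"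
  have fB: "finite B" using orth_card[OF B(1)] by simp
  have VS: "V \<subseteq> S" using V by (simp add: subsp_def)
  have sV: "(\<lambda>x. ?t B F x) \<in> V"
    by (rule subsp_sum[OF fB V]) (use B in auto)
  have GV: "G \<in> V" unfolding G_def using V F sV by (auto simp: subsp_def)
  have Gb: "ip G b = 0" "ip b G = 0" if "b \<in> B" for b
  proof -
    show "ip G b = 0" unfolding G_def by (rule residual_orth[OF B(1)]) (use F VS that in auto)
    thus "ip b G = 0" using ip_cnj[of G b] GV VS B that by auto
  qed
  have "G = (\<lambda>_. 0)"
  proof (rule ccontr)
    assume "G \<noteq> (\<lambda>_. 0)"
    hence nG: "ip G G \<noteq> 0" using ip_self_nonzero GV VS by auto
    hence "G \<notin> B" using Gb by auto
    have "orth (insert G B)"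
      using B(1) Gb GV VS \<open>G \<noteq> (\<lambda>_. 0)\<close> unfolding orth_def by blast
    hence "card (insert G B) \<le> odim V" using odim_ge GV B(2) by auto
    thus False using \<open>G \<notin> B\<close> fB B(3) by simp
  qed
  hence "F x + (?t B F x) = 0" for x unfolding G_def by (rule fun_cong)
  hence "F x = (\<Sum>b\<in>B. (ip F b / ip b b) * b x)" for x
    by (simp add: sum_negf eq_neg_iff_add_eq_0 add_eq_0_iff2)
  thus ?thesis by blast
qed

lemma odim_less:
  assumes V: "subsp V" "subsp W" "W \<subseteq> V" "W \<noteq> V" shows "odim W < odim V"
proof -
  obtain B where B: "orth B" "B \<subseteq> W" "card B = odim W" using odim_attained by blast
  have "odim W \<noteq> odim V"
  proof
    assume eq: "odim W = odim V"
    have "F \<in> W" if F: "F \<in> V" for F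
    proof -
      have "F = (\<lambda>x. \<Sum>b\<in>B. (ip F b / ip b b) * b x)"
        by (rule orth_expansion[OF V(1) B(1)]) (use B V eq F in auto)
      also have "... \<in> W" by (rule subsp_sum[OF _ V(2)]) (use B orth_card in auto)
      finally show ?thesis .
    qed
    thus False using V by auto
  qed
  moreover have "odim W \<le> odim V" using B V odim_ge[OF B(1), of V] by auto
  ultimately show ?thesis by simp
qed

definition lin_on :: "('a \<Rightarrow> complex) set \<Rightarrow> (('a \<Rightarrow> complex) \<Rightarrow> 'a \<Rightarrow> complex) \<Rightarrow> bool" where
  "lin_on V T \<longleftrightarrow> (\<forall>f\<in>V. T f \<in> V) \<and> (\<forall>f\<in>V. \<forall>g\<in>V. T (\<lambda>x. f x + g x) = (\<lambda>x. T f x + T g x)) \<and>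
     (\<forall>c. \<forall>f\<in>V. T (\<lambda>x. c * f x) = (\<lambda>x. c * T f x))"

lemma subspD:
  "subsp V \<Longrightarrow> f \<in> V \<Longrightarrow> g \<in> V \<Longrightarrow> (\<lambda>x. f x + g x) \<in> V" "subsp V \<Longrightarrow> f \<in> V \<Longrightarrow> (\<lambda>x. c * f x) \<in> V"
  "subsp V \<Longrightarrow> f \<in> V \<Longrightarrow> f \<in> S"
  unfolding subsp_def by blast+

lemma lin_onD: "lin_on V T \<Longrightarrow> f \<in> V \<Longrightarrow> T f \<in> V"
  "lin_on V T \<Longrightarrow> f \<in> V \<Longrightarrow> g \<in> V \<Longrightarrow> T (\<lambda>x. f x + g x) = (\<lambda>x. T f x + T g x)"
  "lin_on V T \<Longrightarrow> f \<in> V \<Longrightarrow> T (\<lambda>x. c * f x) = (\<lambda>x. c * T f x)"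
  unfolding lin_on_def by blast+

lemma lin_sum:
  assumes "lin_on V T" "subsp V" "finite J" "\<And>j. j \<in> J \<Longrightarrow> v j \<in> V"
  shows "T (\<lambda>x. \<Sum>j\<in>J. c j * v j x) = (\<lambda>x. \<Sum>j\<in>J. c j * T (v j) x)"
  using assms(3,4)
proof (induction J rule: finite_induct)
  case empty
  have "(\<lambda>_. 0) \<in> V" using assms(2) by (simp add: subsp_def)
  from lin_onD(3)[OF assms(1) this, of 0] show ?case by simp
next
  case (insert j J)
  have 1: "(\<lambda>x. c j * v j x) \<in> V" by (rule subspD(2)[OF assms(2)]) (use insert in auto)
  have 2: "(\<lambda>x. \<Sum>j\<in>J. c j * v j x) \<in> V" by (rule subsp_sum[OF _ assms(2)]) (use insert in auto)
  have "T (\<lambda>x. c j * v j x + (\<Sum>j\<in>J. c j * v j x)) = (\<lambda>x. c j * T (v j) x + (\<Sum>j\<in>J. c j * T (v j) x))"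
    unfolding lin_onD(2)[OF assms(1) 1 2] using insert by (subst lin_onD(3)[OF assms(1)]) auto
  thus ?case using insert by simp
qed

text \<open>The \<open>N + 1\<close> vectors \<open>F, T F, ..., T^N F\<close> are dependent, so
  some non-zero polynomial in \<open>T\<close> kills \<open>F\<close>. One of least degree is not
  constant and has a complex root \<open>u\<close>; the quotient by the linear factor, applied to
  \<open>F\<close>, is non-zero by minimality and is an eigenvector for \<open>u\<close>.\<close>

lemma eigenvector_exists:
  assumes V: "subsp V" "lin_on V T" "F \<in> V" "F \<noteq> (\<lambda>_. 0)"
  shows "\<exists>G\<in>V. \<exists>u. G \<noteq> (\<lambda>_. 0) \<and> T G = (\<lambda>x. u * G x)"
proof -
  \<comment> \<open>\<open>P p M\<close> is \<open>p\<close> evaluated at \<open>T\<close> and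
    applied to \<open>F\<close>, cut off at degree \<open>M\<close>. The cut-off is a parameter
    because the quotient polynomial is summed only up to \<open>M\<close> with
    \<open>N = Suc M\<close>, which leaves room for one more application of
    \<open>T\<close>.\<close>
  define P where "P p M = (\<lambda>x. \<Sum>i\<le>M. coeff p i * (T ^^ i) F x)" for p M
  define R where "R p \<longleftrightarrow> p \<noteq> 0 \<and> degree p \<le> N \<and> P p N = (\<lambda>_. 0)" for p
  have TV: "(T ^^ i) F \<in> V" for i by (induction i) (use V lin_onD(1) in auto)
  have VS: "(T ^^ j) F \<in> S" for j using subspD(3)[OF V(1) TV] .
  obtain c where c: "\<exists>j\<in>{..N}. c j \<noteq> 0" "(\<lambda>x. \<Sum>j\<in>{..N}. c j * (T ^^ j) F x) = (\<lambda>_. 0)"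
    by (rule dependent[of "{..N}" "\<lambda>j. (T ^^ j) F"]) (use VS in auto)
  define p0 where "p0 = (\<Sum>i\<le>N. monom (c i) i)"
  have cp: "coeff p0 i = (if i \<le> N then c i else 0)" for i by (simp add: p0_def coeff_sum)
  have "p0 \<noteq> 0" using c(1) cp by (metis atMost_iff coeff_0)
  moreover have "degree p0 \<le> N" by (rule degree_le) (simp add: cp)
  ultimately have "R p0" using c(2) by (simp add: R_def P_def cp)
  then obtain p where p: "R p" and min: "\<And>q. R q \<Longrightarrow> degree p \<le> degree q"
    using ex_has_least_nat[of R p0 degree] by blast
  have d0: "degree p \<noteq> 0"
  proof
    assume "degree p = 0"
    then obtain a where a: "p = [:a:]" by (metis degree_eq_zeroE)
    have "P p N x = a * F x" for x
    proof -
      have "P p N x = (\<Sum>i\<in>{0}. coeff p i * (T ^^ i) F x)"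
        unfolding P_def by (rule sum.mono_neutral_right) (auto simp: a coeff_pCons split: nat.splits)
      thus ?thesis by (simp add: a)
    qed
    thus False using p V(4) a by (auto simp: R_def fun_eq_iff)
  qed
  hence "\<not> constant (poly p)" by (metis constant_degree)
  then obtain u where "poly p u = 0" using fundamental_theorem_of_algebra by blast
  then obtain q where q: "p = [:- u, 1:] * q" by (metis dvdE poly_eq_0_iff_dvd)
  have q0: "q \<noteq> 0" using p q by (auto simp: R_def)
  have dp: "degree p = Suc (degree q)"
    unfolding q by (subst degree_mult_eq) (use q0 in auto)
  then obtain M where M: "N = Suc M" "degree q \<le> M" using p by (cases N) (auto simp: R_def)
  define G where "G = P q M"
  have GN: "P q N = G" using M(2) by (simp add: G_def P_def M(1) coeff_eq_0)
  have c0: "coeff p 0 = - u * coeff q 0" and cS: "coeff p (Suc i) = coeff q i - u * coeff q (Suc i)" for i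
    unfolding q by (simp_all add: mult_pCons_left)
  have "T G x = u * G x" for x
  proof -
    have "0 = P p N x" using p by (simp add: R_def)
    also have "... = coeff p 0 * F x + (\<Sum>i\<le>M. coeff p (Suc i) * (T ^^ Suc i) F x)"
      unfolding P_def M by (subst sum.atMost_Suc_shift) simp
    also have "... = (\<Sum>i\<le>M. coeff q i * (T ^^ Suc i) F x) - u * (coeff q 0 * (T ^^ 0) F x + (\<Sum>i\<le>M. coeff q (Suc i) * (T ^^ Suc i) F x))"
      by (simp add: c0 cS algebra_simps sum_subtractf sum_distrib_left)
    also have "coeff q 0 * (T ^^ 0) F x + (\<Sum>i\<le>M. coeff q (Suc i) * (T ^^ Suc i) F x) = P q N x"
      unfolding P_def M by (subst sum.atMost_Suc_shift) simp
    also have "(\<Sum>i\<le>M. coeff q i * (T ^^ Suc i) F x) = T G x"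
      unfolding G_def P_def by (subst lin_sum[OF V(2,1)]) (use TV in auto)
    finally show ?thesis by (simp add: GN)
  qed
  moreover have "G \<noteq> (\<lambda>_. 0)" using min[of q] p dp q0 by (auto simp: R_def GN)
  moreover have "G \<in> V" unfolding G_def P_def by (rule subsp_sum[OF _ V(1) TV]) simp
  ultimately show ?thesis by blast
qed

text \<open>The orthogonal complement \<open>W\<close> of all common eigenvectors is stable, by
  self-adjointness. If it were non-zero, a non-zero stable subspace \<open>V\<close> of
  \<open>W\<close> of least dimension would exist. Each operator has an eigenspace in
  \<open>V\<close>, which is stable by commutation and hence all of \<open>V\<close>; so every
  operator is scalar on \<open>V\<close>, and a non-zero element of \<open>V\<close> is a common
  eigenvector orthogonal to itself. Minimality handles infinitely many operators at once.\<close>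

theorem common_eigenvectors_complete:
  fixes T :: "nat \<Rightarrow> ('a \<Rightarrow> complex) \<Rightarrow> 'a \<Rightarrow> complex"
  assumes lin: "\<And>n. lin_on S (T n)"
    and comm: "\<And>m n f. f \<in> S \<Longrightarrow> T m (T n f) = T n (T m f)"
    and adj: "\<And>n f g. f \<in> S \<Longrightarrow> g \<in> S \<Longrightarrow> ip (T n f) g = ip f (T n g)"
    and F: "F \<in> S" "\<And>f. f \<in> S \<Longrightarrow> f \<noteq> (\<lambda>_. 0) \<Longrightarrow> (\<And>n. \<exists>u. T n f = (\<lambda>x. u * f x)) \<Longrightarrow> ip F f = 0"
  shows "F = (\<lambda>_. 0)"
proof (rule ccontr)
  assume F0: "F \<noteq> (\<lambda>_. 0)"
  define E where "E = {f \<in> S. f \<noteq> (\<lambda>_. 0) \<and> (\<forall>n. \<exists>u. T n f = (\<lambda>x. u * f x))}"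
  define W where "W = {g \<in> S. \<forall>f\<in>E. ip g f = 0}"
  define Q where "Q V \<longleftrightarrow> subsp V \<and> V \<subseteq> W \<and> V \<noteq> {\<lambda>_. 0} \<and> (\<forall>n. \<forall>f\<in>V. T n f \<in> V)" for V
  have ES: "f \<in> S" if "f \<in> E" for f using that by (simp add: E_def)
  have ip_scale_r: "ip f (\<lambda>x. c * g x) = cnj c * ip f g" if "f \<in> S" "g \<in> S" for f g c
    using ip_cnj[of "\<lambda>x. c * g x" f] ip_cnj[of g f] ip_scale[of g f c] S_scale[of g c] that by simp
  have subW: "subsp W"
    unfolding subsp_def W_def using S_0 S_add S_scale ES by (auto simp: ip_add ip_scale)
  have "Q W" unfolding Q_def
  proof (intro conjI allI ballI)
    show "W \<noteq> {\<lambda>_. 0}" using F F0 unfolding W_def E_def by blast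
    fix n g assume g: "g \<in> W"
    have gS: "g \<in> S" using g by (simp add: W_def)
    have "ip (T n g) f = 0" if f: "f \<in> E" for f
    proof -
      obtain u where "T n f = (\<lambda>x. u * f x)" using f by (auto simp: E_def)
      thus ?thesis using adj[OF gS ES[OF f], of n] ip_scale_r[OF gS ES[OF f], of u] g f by (simp add: W_def)
    qed
    thus "T n g \<in> W" using lin_onD(1)[OF lin gS] by (simp add: W_def)
  qed (use subW in auto)
  then obtain V where V: "Q V" and min: "\<And>U. Q U \<Longrightarrow> odim V \<le> odim U"
    using ex_has_least_nat[of Q W odim] by blast
  have VS: "V \<subseteq> S" and subV: "subsp V" and VW: "V \<subseteq> W" using V by (auto simp: Q_def subsp_def)
  have scalar: "\<exists>u. \<forall>f\<in>V. T n f = (\<lambda>x. u * f x)" for n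
  proof -
    have linV: "lin_on V (T n)" using V lin[of n] VS unfolding Q_def lin_on_def by blast
    have "(\<lambda>_. 0) \<in> V" using subV by (simp add: subsp_def)
    then obtain G0 where "G0 \<in> V" "G0 \<noteq> (\<lambda>_. 0)" using V unfolding Q_def by blast
    then obtain G u where G: "G \<in> V" "G \<noteq> (\<lambda>_. 0)" "T n G = (\<lambda>x. u * G x)"
      using eigenvector_exists[OF subV linV] by blast
    define U where "U = {f \<in> V. T n f = (\<lambda>x. u * f x)}"
    have subU: "subsp U" unfolding subsp_def
    proof (intro conjI ballI allI)
      show "U \<subseteq> S" using VS by (auto simp: U_def)
      show "(\<lambda>_. 0) \<in> U" using \<open>(\<lambda>_. 0) \<in> V\<close> lin_onD(3)[OF linV \<open>(\<lambda>_. 0) \<in> V\<close>, of 0] by (simp add: U_def)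
    next
      fix f g assume "f \<in> U" "g \<in> U"
      thus "(\<lambda>x. f x + g x) \<in> U"
        using subspD(1)[OF subV, of f g] lin_onD(2)[OF linV, of f g] by (simp add: U_def algebra_simps)
    next
      fix f c assume "f \<in> U"
      thus "(\<lambda>x. c * f x) \<in> U"
        using subspD(2)[OF subV, of f c] lin_onD(3)[OF linV, of f c] by (simp add: U_def algebra_simps)
    qed
    have "Q U" unfolding Q_def
    proof (intro conjI ballI allI)
      show "U \<subseteq> W" using VW by (auto simp: U_def)
      show "U \<noteq> {\<lambda>_. 0}" using G by (auto simp: U_def)
      fix m f assume f: "f \<in> U"
      hence fV: "f \<in> V" and fS: "f \<in> S" using VS by (auto simp: U_def)
      have "T n (T m f) = T m (\<lambda>x. u * f x)" using comm[OF fS, of n m] f by (simp add: U_def)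
      also have "... = (\<lambda>x. u * T m f x)" by (rule lin_onD(3)[OF lin fS])
      finally show "T m f \<in> U" using V fV by (simp add: U_def Q_def)
    qed (rule subU)
    hence "\<not> odim U < odim V" using min by (simp add: not_less)
    moreover have "U \<subseteq> V" by (auto simp: U_def)
    ultimately have "U = V" using odim_less[OF subV subU] by blast
    thus ?thesis unfolding U_def by blast
  qed
  have "(\<lambda>_. 0) \<in> V" using subV by (simp add: subsp_def)
  then obtain f where f: "f \<in> V" "f \<noteq> (\<lambda>_. 0)" using V unfolding Q_def by blast
  have "\<exists>u. T n f = (\<lambda>x. u * f x)" for n using scalar[of n] f(1) by blast
  hence "f \<in> E" using f VS by (auto simp: E_def)
  moreover have "f \<in> W" using f VW by blast
  ultimately have "ip f f = 0" by (simp add: W_def)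
  thus False using ip_pos[of f] f VS by blast
qed

end

section \<open>The divisor bound\<close>

lemma divisor_count_mult_le:
  assumes "m > 0" "n > 0" shows "divisor_count (m * n) \<le> divisor_count m * divisor_count n"
proof -
  have "{d. d dvd m * n} \<subseteq> (\<lambda>(a, b). a * b) ` ({d. d dvd m} \<times> {d. d dvd n})"
  proof
    fix d assume "d \<in> {d. d dvd m * n}"
    hence "d dvd m * n" by simp
    from division_decomp[OF this] obtain b c where "d = b * c" "b dvd m" "c dvd n" by blast
    thus "d \<in> (\<lambda>(a, b). a * b) ` ({d. d dvd m} \<times> {d. d dvd n})"
      by (intro image_eqI[of _ _ "(b, c)"]) auto
  qed
  hence "card {d. d dvd m * n} \<le> card ((\<lambda>(a, b). a * b) ` ({d. d dvd m} \<times> {d. d dvd n}))"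
    using assms by (intro card_mono) auto
  also have "... \<le> card ({d. d dvd m} \<times> {d. d dvd n})"
    using assms by (intro card_image_le) auto
  finally show ?thesis by (simp add: divisor_count_def card_cartesian_product)
qed

lemma divisor_count_prime_power: "prime p \<Longrightarrow> divisor_count (p ^ v) \<le> v + 1"
proof -
  assume p: "prime (p::nat)"
  have "{d. d dvd p ^ v} \<subseteq> (\<lambda>i. p ^ i) ` {..v}"
    using p by (auto simp: divides_primepow_nat)
  hence "card {d. d dvd p ^ v} \<le> card ((\<lambda>i. p ^ i) ` {..v})" by (intro card_mono) auto
  also have "... \<le> v + 1" using card_image_le[of "{..v}" "\<lambda>i. p ^ i"] by simp
  finally show ?thesis by (simp add: divisor_count_def)
qed

text \<open>Multiplicativity reduces to prime powers. A prime power \<open>p^v\<close> contributes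
  at most \<open>v + 1\<close>, and this is below \<open>p powr (v d)\<close> as soon as
  \<open>p >= 2 powr (1/d)\<close>; each of the finitely many smaller primes costs at most one
  constant factor \<open>A\<close>.\<close>

lemma divisor_bound:
  assumes d: "d > 0"
  obtains C where "C \<ge> 1" "\<And>n. n > 0 \<Longrightarrow> real (divisor_count n) \<le> C * real n powr d"
proof -
  obtain P :: nat where P: "real P \<ge> 2 powr (1/d)" using real_arch_simple by blast
  \<comment> \<open>\<open>A\<close> is large enough for
    \<open>v + 1 <= A * (1 + v * d * ln 2)\<close>, while
    \<open>1 + v * d * ln 2 <= 2 powr (v * d)\<close> by convexity of the exponential.\<close>
  define A where "A = max 1 (2 / (d * ln 2))"
  have A1: "A \<ge> 1" by (simp add: A_def)
  have big: "real v + 1 \<le> (real p ^ v) powr d" if "p \<ge> P" "p \<ge> 1" for p v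
  proof -
    have "2 = (2 powr (1/d)) powr d" using d by (simp add: powr_powr)
    also have "... \<le> real p powr d" using P that d by (intro powr_mono2) auto
    finally have "2 ^ v \<le> (real p powr d) ^ v" by (intro power_mono) auto
    also have "(real p powr d) ^ v = (real p ^ v) powr d"
      using that by (simp add: powr_powr powr_realpow[symmetric] mult.commute)
    finally have "2 ^ v \<le> (real p ^ v) powr d" .
    moreover have "real v + 1 \<le> 2 ^ v"
      by (induction v) auto
    ultimately show ?thesis by linarith
  qed
  have small: "real v + 1 \<le> A * (real p ^ v) powr d" if "p \<ge> 2" for p v
  proof -
    have "(2::real) powr (real v * d) \<le> (real p ^ v) powr d"
    proof -
      have "(2::real) powr (real v * d) = (2 ^ v) powr d" by (simp add: powr_powr powr_realpow[symmetric])
      also have "... \<le> (real p ^ v) powr d" using that d by (intro powr_mono2 power_mono) auto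
      finally show ?thesis .
    qed
    moreover have "1 + real v * d * ln 2 \<le> (2::real) powr (real v * d)"
      using exp_ge_add_one_self[of "real v * d * ln 2"] by (simp add: powr_def mult_ac)
    ultimately have 1: "1 + real v * d * ln 2 \<le> (real p ^ v) powr d" by linarith
    have "real v + 1 \<le> A * (1 + real v * d * ln 2)"
    proof -
      have "2 / (d * ln 2) \<le> A" by (simp add: A_def)
      hence "2 / (d * ln 2) * (d * ln 2) \<le> A * (d * ln 2)" using d by (intro mult_right_mono) auto
      hence "2 \<le> A * (d * ln 2)" using d by simp
      hence "real v * 1 \<le> real v * (A * (d * ln 2))" by (intro mult_left_mono) auto
      thus ?thesis using A1 by (simp add: algebra_simps)
    qed
    also have "... \<le> A * (real p ^ v) powr d" using 1 A1 by (intro mult_left_mono) auto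
    finally show ?thesis .
  qed
  have main: "real (divisor_count n) \<le> A ^ card {p. prime p \<and> p dvd n \<and> p < P} * real n powr d" if "n > 0" for n
    using that
  proof (induction n rule: less_induct)
    case (less n)
    show ?case
    proof (cases "n = 1")
      case True
      show ?thesis using True A1 by (simp add: divisor_count_def one_le_power)
    next
      case False
      then obtain p where p: "prime p" "p dvd n" using prime_factor_nat by blast
      have p2: "p \<ge> 2" using p prime_ge_2_nat by blast
      define v where "v = multiplicity p n"
      obtain m where m: "n = p ^ v * m" "\<not> p dvd m"
        using multiplicity_decompose'[of n p] less.prems p p2 by (auto simp: v_def)
      have v: "v \<ge> 1" using p less.prems unfolding v_def
        by (simp add: Suc_le_eq prime_multiplicity_gt_zero_iff)
      have m0: "m > 0" using less.prems m by (cases m) auto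
      have "1 < p ^ v" using p2 v by (intro one_less_power) auto
      hence mn: "m < n" using m m0 by simp
      define Sm where "Sm = {q. prime q \<and> q dvd m \<and> q < P}"
      define Sn where "Sn = {q. prime q \<and> q dvd n \<and> q < P}"
      have fin: "finite Sn" "finite Sm" by (auto simp: Sn_def Sm_def)
      have sub: "Sm \<subseteq> Sn" using m by (auto simp: Sm_def Sn_def)
      have IH: "real (divisor_count m) \<le> A ^ card Sm * real m powr d"
        using less.IH[OF mn m0] by (simp add: Sm_def)
      have "real (divisor_count n) \<le> real (divisor_count (p ^ v) * divisor_count m)"
        using divisor_count_mult_le[of "p ^ v" m] p2 m m0 by (simp del: of_nat_mult)
      also have "... \<le> (real v + 1) * (A ^ card Sm * real m powr d)"
        using divisor_count_prime_power[OF p(1), of v] IH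
        unfolding of_nat_mult by (intro mult_mono) auto
      also have "... \<le> A ^ card Sn * (real p ^ v) powr d * real m powr d"
      proof (cases "p < P")
        case True
        have "p \<in> Sn" "p \<notin> Sm" using True p m by (auto simp: Sm_def Sn_def)
        hence "Sm \<subset> Sn" using sub by blast
        hence "card Sm < card Sn" using fin by (intro psubset_card_mono)
        hence "A ^ Suc (card Sm) \<le> A ^ card Sn" using A1 by (intro power_increasing) auto
        have "(real v + 1) * (A ^ card Sm * real m powr d) \<le> (A * (real p ^ v) powr d) * (A ^ card Sm * real m powr d)"
          using small[OF p2, of v] A1 by (intro mult_right_mono) auto
        also have "... = A ^ Suc (card Sm) * (real p ^ v) powr d * real m powr d" by simp
        also have "... \<le> A ^ card Sn * (real p ^ v) powr d * real m powr d"
          using \<open>A ^ Suc (card Sm) \<le> A ^ card Sn\<close> by (intro mult_right_mono) auto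
        finally show ?thesis .
      next
        case False
        have "card Sm \<le> card Sn" using fin sub by (intro card_mono)
        hence "A ^ card Sm \<le> A ^ card Sn" using A1 by (intro power_increasing) auto
        moreover have "real v + 1 \<le> (real p ^ v) powr d" using big[of p v] False p2 by simp
        ultimately have "(real v + 1) * (A ^ card Sm * real m powr d) \<le> (real p ^ v) powr d * (A ^ card Sn * real m powr d)"
          using A1 by (intro mult_mono) auto
        thus ?thesis by (simp add: mult_ac)
      qed
      also have "(real p ^ v) powr d * real m powr d = real n powr d"
        using m by (simp add: powr_mult)
      hence "A ^ card Sn * (real p ^ v) powr d * real m powr d = A ^ card Sn * real n powr d"
        by (simp add: mult.assoc)
      finally show ?thesis by (simp add: Sn_def)
    qed
  qed
  show ?thesis
  proof (rule that[of "A ^ P"])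
    fix n :: nat assume n: "n > 0"
    have "card {p. prime p \<and> p dvd n \<and> p < P} \<le> card {..<P}" by (intro card_mono) auto
    hence "A ^ card {p. prime p \<and> p dvd n \<and> p < P} \<le> A ^ P" using A1 by (intro power_increasing) auto
    thus "real (divisor_count n) \<le> A ^ P * real n powr d"
      using main[OF n] by (meson mult_right_mono order_trans powr_ge_zero)
  qed (use A1 in simp)
qed

section \<open>Petersson products with the kernel\<close>

lemma integrable_complex_iff:
  fixes \<phi> :: "complex \<Rightarrow> 'b :: {banach, second_countable_topology}"
  assumes [measurable]: "\<phi> \<in> borel_measurable borel"
  shows "integrable lborel \<phi> \<longleftrightarrow> integrable (lborel \<Otimes>\<^sub>M lborel) (\<lambda>(x, y). \<phi> (Complex x y))"
    and "integral\<^sup>L lborel \<phi> = integral\<^sup>L (lborel \<Otimes>\<^sub>M lborel) (\<lambda>(x, y). \<phi> (Complex x y))"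
  by (subst lborel_complex_prod, subst integrable_distr_eq, auto simp: case_prod_unfold)
     (subst lborel_complex_prod, subst integral_distr, auto simp: case_prod_unfold)

lemma integrable_complex_product_bound:
  fixes \<phi> :: "complex \<Rightarrow> complex"
  assumes \<phi> [measurable]: "\<phi> \<in> borel_measurable borel"
    and g: "integrable lborel g" and h: "integrable lborel h" and g0: "\<And>x. g x \<ge> 0" and h0: "\<And>y. h y \<ge> (0::real)"
    and bound: "\<And>x y. norm (\<phi> (Complex x y)) \<le> g x * h y"
  shows "integrable lborel \<phi>"
proof -
  have [measurable]: "g \<in> borel_measurable lborel" "h \<in> borel_measurable lborel" using g h by auto
  have "integrable (lborel \<Otimes>\<^sub>M lborel) (\<lambda>(x, y). g x * h y)"
  proof (rule lborel_pair.Fubini_integrable)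
    show "integrable lborel (\<lambda>x. LBINT y. norm (case (x, y) of (x, y) \<Rightarrow> g x * h y))"
      using g h g0 h0 by (simp add: abs_mult)
    show "AE x in lborel. integrable lborel (\<lambda>y. case (x, y) of (x, y) \<Rightarrow> g x * h y)"
      using h by simp
  qed simp
  thus ?thesis unfolding integrable_complex_iff(1)[OF \<phi>]
    by (rule Bochner_Integration.integrable_bound) (auto intro!: AE_I2 order.trans[OF bound])
qed

lemma integral_complex_iterated:
  fixes \<phi> :: "complex \<Rightarrow> complex"
  assumes "integrable lborel \<phi>"
  shows "integral\<^sup>L lborel \<phi> = (LBINT y. (LBINT x. \<phi> (Complex x y)))"
proof -
  have m [measurable]: "\<phi> \<in> borel_measurable borel" using assms by auto
  have "integrable (lborel \<Otimes>\<^sub>M lborel) (\<lambda>(x, y). \<phi> (Complex x y))"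
    using assms integrable_complex_iff(1)[OF m] by simp
  from lborel_pair.integral_snd[OF this] show ?thesis
    using integrable_complex_iff(2)[of \<phi>] by simp
qed

text \<open>The line is cut into the half-open intervals \<open>[b, b + 1)\<close>, each shifted to
  \<open>[0, 1)\<close>. The closed interval in the conclusion differs by one point and is the one
  on which Fourier integrals are taken.\<close>

lemma integral_periodize:
  fixes g :: "real \<Rightarrow> complex"
  assumes g: "integrable lborel g" and sm: "\<And>x. (\<lambda>b::int. norm (g (x + of_int b))) summable_on UNIV"
  shows "integral\<^sup>L lborel g = (LINT x:{0..1}|lborel. \<Sum>\<^sub>\<infinity>b::int. g (x + of_int b))"
    and "set_integrable lborel {0..1} (\<lambda>x. \<Sum>\<^sub>\<infinity>b::int. g (x + of_int b))"
proof -
  let ?S = "\<lambda>(f::int \<Rightarrow> real \<Rightarrow> complex) x. \<Sum>\<^sub>\<infinity>b\<in>UNIV. f b x"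
  have [measurable]: "g \<in> borel_measurable borel" using g by auto
  define I where "I b = {of_int b..<of_int b + 1::real}" for b
  have I: "x \<in> I b \<longleftrightarrow> b = \<lfloor>x\<rfloor>" for x b by (auto simp: I_def floor_eq_iff intro: sym)
  define f where "f b x = indicator (I b) x *\<^sub>R g x" for b x
  define f' where "f' b x = indicator {0..<1::real} x *\<^sub>R g (x + of_int b)" for b :: int and x
  have ff': "f b (of_int b + 1 * x) = f' b x" for b x
    by (auto simp: f_def f'_def I_def indicator_def add.commute)
  have fint: "integrable lborel (f b)" for b
    unfolding f_def I_def by (intro integrable_mult_indicator g) auto
  have f'int: "integrable lborel (f' b)" for b
    using lborel_integrable_real_affine[OF fint[of b], of 1 "of_int b"] by (simp only: ff')
  have neq: "(LBINT x. norm (f b x)) = (LBINT x. norm (f' b x))" for b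
    using lborel_integral_real_affine[of 1 "\<lambda>x. norm (f b x)" "of_int b"] by (simp only: ff') simp
  have eq: "(LBINT x. f b x) = (LBINT x. f' b x)" for b
    using lborel_integral_real_affine[of 1 "f b" "of_int b"] by (simp only: ff') simp
  have fz: "f b x = 0" if "b \<in> UNIV - {\<lfloor>x\<rfloor>}" for b x using that I[of x b] by (simp add: f_def)
  have ns: "(\<lambda>b. LBINT x. norm (f b x)) summable_on UNIV"
  proof (rule nonneg_bdd_above_summable_on)
    show "bdd_above (sum (\<lambda>b. LBINT x. norm (f b x)) ` {F. F \<subseteq> UNIV \<and> finite F})"
    proof (rule bdd_aboveI2)
      fix F :: "int set" assume F: "F \<in> {F. F \<subseteq> UNIV \<and> finite F}"
      have "(\<Sum>b\<in>F. LBINT x. norm (f b x)) = (LBINT x. (\<Sum>b\<in>F. norm (f b x)))"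
        using F fint by (subst Bochner_Integration.integral_sum) auto
      also have "... \<le> (LBINT x. norm (g x))"
      proof (rule integral_mono)
        show "integrable lborel (\<lambda>x. \<Sum>b\<in>F. norm (f b x))" using fint by auto
        fix x
        have "(\<Sum>b\<in>F. norm (f b x)) = (\<Sum>b\<in>F \<inter> {\<lfloor>x\<rfloor>}. norm (f b x))"
          using F fz by (intro sum.mono_neutral_right) auto
        also have "... \<le> (\<Sum>b\<in>{\<lfloor>x\<rfloor>}. norm (f b x))" by (intro sum_mono2) auto
        also have "... = norm (f \<lfloor>x\<rfloor> x)" by simp
        also have "... \<le> norm (g x)" by (simp add: f_def indicator_def)
        finally show "(\<Sum>b\<in>F. norm (f b x)) \<le> norm (g x)" .
      qed (use g in auto)
      finally show "(\<Sum>b\<in>F. LBINT x. norm (f b x)) \<le> (LBINT x. norm (g x))" .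
    qed
  qed simp
  have s1: "((\<lambda>b. LBINT x. f b x) has_sum (LBINT x. (?S f x))) UNIV"
  proof (rule integral_infsum(2)[OF _ fint _ ns])
    fix x
    show "(\<lambda>b. norm (f b x)) summable_on UNIV"
      by (rule summable_on_cong_neutral[THEN iffD1, OF _ _ _ summable_on_finite[of "{\<lfloor>x\<rfloor>}"]]) (use fz in auto)
  qed simp
  have "(?S f x) = g x" for x
  proof -
    have "(?S f x) = (\<Sum>\<^sub>\<infinity>b\<in>{\<lfloor>x\<rfloor>}. f b x)"
      by (rule infsum_cong_neutral) (use fz in auto)
    also have "... = g x" using I[of x "\<lfloor>x\<rfloor>"] by (simp add: f_def)
    finally show ?thesis .
  qed
  with s1 have s1: "((\<lambda>b. LBINT x. f b x) has_sum integral\<^sup>L lborel g) UNIV" by simp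
  have sm': "(\<lambda>b. norm (f' b x)) summable_on UNIV" for x
    unfolding f'_def norm_scaleR by (intro summable_on_cmult_right sm)
  note II = integral_infsum[OF _ f'int sm' ns[unfolded neq]]
  have "((\<lambda>b. LBINT x. f' b x) has_sum (LBINT x. (\<Sum>\<^sub>\<infinity>b\<in>UNIV. f' b x))) UNIV"
    by (rule II) simp
  with s1 have e1: "integral\<^sup>L lborel g = (LBINT x. (\<Sum>\<^sub>\<infinity>b\<in>UNIV. f' b x))"
    unfolding eq by (rule has_sum_unique)
  have e2: "(\<Sum>\<^sub>\<infinity>b\<in>UNIV. f' b x) = indicator {0..<1::real} x *\<^sub>R (\<Sum>\<^sub>\<infinity>b::int. g (x + of_int b))" for x
    by (cases "x \<in> {0..<1}") (auto simp: f'_def)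
  have int1: "integrable lborel (\<lambda>x. \<Sum>\<^sub>\<infinity>b\<in>UNIV. f' b x)" by (rule II) simp
  let ?G = "\<lambda>x. \<Sum>\<^sub>\<infinity>b::int. g (x + of_int b)"
  have "(\<lambda>x. indicator {1} x *\<^sub>R ?G x) = (\<lambda>x. indicator {1::real} x *\<^sub>R ?G 1)"
    by (auto simp: indicator_def fun_eq_iff)
  hence "set_integrable lborel {1} ?G"
    unfolding set_integrable_def by (simp only:) (intro integrable_scaleR_left, simp)
  moreover have "set_integrable lborel {0..<1} ?G" using int1 unfolding e2 set_integrable_def .
  ultimately have "set_integrable lborel ({0..<1} \<union> {1}) ?G" by (intro set_integrable_Un) auto
  also have "{0..<1} \<union> {1} = {0..1::real}" by auto
  finally show int2: "set_integrable lborel {0..1} ?G" .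
  show "integral\<^sup>L lborel g = (LINT x:{0..1}|lborel. ?G x)"
    unfolding e1 e2 set_lebesgue_integral_def
  proof (rule integral_cong_AE)
    show "AE x in lborel. indicator {0..<1} x *\<^sub>R ?G x = indicator {0..1} x *\<^sub>R ?G x"
      using AE_lborel_singleton[of "1::real"] by eventually_elim (auto simp: indicator_def)
  qed (use int1 int2 in \<open>auto simp: e2 set_integrable_def dest: borel_measurable_integrable\<close>)
qed

lemma integrable_inverse_quadratic:
  assumes d: "d > 0"
  shows "integrable lborel (\<lambda>x::real. 1 / ((x + c)^2 + d^2))"
proof -
  have "integrable lborel (\<lambda>x::real. inverse (1 + x^2))"
    using integrable_inverse_1_plus_square by (simp add: set_integrable_def)
  from lborel_integrable_real_affine[OF this, of "1/d" "c/d"] d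
  have "integrable lborel (\<lambda>x. inverse (1 + (c/d + 1/d * x)^2))" by simp
  hence "integrable lborel (\<lambda>x. (1/d^2) * inverse (1 + (c/d + 1/d * x)^2))" by (rule integrable_mult_right)
  also have "(\<lambda>x. (1/d^2) * inverse (1 + (c/d + 1/d * x)^2)) = (\<lambda>x. 1 / ((x + c)^2 + d^2))"
  proof
    fix x
    have "c/d + 1/d * x = (x + c) / d" by (simp add: add_divide_distrib)
    moreover have "1 + ((x + c) / d)^2 \<noteq> 0" by (smt (verit) zero_le_power2)
    moreover have "(x + c)^2 + d^2 \<noteq> 0" using d by (smt (verit) zero_le_power2 zero_less_power2)
    ultimately show "(1/d^2) * inverse (1 + (c/d + 1/d * x)^2) = 1 / ((x + c)^2 + d^2)"
      using d by (simp add: power_divide divide_simps) (simp add: add.commute)?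
  qed
  finally show ?thesis .
qed

lemma integral_power_exp:
  assumes c: "c > 0"
  shows "integrable lborel (\<lambda>y::real. ipos y * (y ^ m * exp (- c * y)))"
    and "(LBINT y. ipos (y::real) * (y ^ m * exp (- c * y))) = fact m / c ^ Suc m"
proof -
  have 1: "has_bochner_integral lborel (\<lambda>x::real. ipos x * (x ^ m * exp (-x))) (fact m)"
    using has_bochner_integral_I0i_power_exp_m[of m] by (simp add: mult_ac)
  let ?f = "\<lambda>x::real. ipos x * (x ^ m * exp (-x))"
  have f: "integrable lborel ?f" "integral\<^sup>L lborel ?f = fact m"
    using 1 by (auto simp: has_bochner_integral_iff)
  have eq: "?f (0 + c * y) = c ^ m * (ipos y * (y ^ m * exp (- c * y)))" for y
    using c by (auto simp: indicator_def power_mult_distrib zero_less_mult_iff)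
  have "integrable lborel (\<lambda>y. ?f (0 + c * y))"
    by (rule lborel_integrable_real_affine[OF f(1)]) (use c in auto)
  thus i: "integrable lborel (\<lambda>y::real. ipos y * (y ^ m * exp (- c * y)))"
    unfolding eq using c by simp
  have "fact m = \<bar>c\<bar> *\<^sub>R (LBINT y. ?f (0 + c * y))"
    using lborel_integral_real_affine[of c ?f 0] c f(2) by simp
  also have "(LBINT y. ?f (0 + c * y)) = c ^ m * (LBINT y. ipos (y::real) * (y ^ m * exp (- c * y)))"
    unfolding eq by simp
  finally show "(LBINT y. ipos (y::real) * (y ^ m * exp (- c * y))) = fact m / c ^ Suc m"
    using c by (simp add: field_simps)
qed

text \<open>The constant of the Lipschitz formula in weight \<open>2 * k\<close> times the gamma
  integral of \<open>y ^ (2 * k - 2) * exp (- 4 pi n y)\<close>. The power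
  \<open>n ^ (2 * k - 1)\<close> in the first cancels against the second, so the constant does not
  depend on \<open>n\<close>.\<close>

definition kernel_const :: "nat \<Rightarrow> complex" where
  "kernel_const k = (2 * of_real pi * \<i>)^(2*k) / fact (2*k - 1) * fact (2*k - 2) / of_real (4 * pi)^(2*k - 1)"

text \<open>The contribution of the identity matrix to the integrand of the Petersson product of
  \<open>F\<close> with the kernel; the other matrices of determinant 1 contribute translates of
  it.\<close>

definition unf :: "nat \<Rightarrow> (complex \<Rightarrow> complex) \<Rightarrow> complex \<Rightarrow> complex \<Rightarrow> complex" where
  "unf k F z' z = F z * cnj (1 / (z' + z)^(2*k)) * of_real (Im z ^ (2*k) / (Im z)^2)"

lemma cnj_measurable [measurable]: "cnj \<in> borel_measurable borel"
  and complex_of_real_measurable [measurable]: "complex_of_real \<in> borel_measurable borel"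
  by (intro borel_measurable_continuous_onI continuous_intros)+

lemma cusp_form_measurable:
  assumes "cusp_form w F" shows "F \<in> borel_measurable borel"
proof -
  have "(\<lambda>z. indicator HH z *\<^sub>R F z) \<in> borel_measurable borel"
    by (intro borel_measurable_continuous_on_indicator cusp_form_continuous[OF assms]) simp
  also have "(\<lambda>z. indicator HH z *\<^sub>R F z) = F"
    using cusp_form_outside[OF assms] by (auto simp: fun_eq_iff indicator_def)
  finally show ?thesis .
qed

text \<open>\<open>F\<close> is replaced by its bound \<open>B * y powr (- k)\<close>. Of the
  \<open>2 * k\<close> factors \<open>|z' + z|\<close> in the denominator two bound a quadratic in
  \<open>x\<close>, two a quadratic in \<open>y\<close>, \<open>k - 2\<close> absorb the remaining
  power of \<open>y\<close>, and the last \<open>k - 2\<close> are at least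
  \<open>Im z'\<close>.\<close>

lemma unf_integrable:
  assumes F: "cusp_form (2*k) F" and z': "z' \<in> HH" and k: "k \<ge> 2"
  shows "integrable lborel (\<lambda>z. indicator HH z *\<^sub>R unf k F z' z)"
    and "y > 0 \<Longrightarrow> integrable lborel (\<lambda>x. unf k F z' (Complex x y))"
proof -
  obtain B where B: "B > 0" "\<And>z. z \<in> HH \<Longrightarrow> Im z ^ k * norm (F z) \<le> B" using cusp_form_bounded[OF F] by blast
  define d where "d = Im z'"
  have d: "d > 0" using z' by (simp add: d_def)
  define g where "g x = 1 / ((x + Re z')^2 + d^2)" for x
  define h where "h y = B / d^(k - 2) * (1 / ((y + 0)^2 + d^2))" for y :: real
  have gi: "integrable lborel g" unfolding g_def by (rule integrable_inverse_quadratic[OF d])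
  have hi: "integrable lborel h" unfolding h_def by (intro integrable_mult_right integrable_inverse_quadratic[OF d])
  have g0: "g x \<ge> 0" and h0: "h y \<ge> 0" for x y using B d by (auto simp: g_def h_def)
  have [measurable]: "F \<in> borel_measurable borel" by (rule cusp_form_measurable[OF F])
  have bound: "norm (unf k F z' (Complex x y)) \<le> g x * h y" if y: "y > 0" for x y
  proof -
    let ?z = "Complex x y"
    have zH: "?z \<in> HH" using y by simp
    define N where "N = norm (z' + ?z)"
    have N2: "N^2 = (x + Re z')^2 + (y + d)^2" by (simp add: N_def d_def cmod_power2 add.commute)
    have yd: "y + d \<le> N" unfolding N_def d_def using abs_Im_le_cmod[of "z' + ?z"] by simp
    have Np: "N > 0" using yd y d by linarith
    have pos: "(x + Re z')^2 + d^2 > 0" "y^2 + d^2 > 0" using d by (auto simp: add_nonneg_pos)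
    have y0: "y ^ (2*k) / y^2 = y ^ k * y ^ (k - 2)"
    proof -
      have "2*k = k + (k - 2) + 2" using k by simp
      hence "y ^ (2*k) = y ^ (k + (k - 2) + 2)" by (rule arg_cong)
      hence "y ^ (2*k) = y ^ k * y ^ (k - 2) * y^2" by (simp only: power_add)
      thus ?thesis using y by simp
    qed
    have "((x + Re z')^2 + d^2) * (y^2 + d^2) * y ^ (k - 2) * d ^ (k - 2) \<le> N^2 * N^2 * N^(k - 2) * N^(k - 2)"
    proof (intro mult_mono power_mono)
      show "(x + Re z')^2 + d^2 \<le> N^2" unfolding N2 using y d by (intro add_left_mono power_mono) auto
      have "y^2 + d^2 \<le> (y + d)^2" using y d by (simp add: power2_sum)
      also have "... \<le> N^2" using yd y d by (intro power_mono) auto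
      finally show "y^2 + d^2 \<le> N^2" .
    qed (use yd y d in auto)
    also have "... = N^(2 + 2 + (k - 2) + (k - 2))" by (simp only: power_add)
    also have "2 + 2 + (k - 2) + (k - 2) = 2*k" using k by simp
    finally have key: "((x + Re z')^2 + d^2) * (y^2 + d^2) * y ^ (k - 2) * d ^ (k - 2) \<le> N^(2*k)" .
    have "norm (unf k F z' ?z) = (y ^ k * norm (F ?z)) * (y ^ (k - 2) / N^(2*k))"
      using y by (simp add: unf_def norm_mult norm_divide norm_power N_def y0
          del: of_real_divide of_real_power complex_cnj_add complex_cnj_divide complex_cnj_power)
    also have "... \<le> B * (y ^ (k - 2) / N^(2*k))"
      using B(2)[OF zH] y Np by (intro mult_right_mono) auto
    also have "y ^ (k - 2) / N^(2*k) \<le> 1 / (((x + Re z')^2 + d^2) * (y^2 + d^2) * d ^ (k - 2))"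
      using key Np pos d by (simp add: divide_simps) (simp add: mult_ac)
    also have "B * ... = g x * h y" using pos d by (simp add: g_def h_def field_simps)
    finally show ?thesis using B by (simp add: mult_left_mono)
  qed
  have m [measurable]: "unf k F z' \<in> borel_measurable borel"
    unfolding unf_def[abs_def] by measurable
  show "integrable lborel (\<lambda>z. indicator HH z *\<^sub>R unf k F z' z)"
    by (rule integrable_complex_product_bound[OF _ gi hi g0 h0])
       (use bound g0 h0 in \<open>auto simp: indicator_def\<close>)
  show "integrable lborel (\<lambda>x. unf k F z' (Complex x y))" if y: "y > 0"
  proof (rule Bochner_Integration.integrable_bound[OF integrable_mult_left[OF gi, of "h y"]])
    have "(\<lambda>x. unf k F z' (Complex x y)) = (\<lambda>x. unf k F z' (of_real x + \<i> * of_real y))" by (simp add: Complex_eq)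
    also have "... \<in> borel_measurable lborel" by measurable
    finally show "(\<lambda>x. unf k F z' (Complex x y)) \<in> borel_measurable lborel" .
    show "AE x in lborel. norm (unf k F z' (Complex x y)) \<le> norm (g x * h y)"
      using bound[OF y] g0 h0 by (intro AE_I2) (simp add: abs_mult)
  qed
qed

text \<open>On a horizontal line \<open>F\<close> is periodic, so the integral folds to a unit
  interval and only the kernel is summed over integral shifts. That sum is a Fourier series by the
  Lipschitz formula, and Parseval pairs it with the series of \<open>F\<close>.\<close>

lemma unf_row:
  assumes F: "cusp_form (2*k) F" and z': "z' \<in> HH" and k: "k \<ge> 2" and y: "y > 0"
  shows "(LBINT x. unf k F z' (Complex x y)) =
    (\<Sum>n. (2 * of_real pi * \<i>)^(2*k) / fact (2*k - 1) * fourier_coeff F n * of_nat n ^ (2*k-1) * cnj (e (of_nat n * z'))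
        * of_real (y ^ (2*k-2) * exp (- (4 * pi * real n) * y)))"
proof -
  let ?a = "fourier_coeff F"
  note FF = cusp_form_fourier[OF F]
  let ?r = "\<lambda>x b. 1 / (z' + Complex (x + of_int b) y)^(2*k)"
  let ?d = "\<lambda>d x. \<Sum>n. d n * e (- (of_nat n * of_real x))"
  define D where "D = (2 * of_real pi * \<i>)^(2*k) / (fact (2*k - 1) :: complex)"
  have cD: "cnj D = D" by (simp add: D_def power_mult power_mult_distrib)
  have D': "(- 2 * of_real pi * \<i>)^(2*k) / fact (2*k - 1) = D" by (simp add: D_def power_mult)
  define Y where "Y = y ^ (2*k) / y^2"
  have Y: "Y = y ^ (2*k - 2)" using y k by (simp add: Y_def power_diff)
  define c where "c n = ?a n * exp (- 2 * pi * real n * y)" for n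
  define d where "d n = D * of_nat n ^ (2*k-1) * cnj (e (of_nat n * z')) * exp (- 2 * pi * real n * y)" for n
  have sc: "summable (\<lambda>n. norm (c n))" unfolding c_def by (rule fourier_Complex(2)[OF FF y])
  have sd: "summable (\<lambda>n. norm (d n))"
  proof -
    define q where "q = exp (- (2 * pi * (Im z' + y)))"
    have "summable (\<lambda>n. norm D * (real n ^ (2*k-1) * q ^ n))"
      by (intro summable_mult npow_summable) (use z' y in \<open>auto simp: q_def add_pos_pos\<close>)
    also have "(\<lambda>n. norm D * (real n ^ (2*k-1) * q ^ n)) = (\<lambda>n. norm (d n))"
      by (auto simp: d_def q_def norm_mult norm_power norm_e exp_of_nat_mult[symmetric] exp_add[symmetric] algebra_simps)
    finally show ?thesis .
  qed
  have per: "F (Complex (x + of_int b) y) = F (Complex x y)" for x b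
    using cusp_form_shift[OF F, of "Complex x y" b] y by (simp add: complex_eq_iff Complex_eq algebra_simps)
  have lip: "((\<lambda>b. cnj (?r x b)) has_sum (?d d x)) UNIV"
    and lips: "(\<lambda>b. norm (cnj (?r x b))) summable_on UNIV" for x
  proof -
    define w where "w = z' + Complex x y"
    have w: "w \<in> HH" using z' y by (simp add: w_def)
    have wb: "z' + Complex (x + of_int b) y = w + of_int b" for b by (simp add: w_def complex_eq_iff)
    show "(\<lambda>b. norm (cnj (?r x b))) summable_on UNIV"
      using add_int_power_summable[of w "2*k"] w k by (simp add: wb del: complex_cnj_divide complex_cnj_power)
    have "((\<lambda>b. cnj (1 / (w + of_int b)^(2*k))) has_sum cnj (D * (\<Sum>n. of_nat n ^ (2*k - 1) * e (of_nat n * w)))) UNIV"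
      using lipschitz_formula[OF w, of "2*k"] k unfolding D' by (subst has_sum_cnj_iff) simp
    moreover have "cnj (D * (\<Sum>n. of_nat n ^ (2*k - 1) * e (of_nat n * w))) = (?d d x)"
    proof -
      have s: "summable (\<lambda>n. of_nat n ^ (2*k - 1) * e (of_nat n * w))"
        unfolding e_of_nat_mult by (rule npow_summable) (use w in \<open>simp add: norm_e\<close>)
      have "cnj (D * (\<Sum>n. of_nat n ^ (2*k - 1) * e (of_nat n * w))) = D * (\<Sum>n. of_nat n ^ (2*k - 1) * cnj (e (of_nat n * w)))"
      proof -
        have "cnj (\<Sum>n. of_nat n ^ (2*k - 1) * e (of_nat n * w)) = (\<Sum>n. of_nat n ^ (2*k - 1) * cnj (e (of_nat n * w)))"
          using bounded_linear.suminf[OF bounded_linear_cnj s] by simp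
        thus ?thesis by (simp add: cD)
      qed
      also have "... = (\<Sum>n. D * (of_nat n ^ (2*k - 1) * cnj (e (of_nat n * w))))"
        by (rule suminf_mult[symmetric])
           (use bounded_linear.summable[OF bounded_linear_cnj s] in simp)
      also have "... = (?d d x)"
      proof -
       have ce: "cnj (e (of_nat n * w)) = cnj (e (of_nat n * z')) * exp (- 2 * pi * real n * y) * e (- (of_nat n * of_real x))" for n
      proof -
        have c1: "cnj (e u) = e (- cnj u)" for u by (simp add: e_def exp_cnj)
        have e1: "- cnj (of_nat n * w) = - cnj (of_nat n * z') + (of_nat n * (\<i> * of_real y)) + (- (of_nat n * of_real x))"
          by (simp add: w_def complex_eq_iff algebra_simps)
        have e3: "e (of_nat n * (\<i> * of_real y)) = of_real (exp (- 2 * pi * real n * y))"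
          by (simp add: e_def exp_of_real[symmetric] algebra_simps)
        show ?thesis unfolding c1 e1 e_add e3 by (rule refl)
       qed
       show ?thesis unfolding ce d_def by (simp add: mult_ac)
      qed
      finally show ?thesis .
    qed
    ultimately show "((\<lambda>b. cnj (?r x b)) has_sum (?d d x)) UNIV"
      by (simp add: wb)
  qed
  let ?g = "\<lambda>x. unf k F z' (Complex x y)"
  have gb: "?g (x + of_int b) = F (Complex x y) * of_real Y * cnj (?r x b)" for x b
    by (simp add: unf_def per Y_def mult_ac)
  have gsum: "(\<Sum>\<^sub>\<infinity>b::int. ?g (x + of_int b)) = of_real Y * (F (Complex x y) * (?d d x))" for x
    unfolding gb by (subst infsum_cmult_right') (use infsumI[OF lip] in simp)
  have gn: "(\<lambda>b::int. norm (?g (x + of_int b))) summable_on UNIV" for x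
    unfolding gb norm_mult by (intro summable_on_cmult_right lips)
  note P = integral_periodize[OF unf_integrable(2)[OF F z' k y] gn, unfolded gsum]
  have "(LBINT x. ?g x) = integral {0..1} (\<lambda>x. of_real Y * (F (Complex x y) * (?d d x)))"
    unfolding P(1) by (rule set_borel_integral_eq_integral(2)[OF P(2)])
  also have "... = of_real Y * (\<Sum>n. c n * d n)"
  proof (rule integral_unique, rule has_integral_mult_right)
    show "((\<lambda>x. F (Complex x y) * (?d d x)) has_integral (\<Sum>n. c n * d n)) {0..1}"
      using parseval[OF sc sd] by (simp add: fourier_Complex(1)[OF FF y] c_def)
  qed
  also have "... = (\<Sum>n. of_real Y * (c n * d n))"
  proof (rule suminf_mult[symmetric], rule summable_norm_cancel)
    obtain K where K: "\<And>n. norm (d n) \<le> K" using summable_imp_bounded[OF sd] by (auto simp: bounded_iff)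
    show "summable (\<lambda>n. norm (c n * d n))"
      by (rule summable_comparison_test'[OF summable_mult2[OF sc, of K]])
         (auto simp: norm_mult intro!: mult_left_mono K)
  qed
  also have "(\<lambda>n. of_real Y * (c n * d n)) = (\<lambda>n. D * ?a n * of_nat n ^ (2*k-1) * cnj (e (of_nat n * z'))
        * of_real (y ^ (2*k-2) * exp (- (4 * pi * real n) * y)))"
  proof
    fix n
    have "exp (- (4 * pi * real n) * y) = exp (- 2 * pi * real n * y) * exp (- 2 * pi * real n * y)"
      by (simp add: exp_add[symmetric])
    thus "of_real Y * (c n * d n) = D * ?a n * of_nat n ^ (2*k-1) * cnj (e (of_nat n * z'))
        * of_real (y ^ (2*k-2) * exp (- (4 * pi * real n) * y))"
      by (simp add: c_def d_def Y)
  qed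
  finally show ?thesis unfolding D_def .
qed

text \<open>Integrating the rows over \<open>y\<close> gives one gamma integral per coefficient.
  Since \<open>cnj (e (n z')) = e (n (- cnj z'))\<close>, what remains is the Fourier series of
  \<open>F\<close> at the reflected point.\<close>

lemma unf_integral:
  assumes F: "cusp_form (2*k) F" and z': "z' \<in> HH" and k: "k \<ge> 2"
  shows "(LINT z:HH|lborel. unf k F z' z) = kernel_const k * F (- cnj z')"
proof -
  let ?a = "fourier_coeff F"
  let ?U = "\<lambda>x y. indicator HH (Complex x y) *\<^sub>R unf k F z' (Complex x y)"
  let ?E = "\<lambda>n. fact (2*k-2) / (4 * pi * real n)^(2*k-1)"
  let ?c = "\<lambda>n. kernel_const k * (?a n * cnj (e (of_nat n * z')))"
  note FF = cusp_form_fourier[OF F]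
  define D where "D = (2 * of_real pi * \<i>)^(2*k) / (fact (2*k - 1) :: complex)"
  define A where "A n = D * ?a n * of_nat n ^ (2*k-1) * cnj (e (of_nat n * z'))" for n
  define E where "E n y = ipos y * (y ^ (2*k-2) * exp (- (4 * pi * real n) * y))" for n y
  define f where "f n y = A n * of_real (E n y)" for n y
  have A0: "A 0 = 0" using cusp_form_coeff_0[OF F] by (simp add: A_def)
  have E: "integrable lborel (E n)" "integral\<^sup>L lborel (E n) = ?E n" if "n > 0" for n
  proof -
    have En: "E n = (\<lambda>y. ipos y * (y ^ (2*k-2) * exp (- (4 * pi * real n) * y)))"
      by (simp add: E_def fun_eq_iff)
    have s: "Suc (2*k-2) = 2*k-1" using k by simp
    have c: "4 * pi * real n > 0" using that by simp
    show "integrable lborel (E n)" unfolding En by (rule integral_power_exp(1)[OF c])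
    show "integral\<^sup>L lborel (E n) = ?E n"
      unfolding En s[symmetric] by (rule integral_power_exp(2)[OF c])
  qed
  have fi: "integrable lborel (f n)" for n
  proof -
    have fn: "f n = (\<lambda>y. A n * of_real (E n y))" by (simp add: f_def fun_eq_iff)
    show ?thesis
    proof (cases "n = 0")
      case True
      hence "A n = 0" using A0 by simp
      thus ?thesis unfolding fn by simp
    next
      case False
      thus ?thesis unfolding fn by (intro integrable_mult_right integrable_of_real E(1)) simp
    qed
  qed
  have E0: "E n y \<ge> 0" for n y by (cases "y > 0") (simp_all add: E_def)
  have nf: "norm (f n y) = norm (A n) * E n y" for n y
    using E0 by (simp add: f_def norm_mult)
  have Ii: "(LBINT y. f n y) = A n * of_real (?E n)" for n
    using A0 E(2)[of n] by (cases "n = 0") (auto simp: f_def)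
  have Ai: "A n * of_real (?E n) = ?c n" for n
  proof (cases "n = 0")
    case True thus ?thesis using A0 cusp_form_coeff_0[OF F] by simp
  next
    case False
    thus ?thesis by (simp add: A_def D_def kernel_const_def power_mult_distrib field_simps)
  qed
  have cz: "cnj (e (of_nat n * z')) = e (of_nat n * (- cnj z'))" for n
    by (simp add: e_def exp_cnj)
  have zH: "- cnj z' \<in> HH" using z' by simp
  have ns: "summable (\<lambda>n. norm (?c n))"
    using summable_mult[OF fourier_abs_summable[OF FF, of "Im z'"], of "norm (kernel_const k)"] z'
    by (simp add: norm_mult norm_e mult_ac)
  have pt: "(\<lambda>n. norm (f n y)) summable_on UNIV" for y
  proof (cases "y > 0")
    case True
    define q where "q = exp (- (4 * pi) * y)"
    have "summable (\<lambda>n. norm (?c n) * (real n ^ (2*k-1) * q ^ n))"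
    proof -
      have "summable (\<lambda>n. real n ^ (2*k-1) * q ^ n)" by (rule npow_summable) (use True in \<open>simp add: q_def\<close>)
      from summable_imp_bounded[OF this] obtain K where K: "\<And>n. norm (real n ^ (2*k-1) * q ^ n) \<le> K"
        unfolding bounded_iff by blast
      show ?thesis
      proof (rule summable_comparison_test'[OF summable_mult2[OF ns, of K], of 0])
        fix n
        show "norm (norm (?c n) * (real n ^ (2*k-1) * q ^ n))
           \<le> norm (?c n) * K"
          using mult_left_mono[OF K[of n], of "norm (?c n)"]
          unfolding real_norm_def abs_mult by simp
      qed
    qed
    hence "summable (\<lambda>n. (norm D / norm (kernel_const k)) * y ^ (2*k-2) * (norm (?c n) * (real n ^ (2*k-1) * q ^ n)))"
      by (rule summable_mult)
    also have "(\<lambda>n. (norm D / norm (kernel_const k)) * y ^ (2*k-2) * (norm (?c n) * (real n ^ (2*k-1) * q ^ n)))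
       = (\<lambda>n. norm (f n y))"
    proof
      fix n
      have "norm (kernel_const k) \<noteq> 0" by (simp add: kernel_const_def)
      thus "(norm D / norm (kernel_const k)) * y ^ (2*k-2) * (norm (?c n) * (real n ^ (2*k-1) * q ^ n)) = norm (f n y)"
        using True unfolding nf by (simp add: A_def E_def q_def norm_mult norm_power exp_of_nat_mult[symmetric] mult_ac)
    qed
    finally show ?thesis by (simp add: summable_on_UNIV_nonneg_real_iff)
  next
    case False
    thus ?thesis by (simp add: f_def E_def)
  qed
  have Ni: "(LBINT y. norm (f n y)) = norm (?c n)" for n
  proof -
    have "(LBINT y. norm (f n y)) = norm (A n) * integral\<^sup>L lborel (E n)" unfolding nf by simp
    also have "... = norm (A n * of_real (?E n))"
      using A0 E(2)[of n] by (cases "n = 0") (auto simp: norm_mult norm_divide norm_power)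
    finally show ?thesis by (simp only: Ai)
  qed
  have row: "(LBINT x. ?U x y) = (\<Sum>\<^sub>\<infinity>n. f n y)" for y
  proof (cases "y > 0")
    case True
    have sf: "summable (\<lambda>n. norm (f n y))" using pt[of y] by (simp add: summable_on_UNIV_nonneg_real_iff)
    have "(LBINT x. ?U x y) = (LBINT x. unf k F z' (Complex x y))"
      using True by (simp add: indicator_def)
    also have "... = (\<Sum>n. f n y)"
      unfolding unf_row[OF F z' k True] using True by (simp add: f_def A_def E_def D_def)
    also have "... = (\<Sum>\<^sub>\<infinity>n. f n y)" by (rule infsum_suminf[OF sf, symmetric])
    finally show ?thesis .
  next
    case False
    thus ?thesis by (simp add: f_def E_def indicator_def)
  qed
  have "(LINT z:HH|lborel. unf k F z' z) = (LBINT y. (LBINT x. ?U x y))"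
    unfolding set_lebesgue_integral_def by (rule integral_complex_iterated[OF unf_integrable(1)[OF F z' k]])
  also have "... = (LBINT y. (\<Sum>\<^sub>\<infinity>n. f n y))" unfolding row ..
  also have "(LBINT y. (\<Sum>\<^sub>\<infinity>n. f n y)) = (\<Sum>n. LBINT y. f n y)"
  proof -
    have "((\<lambda>n. LBINT y. f n y) has_sum (LBINT y. (\<Sum>\<^sub>\<infinity>n. f n y))) UNIV"
      by (rule integral_infsum(2)[OF _ fi pt])
         (use ns in \<open>simp_all add: Ni summable_on_UNIV_nonneg_real_iff del: norm_mult\<close>)
    thus ?thesis using has_sum_imp_sums sums_unique by blast
  qed
  also have "... = (\<Sum>n. ?c n)" unfolding Ii Ai ..
  also have "... = kernel_const k * F (- cnj z')"
    unfolding cz using fourier_sums[OF FF zH] by (simp add: sums_iff suminf_mult)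
  finally show ?thesis .
qed

text \<open>The reproducing property of the kernel. Modularity of \<open>F\<close> turns each term
  of the product over the fundamental domain into a translate of \<open>unf\<close>, and unfolding
  collects them into one integral over the half-plane, counted twice.\<close>

theorem petersson_hform:
  assumes F: "cusp_form (2*k) F" and z': "z' \<in> HH" and k: "k \<ge> 5"
  shows "petersson (2*k) F (hform (2*k) 1 z') = 2 * kernel_const k * F (- cnj z')"
proof -
  let ?u = "\<lambda>M z. (1 / norm (mden M z) ^ 4) *\<^sub>R unf k F z' (mob M z)"
  let ?S = "\<lambda>(f::mat2 \<Rightarrow> complex \<Rightarrow> complex) z. \<Sum>\<^sub>\<infinity>M\<in>mats 1. f M z"
  let ?I = "\<lambda>z. Im z ^ (2*k) / (Im z)^2"
  have k2: "k \<ge> 2" using k by simp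
  have int: "set_integrable lborel HH (unf k F z')"
    using unf_integrable(1)[OF F z' k2] by (simp add: set_integrable_def)
  have intn: "set_integrable lborel HH (\<lambda>z. complex_of_real (norm (unf k F z' z)))"
  proof -
    have "integrable lborel (\<lambda>z. complex_of_real (norm (indicator HH z *\<^sub>R unf k F z' z)))"
      using unf_integrable(1)[OF F z' k2] by (intro integrable_of_real integrable_norm)
    also have "(\<lambda>z. complex_of_real (norm (indicator HH z *\<^sub>R unf k F z' z))) = (\<lambda>z. indicator HH z *\<^sub>R of_real (norm (unf k F z' z)))"
      by (auto simp: indicator_def)
    finally show ?thesis by (simp add: set_integrable_def)
  qed
  define t where "t M z = F z * cnj (1 / kern M z z' ^ (2*k)) * of_real (?I z)" for M z
  have tu: "?u M z = t M z" if M: "M \<in> mats 1" and z: "z \<in> HH" for M z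
  proof -
    have d0: "mden M z \<noteq> 0" using mden_nonzero[of M z] M z by simp
    define j where "j = mden M z"
    define N where "N = norm j"
    have j0: "j \<noteq> 0" and N0: "N > 0" using d0 by (auto simp: j_def N_def)
    have jj: "j * cnj j = of_real (N^2)" unfolding N_def by (rule complex_norm_square[symmetric])
    have jk: "j ^ (2*k) * cnj j ^ (2*k) = of_real (N^(4*k))"
      unfolding power_mult_distrib[symmetric] jj by (simp flip: power_mult)
    have kn: "z' + mob M z = kern M z z' / j"
      using kern_eq[of M z z'] M z j0 by (simp add: j_def)
    have im: "Im (mob M z) = Im z / N^2" using Im_mob[of M z] M z by (simp add: N_def j_def)
    have y: "Im z > 0" using z by simp
    have "Im (mob M z) ^ (2*k) / (Im (mob M z))^2 = ?I z * (N^4 / N^(4*k))"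
      unfolding im using y N0 by (simp add: power_divide field_simps flip: power_mult power_add)
    hence "unf k F z' (mob M z) = (j ^ (2*k) * F z) * cnj (j ^ (2*k) / kern M z z' ^ (2*k)) * of_real (?I z * (N^4 / N^(4*k)))"
      unfolding unf_def kn using cusp_form_mob[OF F, of M z] M z
      by (simp add: power_divide j_def del: of_real_mult of_real_divide of_real_power)
    also have "... = (j ^ (2*k) * cnj j ^ (2*k)) * t M z * of_real (N^4 / N^(4*k))"
      by (simp add: t_def mult_ac)
    also have "... = of_real (N^4) * t M z" unfolding jk using N0 by simp
    finally show ?thesis using N0 by (simp add: N_def j_def scaleR_conv_of_real)
  qed
  have nf: "complex_of_real ((1 / norm (mden M z) ^ 4) * norm (unf k F z' (mob M z))) = of_real (norm (t M z))" if M: "M \<in> mats 1" and z: "z \<in> HH" for M z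
    unfolding tu[OF M z, symmetric] by simp
  define f where "f M z = indicator F0 z *\<^sub>R t M z" for M z
  have fe: "f M z = indicator F0 z *\<^sub>R (?u M z)" if "M \<in> mats 1" for M z
    using tu[OF that, of z] F0_subset by (cases "z \<in> F0") (auto simp: f_def)
  have fi: "integrable lborel (f M)" if "M \<in> mats 1" for M
  proof -
    have "f M = (\<lambda>z. indicator F0 z *\<^sub>R (?u M z))"
      by (rule ext) (rule fe[OF that])
    thus ?thesis using unfolding_tiles(2)[OF int that] unfolding set_integrable_def by (simp only:)
  qed
  have fI: "(LBINT z. f M z) = (LINT z:F0|lborel. ?u M z)" if "M \<in> mats 1" for M
    using fe[OF that] by (simp add: set_lebesgue_integral_def)
  have s1: "((\<lambda>M. LBINT z. f M z) has_sum (2 * (LINT z:HH|lborel. unf k F z' z))) (mats 1)"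
    using unfolding_tiles(1)[OF int] by (subst has_sum_cong[OF fI])
  \<comment> \<open>Unfolding is applied a second time, to the norm of the integrand, to obtain the
    absolute summability that the interchange below needs.\<close>
  have ns: "(\<lambda>M. LBINT z. norm (f M z)) summable_on mats 1"
  proof -
    have "(\<lambda>M. (LINT z:F0|lborel. (1 / norm (mden M z) ^ 4) *\<^sub>R complex_of_real (norm (unf k F z' (mob M z))))) summable_on mats 1"
      using unfolding_tiles(1)[OF intn] by (rule has_sum_imp_summable)
    also have "?this \<longleftrightarrow> (\<lambda>M. complex_of_real (LBINT z. norm (f M z))) summable_on mats 1"
    proof (rule summable_on_cong)
      fix M assume M: "M \<in> mats 1"
      have "complex_of_real (LBINT z. norm (f M z)) = (LBINT z. complex_of_real (norm (f M z)))" by simp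
      also have "... = (LINT z:F0|lborel. (1 / norm (mden M z) ^ 4) *\<^sub>R complex_of_real (norm (unf k F z' (mob M z))))"
        unfolding set_lebesgue_integral_def
        by (rule Bochner_Integration.integral_cong) (auto simp: fe[OF M] indicator_def scaleR_conv_of_real norm_divide norm_power)
      finally show "(LINT z:F0|lborel. (1 / norm (mden M z) ^ 4) *\<^sub>R complex_of_real (norm (unf k F z' (mob M z)))) = complex_of_real (LBINT z. norm (f M z))" by simp
    qed
    finally have "(\<lambda>M. Re (complex_of_real (LBINT z. norm (f M z)))) summable_on mats 1" by (rule summable_on_Re)
    thus ?thesis by simp
  qed
  have pt: "(\<lambda>M. norm (f M z)) summable_on mats 1" for z
  proof (cases "z \<in> F0")
    case True
    have "(\<lambda>M. norm (1 / kern M z z' ^ (2*k))) summable_on mats 1"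
      by (rule kern_abs_summable) (use True F0_subset z' k in auto)
    hence "(\<lambda>M. norm (F z * of_real (?I z)) * norm (1 / kern M z z' ^ (2*k))) summable_on mats 1"
      by (rule summable_on_cmult_right)
    thus ?thesis using True by (simp add: f_def t_def norm_mult norm_divide norm_power mult_ac)
  qed (simp add: f_def)
  have "((\<lambda>M. LBINT z. f M z) has_sum (LBINT z. (?S f z))) (mats 1)"
    by (rule integral_infsum(2)[OF _ fi pt ns]) auto
  with s1 have e1: "(LBINT z. (?S f z)) = 2 * (LINT z:HH|lborel. unf k F z' z)"
    using has_sum_unique by blast
  let ?H = "\<lambda>z. F z * cnj (hform (2*k) 1 z' z) * of_real (?I z)"
  have sH: "(?S f z) = indicator F0 z *\<^sub>R ?H z" for z
  proof (cases "z \<in> F0")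
    case True
    have zH: "z \<in> HH" using True F0_subset by blast
    have "(?S f z) = (\<Sum>\<^sub>\<infinity>M\<in>mats 1. (F z * of_real (?I z)) * cnj (1 / kern M z z' ^ (2*k)))"
      using True by (intro infsum_cong) (simp add: f_def t_def mult_ac)
    also have "... = (F z * of_real (?I z)) * cnj (\<Sum>\<^sub>\<infinity>M\<in>mats 1. 1 / kern M z z' ^ (2*k))"
      by (subst infsum_cmult_right') (simp only: infsum_cnj)
    finally show ?thesis using True zH by (simp add: hker_def mult_ac)
  qed (simp add: f_def)
  have [measurable]: "F \<in> borel_measurable borel" "hform (2*k) 1 z' \<in> borel_measurable borel"
    using cusp_form_measurable[OF F] cusp_form_measurable[OF cusp_form_hform[OF z', of 1 "2*k"]] k by auto
  have mH: "?H \<in> borel_measurable borel" by measurable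
  have "petersson (2*k) F (hform (2*k) 1 z') = (LBINT z. indicator fundamental_domain z *\<^sub>R ?H z)"
    by (simp add: petersson_def set_lebesgue_integral_def)
  also have "... = (LBINT z. indicator F0 z *\<^sub>R ?H z)"
  proof (rule integral_cong_AE)
    show "AE z in lborel. indicator fundamental_domain z *\<^sub>R ?H z = indicator F0 z *\<^sub>R ?H z"
      by (rule AE_I'[OF null_fd_F0]) (use F0_subset in \<open>auto simp: indicator_def split: if_splits\<close>)
  qed (use mH in measurable)
  also have "... = 2 * (LINT z:HH|lborel. unf k F z' z)" using e1 unfolding sH .
  also have "... = 2 * kernel_const k * F (- cnj z')" by (simp add: unf_integral[OF F z' k2])
  finally show ?thesis .
qed

section \<open>Hecke operators\<close>

text \<open>Upper triangular representatives for the modular group acting from the left. The sign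
  \<open>s\<close> distinguishes two systems: \<open>s = 1\<close> matches the definition of the
  Hecke operator, and \<open>s = -1\<close> is the system that appears after the reflection
  \<open>u \<mapsto> - cnj u\<close>.\<close>

definition coset_rep :: "int \<Rightarrow> nat \<Rightarrow> nat \<times> nat \<Rightarrow> mat2" where
  "coset_rep s n = (\<lambda>(d, b). (int (n div d), s * int b, 0, int d))"

definition coset_idx :: "nat \<Rightarrow> (nat \<times> nat) set" where
  "coset_idx n = (SIGMA t:{d. d dvd n}. {..<t})"

lemma finite_coset_idx: "n > 0 \<Longrightarrow> finite (coset_idx n)"
  by (simp add: coset_idx_def)

text \<open>Hermite normal form. For existence, the first column divided by its gcd is completed to
  a unimodular matrix by Bezout, and a translation reduces the upper right entry. For uniqueness,
  the quotient of two unimodular factors is forced to be upper triangular with diagonal 1, and the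
  range of the remainder leaves only the identity.\<close>

lemma coset_bij:
  assumes n: "n > 0" and s: "s = 1 \<or> s = -1"
  shows "bij_betw (\<lambda>(j, M). mmul M (coset_rep s n j)) (coset_idx n \<times> mats 1) (mats (int n))"
proof (rule bij_betw_imageI)
  have pos: "g > 0" "n div g > 0" "n div g * g = n" if "(g, h) \<in> coset_idx n" for g h
    using that n by (auto simp: coset_idx_def dvd_div_eq_0_iff intro: Nat.gr0I)
  have det: "mdet (coset_rep s n j) = int n" if "j \<in> coset_idx n" for j
    using that pos by (cases j) (auto simp: coset_rep_def simp flip: of_nat_mult)
  show "inj_on (\<lambda>(j, M). mmul M (coset_rep s n j)) (coset_idx n \<times> mats 1)"
  proof (rule inj_onI)
    fix x y :: "(nat \<times> nat) \<times> mat2"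
    assume x: "x \<in> coset_idx n \<times> mats 1" and y: "y \<in> coset_idx n \<times> mats 1"
      and xy: "(case x of (j, M) \<Rightarrow> mmul M (coset_rep s n j)) = (case y of (j, M) \<Rightarrow> mmul M (coset_rep s n j))"
    obtain g h a b c d where xd: "x = ((g, h), (a, b, c, d))" by (metis surj_pair)
    obtain g' h' a' b' c' d' where yd: "y = ((g', h'), (a', b', c', d'))" by (metis surj_pair)
    have j: "(g, h) \<in> coset_idx n" "(g', h') \<in> coset_idx n"
      and M: "(a, b, c, d) \<in> mats 1" "(a', b', c', d') \<in> mats 1"
      and eq: "mmul (a, b, c, d) (coset_rep s n (g, h)) = mmul (a', b', c', d') (coset_rep s n (g', h'))"
      using x y xy unfolding xd yd by (auto simp del: mmul.simps)
    obtain p q r t where N: "mmul (madj (a', b', c', d')) (a, b, c, d) = (p, q, r, t)" by (metis prod_cases4)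
    have dN: "p * t - q * r = 1"
      using mdet_mmul[of "madj (a', b', c', d')" "(a, b, c, d)"] M unfolding N by (simp add: mult.commute)
    have "mmul (p, q, r, t) (coset_rep s n (g, h)) = mmul (madj (a', b', c', d')) (mmul (a', b', c', d') (coset_rep s n (g', h')))"
      unfolding N[symmetric] mmul_assoc eq ..
    also have "... = coset_rep s n (g', h')"
      using M by (simp only: mmul_assoc[symmetric] mmul_madj) simp
    finally have E: "p * int (n div g) = int (n div g')" "r * int (n div g) = 0"
        "p * (s * int h) + q * int g = s * int h'" "r * (s * int h) + t * int g = int g'"
      by (auto simp: coset_rep_def)
    have r0: "r = 0" using E(2) pos(2)[OF j(1)] by simp
    hence pt: "p * t = 1" using dN by simp
    have "p > 0" using E(1) pos(2)[OF j(1)] pos(2)[OF j(2)] by (metis of_nat_0_less_iff zero_less_mult_pos2)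
    hence p1: "p = 1" "t = 1" using pt by (auto simp: zmult_eq_1_iff)
    have g: "g = g'" using E(4) r0 p1 by simp
    have h: "h < g" "h' < g" using j g by (auto simp: coset_idx_def)
    have "q * int g = s * (int h' - int h)" using E(3) p1 by (simp add: algebra_simps)
    hence "s * (q * int g) = (s * s) * (int h' - int h)" by simp
    moreover have "s * s = 1" using s by auto
    ultimately have "int h' - int h = int g * (s * q)" by (simp add: mult_ac)
    hence "int g dvd int h' - int h" by simp
    moreover have "\<bar>int h' - int h\<bar> < int g" using h by linarith
    ultimately have "int h' - int h = 0" using dvd_imp_le_int[of "int h' - int h" "int g"] by linarith
    hence bb: "h = h'" by simp
    have "q = 0" using E(3) p1 bb pos(1)[OF j(1)] by simp
    hence "mmul (madj (a', b', c', d')) (a, b, c, d) = (1, 0, 0, 1)" using N p1 r0 by simp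
    hence "mmul (a', b', c', d') (mmul (madj (a', b', c', d')) (a, b, c, d)) = (a', b', c', d')"
      by simp
    hence "(a, b, c, d) = (a', b', c', d')"
      using M by (simp only: mmul_assoc[symmetric] mmul_madj) simp
    thus "x = y" using g bb by (simp add: xd yd)
  qed
  show "(\<lambda>(j, M). mmul M (coset_rep s n j)) ` (coset_idx n \<times> mats 1) = mats (int n)"
  proof (intro equalityI subsetI)
    fix P assume "P \<in> (\<lambda>(j, M). mmul M (coset_rep s n j)) ` (coset_idx n \<times> mats 1)"
    thus "P \<in> mats (int n)" using det by auto
  next
    fix P assume P: "P \<in> mats (int n)"
    obtain x y u v where Pd: "P = (x, y, u, v)" by (cases P)
    have dP: "x * v - y * u = int n" using P by (simp add: Pd)
    define \<alpha> where "\<alpha> = gcd x u"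
    have \<alpha>: "\<alpha> > 0" using dP n by (auto simp: \<alpha>_def)
    obtain a c where ac: "x = \<alpha> * a" "u = \<alpha> * c" unfolding \<alpha>_def by (meson dvdE gcd_dvd1 gcd_dvd2)
    have "gcd (\<alpha> * a) (\<alpha> * c) = \<alpha>" unfolding ac[symmetric] by (rule \<alpha>_def[symmetric])
    hence "\<alpha> * gcd a c = \<alpha>" using \<alpha> gcd_mult_distrib_int[of \<alpha> a c] by simp
    hence "gcd a c = 1" using \<alpha> by simp
    then obtain d b' where "a * d + c * b' = 1" using bezout_int[of a c] by (metis mult.commute)
    then obtain b where ad: "a * d - b * c = 1" by (metis add_uminus_conv_diff mult.commute mult_minus_left minus_minus)
    have n1: "\<alpha> * (a * v - c * y) = int n" using dP ac by (simp add: algebra_simps)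
    define g where "g = nat (a * v - c * y)"
    have "a * v - c * y > 0" using n1 \<alpha> n by (metis of_nat_0_less_iff zero_less_mult_pos)
    hence g: "int g = a * v - c * y" "g > 0" by (auto simp: g_def)
    have nd: "n = nat \<alpha> * g" using n1 g \<alpha> by (metis int_nat_eq nat_int nat_mult_distrib less_imp_le zero_less_imp_eq_int)
    have dv: "g dvd n" and n\<alpha>: "int (n div g) = \<alpha>" using nd g \<alpha> by auto
    define X where "X = d * y - b * v"
    define h where "h = nat ((s * X) mod int g)"
    have h: "int h = (s * X) mod int g" "h < g" using g by (auto simp: h_def nat_less_iff)
    \<comment> \<open>Division with remainder of \<open>s * X\<close> by \<open>g\<close>,
      multiplied back by \<open>s\<close>; it yields \<open>X = t * g + s * h\<close> with
      \<open>0 <= h < g\<close> for either sign.\<close>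
    define t where "t = s * ((s * X) div int g)"
    have ss: "s * s = 1" using s by auto
    have 1: "s * (s * X) = X" using ss by (simp only: mult.assoc[symmetric] mult_1)
    have "s * X = (s * X) div int g * int g + (s * X) mod int g" by (rule div_mult_mod_eq[symmetric])
    hence "s * (s * X) = s * ((s * X) div int g * int g + (s * X) mod int g)" by (rule arg_cong)
    hence X: "X = t * int g + s * int h" unfolding 1 h(1) t_def by (simp only: distrib_left mult.assoc)
    define M where "M = mmul (a, b, c, d) (1, t, 0, 1)"
    have dM: "mdet M = 1" using ad by (simp add: M_def algebra_simps)
    have 1: "mmul (1, t, 0, 1) (coset_rep s n (g, h)) = (\<alpha>, X, 0, int g)"
      unfolding coset_rep_def using n\<alpha> X by simp
    have "mmul M (coset_rep s n (g, h)) = mmul (a, b, c, d) (\<alpha>, X, 0, int g)"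
      unfolding M_def mmul_assoc 1 ..
    also have "... = (x, y, u, v)"
    proof -
      have "a * X + b * int g = (a * d - b * c) * y" unfolding X_def g by (simp add: algebra_simps)
      moreover have "c * X + d * int g = (a * d - b * c) * v" unfolding X_def g by (simp add: algebra_simps)
      ultimately show ?thesis using ac ad by (simp add: mult.commute)
    qed
    finally have "P = mmul M (coset_rep s n (g, h))" by (simp add: Pd)
    moreover have "(g, h) \<in> coset_idx n" using dv h by (simp add: coset_idx_def)
    ultimately show "P \<in> (\<lambda>(j, M). mmul M (coset_rep s n j)) ` (coset_idx n \<times> mats 1)"
      using dM by (intro image_eqI[of _ _ "((g, h), M)"]) auto
  qed
qed

lemma coset_rep_point_HH:
  "z \<in> HH \<Longrightarrow> d dvd n \<Longrightarrow> n > 0 \<Longrightarrow> (of_nat (n div d) * z + of_int x) / of_nat d \<in> HH"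
  by (auto simp: Im_divide_of_nat dvd_div_eq_0_iff intro!: divide_pos_pos mult_pos_pos intro: Nat.gr0I)

text \<open>Sorting the matrices of determinant \<open>n\<close> by cosets exhibits this kernel as
  the Hecke operator applied to the kernel of determinant 1 in its first variable, up to the factor
  \<open>n ^ (w - 1)\<close>, and with either sign of the translations.\<close>

lemma hker_cosets:
  assumes n: "n > 0" and s: "s = 1 \<or> s = -1" and z: "z \<in> HH" "z' \<in> HH" and w: "w \<ge> 8"
  shows "hker w (int n) z z' =
    (\<Sum>d | d dvd n. \<Sum>b<d. hker w 1 ((of_nat (n div d) * z + of_int (s * int b)) / of_nat d) z' / of_nat d ^ w)"
proof -
  let ?c = "\<lambda>d b. coset_rep s n (d, b)"
  let ?p = "\<lambda>d b. (of_nat (n div d) * z + of_int (s * int b)) / of_nat d"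
  have term_eq: "1 / kern (mmul M (?c d b)) z z' ^ w =
      1 / kern M (?p d b) z' ^ w / of_nat d ^ w"
    if "(d, b) \<in> coset_idx n" for M d b
  proof -
    have d: "d > 0" using that n by (auto simp: coset_idx_def intro: Nat.gr0I)
    have md: "mden (?c d b) z = of_nat d" by (simp add: coset_rep_def)
    have mo: "mob (?c d b) z = ?p d b"
      by (simp add: mob_def coset_rep_def)
    have "kern (mmul M (?c d b)) z z' = kern M (mob (?c d b) z) z' * of_nat d"
      using kern_mob[of "?c d b" z M z'] md d by simp
    thus ?thesis unfolding mo by (simp add: power_mult_distrib)
  qed
  let ?f = "\<lambda>M. 1 / kern M z z' ^ w"
  have sm: "?f summable_on mats (int n)" by (rule kern_summable) (use z n w in auto)
  have sm': "(\<lambda>(j, M). ?f (mmul M (coset_rep s n j))) summable_on (coset_idx n \<times> mats 1)"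
    using summable_on_reindex_bij_betw[OF coset_bij[OF n s], of ?f] sm by (simp add: case_prod_unfold)
  have "hker w (int n) z z' = (\<Sum>\<^sub>\<infinity>(j, M)\<in>coset_idx n \<times> mats 1. ?f (mmul M (coset_rep s n j)))"
    unfolding hker_def using infsum_reindex_bij_betw[OF coset_bij[OF n s], of ?f] by (simp add: case_prod_unfold)
  also have "... = (\<Sum>\<^sub>\<infinity>j\<in>coset_idx n. \<Sum>\<^sub>\<infinity>M\<in>mats 1. ?f (mmul M (coset_rep s n j)))"
    using infsum_Sigma'_banach[OF sm'] by simp
  also have "... = (\<Sum>j\<in>coset_idx n. \<Sum>\<^sub>\<infinity>M\<in>mats 1. ?f (mmul M (coset_rep s n j)))"
    by (rule infsum_finite[OF finite_coset_idx[OF n]])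
  also have "... = (\<Sum>(d, b)\<in>coset_idx n. hker w 1 (?p d b) z' / of_nat d ^ w)"
  proof (rule sum.cong, rule refl, clarify)
    fix d b assume j: "(d, b) \<in> coset_idx n"
    have "(\<Sum>\<^sub>\<infinity>M\<in>mats 1. ?f (mmul M (?c d b))) =
      (\<Sum>\<^sub>\<infinity>M\<in>mats 1. 1 / of_nat d ^ w * (1 / kern M (?p d b) z' ^ w))"
      by (rule infsum_cong) (subst term_eq[OF j], simp)
    also have "... = 1 / of_nat d ^ w * hker w 1 (?p d b) z'"
      unfolding hker_def by (rule infsum_cmult_right')
    finally show "(\<Sum>\<^sub>\<infinity>M\<in>mats 1. ?f (mmul M (?c d b))) =
       hker w 1 (?p d b) z' / of_nat d ^ w" by simp
  qed
  also have "... = (\<Sum>d | d dvd n. \<Sum>b<d. hker w 1 (?p d b) z' / of_nat d ^ w)"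
    unfolding coset_idx_def using n by (subst sum.Sigma) auto
  finally show ?thesis .
qed

lemma hecke_operator_outside:
  assumes "\<And>z. z \<notin> HH \<Longrightarrow> F z = 0" "z \<notin> HH" "n > 0"
  shows "hecke_operator w n F z = 0"
proof -
  have "F ((of_nat (n div d) * z + of_nat b) / of_nat d) = 0" if "d dvd n" for d b
  proof -
    have "d > 0" using that assms by (auto intro: Nat.gr0I)
    hence "(of_nat (n div d) * z + of_nat b) / of_nat d \<notin> HH"
      using assms(2) by (auto simp: Im_divide_of_nat zero_less_divide_iff zero_less_mult_iff not_less)
    thus ?thesis by (rule assms(1))
  qed
  thus ?thesis by (simp add: hecke_operator_def)
qed

lemma hecke_operator_hform:
  assumes n: "n > 0" and z': "z' \<in> HH" and w: "w \<ge> 8"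
  shows "hecke_operator w n (hform w 1 z') = (\<lambda>z. of_nat n powi (int w - 1) * hform w (int n) z' z)"
proof
  fix z
  show "hecke_operator w n (hform w 1 z') z = of_nat n powi (int w - 1) * hform w (int n) z' z"
  proof (cases "z \<in> HH")
    case True
    have "hform w 1 z' ((of_nat (n div d) * z + of_nat b) / of_nat d) =
       hker w 1 ((of_nat (n div d) * z + of_int (1 * int b)) / of_nat d) z'" if "d dvd n" for d b
      using coset_rep_point_HH[OF True that n, of "int b"] by (simp add: hform_def)
    thus ?thesis using True hker_cosets[OF n _ True z' w, of 1] by (simp add: hecke_operator_def)
  next
    case False
    thus ?thesis using hecke_operator_outside[of "hform w 1 z'" z n w] n by (simp add: hform_def)
  qed
qed

section \<open>Linear structure of cusp forms and Hecke operators on Fourier coefficients\<close>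

lemma fourier_expansion_add:
  assumes "has_fourier_expansion f a" "has_fourier_expansion g b"
  shows "has_fourier_expansion (\<lambda>z. f z + g z) (\<lambda>n. a n + b n)"
  using assms unfolding has_fourier_expansion_def by (auto simp: ring_distribs intro!: sums_add)

lemma fourier_expansion_scale:
  assumes "has_fourier_expansion f a"
  shows "has_fourier_expansion (\<lambda>z. c * f z) (\<lambda>n. c * a n)"
  using assms unfolding has_fourier_expansion_def by (auto simp: mult.assoc intro!: sums_mult)

lemma cusp_form_add:
  assumes f: "cusp_form w f" and g: "cusp_form w g"
  shows "cusp_form w (\<lambda>z. f z + g z)" "fourier_coeff (\<lambda>z. f z + g z) n = fourier_coeff f n + fourier_coeff g n"
proof -
  have F: "has_fourier_expansion (\<lambda>z. f z + g z) (\<lambda>n. fourier_coeff f n + fourier_coeff g n)"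
    by (intro fourier_expansion_add cusp_form_fourier[OF f] cusp_form_fourier[OF g])
  thus "fourier_coeff (\<lambda>z. f z + g z) n = fourier_coeff f n + fourier_coeff g n"
    by (simp add: fourier_coeff_eq)
  show "cusp_form w (\<lambda>z. f z + g z)"
    unfolding cusp_form_def
  proof (intro conjI allI impI ballI exI)
    show "(\<lambda>z. f z + g z) holomorphic_on HH"
      by (intro holomorphic_intros cusp_form_holomorphic[OF f] cusp_form_holomorphic[OF g])
    show "has_fourier_expansion (\<lambda>z. f z + g z) (\<lambda>n. fourier_coeff f n + fourier_coeff g n)" by (rule F)
    show "fourier_coeff f 0 + fourier_coeff g 0 = 0"
      using cusp_form_coeff_0[OF f] cusp_form_coeff_0[OF g] by simp
  qed (use f g in \<open>auto simp: cusp_form_def ring_distribs\<close>)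
qed

lemma cusp_form_scale:
  assumes f: "cusp_form w f"
  shows "cusp_form w (\<lambda>z. c * f z)" "fourier_coeff (\<lambda>z. c * f z) n = c * fourier_coeff f n"
proof -
  have F: "has_fourier_expansion (\<lambda>z. c * f z) (\<lambda>n. c * fourier_coeff f n)"
    by (intro fourier_expansion_scale cusp_form_fourier[OF f])
  thus "fourier_coeff (\<lambda>z. c * f z) n = c * fourier_coeff f n"
    by (simp add: fourier_coeff_eq)
  show "cusp_form w (\<lambda>z. c * f z)"
    unfolding cusp_form_def
  proof (intro conjI allI impI ballI exI)
    show "(\<lambda>z. c * f z) holomorphic_on HH"
      by (intro holomorphic_intros cusp_form_holomorphic[OF f])
    show "has_fourier_expansion (\<lambda>z. c * f z) (\<lambda>n. c * fourier_coeff f n)" by (rule F)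
    show "c * fourier_coeff f 0 = 0" using cusp_form_coeff_0[OF f] by simp
  qed (use f in \<open>auto simp: cusp_form_def\<close>)
qed

lemma cusp_form_zero: "cusp_form w (\<lambda>_. 0)"
  unfolding cusp_form_def has_fourier_expansion_def by (auto intro!: exI[of _ "\<lambda>_. 0"])

lemma cusp_form_eqI:
  assumes f: "cusp_form w f" and g: "cusp_form w g" and eq: "\<And>n. fourier_coeff f n = fourier_coeff g n"
  shows "f = g"
proof
  fix z
  show "f z = g z"
  proof (cases "z \<in> HH")
    case True
    have "(\<lambda>n. fourier_coeff f n * e (of_nat n * z)) sums f z"
      by (rule fourier_sums[OF cusp_form_fourier[OF f] True])
    moreover have "(\<lambda>n. fourier_coeff f n * e (of_nat n * z)) sums g z"
      unfolding eq by (rule fourier_sums[OF cusp_form_fourier[OF g] True])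
    ultimately show ?thesis by (rule sums_unique2)
  qed (use cusp_form_outside[OF f] cusp_form_outside[OF g] in auto)
qed

lemma sum_e_roots:
  assumes "\<delta> > 0"
  shows "(\<Sum>b<\<delta>. e (of_nat (m * b) / of_nat \<delta>)) = (if \<delta> dvd m then of_nat \<delta> else 0)"
proof -
  define q where "q = e (of_nat m / of_nat \<delta>)"
  have eq: "e (of_nat (m * b) / of_nat \<delta>) = q ^ b" for b
    by (simp add: q_def e_of_nat_mult[symmetric] mult_ac)
  have q\<delta>: "q ^ \<delta> = 1" unfolding q_def e_of_nat_mult[symmetric] using assms by simp
  show ?thesis
  proof (cases "\<delta> dvd m")
    case True
    then obtain j where "m = \<delta> * j" by auto
    hence "q = 1" using assms by (simp add: q_def)
    thus ?thesis using True unfolding eq by simp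
  next
    case False
    have "q \<noteq> 1"
    proof
      assume "q = 1"
      hence "e (of_nat m / of_nat \<delta>) = e 0" by (simp add: q_def)
      then obtain j :: int where "of_nat m / of_nat \<delta> = 0 + (of_int j :: complex)" unfolding e_eq_iff by auto
      hence "of_int (int m) = (of_int (j * int \<delta>) :: complex)" using assms by (simp add: field_simps)
      hence "int m = j * int \<delta>" by (simp only: of_int_eq_iff)
      hence "int \<delta> dvd int m" by simp
      thus False using False by simp
    qed
    thus ?thesis using False sum_gp_strict[of q \<delta>] q\<delta> unfolding eq by simp
  qed
qed

definition hecke_seq :: "nat \<Rightarrow> nat \<Rightarrow> (nat \<Rightarrow> complex) \<Rightarrow> nat \<Rightarrow> complex" where
  "hecke_seq w n a m = (\<Sum>d | d dvd n \<and> d dvd m. of_nat d ^ (w - 1) * a ((n div d) * (m div d)))"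

text \<open>For fixed \<open>\<delta>\<close> the sum over shifts is a sum of roots of unity and
  keeps only the coefficients whose index is a multiple \<open>\<delta> * r\<close>; these land at
  the exponent \<open>\<alpha> * r\<close> with \<open>\<alpha> = n div \<delta>\<close>. Replacing
  \<open>\<delta>\<close> by the complementary divisor gives \<open>hecke_seq\<close>.\<close>

lemma fourier_hecke:
  assumes F: "has_fourier_expansion F a" and n: "n > 0" and w: "w \<ge> 1"
  shows "has_fourier_expansion (hecke_operator w n F) (hecke_seq w n a)"
  unfolding has_fourier_expansion_def
proof
  fix z assume z: "z \<in> HH"
  define D where "D = {d. d dvd n}"
  let ?w = "\<lambda>\<alpha> \<beta> \<delta>. (of_nat \<alpha> * z + of_nat \<beta>) / of_nat \<delta>"
  have fD: "finite D" using n by (simp add: D_def)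
  have pos: "\<delta> > 0" "n div \<delta> > 0" "n div \<delta> * \<delta> = n" "n div (n div \<delta>) = \<delta>" if "\<delta> \<in> D" for \<delta>
    using that n by (auto simp: D_def dvd_div_eq_0_iff intro: Nat.gr0I)
  define X where "X \<delta> = (\<Sum>\<beta><\<delta>. F ((of_nat (n div \<delta>) * z + of_nat \<beta>) / of_nat \<delta>))" for \<delta>
  define c where "c \<alpha> m = (if \<alpha> dvd m then of_nat \<alpha> ^ (w - 1) * a ((n div \<alpha>) * (m div \<alpha>)) else 0)" for \<alpha> m
  have S: "(\<lambda>m. c (n div \<delta>) m * e (of_nat m * z)) sums (of_nat n ^ (w - 1) * (X \<delta> / of_nat \<delta> ^ w))" if \<delta>: "\<delta> \<in> D" for \<delta>
  proof -
    define \<alpha> where "\<alpha> = n div \<delta>"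
    note p = pos[OF \<delta>, folded \<alpha>_def]
    have "(\<lambda>m. \<Sum>\<beta><\<delta>. a m * e (of_nat m * (?w \<alpha> \<beta> \<delta>))) sums X \<delta>"
      unfolding X_def \<alpha>_def[symmetric]
    proof (intro sums_sum)
      fix \<beta>
      have "(of_nat (n div \<delta>) * z + of_int (int \<beta>)) / of_nat \<delta> \<in> HH"
        by (rule coset_rep_point_HH[OF z _ n]) (use \<delta> in \<open>simp add: D_def\<close>)
      from fourier_sums[OF F this]
      show "(\<lambda>m. a m * e (of_nat m * (?w \<alpha> \<beta> \<delta>))) sums F (?w \<alpha> \<beta> \<delta>)"
        by (simp add: \<alpha>_def)
    qed
    also have "(\<lambda>m. \<Sum>\<beta><\<delta>. a m * e (of_nat m * (?w \<alpha> \<beta> \<delta>)))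
       = (\<lambda>m. if \<delta> dvd m then of_nat \<delta> * a m * e (of_nat (\<alpha> * (m div \<delta>)) * z) else 0)"
    proof
      fix m
      have "e (of_nat m * (?w \<alpha> \<beta> \<delta>)) = e (of_nat (m * \<alpha>) / of_nat \<delta> * z) * e (of_nat (m * \<beta>) / of_nat \<delta>)" for \<beta>
        by (simp add: e_add[symmetric] add_divide_distrib algebra_simps)
      hence "(\<Sum>\<beta><\<delta>. a m * e (of_nat m * (?w \<alpha> \<beta> \<delta>)))
          = a m * e (of_nat (m * \<alpha>) / of_nat \<delta> * z) * (\<Sum>\<beta><\<delta>. e (of_nat (m * \<beta>) / of_nat \<delta>))"
        by (simp add: sum_distrib_left mult.assoc)
      also have "... = (if \<delta> dvd m then of_nat \<delta> * a m * e (of_nat (\<alpha> * (m div \<delta>)) * z) else 0)"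
      proof (cases "\<delta> dvd m")
        case True
        then obtain j where "m = \<delta> * j" by auto
        thus ?thesis using p sum_e_roots[OF p(1), of m] by (simp add: mult_ac)
      next
        case False
        thus ?thesis using sum_e_roots[OF p(1), of m] by simp
      qed
      finally show "(\<Sum>\<beta><\<delta>. a m * e (of_nat m * (?w \<alpha> \<beta> \<delta>)))
         = (if \<delta> dvd m then of_nat \<delta> * a m * e (of_nat (\<alpha> * (m div \<delta>)) * z) else 0)" .
    qed
    finally have "(\<lambda>m. if \<delta> dvd m then of_nat \<delta> * a m * e (of_nat (\<alpha> * (m div \<delta>)) * z) else 0) sums X \<delta>" .
    hence "(\<lambda>r. (if \<delta> dvd (\<delta> * r) then of_nat \<delta> * a (\<delta> * r) * e (of_nat (\<alpha> * ((\<delta> * r) div \<delta>)) * z) else 0)) sums X \<delta>"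
      by (subst sums_mono_reindex[where g = "\<lambda>r. \<delta> * r" and f = "\<lambda>m. if \<delta> dvd m then of_nat \<delta> * a m * e (of_nat (\<alpha> * (m div \<delta>)) * z) else 0"])
         (use p in \<open>auto simp: strict_mono_def\<close>)
    hence "(\<lambda>r. of_nat \<delta> * a (\<delta> * r) * e (of_nat (\<alpha> * r) * z)) sums X \<delta>" using p by simp
    hence sX: "(\<lambda>r. of_nat n ^ (w - 1) / of_nat \<delta> ^ w * (of_nat \<delta> * a (\<delta> * r) * e (of_nat (\<alpha> * r) * z))) sums (of_nat n ^ (w - 1) / of_nat \<delta> ^ w * X \<delta>)"
      by (rule sums_mult)
    have "of_nat n ^ (w - 1) / of_nat \<delta> ^ w * of_nat \<delta> = (of_nat \<alpha> ^ (w - 1) :: complex)"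
    proof -
      have "of_nat n ^ (w - 1) = (of_nat \<alpha> ^ (w - 1) * of_nat \<delta> ^ (w - 1) :: complex)"
        using p(3) by (metis of_nat_mult power_mult_distrib)
      moreover have "of_nat \<delta> ^ w = (of_nat \<delta> ^ (w - 1) * of_nat \<delta> :: complex)" using w by (cases w) auto
      ultimately show ?thesis using p(1) by simp
    qed
    hence eq2: "of_nat n ^ (w - 1) / of_nat \<delta> ^ w * (of_nat \<delta> * x) = of_nat \<alpha> ^ (w - 1) * x" for x :: complex
      by (metis mult.assoc)
    have "of_nat n ^ (w - 1) / of_nat \<delta> ^ w * X \<delta> = of_nat n ^ (w - 1) * (X \<delta> / of_nat \<delta> ^ w)" by simp
    with sX have "(\<lambda>r. of_nat \<alpha> ^ (w - 1) * a (\<delta> * r) * e (of_nat (\<alpha> * r) * z)) sums (of_nat n ^ (w - 1) * (X \<delta> / of_nat \<delta> ^ w))"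
      by (simp only: mult.assoc eq2)
    hence "(\<lambda>r. c \<alpha> (\<alpha> * r) * e (of_nat (\<alpha> * r) * z)) sums (of_nat n ^ (w - 1) * (X \<delta> / of_nat \<delta> ^ w))"
      using p by (simp add: c_def)
    thus ?thesis unfolding \<alpha>_def[symmetric]
      by (subst (asm) sums_mono_reindex[where g = "\<lambda>r. \<alpha> * r" and f = "\<lambda>m. c \<alpha> m * e (of_nat m * z)"])
         (use p in \<open>auto simp: strict_mono_def c_def\<close>)
  qed
  have "(\<lambda>m. \<Sum>\<delta>\<in>D. c (n div \<delta>) m * e (of_nat m * z)) sums (\<Sum>\<delta>\<in>D. of_nat n ^ (w - 1) * (X \<delta> / of_nat \<delta> ^ w))"
    by (intro sums_sum S)
  also have "(\<Sum>\<delta>\<in>D. of_nat n ^ (w - 1) * (X \<delta> / of_nat \<delta> ^ w)) = hecke_operator w n F z"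
  proof -
    have "(of_nat n :: complex) powi (int w - 1) = of_nat n ^ (w - 1)"
      using w by (metis of_nat_1 of_nat_diff power_int_of_nat)
    thus ?thesis
      by (simp add: hecke_operator_def X_def D_def sum_distrib_left sum_divide_distrib)
  qed
  also have "(\<lambda>m. \<Sum>\<delta>\<in>D. c (n div \<delta>) m * e (of_nat m * z)) = (\<lambda>m. hecke_seq w n a m * e (of_nat m * z))"
  proof
    fix m
    have "(\<Sum>\<delta>\<in>D. c (n div \<delta>) m) = (\<Sum>\<alpha>\<in>D. c \<alpha> m)"
      by (rule sum.reindex_bij_witness[of _ "\<lambda>\<delta>. n div \<delta>" "\<lambda>\<delta>. n div \<delta>"]) (use pos n in \<open>auto simp: D_def\<close>)
    also have "... = (\<Sum>\<alpha>\<in>{\<alpha>. \<alpha> dvd n \<and> \<alpha> dvd m}. of_nat \<alpha> ^ (w - 1) * a ((n div \<alpha>) * (m div \<alpha>)))"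
      using fD by (intro sum.mono_neutral_cong_right) (auto simp: D_def c_def)
    finally show "(\<Sum>\<delta>\<in>D. c (n div \<delta>) m * e (of_nat m * z)) = hecke_seq w n a m * e (of_nat m * z)"
      by (simp add: hecke_seq_def sum_distrib_right[symmetric])
  qed
  finally show "(\<lambda>m. hecke_seq w n a m * e (of_nat m * z)) sums hecke_operator w n F z" .
qed

lemma hecke_seq_0: "a 0 = 0 \<Longrightarrow> hecke_seq w n a 0 = 0"
  by (simp add: hecke_seq_def)

lemma hecke_seq_1: "n > 0 \<Longrightarrow> hecke_seq w n a 1 = a n"
proof -
  have "{d. d dvd n \<and> d dvd 1} = {1::nat}" by auto
  thus ?thesis by (simp add: hecke_seq_def)
qed

text \<open>The bijection between the pairs of divisors that occur in \<open>T_m T_n\<close> and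
  those in \<open>T_n T_m\<close>. With \<open>e' = g * e1\<close> and \<open>d = hh * d1\<close>,
  where \<open>hh\<close> is the gcd of \<open>n div e'\<close> and \<open>d\<close>, the new pair
  is \<open>(e1 * hh, g * d1)\<close>; the product of the two entries is kept.\<close>

definition swap_pair :: "nat \<Rightarrow> nat \<Rightarrow> nat \<times> nat \<Rightarrow> nat \<times> nat" where
  "swap_pair m n = (\<lambda>(d, e'). let g = gcd e' (m div d); D = d * e' div g; d' = gcd (n div g) D in (d', g * D div d'))"

definition hecke_pairs :: "nat \<Rightarrow> nat \<Rightarrow> nat \<Rightarrow> (nat \<times> nat) set" where
  "hecke_pairs m n r = {(d, e'). d dvd m \<and> d dvd r \<and> e' dvd n \<and> e' dvd (m div d) * (r div d)}"

text \<open>All numbers are factored into pieces: \<open>m = hh d1 g a1\<close>,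
  \<open>n = g e1 hh b1\<close>, \<open>r = hh d1 e1 r1\<close>, with \<open>e1, a1\<close> coprime
  and \<open>b1, d1\<close> coprime. The divisibilities are then visible, and coprimality lets the
  reverse map recover the same gcds.\<close>

lemma swap_pair_involution:
  assumes P: "(d, e') \<in> hecke_pairs m n r" and pos: "m > 0" "n > 0" "r > 0"
  shows "swap_pair m n (d, e') \<in> hecke_pairs n m r"
    and "swap_pair n m (swap_pair m n (d, e')) = (d, e')"
    and "fst (swap_pair m n (d, e')) * snd (swap_pair m n (d, e')) = d * e'"
proof -
  have h: "d dvd m" "d dvd r" "e' dvd n" "e' dvd (m div d) * (r div d)" using P by (auto simp: hecke_pairs_def)
  have d0: "d > 0" and e0: "e' > 0" using h pos by (auto intro: Nat.gr0I)
  obtain a where a: "m = d * a" using h by auto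
  obtain s where s: "r = d * s" using h by auto
  have a0: "a > 0" using a pos by (auto intro: Nat.gr0I)
  have md: "m div d = a" "r div d = s" using a s d0 by auto
  define g where "g = gcd e' a"
  have g0: "g > 0" using e0 by (simp add: g_def)
  obtain e1 a1 where e1: "e' = g * e1" and a1: "a = g * a1" unfolding g_def by (meson dvdE gcd_dvd1 gcd_dvd2)
  have "gcd (g * e1) (g * a1) = g" unfolding e1[symmetric] a1[symmetric] by (rule g_def[symmetric])
  hence cop1: "gcd e1 a1 = 1" using g0 by (simp add: gcd_mult_distrib_nat[symmetric])
  have e10: "e1 > 0" using e1 e0 by (auto intro: Nat.gr0I)
  have "g * e1 dvd g * a1 * s" using h(4) md e1 a1 by simp
  hence "e1 dvd a1 * s" using g0 by (simp add: mult.assoc)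
  hence "e1 dvd s" using cop1 by (simp add: coprime_dvd_mult_right_iff coprime_iff_gcd_eq_1)
  then obtain r1 where r1: "s = e1 * r1" by auto
  obtain b where b: "n = e' * b" using h by auto
  have b0: "b > 0" using b pos by (auto intro: Nat.gr0I)
  define hh where "hh = gcd b d"
  have hh0: "hh > 0" using b0 by (simp add: hh_def)
  obtain b1 d1 where b1: "b = hh * b1" and d1: "d = hh * d1" unfolding hh_def by (meson dvdE gcd_dvd1 gcd_dvd2)
  have "gcd (hh * b1) (hh * d1) = hh" unfolding b1[symmetric] d1[symmetric] by (rule hh_def[symmetric])
  hence cop2: "gcd b1 d1 = 1" using hh0 by (simp add: gcd_mult_distrib_nat[symmetric])
  have D: "d * e' div g = d * e1" using e1 g0 by simp
  have ng: "n div g = e1 * b" using b e1 g0 by (simp add: mult.assoc)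
  have d': "gcd (n div g) (d * e1) = e1 * hh"
  proof -
    have "gcd (e1 * b) (e1 * d) = e1 * gcd b d" by (simp add: gcd_mult_distrib_nat)
    thus ?thesis unfolding ng hh_def by (simp add: mult.commute)
  qed
  have e'': "g * (d * e1) div (e1 * hh) = g * d1"
  proof -
    have "g * (d * e1) = (g * d1) * (e1 * hh)" using d1 by simp
    thus ?thesis using e10 hh0 by (simp only: nonzero_mult_div_cancel_right) simp
  qed
  have sw: "swap_pair m n (d, e') = (e1 * hh, g * d1)"
    unfolding swap_pair_def by (simp only: case_prod_conv Let_def md g_def[symmetric] D d' e'')
  have mm: "m = hh * d1 * (g * a1)" using a a1 d1 by simp
  have nn: "n = g * e1 * (hh * b1)" using b b1 e1 by simp
  have rr: "r = hh * d1 * (e1 * r1)" using s r1 d1 by simp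
  have nd': "n div (e1 * hh) = g * b1"
  proof -
    have "n = (g * b1) * (e1 * hh)" using nn by simp
    thus ?thesis using e10 hh0 by (simp only: nonzero_mult_div_cancel_right) simp
  qed
  have rd': "r div (e1 * hh) = d1 * r1"
  proof -
    have "r = (d1 * r1) * (e1 * hh)" using rr by simp
    thus ?thesis using e10 hh0 by (simp only: nonzero_mult_div_cancel_right) simp
  qed
  show "swap_pair m n (d, e') \<in> hecke_pairs n m r"
  proof -
    have "e1 * hh dvd n" "e1 * hh dvd r" "g * d1 dvd m"
      by (auto simp: nn rr mm dvd_def intro: exI[of _ "g * b1"] exI[of _ "d1 * r1"] exI[of _ "hh * a1"])
    moreover have "g * d1 dvd (n div (e1 * hh)) * (r div (e1 * hh))"
      unfolding nd' rd' by simp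
    ultimately show ?thesis unfolding sw hecke_pairs_def by simp
  qed
  show "fst (swap_pair m n (d, e')) * snd (swap_pair m n (d, e')) = d * e'"
    unfolding sw by (simp add: d1 e1)
  show "swap_pair n m (swap_pair m n (d, e')) = (d, e')"
  proof -
    have g': "gcd (g * d1) (n div (e1 * hh)) = g"
      unfolding nd' using cop2 by (simp add: gcd_mult_distrib_nat[symmetric] gcd.commute)
    have D': "e1 * hh * (g * d1) div g = d * e1" using g0 d1 by simp
    have mg: "m div g = d * a1" using a a1 g0 by simp
    have d'': "gcd (m div g) (d * e1) = d"
      unfolding mg using cop1 by (simp add: gcd_mult_distrib_nat[symmetric] gcd.commute)
    have "g * (d * e1) div d = e'" using d0 e1 by simp
    thus ?thesis unfolding sw unfolding swap_pair_def
      by (simp only: case_prod_conv Let_def g' D' d'')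
  qed
qed

text \<open>After expansion a summand depends only on the product of the two divisors, through
  \<open>a (m n r / (d e')^2)\<close> and the weight \<open>(d e') ^ (w - 1)\<close>. A bijection of
  the index sets that keeps this product is therefore enough, for arbitrary coefficient
  sequences.\<close>

lemma hecke_seq_commute:
  assumes pos: "m > 0" "n > 0" and a0: "a 0 = 0"
  shows "hecke_seq w m (hecke_seq w n a) r = hecke_seq w n (hecke_seq w m a) r"
proof (cases "r = 0")
  case True
  thus ?thesis using a0 by (simp add: hecke_seq_0)
next
  case False
  hence r: "r > 0" by simp
  have expand: "hecke_seq w m (hecke_seq w n a) r =
      (\<Sum>(d, e')\<in>hecke_pairs m n r. of_nat (d * e') ^ (w - 1) * a (m * n * r div (d * e')^2))"
    if pos: "m > 0" "n > 0" for m n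
  proof -
    have "hecke_seq w m (hecke_seq w n a) r = (\<Sum>d | d dvd m \<and> d dvd r. \<Sum>e' | e' dvd n \<and> e' dvd (m div d) * (r div d).
         of_nat d ^ (w - 1) * (of_nat e' ^ (w - 1) * a ((n div e') * ((m div d) * (r div d) div e'))))"
      unfolding hecke_seq_def by (simp add: sum_distrib_left)
    also have "... = (\<Sum>(d, e')\<in>(SIGMA d:{d. d dvd m \<and> d dvd r}. {e'. e' dvd n \<and> e' dvd (m div d) * (r div d)}).
         of_nat d ^ (w - 1) * (of_nat e' ^ (w - 1) * a ((n div e') * ((m div d) * (r div d) div e'))))"
      using pos by (subst sum.Sigma) auto
    also have "... = (\<Sum>(d, e')\<in>hecke_pairs m n r. of_nat (d * e') ^ (w - 1) * a (m * n * r div (d * e')^2))"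
    proof (rule sum.cong)
      show "(SIGMA d:{d. d dvd m \<and> d dvd r}. {e'. e' dvd n \<and> e' dvd (m div d) * (r div d)}) = hecke_pairs m n r"
        by (auto simp: hecke_pairs_def)
    next
      fix x assume x: "x \<in> hecke_pairs m n r"
      obtain d e' where de: "x = (d, e')" by (cases x)
      have h: "d dvd m" "d dvd r" "e' dvd n" "e' dvd (m div d) * (r div d)" using x by (auto simp: de hecke_pairs_def)
      obtain a' where o1: "m = d * a'" using h(1) by blast
      obtain s where o2: "r = d * s" using h(2) by blast
      obtain b where o3: "n = e' * b" using h(3) by blast
      note o = o1 o2 o3
      have d0: "d > 0" "e' > 0" using o pos by (auto intro: Nat.gr0I)
      obtain u where u: "a' * s = e' * u" using h o d0 by auto
      have "m * n * r = (a' * s) * (d * d) * (e' * b)" using o by simp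
      also have "... = (b * u) * (d * e')^2" unfolding u by (simp add: power2_eq_square)
      finally have "m * n * r div (d * e')^2 = b * u" using d0 by simp
      moreover have "(n div e') * ((m div d) * (r div d) div e') = b * u" using o d0 u by simp
      ultimately show "(case x of (d, e') \<Rightarrow> of_nat d ^ (w - 1) * (of_nat e' ^ (w - 1) * a ((n div e') * ((m div d) * (r div d) div e')))) =
        (case x of (d, e') \<Rightarrow> of_nat (d * e') ^ (w - 1) * a (m * n * r div (d * e')^2))"
        unfolding de case_prod_conv by (simp only:) (simp add: power_mult_distrib)
    qed
    finally show ?thesis .
  qed
  show ?thesis
    unfolding expand[OF pos] expand[OF pos(2,1)]
  proof (rule sum.reindex_bij_witness[of _ "swap_pair n m" "swap_pair m n"])
    fix x assume x: "x \<in> hecke_pairs m n r"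
    obtain d e' where de: "x = (d, e')" by (cases x)
    note S = swap_pair_involution[OF x[unfolded de] pos r]
    show "swap_pair n m (swap_pair m n x) = x" "swap_pair m n x \<in> hecke_pairs n m r"
      using S by (simp_all add: de)
    show "(case swap_pair m n x of (d, e') \<Rightarrow> of_nat (d * e') ^ (w - 1) * a (n * m * r div (d * e')^2)) =
        (case x of (d, e') \<Rightarrow> of_nat (d * e') ^ (w - 1) * a (m * n * r div (d * e')^2))"
      using S(3) by (simp add: de case_prod_unfold mult.commute[of n m] del: of_nat_mult)
  next
    fix x assume x: "x \<in> hecke_pairs n m r"
    obtain d e' where de: "x = (d, e')" by (cases x)
    note S = swap_pair_involution[OF x[unfolded de] pos(2,1) r]
    show "swap_pair m n (swap_pair n m x) = x" "swap_pair n m x \<in> hecke_pairs m n r"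
      using S by (simp_all add: de)
  qed
qed

section \<open>The spectral expansion of the kernel\<close>

lemma petersson_integrable:
  assumes f: "cusp_form (2*k) f" and g: "cusp_form (2*k) g"
  shows "integrable lborel (\<lambda>z. indicator fundamental_domain z *\<^sub>R (f z * cnj (g z) * of_real (Im z ^ (2*k) / (Im z)^2)))"
proof -
  obtain A where A: "A > 0" "\<And>z. z \<in> HH \<Longrightarrow> Im z ^ k * norm (f z) \<le> A" using cusp_form_bounded[OF f] by blast
  obtain B where B: "B > 0" "\<And>z. z \<in> HH \<Longrightarrow> Im z ^ k * norm (g z) \<le> B" using cusp_form_bounded[OF g] by blast
  have [measurable]: "f \<in> borel_measurable borel" "g \<in> borel_measurable borel"
    using cusp_form_measurable f g by blast+
  show ?thesis
  proof (rule integrable_complex_product_bound)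
    show "integrable lborel (indicator {-1/2..1/2::real} :: real \<Rightarrow> real)" by simp
    \<comment> \<open>Boundedness of both forms leaves \<open>1 / y^2\<close> on the strip; the
      factor 5 comes from \<open>y^2 + 1 <= 5 * y^2\<close> for \<open>y >= 1/2\<close>.\<close>
    show "integrable lborel (\<lambda>y. (5 * A * B) * (1 / ((y + 0)^2 + 1^2)))"
      by (intro integrable_mult_right integrable_inverse_quadratic) simp
    fix x y
    show "norm (indicator fundamental_domain (Complex x y) *\<^sub>R (f (Complex x y) * cnj (g (Complex x y)) *
            of_real (Im (Complex x y) ^ (2*k) / (Im (Complex x y))^2)))
          \<le> indicator {-1/2..1/2} x * ((5 * A * B) * (1 / ((y + 0)^2 + 1^2)))"
    proof (cases "Complex x y \<in> fundamental_domain")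
      case True
      have y: "y \<ge> 1/2" using fundamental_domain_Im[OF True] by simp
      have x: "x \<in> {-1/2..1/2}" using True by (auto simp: fundamental_domain_def)
      have zH: "Complex x y \<in> HH" using y by simp
      have y2: "(1/2)^2 \<le> y^2" using y by (intro power_mono) auto
      have "norm (f (Complex x y) * cnj (g (Complex x y)) * of_real (y ^ (2*k) / y^2)) =
         (y ^ k * norm (f (Complex x y))) * (y ^ k * norm (g (Complex x y))) * (1 / y^2)"
        using y by (simp add: norm_mult norm_divide norm_power mult_2 power_add del: of_real_divide of_real_power)
      also have "... \<le> A * B * (5 / (y^2 + 1))"
      proof (intro mult_mono)
        show "1 / y^2 \<le> 5 / (y^2 + 1)" using y2 y by (simp add: divide_simps power2_eq_square)
      qed (use A(2)[OF zH] B(2)[OF zH] A(1) B(1) y in auto)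
      finally show ?thesis using True x by (simp add: mult_ac)
    next
      case False
      thus ?thesis using A B by (simp add: indicator_def add_nonneg_nonneg)
    qed
  qed (use A B in \<open>auto simp: add_nonneg_nonneg\<close>)
qed

lemma petersson_eq: "petersson (2*k) f g = (LBINT z. indicator fundamental_domain z *\<^sub>R (f z * cnj (g z) * of_real (Im z ^ (2*k) / (Im z)^2)))"
  by (simp add: petersson_def set_lebesgue_integral_def)

text \<open>A continuous non-negative density with integral zero vanishes on the open set
  \<open>F0\<close>, and the identity theorem carries this to the half-plane.\<close>

lemma petersson_positive:
  assumes f: "cusp_form (2*k) f" and zero: "petersson (2*k) f f = 0"
  shows "f = (\<lambda>_. 0)"
proof -
  define h where "h z = indicator fundamental_domain z * ((norm (f z))^2 * (Im z ^ (2*k) / (Im z)^2))" for z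
  have eq: "indicator fundamental_domain z *\<^sub>R (f z * cnj (f z) * of_real (Im z ^ (2*k) / (Im z)^2)) = complex_of_real (h z)" for z
    by (simp add: h_def complex_norm_square[symmetric] scaleR_conv_of_real indicator_def)
  have h0: "h z \<ge> 0" for z
    by (cases "z \<in> fundamental_domain") (simp_all add: h_def)
  have int: "integrable lborel h"
    using integrable_Re[OF petersson_integrable[OF f f]] unfolding eq by simp
  have "complex_of_real (integral\<^sup>L lborel h) = 0"
    using zero unfolding petersson_eq eq by simp
  hence "integral\<^sup>L lborel h = 0" by simp
  hence ae: "AE z in lborel. h z = 0"
    using integral_nonneg_eq_0_iff_AE[OF int] h0 by auto
  define U where "U = {z \<in> F0. f z \<noteq> 0}"
  have cont: "continuous_on F0 f"
    using cusp_form_continuous[OF f] F0_subset(2) continuous_on_subset by blast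
  have openU: "open U"
  proof -
    have "open (F0 \<inter> f -` (- {0}))" by (rule continuous_open_preimage[OF cont open_F0]) auto
    moreover have "F0 \<inter> f -` (- {0}) = U" by (auto simp: U_def)
    ultimately show ?thesis by simp
  qed
  have "AE z in lborel. z \<notin> U"
    using ae
  proof eventually_elim
    case (elim z)
    show ?case
    proof
      assume "z \<in> U"
      hence "z \<in> fundamental_domain" "f z \<noteq> 0" "Im z > 0"
        using F0_subset by (auto simp: U_def F0_def)
      thus False using elim by (simp add: h_def)
    qed
  qed
  hence "U \<in> null_sets lborel"
    using openU AE_iff_null_sets[of U "lborel :: complex measure"] by auto
  hence "negligible U" by (auto simp: negligible_iff_null_sets intro: null_sets_completionI)
  hence "U = {}" using openU open_not_negligible by blast
  hence f0: "f z = 0" if "z \<in> F0" for z using that by (auto simp: U_def)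
  have "2 * \<i> \<in> F0" by (simp add: F0_def norm_mult)
  hence ne: "F0 \<noteq> {}" by blast
  have "f z = 0" if "z \<in> HH" for z
    by (rule analytic_continuation_open[OF open_F0 open_HH ne _ F0_subset(2) cusp_form_holomorphic[OF f] _ _ that, of "\<lambda>_. 0"])
       (use f0 convex_HH in \<open>auto intro: convex_connected\<close>)
  thus ?thesis using cusp_form_outside[OF f] by (intro ext) blast
qed

text \<open>A fixed choice of the bound from \<open>cusp_form_determined\<close>, so that it can
  serve as a parameter of the locale \<open>fin_ip\<close>.\<close>

definition siegel_bound :: "nat \<Rightarrow> nat" where
  "siegel_bound k = (SOME N. \<forall>f. cusp_form (2 * k) f \<longrightarrow> (\<forall>n<N. fourier_coeff f n = 0) \<longrightarrow> f = (\<lambda>_. 0))"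

lemma siegel_bound:
  assumes "cusp_form (2 * k) f" "\<And>n. n < siegel_bound k \<Longrightarrow> fourier_coeff f n = 0" shows "f = (\<lambda>_. 0)"
proof -
  have "\<exists>N. \<forall>f. cusp_form (2 * k) f \<longrightarrow> (\<forall>n<N. fourier_coeff f n = 0) \<longrightarrow> f = (\<lambda>_. 0)"
    using cusp_form_determined[of k] by metis
  hence "\<forall>f. cusp_form (2 * k) f \<longrightarrow> (\<forall>n<siegel_bound k. fourier_coeff f n = 0) \<longrightarrow> f = (\<lambda>_. 0)"
    unfolding siegel_bound_def by (rule someI_ex)
  thus ?thesis using assms by blast
qed

interpretation cf: fin_ip "{F. cusp_form (2 * k) F}" "petersson (2 * k)" "\<lambda>n F. fourier_coeff F n" "siegel_bound k" for k
proof unfold_locales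
  show "(\<lambda>_. 0) \<in> {F. cusp_form (2 * k) F}" by (simp add: cusp_form_zero)
  fix f g h :: "complex \<Rightarrow> complex" and c :: complex and n
  show "petersson (2 * k) (\<lambda>x. f x + g x) h = petersson (2 * k) f h + petersson (2 * k) g h"
    if "f \<in> {F. cusp_form (2 * k) F}" "g \<in> {F. cusp_form (2 * k) F}" "h \<in> {F. cusp_form (2 * k) F}"
  proof -
    have "petersson (2 * k) f h + petersson (2 * k) g h = (LBINT z. indicator fundamental_domain z *\<^sub>R (f z * cnj (h z) * of_real (Im z ^ (2*k) / (Im z)^2)) +
       indicator fundamental_domain z *\<^sub>R (g z * cnj (h z) * of_real (Im z ^ (2*k) / (Im z)^2)))"
      unfolding petersson_eq
      by (rule Bochner_Integration.integral_add[symmetric]) (use petersson_integrable that in blast)+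
    also have "... = petersson (2 * k) (\<lambda>x. f x + g x) h"
      unfolding petersson_eq scaleR_add_right[symmetric] distrib_right[symmetric] ..
    finally show ?thesis ..
  qed
  show "petersson (2 * k) (\<lambda>x. c * f x) h = c * petersson (2 * k) f h"
    unfolding petersson_eq integral_mult_right_zero[symmetric]
    by (intro Bochner_Integration.integral_cong) (auto simp: mult.assoc)
  show "petersson (2 * k) g f = cnj (petersson (2 * k) f g)"
    unfolding petersson_eq Bochner_Integration.integral_cnj[symmetric]
    by (intro Bochner_Integration.integral_cong) (auto simp: mult_ac)
qed (auto simp: cusp_form_add cusp_form_scale intro: petersson_positive siegel_bound)

context fin_ip begin

lemma ip_scale_right: "f \<in> S \<Longrightarrow> g \<in> S \<Longrightarrow> ip f (\<lambda>x. c * g x) = cnj c * ip f g"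
  using ip_cnj[of "\<lambda>x. c * g x" f] ip_cnj[of g f] ip_scale[of g f c] S_scale[of g c] by simp

lemma ip_sum_right:
  assumes "finite J" "\<And>j. j \<in> J \<Longrightarrow> v j \<in> S" "h \<in> S"
  shows "ip h (\<lambda>x. \<Sum>j\<in>J. c j * v j x) = (\<Sum>j\<in>J. cnj (c j) * ip h (v j))"
proof -
  have "ip h (\<lambda>x. \<Sum>j\<in>J. c j * v j x) = cnj (ip (\<lambda>x. \<Sum>j\<in>J. c j * v j x) h)"
    by (rule ip_cnj[OF S_sum]) (use assms in auto)
  also have "ip (\<lambda>x. \<Sum>j\<in>J. c j * v j x) h = (\<Sum>j\<in>J. c j * ip (v j) h)"
    by (rule ip_sum) (use assms in auto)
  also have "cnj (\<Sum>j\<in>J. c j * ip (v j) h) = (\<Sum>j\<in>J. cnj (c j) * ip h (v j))"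
    unfolding cnj_sum
  proof (rule sum.cong)
    fix j assume "j \<in> J"
    thus "cnj (c j * ip (v j) h) = cnj (c j) * ip h (v j)"
      using ip_cnj[of "v j" h] assms by simp
  qed simp
  finally show ?thesis .
qed

lemma ip_self_real: "f \<in> S \<Longrightarrow> cnj (ip f f) = ip f f"
  using ip_cnj[of f f] by simp

end

section \<open>Modularity, commutation and self-adjointness of Hecke operators\<close>

lemma hecke_operator_add: "hecke_operator w n (\<lambda>z. f z + g z) = (\<lambda>z. hecke_operator w n f z + hecke_operator w n g z)"
  by (rule ext) (simp add: hecke_operator_def sum.distrib add_divide_distrib algebra_simps)

lemma hecke_operator_scale: "hecke_operator w n (\<lambda>z. c * f z) = (\<lambda>z. c * hecke_operator w n f z)"
  by (rule ext) (simp add: hecke_operator_def sum_distrib_left mult_ac)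

lemma kernel_const_nonzero [simp]: "kernel_const k \<noteq> 0"
  by (simp add: kernel_const_def)

lemma cnj_kernel_const [simp]: "cnj (kernel_const k) = kernel_const k"
  by (simp add: kernel_const_def power_mult power_mult_distrib)

lemma of_nat_powi: "w \<ge> 1 \<Longrightarrow> (of_nat n :: complex) powi (int w - 1) = of_nat n ^ (w - 1)"
  by (metis of_nat_1 of_nat_diff power_int_of_nat)

text \<open>The reproducing property is summed over the coset representatives. The kernel is
  evaluated at \<open>- cnj u\<close>, where the real shifts change sign; for this reason the
  representatives with \<open>s = -1\<close> are used.\<close>

lemma hecke_petersson:
  assumes F: "cusp_form (2*k) F" and u: "u \<in> HH" and n: "n > 0" and k: "k \<ge> 5"
  shows "2 * kernel_const k * hecke_operator (2*k) n F u
       = of_nat n ^ (2*k - 1) * petersson (2*k) F (hform (2*k) (int n) (- cnj u))"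
proof -
  define z' where "z' = - cnj u"
  have z': "z' \<in> HH" using u by (simp add: z'_def)
  define p where "p = (\<lambda>(d, b). (of_nat (n div d) * z' + of_int ((-1) * int b)) / of_nat d :: complex)"
  have pH: "p j \<in> HH" if "j \<in> coset_idx n" for j
    using coset_rep_point_HH[OF z' _ n, of "fst j" "- int (snd j)"] that by (auto simp: p_def coset_idx_def)
  have pu: "- cnj (p (d, b)) = (of_nat (n div d) * u + of_nat b) / of_nat d" for d b
    by (simp add: p_def z'_def field_simps minus_divide_left)
  have "hform (2*k) (int n) z' = (\<lambda>z. \<Sum>j\<in>coset_idx n. (1 / of_nat (fst j) ^ (2*k)) * hform (2*k) 1 (p j) z)"
  proof
    fix z
    show "hform (2*k) (int n) z' z = (\<Sum>j\<in>coset_idx n. (1 / of_nat (fst j) ^ (2*k)) * hform (2*k) 1 (p j) z)"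
    proof (cases "z \<in> HH")
      case True
      have "hker (2*k) (int n) z z' = hker (2*k) (int n) z' z" by (rule hker_swap)
      also have "... = (\<Sum>d | d dvd n. \<Sum>b<d. hker (2*k) 1 (p (d, b)) z / of_nat d ^ (2*k))"
        using hker_cosets[OF n _ z' True, of "-1" "2*k"] k by (simp add: p_def)
      also have "... = (\<Sum>j\<in>coset_idx n. hker (2*k) 1 (p j) z / of_nat (fst j) ^ (2*k))"
        unfolding coset_idx_def using n by (subst sum.Sigma) (auto simp: case_prod_unfold)
      finally show ?thesis using True by (simp add: hker_swap[of _ _ z])
    qed (simp add: hform_def)
  qed
  hence "petersson (2*k) F (hform (2*k) (int n) z')
     = (\<Sum>j\<in>coset_idx n. cnj (1 / of_nat (fst j) ^ (2*k)) * petersson (2*k) F (hform (2*k) 1 (p j)))"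
    by (simp only:) (rule cf.ip_sum_right, use F finite_coset_idx[OF n] pH k in \<open>auto intro: cusp_form_hform\<close>)
  also have "... = (\<Sum>j\<in>coset_idx n. 2 * kernel_const k * (F (- cnj (p j)) / of_nat (fst j) ^ (2*k)))"
    by (rule sum.cong) (use petersson_hform[OF F pH k] in auto)
  also have "... = 2 * kernel_const k * (\<Sum>(d, b)\<in>coset_idx n. F ((of_nat (n div d) * u + of_nat b) / of_nat d) / of_nat d ^ (2*k))"
    unfolding sum_distrib_left by (rule sum.cong) (auto simp: pu)
  also have "(\<Sum>(d, b)\<in>coset_idx n. F ((of_nat (n div d) * u + of_nat b) / of_nat d) / of_nat d ^ (2*k))
     = (\<Sum>d | d dvd n. \<Sum>b<d. F ((of_nat (n div d) * u + of_nat b) / of_nat d) / of_nat d ^ (2*k))"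
    unfolding coset_idx_def using n by (subst sum.Sigma) auto
  finally have "petersson (2*k) F (hform (2*k) (int n) z') = 2 * kernel_const k *
       (\<Sum>d | d dvd n. \<Sum>b<d. F ((of_nat (n div d) * u + of_nat b) / of_nat d) / of_nat d ^ (2*k))" .
  thus ?thesis unfolding z'_def[symmetric] hecke_operator_def
    using of_nat_powi[of "2*k" n] k by (simp add: mult_ac)
qed

text \<open>Modularity is inherited from the kernel instead of a permutation of cosets: the value at
  \<open>u\<close> is a Petersson product with the kernel at \<open>- cnj u\<close>, and the kernel
  is modular in its second variable.\<close>

lemma cusp_form_hecke:
  assumes F: "cusp_form (2*k) F" and n: "n > 0" and k: "k \<ge> 5"
  shows "cusp_form (2*k) (hecke_operator (2*k) n F)"
    and "fourier_coeff (hecke_operator (2*k) n F) = hecke_seq (2*k) n (fourier_coeff F)"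
proof -
  have FE: "has_fourier_expansion (hecke_operator (2*k) n F) (hecke_seq (2*k) n (fourier_coeff F))"
    by (rule fourier_hecke[OF cusp_form_fourier[OF F] n]) (use k in simp)
  thus "fourier_coeff (hecke_operator (2*k) n F) = hecke_seq (2*k) n (fourier_coeff F)"
    by (rule fourier_coeff_eq)
  show "cusp_form (2*k) (hecke_operator (2*k) n F)"
    unfolding cusp_form_def
  proof (intro conjI allI impI ballI exI)
    show "has_fourier_expansion (hecke_operator (2*k) n F) (hecke_seq (2*k) n (fourier_coeff F))" by (rule FE)
    show "hecke_seq (2*k) n (fourier_coeff F) 0 = 0" by (rule hecke_seq_0[of "fourier_coeff F", OF cusp_form_coeff_0[OF F]])
    show "hecke_operator (2*k) n F z = 0" if "z \<notin> HH" for z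
      by (rule hecke_operator_outside[OF cusp_form_outside[OF F] that n])
    show "hecke_operator (2*k) n F holomorphic_on HH"
      unfolding hecke_operator_def[abs_def]
    proof (intro holomorphic_intros holomorphic_on_compose_gen[OF _ cusp_form_holomorphic[OF F], unfolded o_def])
      fix d b assume d: "d \<in> {d. d dvd n}" and "b \<in> {..<d}"
      show "(of_nat d :: complex) \<noteq> 0" using d n by (auto intro: Nat.gr0I)
      thus "(of_nat d :: complex) ^ (2 * k) \<noteq> 0" by simp
      show "(\<lambda>z. (of_nat (n div d) * z + of_nat b) / of_nat d) ` HH \<subseteq> HH"
        using coset_rep_point_HH[OF _ _ n, of _ d "int b"] d by auto
    qed
    fix a b c d :: int and u
    assume det: "a * d - b * c = 1" and u: "u \<in> HH"
    define u' where "u' = (of_int a * u + of_int b) / (of_int c * u + of_int d)"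
    define j where "j = of_int c * u + of_int d"
    have M: "mdet (a, b, c, d) = 1" using det by simp
    have u': "u' \<in> HH" using mob_in_HH[of "(a,b,c,d)" u] M u by (simp add: mob_def u'_def)
    \<comment> \<open>The action of \<open>(a, b, c, d)\<close> on \<open>u\<close> becomes that of
      this matrix after the reflection \<open>u \<mapsto> - cnj u\<close>; its automorphy factor is
      \<open>cnj j\<close>, and the conjugate-linear second argument turns it back into
      \<open>j\<close>.\<close>
    have N: "mdet (a, -b, -c, d) = 1" using det by simp
    have v: "- cnj u \<in> HH" using u by simp
    have mo: "mob (a, -b, -c, d) (- cnj u) = - cnj u'"
      by (simp add: mob_def u'_def minus_divide_left)
    have md: "mden (a, -b, -c, d) (- cnj u) = cnj j" by (simp add: j_def)
    have "hform (2*k) (int n) (- cnj u') = (\<lambda>z. cnj j ^ (2*k) * hform (2*k) (int n) (- cnj u) z)"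
      using hker_mob'[OF N v, of "2*k" "int n", unfolded mo md] by (auto simp: hform_def)
    moreover have "cusp_form (2*k) (hform (2*k) (int n) (- cnj u))"
      by (rule cusp_form_hform[OF v]) (use n k in auto)
    ultimately have "petersson (2*k) F (hform (2*k) (int n) (- cnj u')) = j ^ (2*k) * petersson (2*k) F (hform (2*k) (int n) (- cnj u))"
      using cf.ip_scale_right[of F k "hform (2*k) (int n) (- cnj u)" "cnj j ^ (2*k)"] F by simp
    hence "2 * kernel_const k * hecke_operator (2*k) n F u' = j ^ (2*k) * (2 * kernel_const k * hecke_operator (2*k) n F u)"
      unfolding hecke_petersson[OF F u n k] hecke_petersson[OF F u' n k] by simp
    thus "hecke_operator (2*k) n F ((of_int a * u + of_int b) / (of_int c * u + of_int d)) =
         (of_int c * u + of_int d) ^ (2*k) * hecke_operator (2*k) n F u"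
      by (simp add: u'_def j_def)
  qed
qed

lemma hecke_commute:
  assumes F: "cusp_form (2*k) F" and mn: "m > 0" "n > 0" and k: "k \<ge> 5"
  shows "hecke_operator (2*k) m (hecke_operator (2*k) n F) = hecke_operator (2*k) n (hecke_operator (2*k) m F)"
proof (rule cusp_form_eqI)
  note H = cusp_form_hecke[OF _ _ k]
  show "cusp_form (2*k) (hecke_operator (2*k) m (hecke_operator (2*k) n F))"
    "cusp_form (2*k) (hecke_operator (2*k) n (hecke_operator (2*k) m F))"
    by (intro H F mn)+
  fix r
  show "fourier_coeff (hecke_operator (2*k) m (hecke_operator (2*k) n F)) r =
      fourier_coeff (hecke_operator (2*k) n (hecke_operator (2*k) m F)) r"
    using hecke_seq_commute[OF mn, of "fourier_coeff F" "2*k" r] cusp_form_coeff_0[OF F]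
    by (simp add: H F mn)
qed

text \<open>The kernel of determinant \<open>n\<close> has two roles: it represents the Hecke
  operator \<open>T\<close> as a Petersson product, and it is a multiple of \<open>T\<close> applied
  to the kernel of determinant 1. Expanding the latter in an orthogonal basis \<open>B\<close> shows
  that the coefficient of \<open>T F\<close> at \<open>b\<close> is given by the product of
  \<open>F\<close> with \<open>T b\<close>. This is the adjunction against elements of
  \<open>B\<close>, and linearity extends it.\<close>

lemma hecke_self_adjoint:
  assumes F: "cusp_form (2*k) F" and G: "cusp_form (2*k) G" and n: "n > 0" and k: "k \<ge> 5"
  shows "petersson (2*k) (hecke_operator (2*k) n F) G = petersson (2*k) F (hecke_operator (2*k) n G)"
proof -
  let ?T = "hecke_operator (2*k) n" and ?ip = "petersson (2*k)"
  note H = cusp_form_hecke(1)[OF _ n k]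
  obtain B where B: "cf.orth k B" "B \<subseteq> {F. cusp_form (2*k) F}" "card B = cf.odim k {F. cusp_form (2*k) F}"
    using cf.odim_attained by blast
  have fB: "finite B" using cf.orth_card[OF B(1)] by simp
  have BS: "cusp_form (2*k) b" if "b \<in> B" for b using B(2) that by blast
  have expand: "F = (\<lambda>z. \<Sum>b\<in>B. (?ip F b / ?ip b b) * b z)" if "cusp_form (2*k) F" for F
    by (rule cf.orth_expansion[OF cf.subsp_S B]) (use that in simp)
  have Tsum: "?T (\<lambda>z. \<Sum>b\<in>B. c b * b z) = (\<lambda>z. \<Sum>b\<in>B. c b * ?T b z)" for c
  proof -
    have "?T (\<lambda>z. \<Sum>b\<in>A. c b * b z) = (\<lambda>z. \<Sum>b\<in>A. c b * ?T b z)" if "finite A" for A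
      using that
    proof (induction A rule: finite_induct)
      case empty show ?case by (simp add: hecke_operator_def)
    next
      case (insert a A)
      have "?T (\<lambda>z. c a * a z + (\<Sum>b\<in>A. c b * b z)) = (\<lambda>z. c a * ?T a z + (\<Sum>b\<in>A. c b * ?T b z))"
        unfolding hecke_operator_add hecke_operator_scale insert.IH ..
      thus ?case using insert by simp
    qed
    thus ?thesis using fB by blast
  qed
  have bb: "cnj (?ip b b) = ?ip b b" if "b \<in> B" for b using cf.ip_self_real[of b k] BS[OF that] by simp
  have TF: "?T F = (\<lambda>u. \<Sum>b\<in>B. (?ip F (?T b) / ?ip b b) * b u)"
  proof
    fix u
    show "?T F u = (\<Sum>b\<in>B. (?ip F (?T b) / ?ip b b) * b u)"
    proof (cases "u \<in> HH")
      case True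
      define z' where "z' = - cnj u"
      have z': "z' \<in> HH" using True by (simp add: z'_def)
      have h1: "cusp_form (2*k) (hform (2*k) 1 z')" by (rule cusp_form_hform[OF z']) (use k in auto)
      have coeff: "?ip (hform (2*k) 1 z') b = cnj (2 * kernel_const k * b u)" if "b \<in> B" for b
        using cf.ip_cnj[of b k "hform (2*k) 1 z'"] petersson_hform[OF BS[OF that] z' k] BS[OF that] h1
        by (simp add: z'_def)
      have "(\<lambda>z. of_nat n ^ (2*k-1) * hform (2*k) (int n) z' z) = ?T (hform (2*k) 1 z')"
        using hecke_operator_hform[OF n z', of "2*k"] k of_nat_powi[of "2*k" n] by simp
      also have "... = ?T (\<lambda>z. \<Sum>b\<in>B. (?ip (hform (2*k) 1 z') b / ?ip b b) * b z)"
        using expand[OF h1] by (rule arg_cong)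
      also have "... = (\<lambda>z. \<Sum>b\<in>B. (?ip (hform (2*k) 1 z') b / ?ip b b) * ?T b z)" by (rule Tsum)
      finally have "?ip F (\<lambda>z. of_nat n ^ (2*k-1) * hform (2*k) (int n) z' z) =
         ?ip F (\<lambda>z. \<Sum>b\<in>B. (?ip (hform (2*k) 1 z') b / ?ip b b) * ?T b z)" by simp
      also have "... = (\<Sum>b\<in>B. cnj (?ip (hform (2*k) 1 z') b / ?ip b b) * ?ip F (?T b))"
        by (rule cf.ip_sum_right) (use fB F BS in \<open>auto intro: H\<close>)
      also have "... = (\<Sum>b\<in>B. 2 * kernel_const k * (b u / ?ip b b * ?ip F (?T b)))"
        by (rule sum.cong) (auto simp: coeff bb)
      also have "... = 2 * kernel_const k * (\<Sum>b\<in>B. b u / ?ip b b * ?ip F (?T b))" by (simp add: sum_distrib_left)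
      also have "?ip F (\<lambda>z. of_nat n ^ (2*k-1) * hform (2*k) (int n) z' z) = of_nat n ^ (2*k-1) * ?ip F (hform (2*k) (int n) z')"
        using cf.ip_scale_right[of F k "hform (2*k) (int n) z'"] F cusp_form_hform[OF z', of "int n" "2*k"] n k by simp
      also have "... = 2 * kernel_const k * ?T F u"
        using hecke_petersson[OF F True n k] by (simp add: z'_def)
      finally show ?thesis by (simp add: mult_ac)
    next
      case False
      have "b u = 0" if "b \<in> B" for b using cusp_form_outside[OF BS[OF that] False] .
      hence "(\<Sum>b\<in>B. (?ip F (?T b) / ?ip b b) * b u) = 0" by (intro sum.neutral ballI) simp
      moreover have "?T F u = 0" using cusp_form_outside[OF H[OF F] False] .
      ultimately show ?thesis by simp
    qed
  qed
  have Tb: "?ip (?T F) b = ?ip F (?T b)" if b: "b \<in> B" for b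
  proof -
    have "?ip (?T F) b = (\<Sum>i\<in>B. (?ip F (?T i) / ?ip i i) * ?ip i b)"
      unfolding TF by (rule cf.ip_sum) (use fB BS b in auto)
    also have "... = (\<Sum>i\<in>B. if i = b then ?ip F (?T b) else 0)"
    proof (rule sum.cong)
      fix i assume i: "i \<in> B"
      show "(?ip F (?T i) / ?ip i i) * ?ip i b = (if i = b then ?ip F (?T b) else 0)"
      proof (cases "i = b")
        case True
        have "b \<noteq> (\<lambda>_. 0)" using B(1) b unfolding cf.orth_def by blast
        hence "?ip b b \<noteq> 0" using cf.ip_self_nonzero[of b k] BS[OF b] by simp
        thus ?thesis using True by simp
      next
        case False
        hence "?ip i b = 0" using B(1) i b unfolding cf.orth_def by blast
        thus ?thesis using False by simp
      qed
    qed simp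
    also have "... = ?ip F (?T b)" using fB b by simp
    finally show ?thesis .
  qed
  define g where "g b = ?ip G b / ?ip b b" for b
  have Gx: "G = (\<lambda>z. \<Sum>b\<in>B. g b * b z)" unfolding g_def by (rule expand[OF G])
  have "?ip (?T F) (\<lambda>z. \<Sum>b\<in>B. g b * b z) = (\<Sum>b\<in>B. cnj (g b) * ?ip (?T F) b)"
    by (rule cf.ip_sum_right) (use fB BS H[OF F] in auto)
  also have "... = (\<Sum>b\<in>B. cnj (g b) * ?ip F (?T b))" by (rule sum.cong) (auto simp: Tb)
  also have "... = ?ip F (\<lambda>z. \<Sum>b\<in>B. g b * ?T b z)"
    by (rule cf.ip_sum_right[symmetric]) (use fB BS F in \<open>auto intro: H\<close>)
  also have "(\<lambda>z. \<Sum>b\<in>B. g b * ?T b z) = ?T G" unfolding Tsum[symmetric] Gx[symmetric] ..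
  finally show ?thesis unfolding Gx[symmetric] .
qed

text \<open>The first coefficient of the image is the n-th coefficient of \<open>F\<close>. Hence
  eigenvalues together with the first coefficient determine an eigenform, which is multiplicity
  one.\<close>

lemma hecke_eigenvalue:
  assumes F: "cusp_form (2*k) F" and n: "n > 0" and k: "k \<ge> 5"
    and ev: "hecke_operator (2*k) n F = (\<lambda>z. c * F z)"
  shows "fourier_coeff F n = c * fourier_coeff F 1"
proof -
  have "fourier_coeff F n = hecke_seq (2*k) n (fourier_coeff F) 1" by (rule hecke_seq_1[OF n, symmetric])
  also have "... = fourier_coeff (hecke_operator (2*k) n F) 1" by (simp only: cusp_form_hecke(2)[OF F n k])
  also have "... = c * fourier_coeff F 1" unfolding ev by (rule cusp_form_scale(2)[OF F])
  finally show ?thesis .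
qed

section \<open>Primitive forms as an orthogonal basis\<close>

lemma primitive_formD:
  assumes "f \<in> primitive_forms (2*k)" and k: "k \<ge> 5"
  shows "cusp_form (2*k) f" "fourier_coeff f 1 = 1" "f \<noteq> (\<lambda>_. 0)"
    and "n > 0 \<Longrightarrow> hecke_operator (2*k) n f = (\<lambda>z. fourier_coeff f n * f z)"
proof -
  show f: "cusp_form (2*k) f" and f1: "fourier_coeff f 1 = 1"
    using assms by (auto simp: primitive_forms_def)
  have "fourier_coeff (\<lambda>_. 0) 1 = (0 :: complex)" by (rule cf.\<phi>_0)
  thus "f \<noteq> (\<lambda>_. 0)" using f1 by auto
  assume n: "n > 0"
  then obtain c where "\<forall>z\<in>HH. hecke_operator (2*k) n f z = c * f z"
    using assms by (auto simp: primitive_forms_def Suc_le_eq)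
  hence c: "hecke_operator (2*k) n f z = c * f z" if "z \<in> HH" for z using that by blast
  have ev: "hecke_operator (2*k) n f = (\<lambda>z. c * f z)"
  proof
    fix z
    show "hecke_operator (2*k) n f z = c * f z"
      using c[of z] cusp_form_outside[OF f, of z] cusp_form_outside[OF cusp_form_hecke(1)[OF f n k], of z]
      by (cases "z \<in> HH") auto
  qed
  show "hecke_operator (2*k) n f = (\<lambda>z. fourier_coeff f n * f z)"
    using hecke_eigenvalue[OF f n k ev] f1 ev by simp
qed

lemma primitive_form_norm_nonzero:
  "f \<in> primitive_forms (2*k) \<Longrightarrow> k \<ge> 5 \<Longrightarrow> petersson (2*k) f f \<noteq> 0"
  using primitive_formD(1,3) petersson_positive by blast

lemma primitive_coeff_real:
  assumes f: "f \<in> primitive_forms (2*k)" and k: "k \<ge> 5"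
  shows "cnj (fourier_coeff f n) = fourier_coeff f n"
proof (cases "n = 0")
  case False
  hence n: "n > 0" by simp
  note D = primitive_formD[OF f k]
  have "fourier_coeff f n * petersson (2*k) f f = petersson (2*k) (hecke_operator (2*k) n f) f"
    unfolding D(4)[OF n] using cf.ip_scale[of f k f] D(1) by simp
  also have "... = petersson (2*k) f (hecke_operator (2*k) n f)" by (rule hecke_self_adjoint[OF D(1) D(1) n k])
  also have "... = cnj (fourier_coeff f n) * petersson (2*k) f f"
    unfolding D(4)[OF n] using cf.ip_scale_right[of f k f] D(1) by simp
  finally show ?thesis using primitive_form_norm_nonzero[OF f k] by simp
qed (use cusp_form_coeff_0[OF primitive_formD(1)[OF f k]] in simp)

lemma primitive_forms_orth:
  assumes k: "k \<ge> 5" shows "cf.orth k (primitive_forms (2*k))"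
  unfolding cf.orth_def
proof (intro conjI ballI impI)
  show "primitive_forms (2*k) \<subseteq> {F. cusp_form (2*k) F}" using primitive_formD(1)[OF _ k] by blast
  fix f assume f: "f \<in> primitive_forms (2*k)"
  show "f \<noteq> (\<lambda>_. 0)" by (rule primitive_formD(3)[OF f k])
  fix g assume g: "g \<in> primitive_forms (2*k)" and ne: "f \<noteq> g"
  note Df = primitive_formD[OF f k] and Dg = primitive_formD[OF g k]
  obtain n where n: "fourier_coeff f n \<noteq> fourier_coeff g n" using cusp_form_eqI[OF Df(1) Dg(1)] ne by blast
  have n0: "n > 0" using n cusp_form_coeff_0[OF Df(1)] cusp_form_coeff_0[OF Dg(1)] by (cases n) auto
  have "fourier_coeff f n * petersson (2*k) f g = petersson (2*k) (hecke_operator (2*k) n f) g"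
    unfolding Df(4)[OF n0] using cf.ip_scale[of f k g] Df(1) Dg(1) by simp
  also have "... = petersson (2*k) f (hecke_operator (2*k) n g)" by (rule hecke_self_adjoint[OF Df(1) Dg(1) n0 k])
  also have "... = fourier_coeff g n * petersson (2*k) f g"
    unfolding Dg(4)[OF n0] using cf.ip_scale_right[of f k g] Df(1) Dg(1) primitive_coeff_real[OF g k] by simp
  finally show "petersson (2*k) f g = 0" using n by simp
qed

lemma finite_primitive_forms: "k \<ge> 5 \<Longrightarrow> finite (primitive_forms (2*k))"
  using cf.orth_card[OF primitive_forms_orth] by blast

text \<open>The residual \<open>G\<close> after projection to the primitive forms is orthogonal to
  them. A common eigenvector has a non-zero first coefficient, for otherwise all of its coefficients
  would vanish; so it is a multiple of a primitive form and also orthogonal to \<open>G\<close>.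
  Completeness of the common eigenvectors gives \<open>G = 0\<close>.\<close>

lemma primitive_expansion:
  assumes k: "k \<ge> 5" and F: "cusp_form (2*k) F"
  shows "F z = (\<Sum>f\<in>primitive_forms (2*k). (petersson (2*k) F f / petersson (2*k) f f) * f z)"
proof -
  let ?P = "primitive_forms (2*k)" and ?ip = "petersson (2*k)"
  note H = cusp_form_hecke(1)[OF _ _ k]
  define G where "G = (\<lambda>x. F x + (\<Sum>b\<in>?P. (- ?ip F b / ?ip b b) * b x))"
  have fin: "finite ?P" by (rule finite_primitive_forms[OF k])
  have PS: "f \<in> {F. cusp_form (2*k) F}" if "f \<in> ?P" for f using primitive_formD(1)[OF that k] by simp
  have GS: "G \<in> {F. cusp_form (2*k) F}"
    unfolding G_def by (rule cf.S_add[OF _ cf.S_sum]) (use F PS fin in auto)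
  have Gp: "?ip G f = 0" if "f \<in> ?P" for f
    unfolding G_def by (rule cf.residual_orth[OF primitive_forms_orth[OF k]]) (use F that in auto)
  have "G = (\<lambda>_. 0)"
  proof (rule cf.common_eigenvectors_complete[where T = "\<lambda>i. hecke_operator (2*k) (Suc i)" and k = k])
    show "cf.lin_on {F. cusp_form (2*k) F} (hecke_operator (2*k) (Suc n))" for n
      unfolding cf.lin_on_def using H by (auto simp: hecke_operator_add hecke_operator_scale)
    show "hecke_operator (2*k) (Suc m) (hecke_operator (2*k) (Suc n) f) =
       hecke_operator (2*k) (Suc n) (hecke_operator (2*k) (Suc m) f)" if "f \<in> {F. cusp_form (2*k) F}" for m n f
      by (rule hecke_commute) (use that k in auto)
    show "?ip (hecke_operator (2*k) (Suc n) f) g = ?ip f (hecke_operator (2*k) (Suc n) g)"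
      if "f \<in> {F. cusp_form (2*k) F}" "g \<in> {F. cusp_form (2*k) F}" for n f g
      by (rule hecke_self_adjoint) (use that k in auto)
    show "G \<in> {F. cusp_form (2*k) F}" by (rule GS)
    fix f assume f: "f \<in> {F. cusp_form (2*k) F}" "f \<noteq> (\<lambda>_. 0)"
      and ev: "\<And>n. \<exists>c. hecke_operator (2*k) (Suc n) f = (\<lambda>x. c * f x)"
    have fc: "cusp_form (2*k) f" using f by simp
    have f1: "fourier_coeff f 1 \<noteq> 0"
    proof
      assume 0: "fourier_coeff f 1 = 0"
      have "fourier_coeff f n = 0" for n
      proof (cases n)
        case (Suc m)
        obtain c where "hecke_operator (2*k) (Suc m) f = (\<lambda>x. c * f x)" using ev by blast
        from hecke_eigenvalue[OF fc _ k this] show ?thesis using 0 Suc by simp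
      qed (use cusp_form_coeff_0[OF fc] in simp)
      hence "f = (\<lambda>_. 0)" by (intro siegel_bound[OF fc])
      thus False using f by simp
    qed
    define g where "g = (\<lambda>x. (1 / fourier_coeff f 1) * f x)"
    have gc: "cusp_form (2*k) g" unfolding g_def by (rule cusp_form_scale(1)[OF fc])
    have "g \<in> ?P" unfolding primitive_forms_def
    proof (intro CollectI conjI allI impI)
      show "cusp_form (2*k) g" by (rule gc)
      show "fourier_coeff g 1 = 1" unfolding g_def cusp_form_scale(2)[OF fc] using f1 by simp
      fix n :: nat assume "n \<ge> 1"
      then obtain m where m: "n = Suc m" by (cases n) auto
      obtain c where c: "hecke_operator (2*k) (Suc m) f = (\<lambda>x. c * f x)" using ev by blast
      have "hecke_operator (2*k) n g = (\<lambda>x. c * g x)"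
        unfolding m g_def hecke_operator_scale c by (simp add: mult_ac)
      thus "\<exists>c. \<forall>z\<in>HH. hecke_operator (2*k) n g z = c * g z" by auto
    qed
    hence g0: "?ip G g = 0" by (rule Gp)
    have "f = (\<lambda>x. fourier_coeff f 1 * g x)" using f1 by (simp add: g_def)
    hence "?ip G f = ?ip G (\<lambda>x. fourier_coeff f 1 * g x)" by (rule arg_cong)
    also have "... = cnj (fourier_coeff f 1) * ?ip G g"
      by (rule cf.ip_scale_right) (use GS gc in auto)
    finally show "?ip G f = 0" using g0 by simp
  qed
  hence "F z + (\<Sum>b\<in>?P. (- ?ip F b / ?ip b b) * b z) = 0" unfolding G_def by (rule fun_cong)
  thus ?thesis by (simp add: sum_negf add_eq_0_iff)
qed

lemma primitive_cnj:
  assumes f: "f \<in> primitive_forms (2*k)" and k: "k \<ge> 5" and z: "z \<in> HH"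
  shows "cnj (f (- cnj z)) = f z"
proof -
  note F = cusp_form_fourier[OF primitive_formD(1)[OF f k]]
  have zH: "- cnj z \<in> HH" using z by simp
  have "(\<lambda>n. cnj (fourier_coeff f n * e (of_nat n * (- cnj z)))) sums cnj (f (- cnj z))"
    using fourier_sums[OF F zH] by (subst sums_cnj)
  also have "(\<lambda>n. cnj (fourier_coeff f n * e (of_nat n * (- cnj z)))) = (\<lambda>n. fourier_coeff f n * e (of_nat n * z))"
    using primitive_coeff_real[OF f k] by (auto simp: e_def exp_cnj)
  finally show ?thesis using fourier_sums[OF F z] sums_unique2 by blast
qed

text \<open>The coefficient of the kernel at \<open>f\<close> is the conjugate of a Hecke eigenvalue
  times \<open>f (- cnj z')\<close>. As the Fourier coefficients are real, conjugation undoes the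
  reflection, and the result is holomorphic in both variables.\<close>

theorem kernel_expansion:
  assumes k: "k \<ge> 5" and z: "z \<in> HH" "z' \<in> HH" and n: "n > 0"
  shows "of_nat n ^ (2*k - 1) * hker (2*k) (int n) z z' =
     2 * kernel_const k * (\<Sum>f\<in>primitive_forms (2*k). fourier_coeff f n * f z * f z' / petersson (2*k) f f)"
proof -
  let ?ip = "petersson (2*k)"
  define u where "u = - cnj z'"
  have u: "u \<in> HH" "- cnj u = z'" using z by (auto simp: u_def)
  have hc: "cusp_form (2*k) (hform (2*k) (int n) z')" by (rule cusp_form_hform) (use z n k in auto)
  have coeff: "of_nat n ^ (2*k - 1) * ?ip (hform (2*k) (int n) z') f = 2 * kernel_const k * (fourier_coeff f n * f z')"
    if f: "f \<in> primitive_forms (2*k)" for f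
  proof -
    note D = primitive_formD[OF f k]
    have "of_nat n ^ (2*k - 1) * ?ip f (hform (2*k) (int n) z') = 2 * kernel_const k * (fourier_coeff f n * f u)"
      using hecke_petersson[OF D(1) u(1) n k] unfolding u(2) D(4)[OF n] by simp
    hence "cnj (of_nat n ^ (2*k - 1) * ?ip f (hform (2*k) (int n) z')) = cnj (2 * kernel_const k * (fourier_coeff f n * f u))"
      by (rule arg_cong)
    moreover have "?ip (hform (2*k) (int n) z') f = cnj (?ip f (hform (2*k) (int n) z'))"
      by (rule cf.ip_cnj) (use D hc in auto)
    moreover have "cnj (f u) = f z'" unfolding u_def by (rule primitive_cnj[OF f k z(2)])
    ultimately show ?thesis using primitive_coeff_real[OF f k] by simp
  qed
  have "of_nat n ^ (2*k - 1) * hker (2*k) (int n) z z' = of_nat n ^ (2*k - 1) * hform (2*k) (int n) z' z" using z by simp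
  also have "... = (\<Sum>f\<in>primitive_forms (2*k). (of_nat n ^ (2*k - 1) * ?ip (hform (2*k) (int n) z') f) / ?ip f f * f z)"
    by (subst primitive_expansion[OF k hc]) (simp add: sum_distrib_left mult_ac)
  also have "... = (\<Sum>f\<in>primitive_forms (2*k). 2 * kernel_const k * (fourier_coeff f n * f z * f z' / ?ip f f))"
  proof (rule sum.cong)
    fix f assume f: "f \<in> primitive_forms (2*k)"
    show "(of_nat n ^ (2*k - 1) * ?ip (hform (2*k) (int n) z') f) / ?ip f f * f z =
       2 * kernel_const k * (fourier_coeff f n * f z * f z' / ?ip f f)"
      unfolding coeff[OF f] by simp
  qed simp
  finally show ?thesis by (simp add: sum_distrib_left)
qed

section \<open>Central values as Mellin integrals\<close>

text \<open>The Mellin weight \<open>y powr (u - 1)\<close> for positive \<open>y\<close>, written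
  so that its dependence on \<open>u\<close> is a plain exponential with a power series.\<close>

definition cpw :: "real \<Rightarrow> complex \<Rightarrow> complex" where
  "cpw y u = exp ((u - 1) * of_real (ln y))"

lemma cpw_eq_powr: "y > 0 \<Longrightarrow> of_real y powr (u - 1) = cpw y u"
  by (simp add: cpw_def powr_def Ln_of_real)

lemma norm_cpw: "y > 0 \<Longrightarrow> norm (cpw y u) = y powr (Re u - 1)"
  by (simp add: cpw_def powr_def)

lemma cpw_mult: "c > 0 \<Longrightarrow> y > 0 \<Longrightarrow> cpw (c * y) u = cpw c u * cpw y u"
  by (simp add: cpw_def ln_mult exp_add[symmetric] ring_distribs)

lemma cpw_measurable [measurable]: "(\<lambda>y. cpw y u) \<in> borel_measurable borel"
  unfolding cpw_def by measurable

lemma Gamma_integral_cpw: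
  assumes u: "Re u > 0" and c: "c > 0"
  shows "integrable lborel (\<lambda>y. ipos y *\<^sub>R (cpw y u * of_real (exp (- (c * y)))))"
    and "(LBINT y. ipos y *\<^sub>R (cpw y u * of_real (exp (- (c * y))))) = Gamma u * of_real c powr (- u)"
proof -
  let ?f = "\<lambda>y. ipos y *\<^sub>R (cpw y u * of_real (exp (- y)))"
  have m: "?f \<in> borel_measurable lborel" by measurable
  have eq: "cpw y u * of_real (exp (- y)) = of_real y powr (u - 1) / of_real (exp y)" if "y > 0" for y
    using cpw_eq_powr[OF that] by (simp add: exp_minus field_simps)
  have abs: "(\<lambda>t. of_real t powr (u - 1) / of_real (exp t)) absolutely_integrable_on {0<..}"
    by (rule absolutely_integrable_Gamma_integral'[OF u])
  have feq: "?f = (\<lambda>y. ipos y *\<^sub>R (of_real y powr (u - 1) / of_real (exp y)))"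
    using eq by (auto simp: fun_eq_iff indicator_def)
  have "integrable lebesgue ?f" using abs unfolding feq set_integrable_def .
  hence f1: "integrable lborel ?f" using integrable_completion[OF m] by simp
  have "(LBINT y. ?f y) = (\<integral>y. ?f y \<partial>lebesgue)" by (rule integral_completion[OF m, symmetric])
  also have "... = integral {0<..} (\<lambda>t. of_real t powr (u - 1) / of_real (exp t))"
    using set_lebesgue_integral_eq_integral(2)[OF abs] unfolding feq set_lebesgue_integral_def .
  also have "... = Gamma u" using Gamma_integral_complex'[OF u] by (rule integral_unique)
  finally have f2: "(LBINT y. ?f y) = Gamma u" .
  have sc: "?f (0 + c * y) = cpw c u * (ipos y *\<^sub>R (cpw y u * of_real (exp (- (c * y)))))" for y
    using c by (auto simp: indicator_def zero_less_mult_iff cpw_mult)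
  have cn: "cpw c u \<noteq> 0" by (simp add: cpw_def)
  have "integrable lborel (\<lambda>y. ?f (0 + c * y))"
    by (rule lborel_integrable_real_affine[OF f1]) (use c in auto)
  thus "integrable lborel (\<lambda>y. ipos y *\<^sub>R (cpw y u * of_real (exp (- (c * y)))))"
  proof -
    assume "integrable lborel (\<lambda>y. ?f (0 + c * y))"
    hence "integrable lborel (\<lambda>y. (1 / cpw c u) * ?f (0 + c * y))" by (rule integrable_mult_right)
    thus ?thesis unfolding sc using cn by (simp only: mult.assoc[symmetric]) simp
  qed
  have "Gamma u = \<bar>c\<bar> *\<^sub>R (LBINT y. ?f (0 + c * y))"
    using lborel_integral_real_affine[of c ?f 0] c f2 by simp
  also have "(LBINT y. ?f (0 + c * y)) = cpw c u * (LBINT y. ipos y *\<^sub>R (cpw y u * of_real (exp (- (c * y)))))"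
    unfolding sc by (rule integral_mult_right_zero)
  finally have "Gamma u = (of_real c * cpw c u) * (LBINT y. ipos y *\<^sub>R (cpw y u * of_real (exp (- (c * y)))))"
    using c by (simp add: scaleR_conv_of_real mult.assoc)
  moreover have "of_real c * cpw c u * of_real c powr (- u) = 1"
    using c by (simp add: cpw_def powr_def Ln_of_real exp_of_real[symmetric] exp_add[symmetric] algebra_simps)
       (simp add: exp_minus exp_diff exp_of_real)
  ultimately show "(LBINT y. ipos y *\<^sub>R (cpw y u * of_real (exp (- (c * y))))) = Gamma u * of_real c powr (- u)"
    by (simp add: mult_ac)
qed

lemma Gamma_integral_powr:
  fixes u c :: real
  assumes u: "u > 0" and c: "c > 0"
  shows "integrable lborel (\<lambda>y. ipos y * (y powr (u - 1) * exp (- (c * y))))"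
    and "(LBINT y. ipos y * (y powr (u - 1) * exp (- (c * y)))) = Gamma u * c powr (- u)"
proof -
  have eq: "ipos y *\<^sub>R (cpw y (of_real u) * of_real (exp (- (c * y)))) =
      complex_of_real (ipos y * (y powr (u - 1) * exp (- (c * y))))" for y
    by (cases "y > 0") (auto simp: cpw_def powr_def exp_of_real[symmetric])
  have re: "Re (complex_of_real u) > 0" using u by simp
  note G = Gamma_integral_cpw[OF re c, unfolded eq]
  show "integrable lborel (\<lambda>y. ipos y * (y powr (u - 1) * exp (- (c * y))))"
    using integrable_Re[OF G(1)] by simp
  have "complex_of_real (LBINT y. ipos y * (y powr (u - 1) * exp (- (c * y)))) = Gamma (of_real u) * of_real c powr (- of_real u)"
    unfolding integral_complex_of_real[symmetric] by (rule G(2))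
  also have "... = of_real (Gamma u * c powr (- u))"
    using c powr_of_real[of c "- u"] by (simp add: Gamma_complex_of_real)
  finally show "(LBINT y. ipos y * (y powr (u - 1) * exp (- (c * y)))) = Gamma u * c powr (- u)"
    by (simp only: of_real_eq_iff)
qed

text \<open>The weight is expanded in powers of \<open>u - 1\<close> and integrated term by term.
  The exponential moments in \<open>|ln y|\<close>, taken with \<open>R = |u - 1|\<close>, justify
  this for every \<open>u\<close>, so the resulting power series converges everywhere.\<close>

lemma mellin_entire:
  fixes g :: "real \<Rightarrow> complex"
  assumes g [measurable]: "g \<in> borel_measurable borel"
    and int: "\<And>R. R \<ge> 0 \<Longrightarrow> integrable lborel (\<lambda>y. norm (g y) * exp (R * \<bar>ln y\<bar>))"
  shows "(\<lambda>u. LBINT y. g y * cpw y u) holomorphic_on UNIV"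
proof -
  let ?r = "\<lambda>(v::complex) y. norm v * \<bar>ln y\<bar>"
  define c where "c j = (LBINT y. g y * of_real (ln y ^ j / fact j))" for j
  have main: "summable (\<lambda>j. c j * v ^ j) \<and> (LBINT y. g y * cpw y (v + 1)) = (\<Sum>j. c j * v ^ j)" for v :: complex
  proof -
    define f where "f j y = g y * (of_real (ln y ^ j / fact j) * v ^ j)" for j y
    have nf: "norm (f j y) = norm (g y) * ((?r v y) ^ j / fact j)" for j y
      by (simp add: f_def norm_mult norm_divide norm_power power_mult_distrib mult_ac power_abs)
    have es: "(\<lambda>j. (?r v y) ^ j / fact j) sums exp (?r v y)" for y
      using exp_converges[of "?r v y"] by (simp add: divide_inverse mult_ac)
    have nfs: "(\<lambda>j. norm (f j y)) sums (norm (g y) * exp (?r v y))" for y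
      unfolding nf by (intro sums_mult es)
    have nfle: "norm (f j y) \<le> norm (g y) * exp (?r v y)" for j y
      using sum_le_suminf[of "\<lambda>j. norm (f j y)" "{j}"] nfs[of y] by (simp add: sums_iff)
    have I: "integrable lborel (\<lambda>y. norm (g y) * exp (?r v y))" by (rule int) simp
    have m: "f j \<in> borel_measurable lborel" for j unfolding f_def by measurable
    have fi: "integrable lborel (f j)" for j
      by (rule Bochner_Integration.integrable_bound[OF I m]) (auto intro!: AE_I2 order.trans[OF nfle])
    have sn: "summable (\<lambda>j. LBINT y. norm (f j y))"
    proof (rule summableI_nonneg_bounded[where x = "\<integral>y. norm (g y) * exp (?r v y) \<partial>lborel"])
      fix n
      have "(\<Sum>j<n. LBINT y. norm (f j y)) = (LBINT y. (\<Sum>j<n. norm (f j y)))"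
        using fi by (subst Bochner_Integration.integral_sum) auto
      also have "... \<le> (LBINT y. norm (g y) * exp (?r v y))"
      proof (rule integral_mono[OF _ I])
        show "integrable lborel (\<lambda>y. \<Sum>j<n. norm (f j y))" using fi by auto
        fix y
        show "(\<Sum>j<n. norm (f j y)) \<le> norm (g y) * exp (?r v y)"
          using sum_le_suminf[of "\<lambda>j. norm (f j y)" "{..<n}"] nfs[of y] by (simp add: sums_iff)
      qed
      finally show "(\<Sum>j<n. LBINT y. norm (f j y)) \<le> (LBINT y. norm (g y) * exp (?r v y))" .
    qed simp
    have fc: "(LBINT y. f j y) = c j * v ^ j" for j
      unfolding f_def c_def mult.assoc[symmetric] by (rule integral_mult_left_zero)
    have S: "(\<lambda>j. c j * v ^ j) sums (LBINT y. (\<Sum>j. f j y))"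
      unfolding fc[symmetric]
      by (rule sums_integral[OF fi _ sn]) (use nfs in \<open>auto intro!: AE_I2 simp: sums_iff\<close>)
    have "(\<Sum>j. f j y) = g y * cpw y (v + 1)" for y
    proof -
      have "(\<lambda>j. of_real (ln y ^ j / fact j) * v ^ j) sums exp (v * of_real (ln y))"
        using exp_converges[of "v * of_real (ln y)"]
        by (simp add: scaleR_conv_of_real power_mult_distrib divide_inverse mult_ac)
      from sums_mult[OF this, of "g y"] show ?thesis unfolding f_def cpw_def by (simp add: sums_iff)
    qed
    thus ?thesis using S by (simp add: sums_iff)
  qed
  have "((\<lambda>v. \<Sum>j. c j * v ^ j) has_field_derivative (\<Sum>j. diffs c j * v ^ j)) (at v)" for v
    by (rule termdiffs_strong_converges_everywhere) (use main in blast)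
  hence "(\<lambda>v. \<Sum>j. c j * v ^ j) holomorphic_on UNIV"
    by (meson field_differentiable_def field_differentiable_at_within holomorphic_on_def)
  moreover have "(\<lambda>u::complex. u - 1) holomorphic_on UNIV" by (intro holomorphic_intros)
  ultimately have "((\<lambda>v. \<Sum>j. c j * v ^ j) \<circ> (\<lambda>u. u - 1)) holomorphic_on UNIV"
    by (intro holomorphic_on_compose_gen) auto
  hence "(\<lambda>u. (\<lambda>v. \<Sum>j. c j * v ^ j) (u - 1)) holomorphic_on UNIV" by (simp only: o_def)
  also have "(\<lambda>u. (\<lambda>v. \<Sum>j. c j * v ^ j) (u - 1)) = (\<lambda>u. LBINT y. g y * cpw y u)"
  proof
    fix u
    show "(\<Sum>j. c j * (u - 1) ^ j) = (LBINT y. g y * cpw y u)" using main[of "u - 1"] by simp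
  qed
  finally show ?thesis .
qed

section \<open>The Mellin transform along the imaginary half-axis\<close>

context
  fixes k :: nat and F :: "complex \<Rightarrow> complex"
  assumes F: "cusp_form (2*k) F"
begin

definition axis_int :: "complex \<Rightarrow> complex" where
  "axis_int u = (LBINT y. ipos y *\<^sub>R (F (\<i> * of_real y) * cpw y u))"

lemma axis_measurable: "(\<lambda>y. F (\<i> * complex_of_real y)) \<in> borel_measurable borel"
proof -
  have "(\<lambda>y. \<i> * complex_of_real y) \<in> borel_measurable borel" by measurable
  thus ?thesis using cusp_form_measurable[OF F] by measurable
qed

lemma axis_inv: "y > 0 \<Longrightarrow> F (\<i> * of_real (1 / y)) = (-1)^k * of_real (y ^ (2*k)) * F (\<i> * of_real y)"
proof -
  assume y: "y > 0"
  have "-1 / (\<i> * of_real y) = \<i> * of_real (1 / y)" using y by (simp add: complex_eq_iff Re_divide Im_divide power2_eq_square)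
  moreover have "(\<i> * of_real y) ^ (2*k) = (-1)^k * complex_of_real (y ^ (2*k))"
    using power_minus[of "(complex_of_real y)^2" k] by (simp add: power_mult_distrib power_mult)
  ultimately show ?thesis using cusp_form_inv[OF F, of "\<i> * of_real y"] y by simp
qed

text \<open>For \<open>y >= 1\<close> the exponential decay dominates \<open>y powr R\<close>. Below
  1 the inversion \<open>y \<mapsto> 1 / y\<close> transports the same decay to the origin, at the
  price of a power of \<open>1 / y\<close>.\<close>

lemma axis_decay:
  assumes "R \<ge> 0"
  shows "integrable lborel (\<lambda>y. norm (ipos y *\<^sub>R F (\<i> * of_real y)) * exp (R * \<bar>ln y\<bar>))"
proof -
  let ?f = "\<lambda>y. ipos y *\<^sub>R F (\<i> * of_real y)"
  obtain M where M: "M > 0" "\<And>z. Im z \<ge> 1 \<Longrightarrow> norm (F z) \<le> M * exp (- 2 * pi * Im z)"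
    using cusp_form_decay[OF F, of 1] by auto
  \<comment> \<open>A natural exponent above \<open>2 * k + R\<close>, so that the power produced by
    the inversion is bounded by \<open>fact m * exp v\<close>.\<close>
  obtain m :: nat where m: "real m \<ge> 2 * real k + R" using real_arch_simple by blast
  let ?h = "\<lambda>y. indicator {0..1} y * (M * fact m) + M * (ipos y * (y powr ((R + 1) - 1) * exp (- (2 * pi * y))))"
  have hi: "integrable lborel ?h"
    by (intro Bochner_Integration.integrable_add integrable_mult_right integrable_mult_left Gamma_integral_powr(1))
       (use assms in auto)
  have [measurable]: "(\<lambda>y. F (\<i> * complex_of_real y)) \<in> borel_measurable borel" by (rule axis_measurable)
  show ?thesis
  proof (rule Bochner_Integration.integrable_bound[OF hi])
    show "(\<lambda>y. norm (?f y) * exp (R * \<bar>ln y\<bar>)) \<in> borel_measurable lborel" by measurable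
    have "norm (?f y) * exp (R * \<bar>ln y\<bar>) \<le> ?h y" for y
    proof (cases "y > 0")
      case y: True
      have G0: "0 \<le> M * (y powr ((R + 1) - 1) * exp (- (2 * pi * y)))" using M by simp
      show ?thesis
      proof (cases "y \<ge> 1")
        case True
        hence "exp (R * \<bar>ln y\<bar>) = y powr ((R + 1) - 1)" using y by (simp add: powr_def)
        moreover have "norm (F (\<i> * of_real y)) \<le> M * exp (- (2 * pi * y))" using M(2)[of "\<i> * of_real y"] True by simp
        hence "norm (F (\<i> * of_real y)) * y powr ((R + 1) - 1) \<le> M * exp (- (2 * pi * y)) * y powr ((R + 1) - 1)"
          by (intro mult_right_mono) auto
        ultimately have "norm (?f y) * exp (R * \<bar>ln y\<bar>)
            \<le> M * (ipos y * (y powr ((R + 1) - 1) * exp (- (2 * pi * y))))"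
          using y by (simp add: mult_ac)
        moreover have "0 \<le> indicator {0..1} y * (M * fact m)" using M by simp
        ultimately show ?thesis by linarith
      next
        case False
        hence ly: "ln y \<le> 0" using y by simp
        define v where "v = 1 / y"
        have v: "v \<ge> 1" "v > 0" using False y by (auto simp: v_def)
        have ev: "exp (R * \<bar>ln y\<bar>) = v powr R" using ly y by (simp add: powr_def v_def ln_div)
        have "F (\<i> * of_real y) = (-1)^k * of_real (v ^ (2*k)) * F (\<i> * of_real v)"
          using axis_inv[of v] v by (simp add: v_def)
        hence "norm (F (\<i> * of_real y)) = v powr (2 * real k) * norm (F (\<i> * of_real v))"
          using v powr_realpow[of v "2*k"] by (simp add: norm_mult norm_power)
        also have "... \<le> v powr (2 * real k) * (M * exp (- (2 * pi * v)))"
          using M(2)[of "\<i> * of_real v"] v by (intro mult_left_mono) auto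
        finally have "norm (F (\<i> * of_real y)) * exp (R * \<bar>ln y\<bar>) \<le> v powr (2 * real k) * (M * exp (- (2 * pi * v))) * v powr R"
          unfolding ev by (intro mult_right_mono) auto
        also have "... = M * (v powr (2 * real k + R) * exp (- (2 * pi * v)))" by (simp add: powr_add mult_ac)
        also have "... \<le> M * (fact m * exp v * exp (- (2 * pi * v)))"
        proof (intro mult_left_mono mult_right_mono)
          have "v powr (2 * real k + R) \<le> v powr real m" using m v by (intro powr_mono) auto
          also have "... = v ^ m" using v by (simp add: powr_realpow)
          also have "... \<le> fact m * exp v" by (rule power_le_fact_exp) (use v in simp)
          finally show "v powr (2 * real k + R) \<le> fact m * exp v" .
        qed (use M in auto)
        also have "... \<le> M * (fact m * 1)"
        proof -
          have "exp v * exp (- (2 * pi * v)) = exp (- ((2 * pi - 1) * v))" by (simp add: exp_add[symmetric] algebra_simps)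
          also have "... \<le> 1" using v pi_gt3 by simp
          finally show ?thesis using M by (simp add: mult.assoc)
        qed
        finally show ?thesis using False y G0 by (simp add: indicator_def)
      qed
    qed (use M in simp)
    moreover have "0 \<le> norm (?f y) * exp (R * \<bar>ln y\<bar>)" for y by simp
    ultimately show "AE y in lborel. norm (norm (?f y) * exp (R * \<bar>ln y\<bar>)) \<le> norm (?h y)"
      by (intro AE_I2) (smt (verit) real_norm_def)
  qed
qed

lemma axis_int_integrable: "integrable lborel (\<lambda>y. ipos y *\<^sub>R (F (\<i> * of_real y) * cpw y u))"
proof (rule Bochner_Integration.integrable_bound[OF axis_decay[of "norm (u - 1)"]])
  have [measurable]: "(\<lambda>y. F (\<i> * complex_of_real y)) \<in> borel_measurable borel" by (rule axis_measurable)
  show "(\<lambda>y. ipos y *\<^sub>R (F (\<i> * of_real y) * cpw y u)) \<in> borel_measurable lborel" by measurable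
  show "AE y in lborel. norm (ipos y *\<^sub>R (F (\<i> * of_real y) * cpw y u))
     \<le> norm (norm (ipos y *\<^sub>R F (\<i> * of_real y)) * exp (norm (u - 1) * \<bar>ln y\<bar>))"
  proof (rule AE_I2)
    fix y
    have "norm (cpw y u) \<le> exp (norm ((u - 1) * of_real (ln y)))" unfolding cpw_def by (rule norm_exp)
    also have "norm ((u - 1) * of_real (ln y)) = norm (u - 1) * \<bar>ln y\<bar>" by (simp add: norm_mult)
    finally have "norm (F (\<i> * of_real y)) * norm (cpw y u) \<le> norm (F (\<i> * of_real y)) * exp (norm (u - 1) * \<bar>ln y\<bar>)"
      by (intro mult_left_mono) auto
    thus "norm (ipos y *\<^sub>R (F (\<i> * of_real y) * cpw y u))
     \<le> norm (norm (ipos y *\<^sub>R F (\<i> * of_real y)) * exp (norm (u - 1) * \<bar>ln y\<bar>))"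
      by (simp add: norm_mult indicator_def)
  qed
qed simp

lemma axis_int_entire: "axis_int holomorphic_on UNIV"
proof -
  have [measurable]: "(\<lambda>y. F (\<i> * complex_of_real y)) \<in> borel_measurable borel" by (rule axis_measurable)
  have "(\<lambda>u. LBINT y. (ipos y *\<^sub>R F (\<i> * of_real y)) * cpw y u) holomorphic_on UNIV"
    by (rule mellin_entire[OF _ axis_decay]) measurable
  thus ?thesis by (simp add: axis_int_def[abs_def])
qed

text \<open>The mean square of the coefficients is controlled by Bessel's inequality on the lines
  \<open>Im z = 2 ^ (- j)\<close>: the one with \<open>2 ^ j \<le> n < 2 ^ (j + 1)\<close> takes care of \<open>n\<close>.\<close>
lemma coeff_square_summable:
  assumes v: "v > 2 * real k"
  shows "summable (\<lambda>n. (norm (fourier_coeff F n))\<^sup>2 * real n powr (- v))"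
proof -
  let ?a = "fourier_coeff F"
  obtain B where B: "B > 0" "\<And>z. z \<in> HH \<Longrightarrow> Im z ^ k * norm (F z) \<le> B" using cusp_form_bounded[OF F] by blast
  define b where "b j n = (norm (?a n))\<^sup>2 * exp (- 4 * pi * real n * (1 / 2 ^ j))" for j n
  define r where "r = 2 powr (2 * real k - v)"
  have r: "0 < r" "r < 1" using v by (auto simp: r_def powr_less_one)
  have b0: "b j n \<ge> 0" for j n by (simp add: b_def)
  have bes: "(\<Sum>n<N. b j n) \<le> B\<^sup>2 * 2 ^ (2 * k * j)" for N j
  proof -
    have "norm (F (Complex x (1 / 2 ^ j))) \<le> B * 2 ^ (k * j)" for x
      using B(2)[of "Complex x (1 / 2 ^ j)"] by (simp add: power_divide divide_simps power_mult[symmetric] mult.commute)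
    note bes = bessel[OF cusp_form_fourier[OF F] _ this]
    have "(\<Sum>n<N. b j n) \<le> (\<Sum>n. b j n)"
      unfolding b_def by (rule sum_le_suminf[OF bes(2)]) auto
    also have "... \<le> (B * 2 ^ (k * j))\<^sup>2" unfolding b_def by (rule bes(1)) simp
    finally show ?thesis by (simp add: power_mult_distrib power_mult[symmetric] mult_ac)
  qed
  \<comment> \<open>Undoes the damping on the line of height \<open>1 / 2 ^ j\<close>: for
    \<open>n < 2 ^ (j + 1)\<close> the exponent there is at most \<open>8 * pi\<close>.\<close>
  let ?K = "exp (8 * pi)"
  have pt: "(norm (?a n))\<^sup>2 * real n powr (- v) \<le> (\<Sum>j<N. ?K * 2 powr (- v * real j) * b j n)" if n: "n < N" for n N
  proof (cases "n = 0")
    case False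
    obtain j where j: "2 ^ j \<le> n" "n < 2 ^ (j + 1)" using ex_power_ivl1[of 2 n] False by auto
    have jN: "j < N" using j(1) n less_exp[of j] by linarith
    have "real n powr (- v) \<le> (2 ^ j) powr (- v)"
      using j(1) v by (intro powr_mono2') (auto simp: of_nat_le_iff[of "2 ^ j", where 'a = real, simplified])
    also have "(2 ^ j :: real) powr (- v) = 2 powr (- v * real j)"
      by (simp add: powr_realpow[symmetric] powr_powr mult.commute)
    finally have 1: "real n powr (- v) \<le> 2 powr (- v * real j)" .
    have "real n < 2 ^ (j + 1)" using j(2) by (metis of_nat_less_iff of_nat_numeral of_nat_power)
    hence "4 * pi * real n * (1 / 2 ^ j) \<le> 8 * pi" by (simp add: divide_simps)
    hence 2: "1 \<le> ?K * exp (- 4 * pi * real n * (1 / 2 ^ j))" by (simp add: exp_add[symmetric])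
    have "(norm (?a n))\<^sup>2 * real n powr (- v) * 1 \<le> (norm (?a n))\<^sup>2 * 2 powr (- v * real j) * (?K * exp (- 4 * pi * real n * (1 / 2 ^ j)))"
      by (intro mult_mono mult_left_mono 1 2) auto
    also have "... = ?K * 2 powr (- v * real j) * b j n" by (simp add: b_def)
    also have "... \<le> (\<Sum>j<N. ?K * 2 powr (- v * real j) * b j n)"
      by (rule member_le_sum[of j "{..<N}" "\<lambda>j. ?K * 2 powr (- v * real j) * b j n"]) (use jN b0 in auto)
    finally show ?thesis by simp
  qed (use b0 in \<open>auto intro!: sum_nonneg\<close>)
  show ?thesis
  proof (rule summableI_nonneg_bounded[where x = "?K * B\<^sup>2 * (1 / (1 - r))"])
    fix N
    have "(\<Sum>n<N. (norm (?a n))\<^sup>2 * real n powr (- v)) \<le> (\<Sum>n<N. \<Sum>j<N. ?K * 2 powr (- v * real j) * b j n)"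
      by (rule sum_mono) (use pt in auto)
    also have "... = (\<Sum>j<N. ?K * 2 powr (- v * real j) * (\<Sum>n<N. b j n))"
      by (subst sum.swap) (simp only: sum_distrib_left)
    also have "... \<le> (\<Sum>j<N. ?K * 2 powr (- v * real j) * (B\<^sup>2 * 2 ^ (2 * k * j)))"
      by (intro sum_mono mult_left_mono bes) auto
    also have "... = ?K * B\<^sup>2 * (\<Sum>j<N. r ^ j)"
    proof -
      have e: "r ^ j = 2 powr (- v * real j) * 2 ^ (2 * k * j)" for j
        by (simp add: r_def powr_realpow[symmetric] powr_powr powr_add[symmetric] algebra_simps)
      show ?thesis unfolding e sum_distrib_left by (rule sum.cong) simp_all
    qed
    also have "... \<le> ?K * B\<^sup>2 * (1 / (1 - r))"
      using sum_le_suminf[of "\<lambda>j. r ^ j" "{..<N}"] r by (intro mult_left_mono) (auto simp: suminf_geometric)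
    finally show "(\<Sum>n<N. (norm (?a n))\<^sup>2 * real n powr (- v)) \<le> ?K * B\<^sup>2 * (1 / (1 - r))" .
  qed simp
qed

text \<open>Cauchy-Schwarz in the form \<open>x y <= x^2 + y^2\<close>. With the mean square in
  place of pointwise bounds for the coefficients it already reaches the half-plane that corresponds
  to \<open>Re s > 1\<close> after normalisation.\<close>

lemma coeff_dirichlet_summable:
  assumes u: "u > real k + 1/2"
  shows "summable (\<lambda>n. norm (fourier_coeff F n) * real n powr (- u))"
proof -
  \<comment> \<open>With this \<open>v\<close> the two requirements \<open>v > 2 * k\<close> and
    \<open>2 * u - v > 1\<close> both become the hypothesis \<open>u > k + 1/2\<close>.\<close>
  define v where "v = u + real k - 1/2"
  let ?x = "\<lambda>n. norm (fourier_coeff F n) * real n powr (- v / 2)" and ?y = "\<lambda>n. real n powr (v / 2 - u)"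
  have "summable (\<lambda>n. real n powr (v - 2 * u))" using u by (subst summable_real_powr_iff) (simp add: v_def)
  hence s: "summable (\<lambda>n. (norm (fourier_coeff F n))\<^sup>2 * real n powr (- v) + real n powr (v - 2 * u))"
    using coeff_square_summable[of v] u by (intro summable_add) (auto simp: v_def)
  have "norm (fourier_coeff F n) * real n powr (- u) \<le> (norm (fourier_coeff F n))\<^sup>2 * real n powr (- v) + real n powr (v - 2 * u)" for n
  proof -
    have e: "norm (fourier_coeff F n) * real n powr (- u) = ?x n * ?y n" by (simp add: powr_add[symmetric])
    have "0 \<le> ?x n * ?y n" by simp
    hence "?x n * ?y n \<le> (?x n)\<^sup>2 + (?y n)\<^sup>2"
      using sum_squares_bound[of "?x n" "?y n"] unfolding mult.assoc[of 2] by linarith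
    also have "... = (norm (fourier_coeff F n))\<^sup>2 * real n powr (- v) + real n powr (v - 2 * u)"
      by (simp add: power_mult_distrib power2_eq_square[of "_ powr _"] powr_add[symmetric])
    finally show ?thesis unfolding e .
  qed
  thus ?thesis by (intro summable_comparison_test'[OF s, of 0]) simp
qed

text \<open>Each Fourier term contributes one gamma integral. Its norm integral is the same integral
  at \<open>Re u\<close>, so the interchange needs exactly the absolute convergence of the Dirichlet
  series.\<close>

lemma axis_int_dirichlet:
  assumes u: "Re u > real k + 1/2"
  shows "(\<lambda>n. fourier_coeff F n * of_nat n powr (- u)) sums (axis_int u * of_real (2 * pi) powr u / Gamma u)"
proof -
  let ?G = "\<lambda>n. Gamma u * of_real (2 * pi * real n) powr (- u)"
  let ?a = "fourier_coeff F"
  note FF = cusp_form_fourier[OF F]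
  have u0: "Re u > 0" using u by simp
  define f where "f n y = ?a n * (ipos y *\<^sub>R (cpw y u * of_real (exp (- (2 * pi * real n * y)))))" for n y
  have fi: "integrable lborel (f n) \<and> (LBINT y. f n y) = ?a n * (?G n)
      \<and> (LBINT y. norm (f n y)) = norm (?a n) * (Gamma (Re u) * (2 * pi * real n) powr (- Re u))" for n
  proof (cases "n = 0")
    case True
    thus ?thesis using cusp_form_coeff_0[OF F] by (simp add: f_def[abs_def])
  next
    case False
    hence c: "2 * pi * real n > 0" by simp
    have nf: "norm (f n y) = norm (?a n) * (ipos y * (y powr (Re u - 1) * exp (- (2 * pi * real n * y))))" for y
      by (cases "y > 0") (auto simp: f_def norm_mult norm_cpw)
    have fe: "f n = (\<lambda>y. ?a n * (ipos y *\<^sub>R (cpw y u * of_real (exp (- (2 * pi * real n * y))))))"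
      by (simp add: f_def fun_eq_iff)
    have 1: "integrable lborel (f n)" unfolding fe by (rule integrable_mult_right[OF Gamma_integral_cpw(1)[OF u0 c]])
    have 2: "(LBINT y. f n y) = ?a n * (?G n)"
      unfolding fe by (subst integral_mult_right_zero) (simp only: Gamma_integral_cpw(2)[OF u0 c])
    have 3: "(LBINT y. norm (f n y)) = norm (?a n) * (Gamma (Re u) * (2 * pi * real n) powr (- Re u))"
      unfolding nf by (subst integral_mult_right_zero) (simp only: Gamma_integral_powr(2)[OF u0 c])
    show ?thesis using 1 2 3 by blast
  qed
  have eqn: "norm (?a n) * (Gamma (Re u) * (2 * pi * real n) powr (- Re u)) = (Gamma (Re u) * (2 * pi) powr (- Re u)) * (norm (?a n) * real n powr (- Re u))" for n
    by (simp add: powr_mult mult_ac)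
  have sn: "summable (\<lambda>n. LBINT y. norm (f n y))"
    using fi by (simp only: eqn) (rule summable_mult[OF coeff_dirichlet_summable[OF u]])
  have pt: "summable (\<lambda>n. norm (f n y))" for y
  proof (cases "y > 0")
    case True
    have "summable (\<lambda>n. norm (cpw y u) * (norm (?a n) * exp (- 2 * pi * real n * y)))"
      by (rule summable_mult[OF fourier_abs_summable[OF FF True]])
    thus ?thesis using True by (simp add: f_def norm_mult mult_ac)
  qed (simp add: f_def)
  have S: "(\<lambda>n. LBINT y. f n y) sums (LBINT y. (\<Sum>n. f n y))"
    by (rule sums_integral[OF _ _ sn]) (use fi pt in auto)
  have "(\<Sum>n. f n y) = ipos y *\<^sub>R (F (\<i> * of_real y) * cpw y u)" for y
  proof (cases "y > 0")
    case True
    have "(\<lambda>n. ?a n * e (of_nat n * (\<i> * of_real y))) sums F (\<i> * of_real y)"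
      using fourier_sums[OF FF, of "\<i> * of_real y"] True by simp
    hence "(\<lambda>n. ?a n * e (of_nat n * (\<i> * of_real y)) * cpw y u) sums (F (\<i> * of_real y) * cpw y u)" by (rule sums_mult2)
    moreover have "?a n * e (of_nat n * (\<i> * of_real y)) * cpw y u = f n y" for n
      using True by (simp add: f_def e_def exp_of_real[symmetric] algebra_simps)
    ultimately show ?thesis using True by (simp add: sums_iff)
  qed (simp add: f_def)
  hence "(LBINT y. (\<Sum>n. f n y)) = axis_int u" unfolding axis_int_def by (simp only:)
  with S have "(\<lambda>n. ?a n * (?G n)) sums axis_int u"
    using fi by simp
  hence "(\<lambda>n. ?a n * (?G n) * (of_real (2 * pi) powr u / Gamma u)) sums (axis_int u * (of_real (2 * pi) powr u / Gamma u))"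
    by (rule sums_mult2)
  also have "(\<lambda>n. ?a n * (?G n) * (of_real (2 * pi) powr u / Gamma u)) = (\<lambda>n. ?a n * of_nat n powr (- u))"
  proof
    fix n
    have G: "Gamma u \<noteq> 0" using u0 by (auto simp: Gamma_eq_zero_iff elim!: nonpos_Ints_cases)
    have "complex_of_real (2 * pi * real n) powr (- u) = of_real (2 * pi) powr (- u) * of_nat n powr (- u)"
    proof -
      have "(complex_of_real (2 * pi) * of_real (real n)) powr (- u) = of_real (2 * pi) powr (- u) * of_real (real n) powr (- u)"
        by (rule powr_times_real) auto
      thus ?thesis by simp
    qed
    moreover have "complex_of_real (2 * pi) powr (- u) * of_real (2 * pi) powr u = 1"
      by (simp add: powr_def exp_add[symmetric])
    ultimately show "?a n * (?G n) * (of_real (2 * pi) powr u / Gamma u) = ?a n * of_nat n powr (- u)"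
      using G by (simp add: field_simps)
  qed
  finally show ?thesis by simp
qed

text \<open>The entire function \<open>axis_int\<close>, shifted by \<open>k - 1/2\<close> and
  multiplied by an exponential and the entire reciprocal gamma function, continues the Dirichlet
  series. By the identity theorem it is the only continuation, so it is the object selected in
  \<open>L_function\<close>. At \<open>s = 1/2\<close> the shifted argument is \<open>k\<close>,
  where the gamma factor is \<open>fact (k - 1)\<close>.\<close>

theorem L_function_half:
  assumes k: "k \<ge> 1"
  shows "axis_int (of_nat k) = fact (k - 1) / of_real (2 * pi) ^ k * L_function (2*k) F (1/2)"
proof -
  let ?a = "fourier_coeff F"
  define sh where "sh s = s + of_real (real k - 1/2)" for s :: complex
  define L where "L s = axis_int (sh s) * of_real (2 * pi) powr (sh s) * rGamma (sh s)" for s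
  have holL: "L holomorphic_on UNIV"
  proof -
    have sh: "sh holomorphic_on UNIV" unfolding sh_def[abs_def] by (intro holomorphic_intros)
    have 1: "(\<lambda>s. axis_int (sh s)) holomorphic_on UNIV"
      using holomorphic_on_compose_gen[OF sh axis_int_entire subset_UNIV] by (simp add: o_def)
    have 2: "(\<lambda>s. rGamma (sh s)) holomorphic_on UNIV"
      using holomorphic_on_compose_gen[OF sh holomorphic_rGamma[of UNIV] subset_UNIV] by (simp add: o_def)
    have "(\<lambda>s. complex_of_real (2 * pi) powr (sh s)) = (\<lambda>s. exp (sh s * Ln (of_real (2 * pi))))"
      by (simp add: powr_def)
    hence 3: "(\<lambda>s. complex_of_real (2 * pi) powr (sh s)) holomorphic_on UNIV"
      by (simp only:) (intro holomorphic_intros sh)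
    show ?thesis unfolding L_def[abs_def] by (intro holomorphic_on_mult 1 2 3)
  qed
  have sumsL: "(\<lambda>n. hecke_coeff (2*k) F (Suc n) * of_nat (Suc n) powr (- s)) sums L s" if s: "Re s > 1" for s
  proof -
    have "Re (sh s) > real k + 1/2" using s by (simp add: sh_def)
    from axis_int_dirichlet[OF this]
    have "(\<lambda>n. ?a n * of_nat n powr (- sh s)) sums L s" by (simp add: L_def Gamma_def divide_inverse)
    hence "(\<lambda>n. ?a (Suc n) * of_nat (Suc n) powr (- sh s)) sums L s"
      using sums_Suc_iff[of "\<lambda>n. ?a n * of_nat n powr (- sh s)" "L s"] by simp
    also have "(\<lambda>n. ?a (Suc n) * of_nat (Suc n) powr (- sh s)) = (\<lambda>n. hecke_coeff (2*k) F (Suc n) * of_nat (Suc n) powr (- s))"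
    proof
      fix n
      have "(of_nat (Suc n) :: complex) powr (- sh s) = of_nat (Suc n) powr (- s) * of_nat (Suc n) powr (of_real (- (real k - 1/2)))"
        unfolding sh_def by (subst powr_add[symmetric]) (simp add: algebra_simps)
      also have "(of_nat (Suc n) :: complex) powr (of_real (- (real k - 1/2))) = of_real (real (Suc n) powr (- (real k - 1/2)))"
        using powr_of_real[of "real (Suc n)" "- (real k - 1/2)"] by simp
      also have "real (Suc n) powr (- (real k - 1/2)) = 1 / real (Suc n) powr ((real (2*k) - 1) / 2)"
      proof -
        have "(real (2*k) - 1) / 2 = real k - 1/2" by (simp add: field_simps)
        thus ?thesis by (simp only: powr_minus inverse_eq_divide)
      qed
      finally show "?a (Suc n) * of_nat (Suc n) powr (- sh s) = hecke_coeff (2*k) F (Suc n) * of_nat (Suc n) powr (- s)"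
        unfolding hecke_coeff_def by (simp add: mult_ac del: of_nat_Suc)
    qed
    finally show ?thesis .
  qed
  have "L_function (2*k) F = L"
    unfolding L_function_def
  proof (rule the_equality)
    show "L holomorphic_on UNIV \<and> (\<forall>s. 1 < Re s \<longrightarrow> (\<lambda>n. hecke_coeff (2*k) F (Suc n) * of_nat (Suc n) powr (- s)) sums L s)"
      using holL sumsL by blast
    fix L' assume L': "L' holomorphic_on UNIV \<and> (\<forall>s. 1 < Re s \<longrightarrow> (\<lambda>n. hecke_coeff (2*k) F (Suc n) * of_nat (Suc n) powr (- s)) sums L' s)"
    have eq: "L' s = L s" if "s \<in> {s. Re s > 1}" for s
      using that L' sumsL sums_unique2 by blast
    have "L' s = L s" for s
    proof (rule analytic_continuation_open[of "{s. Re s > 1}" UNIV L' L s])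
      show "open {s. 1 < Re s}" by (rule open_halfspace_Re_gt)
      have "(2 :: complex) \<in> {s. 1 < Re s}" by simp
      thus "{s. 1 < Re s} \<noteq> {}" by blast
    qed (use L' holL eq in auto)
    thus "L' = L" by blast
  qed
  hence "L_function (2*k) F (1/2) = axis_int (of_nat k) * of_real (2 * pi) powr (of_nat k) * rGamma (of_nat k)"
    by (simp add: L_def sh_def)
  also have "of_real (2 * pi) powr (of_nat k) = (of_real (2 * pi) ^ k :: complex)"
    by (rule powr_nat') (use k in simp)
  also have "rGamma (of_nat k :: complex) = 1 / fact (k - 1)"
  proof -
    have "Gamma (of_nat (Suc (k - 1)) :: complex) = fact (k - 1)" using Gamma_fact[of "k - 1"] by simp
    thus ?thesis using k by (simp add: rGamma_inverse_Gamma inverse_eq_divide)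
  qed
  finally show ?thesis by (simp add: field_simps)
qed

end

section \<open>The second moment as a single integral\<close>

lemma einterval_pos: "einterval 0 \<infinity> = {0<..}"
  by (auto simp: einterval_def)

lemma integral_FTC_pos:
  fixes f F :: "real \<Rightarrow> 'a::euclidean_space"
  assumes F: "\<And>x. x > 0 \<Longrightarrow> (F has_vector_derivative f x) (at x)"
    and f: "\<And>x. x > 0 \<Longrightarrow> isCont f x"
    and int: "integrable lborel (\<lambda>x. ipos x *\<^sub>R f x)"
    and A: "(F \<longlongrightarrow> A) (at_right 0)" and B: "(F \<longlongrightarrow> B) at_top"
  shows "(LBINT x. ipos x *\<^sub>R f x) = B - A"
proof -
  have "(LBINT x=0..\<infinity>. f x) = B - A"
    by (rule interval_integral_FTC_integrable[where F = F])
      (use F f int A B in \<open>auto simp: einterval_pos set_integrable_def zero_ereal_def ereal_tendsto_simps1\<close>)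
  thus ?thesis
    by (simp add: interval_lebesgue_integral_def einterval_pos set_lebesgue_integral_def)
qed

lemma integral_FTC_pos_nonneg:
  fixes f F :: "real \<Rightarrow> real"
  assumes F: "\<And>x. x > 0 \<Longrightarrow> (F has_real_derivative f x) (at x)"
    and f: "\<And>x. x > 0 \<Longrightarrow> isCont f x" and f0: "\<And>x. x > 0 \<Longrightarrow> f x \<ge> 0"
    and A: "(F \<longlongrightarrow> A) (at_right 0)" and B: "(F \<longlongrightarrow> B) at_top"
  shows "integrable lborel (\<lambda>x. ipos x * f x)"
    and "(LBINT x. ipos x * f x) = B - A"
proof -
  have "set_integrable lborel (einterval 0 \<infinity>) f" "(LBINT x=0..\<infinity>. f x) = B - A"
    by (rule interval_integral_FTC_nonneg[where F = F];
        use F f f0 A B in \<open>auto simp: zero_ereal_def ereal_tendsto_simps1\<close>)+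
  thus "integrable lborel (\<lambda>x. ipos x * f x)" "(LBINT x. ipos x * f x) = B - A"
    by (simp_all add: interval_lebesgue_integral_def einterval_pos set_lebesgue_integral_def set_integrable_def)
qed

lemma norm_of_real_add_ge:
  assumes "Re q > 0" "y > 0"
  shows "y \<le> norm (of_real y + q)" "norm q \<le> norm (of_real y + q)" "y^2 + norm q ^ 2 \<le> norm (of_real y + q) ^ 2"
proof -
  have 1: "norm (of_real y + q) ^ 2 = y^2 + 2 * y * Re q + norm q ^ 2"
    unfolding cmod_power2 by (simp add: power2_eq_square algebra_simps)
  have 2: "0 \<le> 2 * y * Re q" using assms by simp
  show 3: "y^2 + norm q ^ 2 \<le> norm (of_real y + q) ^ 2" unfolding 1 using 2 by simp
  show "y \<le> norm (of_real y + q)" by (rule power2_le_imp_le) (use 3 in \<open>auto intro: order.trans[rotated]\<close>)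
  have "norm q ^ 2 \<le> norm (of_real y + q) ^ 2" using 3 zero_le_power2[of y] by linarith
  thus "norm q \<le> norm (of_real y + q)" by (rule power2_le_imp_le) simp
qed

lemma deriv_power_Suc_shift:
  fixes x q :: complex
  shows "((\<lambda>y. (y + q) ^ Suc p) has_field_derivative of_nat (Suc p) * (x + q) ^ p) (at x)"
proof -
  have "((\<lambda>y. y + q) has_field_derivative 1) (at x)" by (auto intro!: derivative_eq_intros)
  from DERIV_power_Suc[OF this, of p] show ?thesis by simp
qed

lemma deriv_inverse_power_shift:
  fixes x q :: complex
  assumes "x + q \<noteq> 0"
  shows "((\<lambda>y. 1 / (y + q) ^ Suc p) has_field_derivative - of_nat (Suc p) / (x + q) ^ (p + 2)) (at x)"
proof -
  have e: "(0 * w ^ Suc p - 1 * (c * w ^ p)) / (w ^ Suc p * w ^ Suc p) = - c / w ^ (p + 2)" if "w \<noteq> 0" for c w :: complex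
    using that by (simp add: field_simps)
  show ?thesis
    using DERIV_divide[OF DERIV_const[of 1] deriv_power_Suc_shift[of q p x]] assms unfolding e[OF assms] by simp
qed

lemma deriv_power_quotient:
  fixes x q :: complex
  assumes "x + q \<noteq> 0"
  shows "((\<lambda>y. y ^ Suc m / (y + q) ^ Suc p) has_field_derivative
     of_nat (Suc m) * (x ^ m / (x + q) ^ Suc p) - of_nat (Suc p) * (x ^ Suc m / (x + q) ^ (p + 2))) (at x)"
proof -
  have "((\<lambda>y. y ^ Suc m * (1 / (y + q) ^ Suc p)) has_field_derivative
     of_nat (Suc m) * x ^ m * (1 / (x + q) ^ Suc p) + (- of_nat (Suc p) / (x + q) ^ (p + 2)) * x ^ Suc m) (at x)"
    using DERIV_mult[OF deriv_power_Suc_shift[of 0 m x] deriv_inverse_power_shift[OF assms, of p]] by (simp only: add_0_right)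
  moreover have "of_nat (Suc m) * x ^ m * (1 / (x + q) ^ Suc p) + (- of_nat (Suc p) / (x + q) ^ (p + 2)) * x ^ Suc m =
     of_nat (Suc m) * (x ^ m / (x + q) ^ Suc p) - of_nat (Suc p) * (x ^ Suc m / (x + q) ^ (p + 2))"
    by (simp del: of_nat_Suc power_Suc)
  ultimately show ?thesis by (simp only: mult_1_right times_divide_eq_right)
qed

text \<open>Induction on \<open>m\<close> with \<open>n\<close> fixed: integrating the derivative of
  \<open>y ^ (m + 1) / (y + q) ^ (m + n + 2)\<close>, whose boundary values vanish, relates the
  integral for \<open>Suc m\<close> to that for \<open>m\<close>. The parameter \<open>q\<close>
  stays complex throughout, so no contour has to be rotated.\<close>

lemma beta_integral:
  assumes q: "Re q > 0"
  shows "integrable lborel (\<lambda>y. ipos y *\<^sub>R (of_real y ^ m / (of_real y + q) ^ (m + n + 2)))"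
    and "(LBINT y. ipos y *\<^sub>R (of_real y ^ m / (of_real y + q) ^ (m + n + 2))) = fact m * fact n / fact (m + n + 1) / q ^ (n + 1)"
proof -
  let ?g = "\<lambda>m n y. ipos y *\<^sub>R (of_real y ^ m / (of_real y + q) ^ (m + n + 2))"
    and ?d = "\<lambda>m y. of_nat (Suc m) * (of_real y ^ m / (of_real y + q) ^ (m + n + 2)) - of_nat (m + n + 2) * (of_real y ^ Suc m / (of_real y + q) ^ (Suc m + n + 2))"
    and ?F = "\<lambda>y. - (1 / of_nat (n + 1)) * (of_real y ^ 0 / (of_real y + q) ^ (n + 1))"
  have q0: "norm q > 0" using q by auto
  have nz: "of_real y + q \<noteq> 0" if "y > 0" for y
    using norm_of_real_add_ge(2)[OF q that] q0 by auto
  have int: "integrable lborel (?g m n)" for m n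
  proof (rule Bochner_Integration.integrable_bound)
    show "integrable lborel (\<lambda>y. (1 / norm q ^ n) * (1 / ((y + 0)^2 + norm q ^ 2)))"
      by (intro integrable_mult_right integrable_inverse_quadratic q0)
    show "(?g m n) \<in> borel_measurable lborel"
      by measurable
    have "norm (?g m n y) \<le> (1 / norm q ^ n) * (1 / ((y + 0)^2 + norm q ^ 2))" for y
    proof (cases "y > 0")
      case True
      note 1 = norm_of_real_add_ge[OF q True]
      let ?N = "norm (of_real y + q)"
      have N: "?N > 0" using 1 q0 by linarith
      have "y ^ m / ?N ^ (m + n + 2) \<le> ?N ^ m / ?N ^ (m + n + 2)"
        using True 1 N by (intro divide_right_mono power_mono) auto
      also have "... = 1 / ?N ^ n * (1 / ?N^2)" using N by (simp add: power_add power2_eq_square)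
      also have "... \<le> 1 / norm q ^ n * (1 / ((y + 0)^2 + norm q ^ 2))"
        using 1 N q0 True by (intro mult_mono divide_left_mono power_mono mult_pos_pos) (auto intro!: add_nonneg_pos)
      finally show ?thesis using True by (simp add: norm_mult norm_divide norm_power)
    qed (simp add: add_nonneg_pos)
    thus "AE y in lborel. norm (?g m n y) \<le> norm ((1 / norm q ^ n) * (1 / ((y + 0)^2 + norm q ^ 2)))"
      by (intro AE_I2) (auto intro: order.trans[OF _ abs_ge_self])
  qed
  have cont: "isCont (\<lambda>y. of_real y ^ m / (of_real y + q) ^ n) y" if "y > 0" for m n y
    using nz[OF that] by (intro continuous_intros) auto
  have lim: "((\<lambda>y. of_real y ^ m / (of_real y + q) ^ (m + n + 1)) \<longlongrightarrow> 0) at_top" for m n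
  proof (rule Lim_null_comparison)
    show "((\<lambda>y. (1 / norm q ^ n) * (1 / y)) \<longlongrightarrow> 0) at_top"
      by (intro tendsto_mult_right_zero) (simp add: tendsto_inverse_0_at_top filterlim_ident flip: inverse_eq_divide)
    show "\<forall>\<^sub>F y in at_top. norm (of_real y ^ m / (of_real y + q) ^ (m + n + 1)) \<le> (1 / norm q ^ n) * (1 / y)"
      using eventually_gt_at_top[of 0]
    proof eventually_elim
      case (elim y)
      note 1 = norm_of_real_add_ge[OF q elim]
      let ?N = "norm (of_real y + q)"
      have N: "?N > 0" using 1 q0 by linarith
      have "y ^ m / ?N ^ (m + n + 1) \<le> ?N ^ m / ?N ^ (m + n + 1)"
        using elim 1 N by (intro divide_right_mono power_mono) auto
      also have "... = 1 / ?N ^ n * (1 / ?N)" using N by (simp add: power_add)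
      also have "... \<le> 1 / norm q ^ n * (1 / y)"
        using 1 N q0 elim by (intro mult_mono divide_left_mono power_mono mult_pos_pos) auto
      finally show ?case using elim by (simp add: norm_divide norm_power norm_mult)
    qed
  qed
  have lim0: "((\<lambda>y. of_real y ^ m / (of_real y + q) ^ n) \<longlongrightarrow> 0 ^ m / q ^ n) (at_right 0)" for m n
  proof -
    have "isCont (\<lambda>y. of_real y ^ m / (of_real y + q) ^ n) (0::real)"
      using q0 by (intro continuous_intros) auto
    thus ?thesis unfolding isCont_def by (auto intro: tendsto_mono[rotated] at_le)
  qed
  have val: "(LBINT y. ?g m n y) = fact m * fact n / fact (m + n + 1) / q ^ (n + 1)"
  proof (induction m)
    case 0
    have "(LBINT y. ipos y *\<^sub>R (of_real y ^ 0 / (of_real y + q) ^ (0 + n + 2))) = 0 - (- (1 / of_nat (n + 1)) * (0 ^ 0 / q ^ (n + 1)))"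
    proof (rule integral_FTC_pos[OF _ cont int])
      show "(?F has_vector_derivative of_real x ^ 0 / (of_real x + q) ^ (0 + n + 2)) (at x)" if "x > 0" for x
      proof -
        have "((\<lambda>y. - (1 / of_nat (n + 1)) * (y ^ 0 / (y + q) ^ (n + 1))) has_field_derivative of_real x ^ 0 / (of_real x + q) ^ (0 + n + 2)) (at (of_real x))"
          using DERIV_cmult[OF deriv_inverse_power_shift[OF nz[OF that], of n], of "- (1 / of_nat (n + 1))"]
          by (simp del: of_nat_Suc power_Suc)
        thus ?thesis by (rule has_vector_derivative_real_field)
      qed
      show "(?F \<longlongrightarrow> - (1 / of_nat (n + 1)) * (0 ^ 0 / q ^ (n + 1))) (at_right 0)"
        by (intro tendsto_mult_left lim0)
      show "(?F \<longlongrightarrow> 0) at_top"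
        using tendsto_mult_right_zero[OF lim[of 0 n], of "- (1 / of_nat (n + 1))"] by (simp only: add_0)
    qed
    moreover have "fact 0 * fact n / fact (0 + n + 1) / q ^ (n + 1) = 0 - (- (1 / of_nat (n + 1)) * (0 ^ 0 / q ^ (n + 1)))"
    proof -
      have "(fact (n + 1) :: complex) = of_nat (n + 1) * fact n" by simp
      thus ?thesis by (simp del: of_nat_add power_Suc)
    qed
    ultimately show ?case by (simp only:)
  next
    case (Suc m)
    define I where "I m = (LBINT y. ?g m n y)" for m
    have "(LBINT y. ipos y *\<^sub>R (?d m y)) = 0 - 0 ^ Suc m / q ^ (m + n + 2)"
    proof (rule integral_FTC_pos[OF _ _ _ lim0[of "Suc m" "m+n+2"]])
      show "((\<lambda>y. of_real y ^ Suc m / (of_real y + q) ^ (m + n + 2)) has_vector_derivative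
          ?d m x) (at x)" if "x > 0" for x
      proof -
        have "((\<lambda>y. y ^ Suc m / (y + q) ^ (m + n + 2)) has_field_derivative
          ?d m x) (at (of_real x))"
          using deriv_power_quotient[OF nz[OF that], of m "m + n + 1"]
          by (simp only: add_Suc add_Suc_right One_nat_def numeral_2_eq_2 add_0_right)
        thus ?thesis by (rule has_vector_derivative_real_field)
      qed
      show "isCont (\<lambda>y. ?d m y) x" if "x > 0" for x
        by (intro isCont_diff isCont_mult continuous_const cont[OF that])
      show "integrable lborel (\<lambda>y. ipos y *\<^sub>R (?d m y))"
        unfolding scaleR_diff_right mult_scaleR_right[symmetric]
        by (intro Bochner_Integration.integrable_diff integrable_mult_right int)
      show "((\<lambda>y. of_real y ^ Suc m / (of_real y + q) ^ (m + n + 2)) \<longlongrightarrow> 0) at_top" using lim[of "Suc m" n] by simp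
    qed
    moreover have "(LBINT y. ipos y *\<^sub>R (?d m y))
        = of_nat (Suc m) * I m - of_nat (m + n + 2) * I (Suc m)"
      unfolding scaleR_diff_right mult_scaleR_right[symmetric] I_def
      by (subst Bochner_Integration.integral_diff[OF integrable_mult_right[OF int] integrable_mult_right[OF int]])
         (simp only: integral_mult_right_zero)
    ultimately have "of_nat (m + n + 2) * I (Suc m) = of_nat (Suc m) * I m" by simp
    also have "I m = fact m * fact n / fact (m + n + 1) / q ^ (n + 1)" unfolding I_def by (rule Suc.IH)
    finally have "of_nat (m + n + 2) * I (Suc m) = of_nat (Suc m) * (fact m * fact n / fact (m + n + 1) / q ^ (n + 1))" .
    have An: "of_nat (m + n + 2) \<noteq> (0::complex)" by (simp only: of_nat_eq_0_iff)
    note \<open>of_nat (m + n + 2) * I (Suc m) = of_nat (Suc m) * (fact m * fact n / fact (m + n + 1) / q ^ (n + 1))\<close>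
    also have "of_nat (Suc m) * (fact m * fact n / fact (m + n + 1) / q ^ (n + 1)) = of_nat (m + n + 2) * (fact (Suc m) * fact n / fact (Suc m + n + 1) / q ^ (n + 1))"
    proof -
      have f: "fact (Suc m + n + 1) = (of_nat (m + n + 2) * fact (m + n + 1) :: complex)" by (simp add: algebra_simps)
      have gen: "s * (f * g / C / Q) = A * ((s * f) * g / (A * C) / Q)" if "A \<noteq> 0" for A s f g C Q :: complex
        using that by simp
      show ?thesis unfolding f fact_Suc[of m] of_nat_mult[symmetric] using gen[OF An] by (simp only: of_nat_mult)
    qed
    finally have "I (Suc m) = fact (Suc m) * fact n / fact (Suc m + n + 1) / q ^ (n + 1)"
      using An mult_left_cancel by blast
    thus ?case by (simp only: I_def)
  qed
  show "integrable lborel (?g m n)" by (rule int)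
  show "(LBINT y. ?g m n y) = fact m * fact n / fact (m + n + 1) / q ^ (n + 1)" by (rule val)
qed

text \<open>The bound has the order \<open>|q| powr (- k)\<close> of the exact value, so termwise
  norms sum like \<open>half_sum\<close>. It rests on \<open>y * |q| <= |y + q|^2\<close>, used
  \<open>k - 1\<close> times, with one further square left over for integrability.\<close>

lemma beta_integral_norm:
  assumes q: "Re q > 0" and k: "k \<ge> 1"
  shows "(LBINT y. norm (ipos y *\<^sub>R (of_real y ^ (k - 1) / (of_real y + q) ^ (2 * k)))) \<le>
    (LBINT y. 1 / (y^2 + 1)) / norm q ^ k"
proof -
  have q0: "norm q > 0" using q by auto
  let ?g = "\<lambda>y. 1 / ((y + 0)^2 + norm q ^ 2)"
  have gi: "integrable lborel ?g" by (rule integrable_inverse_quadratic[OF q0])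
  have gv: "(LBINT y. ?g y) = (LBINT y. 1 / (y^2 + 1)) / norm q"
  proof -
    have "(LBINT y. ?g y) = norm q * (LBINT y. ?g (0 + norm q * y))"
      using lborel_integral_real_affine[of "norm q" ?g 0] q0 by simp
    also have "(\<lambda>y. ?g (0 + norm q * y)) = (\<lambda>y. 1 / norm q ^ 2 * (1 / (y^2 + 1)))"
    proof
      fix y :: real
      have "(norm q * y)^2 + norm q ^ 2 = norm q ^ 2 * (y^2 + 1)" by (simp add: power_mult_distrib algebra_simps)
      thus "?g (0 + norm q * y) = 1 / norm q ^ 2 * (1 / (y^2 + 1))" by simp
    qed
    also have "(LBINT y. 1 / norm q ^ 2 * (1 / (y^2 + 1))) = 1 / norm q ^ 2 * (LBINT y. 1 / (y^2 + 1))"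
      by (rule integral_mult_right_zero)
    finally show ?thesis using q0 by (simp add: power2_eq_square)
  qed
  have "norm (ipos y *\<^sub>R (of_real y ^ (k - 1) / (of_real y + q) ^ (2 * k))) \<le> 1 / norm q ^ (k - 1) * ?g y" for y
  proof (cases "y > 0")
    case True
    note 1 = norm_of_real_add_ge[OF q True]
    let ?N = "norm (of_real y + q)"
    have "y * norm q \<le> y^2 + norm q ^ 2"
    proof -
      have "0 \<le> (y - norm q)^2" by simp
      hence "2 * (y * norm q) \<le> y^2 + norm q ^ 2" by (simp add: power2_eq_square algebra_simps)
      thus ?thesis using True q0 by (smt (verit) mult_pos_pos)
    qed
    hence "y * norm q \<le> ?N^2" using 1 by linarith
    hence "(y * norm q) ^ (k - 1) * (y^2 + norm q ^ 2) \<le> (?N^2) ^ (k - 1) * ?N^2"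
      using True q0 1 by (intro mult_mono power_mono) auto
    also have "... = (?N^2) ^ Suc (k - 1)" by (simp only: power_Suc2)
    also have "... = ?N ^ (2 * k)" using k by (simp only: power_mult Suc_diff_1)
    finally have 2: "(y * norm q) ^ (k - 1) * (y^2 + norm q ^ 2) \<le> ?N ^ (2 * k)" .
    have 3: "y^2 + norm q ^ 2 > 0" using q0 True by (simp add: add_pos_pos)
    have "?N > 0" using 1(1) True by linarith
    hence 4: "?N ^ (2 * k) > 0" by (rule zero_less_power)
    have "y ^ (k - 1) / ?N ^ (2 * k) \<le> y ^ (k - 1) / ((y * norm q) ^ (k - 1) * (y^2 + norm q ^ 2))"
      using 2 3 4 True q0 by (intro divide_left_mono mult_pos_pos) auto
    also have "... = 1 / norm q ^ (k - 1) * (1 / (y^2 + norm q ^ 2))"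
      using True by (simp add: power_mult_distrib)
    finally show ?thesis using True by (simp add: norm_divide norm_power)
  qed (simp add: add_nonneg_pos)
  hence "(LBINT y. norm (ipos y *\<^sub>R (of_real y ^ (k - 1) / (of_real y + q) ^ (2 * k))))
      \<le> (LBINT y. 1 / norm q ^ (k - 1) * ?g y)"
    by (intro integral_mono_AE' integrable_mult_right gi AE_I2) auto
  also have "... = 1 / norm q ^ (k - 1) * ((LBINT y. 1 / (y^2 + 1)) / norm q)"
    unfolding gv[symmetric] by (rule integral_mult_right_zero)
  also have "... = (LBINT y. 1 / (y^2 + 1)) / norm q ^ k"
    using k by (cases k) (auto simp: field_simps)
  finally show ?thesis .
qed

text \<open>What is left of the kernel after its second variable has been integrated over the
  half-axis: the exponent \<open>2 * k\<close> is shared equally between the two rows.\<close>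

definition half_sum :: "nat \<Rightarrow> int \<Rightarrow> complex \<Rightarrow> complex" where
  "half_sum k l z = (\<Sum>\<^sub>\<infinity>M\<in>mats l. 1 / (mnum M z ^ k * mden M z ^ k))"

abbreviation ray :: "nat \<Rightarrow> (complex \<Rightarrow> complex) \<Rightarrow> real \<Rightarrow> complex" where
  "ray k f y \<equiv> ipos y *\<^sub>R (f (\<i> * of_real y) * of_real y ^ (k - 1))"

lemma i_power_even: assumes "even k" shows "\<i> ^ k * \<i> ^ k = (1::complex)" and "1 / \<i> ^ k = (\<i> ^ k :: complex)"
proof -
  show 1: "\<i> ^ k * \<i> ^ k = (1::complex)"
    using assms by (auto elim!: evenE simp: power_mult power_mult_distrib[symmetric])
  have nz: "\<i> ^ k \<noteq> (0::complex)" by simp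
  show "1 / \<i> ^ k = (\<i> ^ k :: complex)" unfolding nonzero_divide_eq_eq[OF nz] by (rule 1[symmetric])
qed

text \<open>With \<open>P = \<i> (c z + d)\<close> the kernel at \<open>z' = \<i> y\<close> is
  \<open>P (y + q)\<close>, where \<open>q\<close> is \<open>- \<i>\<close> times the Moebius image
  of \<open>z\<close> and so has positive real part. The beta integral yields
  \<open>P powr (- 2 k) * q powr (- k)\<close>, which splits into the two rows because
  \<open>P q = a z + b\<close>.\<close>

lemma integral_hker:
  assumes z: "z \<in> HH" and l: "l > 0" and k: "k \<ge> 4"
  shows "integrable lborel (ray k (hker (2*k) l z))"
    and "(LBINT y. ray k (hker (2*k) l z) y)
       = (fact (k - 1))^2 / fact (2*k - 1) / \<i> ^ k * half_sum k l z"
proof -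
  let ?h = "\<lambda>(q::complex) y. ipos y *\<^sub>R (of_real y ^ (k - 1) / (of_real y + q) ^ (2*k))"
  let ?w = "\<lambda>M. 1 / (mnum M z ^ k * mden M z ^ k)"
  define t where "t M y = ipos y *\<^sub>R (1 / kern M z (\<i> * of_real y) ^ (2*k) * of_real y ^ (k - 1))" for M y
  let ?B = "(fact (k - 1))^2 / fact (2*k - 1) :: complex"
  let ?K = "\<integral>y. 1 / (y^2 + 1) \<partial>(lborel :: real measure)"
  have T: "integrable lborel (t M) \<and> (LBINT y. t M y) = ?B / \<i> ^ k * (?w M)
     \<and> (LBINT y. norm (t M y)) \<le> ?K * norm (?w M)" if M: "M \<in> mats l" for M
  proof -
    have M0: "mdet M > 0" using M l by simp
    have d: "mden M z \<noteq> 0" using mden_nonzero[of M z] M0 z by auto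
    define P where "P = \<i> * mden M z"
    define q where "q = mnum M z / P"
    have P: "P \<noteq> 0" using d by (simp add: P_def)
    have Pq: "P * q = mnum M z" using P by (simp add: q_def)
    have "q = - \<i> * mob M z" using d by (simp add: q_def P_def mob_def field_simps)
    hence q: "Re q > 0" using mob_in_HH[OF M0 z] by simp
    have e: "t M y = 1 / P ^ (2*k) * (?h q y)" for y
    proof -
      have "kern M z (\<i> * of_real y) = P * (of_real y + q)"
        using Pq by (simp add: kern_def P_def ring_distribs mult_ac)
      thus ?thesis unfolding t_def by (simp add: power_mult_distrib scaleR_conv_of_real)
    qed
    have te: "t M = (\<lambda>y. 1 / P ^ (2*k) * (?h q y))"
      by (rule ext) (rule e)
    have kk: "k - 1 + (k - 1) + 2 = 2 * k" "k - 1 + (k - 1) + 1 = 2 * k - 1" "k - 1 + 1 = k" using k by auto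
    note B = beta_integral[OF q, of "k - 1" "k - 1", unfolded kk]
    have 1: "integrable lborel (t M)" unfolding te by (rule integrable_mult_right[OF B(1)])
    have "(LBINT y. t M y) = 1 / P ^ (2*k) * (fact (k - 1) * fact (k - 1) / fact (2 * k - 1) / q ^ k)"
      unfolding te B(2)[symmetric] by (rule integral_mult_right_zero)
    also have "... = ?B * (1 / (P ^ k * (P * q) ^ k))"
      by (simp add: power2_eq_square power_mult_distrib mult_2 power_add)
    also have "... = ?B / \<i> ^ k * (?w M)"
      unfolding Pq by (simp add: P_def power_mult_distrib)
    finally have 2: "(LBINT y. t M y) = ?B / \<i> ^ k * (?w M)" .
    have "(LBINT y. norm (t M y)) = norm (1 / P ^ (2*k)) * (LBINT y. norm (?h q y))"
      unfolding e norm_mult[of "1 / P ^ (2*k)"] by (rule integral_mult_right_zero)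
    also have "... \<le> norm (1 / P ^ (2*k)) * (?K / norm q ^ k)"
      by (intro mult_left_mono beta_integral_norm q) (use k in auto)
    also have "... = ?K * (1 / (norm P ^ k * norm (P * q) ^ k))"
      by (simp add: norm_divide norm_power norm_mult power_mult_distrib mult_2 power_add)
    also have "... = ?K * norm (?w M)"
      unfolding Pq by (simp add: P_def norm_divide norm_mult norm_power mult.commute)
    finally show ?thesis using 1 2 by blast
  qed
  have I: "countable (mats l)" by simp
  have pt: "(\<lambda>M. norm (t M y)) summable_on mats l" for y
  proof (cases "y > 0")
    case True
    have "(\<lambda>M. norm (1 / kern M z (\<i> * of_real y) ^ (2*k)) * norm (of_real y ^ (k - 1) :: complex)) summable_on mats l"
      by (intro summable_on_cmult_left kern_abs_summable) (use z l k True in auto)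
    moreover have "norm (t M y) = norm (1 / kern M z (\<i> * of_real y) ^ (2*k)) * norm (of_real y ^ (k - 1) :: complex)" for M
      unfolding norm_mult[symmetric] t_def using True by simp
    ultimately show ?thesis by (simp only:)
  qed (simp add: t_def)
  have sm: "(\<lambda>M. LBINT y. norm (t M y)) summable_on mats l"
    by (rule summable_on_comparison_test[OF summable_on_cmult_right[OF half_abs_summable[OF z l k], of ?K]])
       (use T in auto)
  have ti: "integrable lborel (t M)" if "M \<in> mats l" for M using T that by blast
  note int = integral_infsum[OF I ti pt sm]
  have inf: "(\<Sum>\<^sub>\<infinity>M\<in>mats l. t M y) = ray k (hker (2*k) l z) y" for y
    unfolding t_def hker_def
    by (simp only: infsum_scaleR_right infsum_cmult_left')
  show "integrable lborel (ray k (hker (2*k) l z))"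
    using int(1) unfolding inf .
  have "(LBINT y. ray k (hker (2*k) l z) y) = (\<Sum>\<^sub>\<infinity>M\<in>mats l. LBINT y. t M y)"
    unfolding inf[symmetric] by (rule infsumI[OF int(2), symmetric])
  also have "... = (\<Sum>\<^sub>\<infinity>M\<in>mats l. ?B / \<i> ^ k * (?w M))"
    by (rule infsum_cong) (use T in blast)
  also have "... = ?B / \<i> ^ k * half_sum k l z" unfolding half_sum_def by (rule infsum_cmult_right')
  finally show "(LBINT y. ray k (hker (2*k) l z) y)
       = ?B / \<i> ^ k * half_sum k l z" .
qed

lemma axis_int_of_nat:
  assumes F: "cusp_form (2*k) F" and k: "k \<ge> 1"
  shows "integrable lborel (ray k F)"
    and "axis_int F (of_nat k) = (LBINT y. ray k F y)"
proof -
  have e: "ipos y *\<^sub>R (F (\<i> * of_real y) * cpw y (of_nat k)) = ray k F y" for y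
  proof (cases "y > 0")
    case True
    have "cpw y (of_nat k) = exp (of_nat (k - 1) * of_real (ln y))" using k by (simp add: cpw_def of_nat_diff)
    also have "... = of_real y ^ (k - 1)" using True by (simp only: exp_of_nat_mult exp_of_real exp_ln)
    finally show ?thesis by simp
  qed simp
  show "integrable lborel (ray k F)"
    using axis_int_integrable[OF F, of "of_nat k"] unfolding e .
  show "axis_int F (of_nat k) = (LBINT y. ray k F y)"
    by (simp only: axis_int_def[OF F] e)
qed

text \<open>Both variables of \<open>kernel_expansion\<close> are integrated. On the spectral side
  only finite sums of \<open>axis_int\<close> occur, and there the integrand is a finite combination
  of cusp forms on the axis; this also gives the integrability claim.\<close>

theorem moment_eq_integral:
  assumes k: "k \<ge> 5" "even k" and n: "n > 0"
  shows "integrable lborel (ray k (half_sum k (int n)))" (is ?A)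
    and "(\<Sum>f\<in>primitive_forms (2*k). harmonic_weight (2*k) f * hecke_coeff (2*k) f n * (L_function (2*k) f (1/2))^2)
      = of_real (real n powr (real k - 1/2)) * \<i> ^ k / 2 *
        (LBINT y. ray k (half_sum k (int n)) y)" (is ?M)
proof -
  let ?L = "\<lambda>f. (L_function (2*k) f (1/2))^2"
  let ?P = "primitive_forms (2*k)"
  let ?B = "(fact (k - 1))^2 / fact (2*k - 1) :: complex"
  define I where "I = (LBINT y. ray k (half_sum k (int n)) y)"
  define c where "c f = fourier_coeff f n / petersson (2*k) f f" for f
  define N where "N = (of_nat n ^ (2*k - 1) :: complex)"
  define D where "D = N * (?B / \<i> ^ k)"
  have N0: "N \<noteq> 0" using n by (simp add: N_def)
  have D0: "D \<noteq> 0" using N0 by (simp add: D_def)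
  have k1: "k \<ge> 1" "k \<ge> 4" using k by auto
  have cf: "cusp_form (2*k) f" if "f \<in> ?P" for f using primitive_formD(1)[OF that k(1)] .
  have half: "D * half_sum k (int n) z = 2 * kernel_const k * (\<Sum>f\<in>?P. c f * f z * axis_int f (of_nat k))" if z: "z \<in> HH" for z
  proof -
    let ?h = "\<lambda>y. ray k (hker (2*k) (int n) z) y"
    have e: "N * ?h y = 2 * kernel_const k * (\<Sum>f\<in>?P. c f * f z * (ray k f y))" for y
    proof (cases "y > 0")
      case True
      have "N * ?h y = (N * hker (2*k) (int n) z (\<i> * of_real y)) * of_real y ^ (k - 1)" using True by simp
      also have "N * hker (2*k) (int n) z (\<i> * of_real y) = 2 * kernel_const k * (\<Sum>f\<in>?P. fourier_coeff f n * f z * f (\<i> * of_real y) / petersson (2*k) f f)"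
        unfolding N_def by (rule kernel_expansion) (use k n z True in auto)
      finally show ?thesis using True by (simp add: c_def sum_distrib_left sum_distrib_right mult_ac)
    qed simp
    have "D * half_sum k (int n) z = N * (LBINT y. ?h y)"
      using integral_hker(2)[OF z, of "int n" k] n k1 by (simp add: D_def)
    also have "... = (LBINT y. N * ?h y)" by (rule integral_mult_right_zero[symmetric])
    also have "... = 2 * kernel_const k * (LBINT y. (\<Sum>f\<in>?P. c f * f z * (ray k f y)))"
      unfolding e by (rule integral_mult_right_zero)
    also have "(LBINT y. (\<Sum>f\<in>?P. c f * f z * (ray k f y)))
       = (\<Sum>f\<in>?P. LBINT y. c f * f z * (ray k f y))"
      by (rule Bochner_Integration.integral_sum) (intro integrable_mult_right axis_int_of_nat(1)[OF cf k1(1)])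
    also have "... = (\<Sum>f\<in>?P. c f * f z * axis_int f (of_nat k))"
      by (rule sum.cong) (simp_all only: integral_mult_right_zero axis_int_of_nat(2)[OF cf k1(1)])
    finally show ?thesis .
  qed
  let ?g = "\<lambda>y. ray k (half_sum k (int n)) y"
  let ?t = "\<lambda>y f. c f * axis_int f (of_nat k) * (ray k f y)"
  have e: "D * ?g y = 2 * kernel_const k * (\<Sum>f\<in>?P. ?t y f)" for y
  proof (cases "y > 0")
    case True
    have "D * ?g y = (D * half_sum k (int n) (\<i> * of_real y)) * of_real y ^ (k - 1)" using True by simp
    also have "D * half_sum k (int n) (\<i> * of_real y) = 2 * kernel_const k * (\<Sum>f\<in>?P. c f * f (\<i> * of_real y) * axis_int f (of_nat k))"
      by (rule half) (use True in simp)
    finally show ?thesis using True by (simp add: sum_distrib_left sum_distrib_right mult_ac)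
  qed simp
  have ti: "integrable lborel (\<lambda>y. \<Sum>f\<in>?P. ?t y f)"
    by (intro Bochner_Integration.integrable_sum integrable_mult_right axis_int_of_nat(1)[OF cf k1(1)])
  have "integrable lborel (\<lambda>y. 1 / D * (D * ?g y))" unfolding e by (intro integrable_mult_right ti)
  thus ?A using D0 by (simp only: mult.assoc[symmetric]) simp
  have "D * I = (LBINT y. D * ?g y)" unfolding I_def by (rule integral_mult_right_zero[symmetric])
  also have "... = 2 * kernel_const k * (LBINT y. (\<Sum>f\<in>?P. ?t y f))" unfolding e by (rule integral_mult_right_zero)
  also have "(LBINT y. (\<Sum>f\<in>?P. ?t y f)) = (\<Sum>f\<in>?P. LBINT y. ?t y f)"
    by (rule Bochner_Integration.integral_sum) (intro integrable_mult_right axis_int_of_nat(1)[OF cf k1(1)])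
  also have "... = (\<Sum>f\<in>?P. c f * axis_int f (of_nat k) * axis_int f (of_nat k))"
    by (rule sum.cong) (simp_all only: integral_mult_right_zero axis_int_of_nat(2)[OF cf k1(1)])
  also have "... = (\<Sum>f\<in>?P. (fact (k - 1) / of_real (2 * pi) ^ k)^2 * (c f * ?L f))"
    by (rule sum.cong) (simp_all add: L_function_half[OF cf k1(1)] power2_eq_square)
  also have "... = (fact (k - 1) / of_real (2 * pi) ^ k)^2 * (\<Sum>f\<in>?P. c f * ?L f)"
    by (rule sum_distrib_left[symmetric])
  finally have 1: "D * I = 2 * kernel_const k * ((fact (k - 1) / of_real (2 * pi) ^ k)^2 * (\<Sum>f\<in>?P. c f * ?L f))" .
  define S where "S = (\<Sum>f\<in>?P. c f * ?L f)"
  define H where "H = (fact (2*k - 2) / of_real ((4 * pi) ^ (2*k - 1)) :: complex)"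
  \<comment> \<open>The square root of \<open>n ^ (2 * k - 1)\<close>: one factor normalises the
    n-th coefficient, the other stays in front of the integral.\<close>
  define w where "w = real n powr (real k - 1/2)"
  have w: "w > 0" "N = of_real (w^2)"
  proof -
    show "w > 0" using n by (simp add: w_def)
    have "w^2 = real n powr real (2*k - 1)" using k n by (simp add: w_def powr_power of_nat_diff algebra_simps)
    also have "... = real n ^ (2*k - 1)" using n by (simp only: powr_realpow of_nat_0_less_iff)
    finally show "N = of_real (w^2)" by (simp add: N_def)
  qed
  note ik = i_power_even[OF k(2)]
  \<comment> \<open>The power of \<open>2 * pi\<close> in the Lipschitz constant cancels against
    those of the two central values. There remain the constant of the harmonic weight and the beta
    value, which also occurs on the kernel side.\<close>
  have kc: "kernel_const k * (fact (k - 1) / of_real (2 * pi) ^ k)^2 = H * ?B"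
  proof -
    have "(2 * complex_of_real pi * \<i>) ^ (2*k) = (of_real (2 * pi) * \<i>) ^ (2*k)" by simp
    also have "... = of_real (2 * pi) ^ (2*k) * \<i> ^ (2*k)" by (rule power_mult_distrib)
    also have "\<i> ^ (2*k) = (1 :: complex)" using ik(1) by (simp only: mult_2 power_add)
    also have "(of_real (2 * pi) :: complex) ^ (2*k) = (of_real (2 * pi) ^ k)^2"
      by (simp only: power_mult[symmetric] mult.commute)
    finally have X: "(2 * complex_of_real pi * \<i>) ^ (2*k) = (of_real (2 * pi) ^ k)^2" by simp
    have nz: "(of_real (2 * pi) :: complex) ^ k \<noteq> 0" by simp
    have gen: "X^2 / f1 * f2 / p * (g / X)^2 = f2 / p * (g^2 / f1)" if "X \<noteq> 0" for X f1 f2 p g :: complex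
      using that by (simp add: power_divide)
    show ?thesis unfolding kernel_const_def H_def X of_real_power by (rule gen[OF nz])
  qed
  have "D * I = 2 * (H * ?B) * S" unfolding 1 kc[symmetric] S_def by (simp only: mult_ac)
  hence "?B * (N / \<i> ^ k * I) = ?B * (2 * H * S)" by (simp add: D_def mult_ac)
  hence 2: "N / \<i> ^ k * I = 2 * H * S" by (subst (asm) mult_cancel_left) simp
  have "harmonic_weight (2*k) f * hecke_coeff (2*k) f n * ?L f = H / of_real w * (c f * ?L f)" for f
  proof -
    have a: "Gamma (real (2*k) - 1) = fact (2*k - 2)"
      using Gamma_fact[of "2*k - 2", where 'a = real] k by (simp add: of_nat_diff)
    have b: "(4 * pi) powr (real (2*k) - 1) = (4 * pi) ^ (2*k - 1)"
      using powr_realpow[of "4 * pi" "2*k - 1"] k by (simp add: of_nat_diff)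
    have d: "(real (2*k) - 1) / 2 = real k - 1/2" by (simp add: field_simps)
    show ?thesis unfolding harmonic_weight_def hecke_coeff_def a b d H_def c_def w_def by (simp add: mult.assoc mult.left_commute)
  qed
  hence "(\<Sum>f\<in>?P. harmonic_weight (2*k) f * hecke_coeff (2*k) f n * ?L f) = H / of_real w * S"
    by (simp add: S_def sum_distrib_left)
  also have "... = (2 * H * S) / (2 * of_real w)" by simp
  also have "... = of_real (w^2) / \<i> ^ k * I / (2 * of_real w)" unfolding 2[symmetric] w(2) ..
  also have "... = of_real w / \<i> ^ k * I / 2" using w(1) by (simp add: power2_eq_square)
  also have "of_real w / \<i> ^ k = of_real w * (\<i> ^ k :: complex)"
    by (simp only: divide_inverse[of "of_real w"] inverse_eq_divide ik(2))
  finally show ?M unfolding I_def w_def by (simp only: times_divide_eq_left times_divide_eq_right)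
qed

section \<open>Matrices without a zero entry\<close>

text \<open>Bernoulli's inequality. Keeping the factor \<open>m\<close> in front of
  \<open>v^2\<close> is the point, since it becomes \<open>1 / sqrt m\<close> after integration over
  \<open>v\<close>.\<close>

lemma power_add_ge:
  fixes L v :: real assumes "L > 0" "m \<ge> 1"
  shows "L ^ (2*m - 2) * (L^2 + real m * v^2) \<le> (L^2 + v^2) ^ m"
proof -
  have "1 + real m * (v^2 / L^2) \<le> (1 + v^2 / L^2) ^ m"
    by (rule Bernoulli_inequality) (use zero_le_power2[of v] zero_le_power2[of L] in \<open>smt (verit) divide_nonneg_nonneg\<close>)
  hence "(L^2) ^ m * (1 + real m * (v^2 / L^2)) \<le> (L^2) ^ m * (1 + v^2 / L^2) ^ m"
    by (rule mult_left_mono) simp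
  also have "... = (L^2 + v^2) ^ m"
    unfolding power_mult_distrib[symmetric] using assms by (simp add: distrib_left)
  also have "(L^2) ^ m * (1 + real m * (v^2 / L^2)) = L ^ (2*m - 2) * (L^2 + real m * v^2)"
  proof -
    obtain j where m: "m = Suc j" using assms(2) by (cases m) auto
    have "2*m - 2 = 2*j" by (simp add: m)
    thus ?thesis using assms by (simp add: m power_mult field_simps power2_eq_square)
  qed
  finally show ?thesis .
qed

text \<open>In the variable \<open>v = a y - b / y\<close>, which runs over the whole line,
  \<open>dv = (a + b / y^2) dy >= 2 sqrt (a b) dy / y\<close> by the inequality of the means. By
  \<open>power_add_ge\<close> only \<open>1 / (L^2 + m v^2)\<close> remains to be integrated, with
  value \<open>pi / (L sqrt m)\<close>.\<close>

lemma arctan_integral_bound: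
  fixes a b L :: real
  assumes p: "a > 0" "b > 0" "L > 0" and m: "m \<ge> 1"
  defines "g \<equiv> \<lambda>y. ipos y * (1 / (y * (L^2 + (a * y - b / y)^2) ^ m))"
  shows "integrable lborel g" and "(LBINT y. g y) \<le> pi / (2 * sqrt (a * b) * L ^ (2*m - 1) * sqrt (real m))"
proof -
  let ?v = "\<lambda>y. a * y - b / y"
  let ?f = "\<lambda>y. (a + b / y^2) / (L^2 + real m * (?v y)^2)"
  let ?F = "\<lambda>y. arctan (sqrt (real m) / L * (?v y)) / (L * sqrt (real m))"
  let ?c = "1 / (2 * sqrt (a * b) * L ^ (2*m - 2))"
  have m0: "real m > 0" using m by simp
  have pos: "L^2 + real m * (?v y)^2 > 0" for y using p by (simp add: add_pos_nonneg)
  have I: "integrable lborel (\<lambda>y. ipos y * ?f y)"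
    "(LBINT y. ipos y * ?f y) = (pi / 2) / (L * sqrt (real m)) - (- (pi / 2)) / (L * sqrt (real m))"
  proof -
    have D: "(?F has_real_derivative ?f x) (at x)" if "x > 0" for x
    proof -
      have "(?F has_real_derivative (sqrt (real m) / L * (a + b / x^2)) / (1 + (sqrt (real m) / L * ?v x)^2) / (L * sqrt (real m))) (at x)"
      proof (rule DERIV_cdivide)
        show "((\<lambda>y. arctan (sqrt (real m) / L * ?v y)) has_real_derivative (sqrt (real m) / L * (a + b / x^2)) / (1 + (sqrt (real m) / L * ?v x)^2)) (at x)"
          using that p by (auto intro!: derivative_eq_intros simp: divide_inverse power2_eq_square)
      qed
      also have "(sqrt (real m) / L * (a + b / x^2)) / (1 + (sqrt (real m) / L * ?v x)^2) / (L * sqrt (real m)) = ?f x"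
      proof -
        have "1 + (sqrt (real m) / L * ?v x)^2 = (L^2 + real m * (?v x)^2) / L^2"
          using p m0 by (simp add: power_mult_distrib power_divide add_divide_distrib)
        thus ?thesis using p m0 by (simp add: power2_eq_square)
      qed
      finally show ?thesis .
    qed
    have C: "isCont ?f x" if "x > 0" for x using pos[of x] that by (intro continuous_intros) auto
    have sm: "sqrt (real m) / L > 0" using p m0 by simp
    have v: "filterlim (\<lambda>y. s * ?v y) at_bot (at_right 0)" "filterlim (\<lambda>y. s * ?v y) at_top at_top" if "s > 0" for s
      using p that by real_asymp+
    note v0 = v(1)[OF sm] and v1 = v(2)[OF sm]
    have 0: "(?F \<longlongrightarrow> (- (pi / 2)) / (L * sqrt (real m))) (at_right 0)"
      using p m0 by (intro tendsto_divide tendsto_const filterlim_compose[OF tendsto_arctan_at_bot v0]) auto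
    have 1: "(?F \<longlongrightarrow> (pi / 2) / (L * sqrt (real m))) at_top"
      using p m0 by (intro tendsto_divide tendsto_const filterlim_compose[OF tendsto_arctan_at_top v1]) auto
    have f0: "?f x \<ge> 0" for x using less_imp_le[OF pos[of x]] p by (intro divide_nonneg_nonneg add_nonneg_nonneg) auto
    show "integrable lborel (\<lambda>y. ipos y * ?f y)"
      "(LBINT y. ipos y * ?f y) = (pi / 2) / (L * sqrt (real m)) - (- (pi / 2)) / (L * sqrt (real m))"
      by (rule integral_FTC_pos_nonneg[OF D C f0 0 1]; simp)+
  qed
  have le: "g y \<le> ?c * (ipos y * ?f y)" and g0: "g y \<ge> 0" for y
  proof -
    show "g y \<le> ?c * (ipos y * ?f y)"
    proof (cases "y > 0")
      case True
      have sq: "sqrt (a * b) > 0" using p by simp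
      have "2 * sqrt (a * b) \<le> y * (a + b / y^2)"
      proof -
        have "2 * sqrt (a * b) = 2 * (sqrt (a * y) * sqrt (b / y))" using True by (simp flip: real_sqrt_mult)
        also have "... \<le> (sqrt (a * y))^2 + (sqrt (b / y))^2"
          using sum_squares_bound[of "sqrt (a * y)" "sqrt (b / y)"] by (simp add: mult.assoc)
        also have "... = y * (a + b / y^2)" using True p by (simp add: field_simps power2_eq_square)
        finally show ?thesis .
      qed
      hence "1 / y \<le> (a + b / y^2) / (2 * sqrt (a * b))"
        using True sq by (simp add: field_simps)
      moreover have "1 / (L^2 + (?v y)^2) ^ m \<le> 1 / (L ^ (2*m - 2) * (L^2 + real m * (?v y)^2))"
        using power_add_ge[OF p(3) m, of "?v y"] pos[of y] p
        by (intro divide_left_mono mult_pos_pos zero_less_power add_pos_nonneg) auto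
      ultimately have "1 / y * (1 / (L^2 + (?v y)^2) ^ m) \<le> (a + b / y^2) / (2 * sqrt (a * b)) * (1 / (L ^ (2*m - 2) * (L^2 + real m * (?v y)^2)))"
        using p True pos[of y] by (intro mult_mono) (auto intro!: divide_nonneg_nonneg add_nonneg_nonneg)
      thus ?thesis using True by (simp add: g_def mult_ac)
    qed (simp add: g_def)
    show "g y \<ge> 0" by (simp add: g_def indicator_def)
  qed
  have gm: "g \<in> borel_measurable lborel" unfolding g_def by measurable
  show gi: "integrable lborel g"
  proof (rule Bochner_Integration.integrable_bound[OF integrable_mult_right[OF I(1)] gm], rule AE_I2)
    fix y
    have "norm (g y) = g y" using g0 by simp
    also have "... \<le> ?c * (ipos y * ?f y)" by (rule le)
    also have "... \<le> norm (?c * (ipos y * ?f y))" unfolding real_norm_def by (rule abs_ge_self)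
    finally show "norm (g y) \<le> norm (?c * (ipos y * ?f y))" .
  qed
  have "(LBINT y. g y) \<le> (LBINT y. ?c * (ipos y * ?f y))"
    by (rule integral_mono[OF gi integrable_mult_right[OF I(1)] le])
  also have "... = ?c * ((pi / 2) / (L * sqrt (real m)) - (- (pi / 2)) / (L * sqrt (real m)))"
    unfolding I(2)[symmetric] by (rule integral_mult_right_zero)
  also have "... = pi / (2 * sqrt (a * b) * L ^ (2*m - 1) * sqrt (real m))"
  proof -
    have "2*m - 1 = Suc (2*m - 2)" using m by simp
    hence "L ^ (2*m - 1) = L * L ^ (2*m - 2)" by simp
    thus ?thesis by (simp add: mult_ac)
  qed
  finally show "(LBINT y. g y) \<le> pi / (2 * sqrt (a * b) * L ^ (2*m - 1) * sqrt (real m))" .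
qed

text \<open>The integral of the term of \<open>(a, b, c, d)\<close> is governed by the two quantities
  \<open>abcd\<close> and \<open>|ad| + |bc|\<close>, because
  \<open>(a\<^sup>2 y\<^sup>2 + b\<^sup>2) (c\<^sup>2 y\<^sup>2 + d\<^sup>2) = y\<^sup>2 ((|ad| + |bc|)\<^sup>2 + (|ac| y - |bd| / y)\<^sup>2)\<close>.\<close>
fun mprod :: "mat2 \<Rightarrow> int" where "mprod (a, b, c, d) = a * b * c * d"

text \<open>The share of a single matrix in \<open>ray k (half_sum k l)\<close>.\<close>

definition axis_term :: "nat \<Rightarrow> mat2 \<Rightarrow> real \<Rightarrow> complex" where
  "axis_term k M y = ipos y *\<^sub>R (1 / (mnum M (\<i> * of_real y) ^ k * mden M (\<i> * of_real y) ^ k) * of_real y ^ (k - 1))"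

lemma axis_term_measurable: "axis_term k M \<in> borel_measurable borel"
  by (cases M) (simp add: axis_term_def[abs_def], measurable)

abbreviation generic_mats :: "nat \<Rightarrow> mat2 set" where
  "generic_mats l \<equiv> {M \<in> mats (int l). mprod M \<noteq> 0}"

abbreviation degenerate_mats :: "nat \<Rightarrow> mat2 set" where
  "degenerate_mats l \<equiv> {M \<in> mats (int l). mprod M = 0}"

fun msize :: "mat2 \<Rightarrow> int" where "msize (a, b, c, d) = \<bar>a * d\<bar> + \<bar>b * c\<bar>"

text \<open>Evenness of \<open>k\<close> allows the k-th powers of the two moduli to be read as the
  \<open>k div 2\<close>-th power of the product of their squares, to which the identity stated with
  \<open>mprod\<close> applies.\<close>

lemma norm_axis_term:
  assumes k: "even k" "k \<ge> 2"
  shows "norm (axis_term k (a, b, c, d) y) = ipos y * (1 / (y *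
     ((of_int (msize (a, b, c, d)))^2 + (of_int \<bar>a * c\<bar> * y - of_int \<bar>b * d\<bar> / y)^2) ^ (k div 2)))"
proof (cases "y > 0")
  case True
  define m where "m = k div 2"
  have km: "k = 2 * m" "m \<ge> 1" using k by (auto simp: m_def)
  let ?p = "norm (mnum (a, b, c, d) (\<i> * of_real y))" and ?q = "norm (mden (a, b, c, d) (\<i> * of_real y))"
  let ?Q = "(real_of_int (msize (a, b, c, d)))^2 + (of_int \<bar>a * c\<bar> * y - of_int \<bar>b * d\<bar> / y)^2"
  define A B C D where "A = \<bar>real_of_int a\<bar>" and "B = \<bar>real_of_int b\<bar>" and "C = \<bar>real_of_int c\<bar>" and "D = \<bar>real_of_int d\<bar>"
  have p: "?p^2 = (A * y)^2 + B^2" and q: "?q^2 = (C * y)^2 + D^2"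
    by (simp_all add: cmod_power2 A_def B_def C_def D_def power_mult_distrib)
  have Q: "?Q = (A * D + B * C)^2 + (A * C * y - B * D / y)^2"
    by (simp add: A_def B_def C_def D_def abs_mult)
  have pq: "?p^2 * ?q^2 = y^2 * ?Q"
    unfolding p q Q using True by (simp add: field_simps power2_eq_square)
  have "?p ^ k * ?q ^ k = (y^2 * ?Q) ^ m" unfolding km(1) power_mult pq[symmetric] by (rule power_mult_distrib[symmetric])
  also have "... = y ^ (k - 1) * y * ?Q ^ m"
    using km by (simp add: power_mult_distrib power_mult[symmetric] power_Suc2[symmetric])
  finally have "norm (axis_term k (a, b, c, d) y) = y ^ (k - 1) / (y ^ (k - 1) * y * ?Q ^ m)"
    using True by (simp add: axis_term_def norm_mult norm_divide norm_power)
  thus ?thesis using True by (simp add: m_def)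
qed (simp add: axis_term_def)

lemma axis_term_integral_bound:
  assumes M: "mprod M \<noteq> 0" and k: "even k" "k \<ge> 2"
  shows "integrable lborel (axis_term k M)"
    and "(LBINT y. norm (axis_term k M y)) \<le> pi / (2 * sqrt (real k / 2)) * (1 / (sqrt \<bar>of_int (mprod M)\<bar> * of_int (msize M) ^ (k - 1)))"
proof -
  obtain a b c d where abcd: "M = (a, b, c, d)" by (cases M)
  define m where "m = k div 2"
  have km: "k = 2 * m" "m \<ge> 1" using k by (auto simp: m_def)
  let ?u = "real_of_int \<bar>a * c\<bar>" and ?q = "real_of_int \<bar>b * d\<bar>"
  have p: "?u > 0" "?q > 0" and L: "real_of_int (msize M) > 0" using M by (auto simp: abcd abs_mult add_pos_pos)
  have nf: "norm (axis_term k M y) = ipos y * (1 / (y * ((of_int (msize M))^2 + (?u * y - ?q / y)^2) ^ m))" for y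
    unfolding abcd norm_axis_term[OF k] m_def ..
  note B = arctan_integral_bound[OF p L km(2)]
  have "integrable lborel (\<lambda>y. norm (axis_term k M y))" unfolding nf by (rule B(1))
  thus "integrable lborel (axis_term k M)"
    using integrable_norm_cancel[of lborel "axis_term k M"] axis_term_measurable[of k M] by simp
  have "(LBINT y. norm (axis_term k M y)) \<le> pi / (2 * sqrt (?u * ?q) * of_int (msize M) ^ (2*m - 1) * sqrt (real m))"
    unfolding nf by (rule B(2))
  also have "?u * ?q = \<bar>of_int (mprod M)\<bar>" by (simp add: abcd abs_mult)
  finally show "(LBINT y. norm (axis_term k M y)) \<le> pi / (2 * sqrt (real k / 2)) * (1 / (sqrt \<bar>of_int (mprod M)\<bar> * of_int (msize M) ^ (k - 1)))"
    by (simp add: km mult_ac)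
qed

section \<open>Counting and summing the matrices without a zero entry\<close>

lemma int_divisors:
  fixes p :: int assumes "p \<noteq> 0"
  shows "finite {a. a dvd p}" "card {a. a dvd p} \<le> 2 * divisor_count (nat \<bar>p\<bar>)"
proof -
  let ?D = "{d. d dvd nat \<bar>p\<bar>}"
  have fD: "finite ?D" by (rule finite_divisors_nat) (use assms in simp)
  have sub: "{a. a dvd p} \<subseteq> int ` ?D \<union> (\<lambda>d. - int d) ` ?D"
  proof
    fix a assume "a \<in> {a. a dvd p}"
    hence d: "nat \<bar>a\<bar> \<in> ?D" by (simp add: nat_abs_dvd_iff int_dvd_int_iff[symmetric] del: int_dvd_int_iff)
    show "a \<in> int ` ?D \<union> (\<lambda>d. - int d) ` ?D"
    proof (cases "a \<ge> 0")
      case True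
      hence "a = int (nat \<bar>a\<bar>)" by simp
      thus ?thesis using d by blast
    next
      case False
      hence "a = - int (nat \<bar>a\<bar>)" by simp
      thus ?thesis using d by blast
    qed
  qed
  show "finite {a. a dvd p}" by (rule finite_subset[OF sub]) (use fD in simp)
  have "card {a. a dvd p} \<le> card (int ` ?D \<union> (\<lambda>d. - int d) ` ?D)" by (rule card_mono) (use sub fD in auto)
  also have "... \<le> card (int ` ?D) + card ((\<lambda>d. - int d) ` ?D)" by (rule card_Un_le)
  also have "... \<le> card ?D + card ?D" using fD by (intro add_mono card_image_le)
  finally show "card {a. a dvd p} \<le> 2 * divisor_count (nat \<bar>p\<bar>)" by (simp add: divisor_count_def)
qed

definition fibre :: "int \<Rightarrow> int \<Rightarrow> mat2 set" where
  "fibre p q = {(a, b, c, d). a * d = p \<and> b * c = q}"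

text \<open>The pair \<open>(a, b)\<close> determines the matrix, with \<open>a\<close> dividing
  \<open>p\<close> and \<open>b\<close> dividing \<open>q\<close>; the factor 4 accounts for the two
  signs.\<close>

lemma card_fibre:
  assumes "p \<noteq> 0" "q \<noteq> 0"
  shows "finite (fibre p q)" "card (fibre p q) \<le> 4 * divisor_count (nat \<bar>p\<bar>) * divisor_count (nat \<bar>q\<bar>)"
proof -
  let ?f = "\<lambda>(a, b, c, d). (a, b)" and ?T = "{a. a dvd p} \<times> {b. b dvd q}"
  have inj: "inj_on ?f (fibre p q)" using assms by (auto simp: inj_on_def fibre_def)
  have sub: "?f ` fibre p q \<subseteq> ?T" by (auto simp: fibre_def)
  have fT: "finite ?T" using int_divisors(1) assms by blast
  show "finite (fibre p q)" using inj sub fT finite_imageD finite_subset by blast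
  have "card (fibre p q) \<le> card ?T" using inj sub fT card_inj_on_le by blast
  also have "... \<le> (2 * divisor_count (nat \<bar>p\<bar>)) * (2 * divisor_count (nat \<bar>q\<bar>))"
    unfolding card_cartesian_product by (intro mult_mono int_divisors(2) assms) auto
  finally show "card (fibre p q) \<le> 4 * divisor_count (nat \<bar>p\<bar>) * divisor_count (nat \<bar>q\<bar>)" by simp
qed

lemma sum_le_by_fibres:
  fixes w :: "'a \<Rightarrow> real"
  assumes F: "finite F" and w: "\<And>M. M \<in> F \<Longrightarrow> w M = v (g M)" and v: "\<And>n. v n \<ge> 0"
    and c: "\<And>n. n \<in> g ` F \<Longrightarrow> {M \<in> F. g M = n} \<subseteq> A n \<and> finite (A n) \<and> real (card (A n)) * v n \<le> u n"
  shows "(\<Sum>M\<in>F. w M) \<le> (\<Sum>n\<in>g ` F. u n)"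
proof -
  have "(\<Sum>M\<in>F. w M) = (\<Sum>n\<in>g ` F. \<Sum>M | M \<in> F \<and> g M = n. w M)" by (rule sum.image_gen[OF F])
  also have "... \<le> (\<Sum>n\<in>g ` F. u n)"
  proof (rule sum_mono)
    fix n assume n: "n \<in> g ` F"
    have "(\<Sum>M | M \<in> F \<and> g M = n. w M) = (\<Sum>M | M \<in> F \<and> g M = n. v n)"
      by (rule sum.cong) (use w in auto)
    also have "... = real (card {M \<in> F. g M = n}) * v n" by simp
    also have "... \<le> real (card (A n)) * v n"
      using c[OF n] v by (intro mult_right_mono) (auto intro: card_mono)
    also have "... \<le> u n" using c[OF n] by blast
    finally show "(\<Sum>M | M \<in> F \<and> g M = n. w M) \<le> u n" .
  qed
  finally show ?thesis .
qed

lemma sum_int_abs_le: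
  fixes h :: "nat \<Rightarrow> real"
  assumes h: "\<And>N. finite N \<Longrightarrow> sum h N \<le> Z" and P: "finite P"
  shows "(\<Sum>p\<in>P. h (nat \<bar>p\<bar>)) \<le> 2 * Z"
proof -
  have half: "(\<Sum>p\<in>Q. h (nat \<bar>p\<bar>)) \<le> Z" if "finite Q" "inj_on (\<lambda>p. nat \<bar>p\<bar>) Q" for Q :: "int set"
    using h[of "(\<lambda>p. nat \<bar>p\<bar>) ` Q"] that by (simp add: sum.reindex o_def)
  have "(\<Sum>p\<in>P. h (nat \<bar>p\<bar>)) = (\<Sum>p\<in>P \<inter> {0..}. h (nat \<bar>p\<bar>)) + (\<Sum>p\<in>P \<inter> {..<0}. h (nat \<bar>p\<bar>))"
    using P by (subst sum.union_disjoint[symmetric]) (auto intro!: sum.cong)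
  also have "... \<le> Z + Z" by (intro add_mono half) (use P in \<open>auto simp: inj_on_def\<close>)
  finally show ?thesis by simp
qed

text \<open>By symmetry let \<open>x <= y\<close>. Then \<open>y\<close> is comparable with
  \<open>x + y\<close>, and the total exponent of \<open>x + y\<close> is divided: the part
  \<open>1 - k + 3 d\<close> is spent on \<open>l\<close>, and \<open>- 1/2 - 2 d\<close> on
  \<open>x\<close>, which leaves the summable \<open>x powr (- 1 - d)\<close>. The bound
  \<open>d <= 1/3\<close> keeps the exponent of \<open>l\<close> non-positive.\<close>

lemma weight_bound:
  fixes x y l d :: real
  assumes xy: "x \<ge> 1" "y \<ge> 1" "x + y \<ge> l" and l: "l \<ge> 1" and d: "d > 0" "d \<le> 1/3" and k: "k \<ge> 2"
  shows "x powr d * y powr d / (sqrt (x * y) * (x + y) ^ (k - 1)) \<le> 2 * l powr (1 - real k + 3*d) * (x powr (- 1 - d) + y powr (- 1 - d))"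
  using xy
proof (induction x y rule: linorder_wlog)
  case (le x y)
  have "y powr (d - 1/2) \<le> ((x + y) / 2) powr (d - 1/2)" using le d by (intro powr_mono2') auto
  also have "... = (x + y) powr (d - 1/2) * 2 powr (1/2 - d)"
    using le powr_minus_divide[of 2 "d - 1/2"] by (simp add: powr_divide)
  also have "... \<le> (x + y) powr (d - 1/2) * 2 powr 1" using d by (intro mult_left_mono powr_mono) auto
  finally have y: "y powr (d - 1/2) \<le> (x + y) powr (d - 1/2) * 2" by simp
  have "(x + y) powr (d - 1/2) / (x + y) ^ (k - 1) = (x + y) powr (- 1/2 - 2*d) * (x + y) powr (1 - real k + 3*d)"
    using le k by (simp add: powr_realpow[symmetric] powr_diff[symmetric] powr_add[symmetric] of_nat_diff)
  also have "... \<le> x powr (- 1/2 - 2*d) * l powr (1 - real k + 3*d)"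
    using le l d k by (intro mult_mono powr_mono2') auto
  finally have s: "(x + y) powr (d - 1/2) / (x + y) ^ (k - 1) \<le> x powr (- 1/2 - 2*d) * l powr (1 - real k + 3*d)" .
  have "x powr d * y powr d / (sqrt (x * y) * (x + y) ^ (k - 1)) = x powr (d - 1/2) * y powr (d - 1/2) / (x + y) ^ (k - 1)"
    using le by (simp add: powr_diff powr_half_sqrt real_sqrt_mult)
  also have "... \<le> x powr (d - 1/2) * ((x + y) powr (d - 1/2) * 2) / (x + y) ^ (k - 1)"
    using y le by (intro divide_right_mono mult_left_mono) auto
  also have "... = 2 * x powr (d - 1/2) * ((x + y) powr (d - 1/2) / (x + y) ^ (k - 1))" by simp
  also have "... \<le> 2 * x powr (d - 1/2) * (x powr (- 1/2 - 2*d) * l powr (1 - real k + 3*d))"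
    by (intro mult_left_mono s) auto
  also have "... = 2 * l powr (1 - real k + 3*d) * (x powr (d - 1/2) * x powr (- 1/2 - 2*d))" by simp
  also have "x powr (d - 1/2) * x powr (- 1/2 - 2*d) = x powr (- 1 - d)"
    unfolding powr_add[symmetric] by (rule arg_cong[where f = "\<lambda>t. x powr t"]) simp
  finally show ?case by (rule order.trans) (intro mult_left_mono, auto)
next
  case (sym y x)
  thus ?case by (simp add: add.commute mult.commute)
qed

text \<open>With \<open>p = a d\<close> and hence \<open>b c = p - l\<close>, the summand depends on
  \<open>p\<close> alone, and the divisor bound counts the matrices for each \<open>p\<close>. Since
  \<open>|p| + |p - l| >= l\<close>, \<open>weight_bound\<close> extracts the power of
  \<open>l\<close> and leaves a series over \<open>p\<close> that is bounded uniformly in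
  \<open>l\<close>.\<close>

lemma sum_weights:
  assumes t: "t > 0" "t \<le> 1/3"
  obtains C where "C \<ge> 0" "\<And>k l F. k \<ge> 2 \<Longrightarrow> l > 0 \<Longrightarrow> finite F \<Longrightarrow> F \<subseteq> generic_mats l \<Longrightarrow>
      (\<Sum>M\<in>F. 1 / (sqrt \<bar>of_int (mprod M)\<bar> * of_int (msize M) ^ (k - 1))) \<le> C * real l powr (1 - real k + 3*t)"
proof -
  obtain D where D: "D \<ge> 1" "\<And>n. n > 0 \<Longrightarrow> real (divisor_count n) \<le> D * real n powr t"
    using divisor_bound[OF t(1)] by blast
  define h where "h n = real n powr (- 1 - t)" for n
  have sz: "summable h" unfolding h_def[abs_def] using t by (subst summable_real_powr_iff) simp
  define Z where "Z = suminf h"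
  have Z: "sum h N \<le> Z" if "finite N" for N
    unfolding Z_def by (rule sum_le_suminf[OF sz that]) (auto simp: h_def)
  have Z0: "Z \<ge> 0" using Z[of "{}"] by simp
  show ?thesis
  \<comment> \<open>The factor 32 collects 4 from the fibres, 2 from \<open>weight_bound\<close>,
    and 4 because both \<open>p\<close> and \<open>p - l\<close> run over integers of either
    sign.\<close>
  proof (rule that[of "32 * D^2 * Z"])
    show "32 * D^2 * Z \<ge> 0" using Z0 by simp
    fix k l :: nat and F assume k: "k \<ge> 2" and l: "l > 0" and F: "finite F" "F \<subseteq> generic_mats l"
    define g where "g = (\<lambda>(a, b :: int, c :: int, d). a * d :: int)"
    define v where "v p = 1 / (sqrt (of_int (\<bar>p\<bar> * \<bar>p - int l\<bar>)) * of_int (\<bar>p\<bar> + \<bar>p - int l\<bar>) ^ (k - 1))" for p :: int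
    define X where "X = 8 * D^2 * real l powr (1 - real k + 3*t)"
    have key: "g M \<noteq> 0 \<and> g M \<noteq> int l \<and> M \<in> fibre (g M) (g M - int l) \<and>
        mprod M = g M * (g M - int l) \<and> msize M = \<bar>g M\<bar> + \<bar>g M - int l\<bar>" if "M \<in> F" for M
    proof -
      obtain a b c d where abcd: "M = (a, b, c, d)" by (cases M)
      have "a * d - b * c = int l" "a * d * (b * c) \<noteq> 0" using subsetD[OF F(2) that] by (auto simp: abcd)
      moreover from this have "b * c = a * d - int l" by simp
      ultimately show ?thesis by (simp add: abcd g_def fibre_def)
    qed
    have "(\<Sum>M\<in>F. 1 / (sqrt \<bar>of_int (mprod M)\<bar> * of_int (msize M) ^ (k - 1))) \<le> (\<Sum>p\<in>g ` F. X * (h (nat \<bar>p\<bar>) + h (nat \<bar>p - int l\<bar>)))"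
    proof (rule sum_le_by_fibres[OF F(1), where v = v and A = "\<lambda>p. fibre p (p - int l)"])
      show "1 / (sqrt \<bar>of_int (mprod M)\<bar> * of_int (msize M) ^ (k - 1)) = v (g M)" if "M \<in> F" for M
        using key[OF that] by (simp add: v_def abs_mult)
      show v0: "v p \<ge> 0" for p by (simp add: v_def)
      fix p assume "p \<in> g ` F"
      hence p: "p \<noteq> 0" "p - int l \<noteq> 0" using key by auto
      define x y where "x = nat \<bar>p\<bar>" and "y = nat \<bar>p - int l\<bar>"
      have xy: "x > 0" "y > 0" "l \<le> x + y" using p by (auto simp: x_def y_def)
      have "real (card (fibre p (p - int l))) \<le> real (4 * divisor_count x * divisor_count y)"
        unfolding x_def y_def by (subst of_nat_le_iff) (rule card_fibre(2)[OF p])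
      also have "... = 4 * (real (divisor_count x) * real (divisor_count y))" by simp
      also have "... \<le> 4 * ((D * real x powr t) * (D * real y powr t))"
        using D xy by (intro mult_left_mono mult_mono) auto
      finally have "real (card (fibre p (p - int l))) * v p \<le> 4 * ((D * real x powr t) * (D * real y powr t)) * v p"
        using v0 by (rule mult_right_mono)
      also have "... = 4 * D^2 * (real x powr t * real y powr t / (sqrt (real x * real y) * (real x + real y) ^ (k - 1)))"
        by (simp add: v_def x_def y_def power2_eq_square)
      also have "... \<le> 4 * D^2 * (2 * real l powr (1 - real k + 3*t) * (real x powr (- 1 - t) + real y powr (- 1 - t)))"
        by (intro mult_left_mono weight_bound t k) (use xy l in auto)
      also have "... = X * (h (nat \<bar>p\<bar>) + h (nat \<bar>p - int l\<bar>))" by (simp add: X_def h_def x_def y_def)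
      finally show "{M \<in> F. g M = p} \<subseteq> fibre p (p - int l) \<and> finite (fibre p (p - int l)) \<and>
          real (card (fibre p (p - int l))) * v p \<le> X * (h (nat \<bar>p\<bar>) + h (nat \<bar>p - int l\<bar>))"
        using key card_fibre(1)[OF p] by auto
    qed
    also have "... = X * ((\<Sum>p\<in>g ` F. h (nat \<bar>p\<bar>)) + (\<Sum>p\<in>(\<lambda>p. p - int l) ` g ` F. h (nat \<bar>p\<bar>)))"
      by (simp add: sum_distrib_left[symmetric] sum.distrib sum.reindex inj_on_def)
    also have "... \<le> X * (2 * Z + 2 * Z)"
      using F(1) by (intro mult_left_mono add_mono sum_int_abs_le Z) (auto simp: X_def)
    finally show "(\<Sum>M\<in>F. 1 / (sqrt \<bar>of_int (mprod M)\<bar> * of_int (msize M) ^ (k - 1))) \<le> 32 * D^2 * Z * real l powr (1 - real k + 3*t)"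
      by (simp add: X_def mult_ac)
  qed
qed

lemma axis_term_abs_summable:
  assumes l: "l > 0" and k: "k \<ge> 4" and N: "N \<subseteq> mats (int l)"
  shows "(\<lambda>M. norm (axis_term k M y)) summable_on N"
proof (cases "y > 0")
  case True
  have "(\<lambda>M. norm (1 / (mnum M (\<i> * of_real y) ^ k * mden M (\<i> * of_real y) ^ k)) * norm (of_real y ^ (k - 1) :: complex)) summable_on N"
    by (rule summable_on_cmult_left, rule summable_on_subset_banach[OF half_abs_summable N])
       (use True l k in auto)
  moreover have "norm (axis_term k M y) = norm (1 / (mnum M (\<i> * of_real y) ^ k * mden M (\<i> * of_real y) ^ k)) * norm (of_real y ^ (k - 1) :: complex)" for M
    unfolding norm_mult[symmetric] axis_term_def using True by simp
  ultimately show ?thesis by (simp only:)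
qed (simp add: axis_term_def)

lemma axis_term_sum:
  assumes N: "N \<subseteq> mats (int l)" and l: "l > 0" and k: "k \<ge> 4"
    and int: "\<And>M. M \<in> N \<Longrightarrow> integrable lborel (axis_term k M)"
    and w: "\<And>M. M \<in> N \<Longrightarrow> (LBINT y. norm (axis_term k M y)) \<le> w M"
    and E: "\<And>F. finite F \<Longrightarrow> F \<subseteq> N \<Longrightarrow> (\<Sum>M\<in>F. w M) \<le> E"
  shows "integrable lborel (\<lambda>y. \<Sum>\<^sub>\<infinity>M\<in>N. axis_term k M y)"
    and "norm (LBINT y. (\<Sum>\<^sub>\<infinity>M\<in>N. axis_term k M y)) \<le> E"
proof -
  have cN: "countable N" by simp
  have pt: "(\<lambda>M. norm (axis_term k M y)) summable_on N" for y by (rule axis_term_abs_summable[OF l k N])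
  have le: "(\<Sum>M\<in>F. LBINT y. norm (axis_term k M y)) \<le> E" if "finite F" "F \<subseteq> N" for F
    using E[OF that] w that(2) by (meson order.trans subsetD sum_mono)
  have sm: "(\<lambda>M. LBINT y. norm (axis_term k M y)) summable_on N"
    by (rule nonneg_bdd_above_summable_on) (use le in \<open>auto intro!: bdd_aboveI2[where M = E]\<close>)
  note I = integral_infsum[OF cN int pt sm]
  show "integrable lborel (\<lambda>y. \<Sum>\<^sub>\<infinity>M\<in>N. axis_term k M y)" by (rule I(1))
  have le1: "norm (LBINT y. axis_term k M y) \<le> (LBINT y. norm (axis_term k M y))" for M
    by (rule integral_norm_bound)
  have sm': "(\<lambda>M. norm (LBINT y. axis_term k M y)) summable_on N"
    by (rule Infinite_Sum.abs_summable_on_comparison_test'[where f = "\<lambda>M. \<integral>y. axis_term k M y \<partial>lborel", OF sm le1])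
  have "norm (LBINT y. (\<Sum>\<^sub>\<infinity>M\<in>N. axis_term k M y)) = norm (\<Sum>\<^sub>\<infinity>M\<in>N. LBINT y. axis_term k M y)"
    using infsumI[OF I(2)] by simp
  also have "... \<le> (\<Sum>\<^sub>\<infinity>M\<in>N. norm (LBINT y. axis_term k M y))" by (rule norm_infsum_bound[OF sm'])
  also have "... \<le> (\<Sum>\<^sub>\<infinity>M\<in>N. LBINT y. norm (axis_term k M y))"
    by (rule infsum_mono[OF sm' sm]) auto
  also have "... \<le> E" by (rule infsum_le_finite_sums[OF sm le])
  finally show "norm (LBINT y. (\<Sum>\<^sub>\<infinity>M\<in>N. axis_term k M y)) \<le> E" .
qed

lemma generic_terms_bound:
  assumes d: "d > 0" "d \<le> 1/3"
  obtains C where "C \<ge> 0" "\<And>k l. even k \<Longrightarrow> k \<ge> 4 \<Longrightarrow> l > 0 \<Longrightarrow>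
      integrable lborel (\<lambda>y. \<Sum>\<^sub>\<infinity>M\<in>generic_mats l. axis_term k M y) \<and>
      norm (LBINT y. (\<Sum>\<^sub>\<infinity>M\<in>generic_mats l. axis_term k M y))
        \<le> C * (real l powr (1 - real k + 3*d) / sqrt (real k))"
proof -
  let ?w = "\<lambda>k M. 1 / (sqrt \<bar>of_int (mprod M)\<bar> * of_int (msize M) ^ (k - 1)) :: real"
  obtain C where C: "C \<ge> 0" "\<And>k l F. k \<ge> 2 \<Longrightarrow> l > 0 \<Longrightarrow> finite F \<Longrightarrow> F \<subseteq> generic_mats l \<Longrightarrow>
      (\<Sum>M\<in>F. ?w k M) \<le> C * real l powr (1 - real k + 3*d)" using sum_weights[OF d] by blast
  show ?thesis
  proof (rule that[of "pi * C"])
    show "pi * C \<ge> 0" using C(1) by simp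
    fix k l :: nat assume k: "even k" "k \<ge> 4" and l: "l > 0"
    have k2: "k \<ge> 2" using k by simp
    let ?N = "generic_mats l" and ?X = "real l powr (1 - real k + 3*d)"
    have "sqrt (real k) = sqrt 2 * sqrt (real k / 2)" by (simp flip: real_sqrt_mult)
    also have "... \<le> 2 * sqrt (real k / 2)" using real_sqrt_le_mono[of 2 4] by (intro mult_right_mono) auto
    finally have sk: "pi / (2 * sqrt (real k / 2)) \<le> pi / sqrt (real k)" using k2 by (intro divide_left_mono) auto
    have E: "(\<Sum>M\<in>F. pi / (2 * sqrt (real k / 2)) * ?w k M) \<le> pi * C * (?X / sqrt (real k))" if F: "finite F" "F \<subseteq> ?N" for F
    proof -
      have "(\<Sum>M\<in>F. pi / (2 * sqrt (real k / 2)) * ?w k M) = pi / (2 * sqrt (real k / 2)) * (\<Sum>M\<in>F. ?w k M)"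
        by (rule sum_distrib_left[symmetric])
      also have "... \<le> pi / sqrt (real k) * (C * ?X)"
        by (rule order.trans[OF mult_left_mono[OF C(2)[OF k2 l F]] mult_right_mono[OF sk]]) (use C(1) in auto)
      finally show ?thesis by (simp add: mult_ac)
    qed
    have N: "?N \<subseteq> mats (int l)" by auto
    have I: "integrable lborel (axis_term k M)" "(LBINT y. norm (axis_term k M y)) \<le> pi / (2 * sqrt (real k / 2)) * ?w k M"
      if "M \<in> ?N" for M using axis_term_integral_bound[OF _ k(1) k2, of M] that by auto
    show "integrable lborel (\<lambda>y. \<Sum>\<^sub>\<infinity>M\<in>?N. axis_term k M y) \<and>
      norm (LBINT y. (\<Sum>\<^sub>\<infinity>M\<in>?N. axis_term k M y)) \<le> pi * C * (?X / sqrt (real k))"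
      using axis_term_sum[OF N l k(2) I E] by blast
  qed
qed

section \<open>Matrices with a zero entry\<close>

text \<open>The value of \<open>\<Sum>n\<ge>1. n powr (j - 1) * exp (- n * X)\<close>; the term \<open>0 ^ 0\<close> of the series
  is removed for \<open>j = 1\<close>.\<close>
definition psum :: "nat \<Rightarrow> real \<Rightarrow> real" where
  "psum j X = (if j = 0 then - ln (1 - exp (- X)) else (\<Sum>n. of_nat n ^ (j - 1) * exp (- X) ^ n) - (if j = 1 then 1 else 0))"

text \<open>Differentiation brings down \<open>- n\<close>. The correction for the term
  \<open>0 ^ 0\<close> is a constant and disappears.\<close>

lemma psum_deriv:
  assumes X: "X > 0"
  shows "(psum j has_real_derivative - psum (Suc j) X) (at X)"
proof (cases "j = 0")
  case True
  have e: "psum j = (\<lambda>X. - ln (1 - exp (- X)))" by (simp add: psum_def fun_eq_iff True)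
  have p: "psum (Suc j) X = exp (- X) / (1 - exp (- X))"
    using X by (simp add: psum_def True suminf_geometric field_simps)
  show ?thesis unfolding e p using X by (auto intro!: derivative_eq_intros)
next
  case False
  have e: "psum j = (\<lambda>X. (\<Sum>n. of_nat n ^ (j - 1) * exp (- X) ^ n) - (if j = 1 then 1 else 0))"
    using False by (simp add: psum_def fun_eq_iff)
  have p: "psum (Suc j) X = (\<Sum>n. of_nat n ^ Suc (j - 1) * exp (- X) ^ n)" using False by (simp add: psum_def)
  have D: "((\<lambda>X::real. exp (- X)) has_real_derivative - exp (- X)) (at X)" by (auto intro!: derivative_eq_intros)
  have "norm (exp (- X)) < 1" "exp (- X) \<noteq> 0" using X by auto
  note N = deriv_npow_series[OF this, of "j - 1"]
  show ?thesis unfolding e p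
    using DERIV_diff[OF DERIV_chain2[OF N D] DERIV_const[of "if j = 1 then 1 else 0"]] by simp
qed

lemma psum_eq_sum: "j \<ge> 2 \<Longrightarrow> psum j X = (\<Sum>n. of_nat n ^ (j - 1) * exp (- X) ^ n)"
  by (simp add: psum_def)

text \<open>Equals the sum over \<open>n >= 1\<close> of \<open>1 / n\<close> times the normalised
  incomplete gamma function \<open>\<Gamma>(k, n X) / \<Gamma>(k)\<close>, expanded as a finite
  exponential sum.\<close>

definition Phi :: "nat \<Rightarrow> real \<Rightarrow> real" where
  "Phi k X = (\<Sum>j<k. X ^ j * psum j X / fact j)"

text \<open>The derivative telescopes: differentiating the power in one summand cancels against
  differentiating \<open>psum\<close> in the preceding one, and only the last term survives.\<close>

lemma Phi_deriv:
  assumes X: "X > 0"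
  shows "(Phi (Suc k) has_real_derivative - (X ^ k / fact k * psum (Suc k) X)) (at X)"
proof (induction k)
  case 0
  have "Phi (Suc 0) = psum 0" by (simp add: Phi_def fun_eq_iff)
  thus ?case using psum_deriv[OF X, of 0] by simp
next
  case (Suc k)
  have e: "Phi (Suc (Suc k)) = (\<lambda>X. Phi (Suc k) X + X ^ Suc k * psum (Suc k) X / fact (Suc k))"
    by (simp add: Phi_def fun_eq_iff)
  have "((\<lambda>X. X ^ Suc k * psum (Suc k) X / fact (Suc k)) has_real_derivative
      (real (Suc k) * X ^ k * psum (Suc k) X + (- psum (Suc (Suc k)) X) * X ^ Suc k) / fact (Suc k)) (at X)"
    using DERIV_cdivide[OF DERIV_mult[OF DERIV_pow[of "Suc k" X] psum_deriv[OF X, of "Suc k"]], of "fact (Suc k)"] by simp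
  from DERIV_add[OF Suc this]
  have "((\<lambda>X. Phi (Suc k) X + X ^ Suc k * psum (Suc k) X / fact (Suc k)) has_real_derivative
     - (X ^ k / fact k * psum (Suc k) X) + (real (Suc k) * X ^ k * psum (Suc k) X + (- psum (Suc (Suc k)) X) * X ^ Suc k) / fact (Suc k)) (at X)" .
  also have "- (X ^ k / fact k * psum (Suc k) X) + (real (Suc k) * X ^ k * psum (Suc k) X + (- psum (Suc (Suc k)) X) * X ^ Suc k) / fact (Suc k)
     = - (X ^ Suc k / fact (Suc k) * psum (Suc (Suc k)) X)"
  proof -
    have f: "(fact (Suc k) :: real) = real (Suc k) * fact k" by simp
    have gen: "- (x / f * P) + (s * x * P + (- Q) * y) / (s * f) = - (y / (s * f) * Q)" if "s > 0" "f > 0" for x f P s Q y :: real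
      using that by (simp add: field_simps)
    show ?thesis unfolding f by (rule gen) auto
  qed
  finally show ?case unfolding e .
qed

lemma lipschitz_psum:
  assumes t: "t > 0" and m: "m \<ge> 2"
  shows "((\<lambda>b::int. 1 / (\<i> * of_real t + of_int b) ^ m) has_sum
     (of_real ((2 * pi * t) ^ m / fact (m - 1) * psum m (2 * pi * t)) / (\<i> * of_real t) ^ m)) UNIV"
proof -
  have "((\<lambda>b::int. 1 / (\<i> * of_real t + of_int b) ^ m) has_sum
    ((-2 * of_real pi * \<i>) ^ m / fact (m - 1) * (\<Sum>n. of_nat n ^ (m - 1) * e (of_nat n * (\<i> * of_real t))))) UNIV"
    by (rule lipschitz_formula) (use t m in auto)
  also have "(\<Sum>n. of_nat n ^ (m - 1) * e (of_nat n * (\<i> * of_real t))) = of_real (psum m (2 * pi * t))"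
  proof -
    have "norm (exp (- (2 * pi * t))) < 1" using t by simp
    hence s: "summable (\<lambda>n. of_nat n ^ (m - 1) * exp (- (2 * pi * t)) ^ n)" by (rule npow_summable)
    have row: "of_nat n ^ (m - 1) * e (of_nat n * (\<i> * of_real t)) = complex_of_real (of_nat n ^ (m - 1) * exp (- (2 * pi * t)) ^ n)" for n
      by (simp add: e_def exp_of_real[symmetric] exp_of_nat_mult[symmetric] algebra_simps)
    hence "(\<Sum>n. of_nat n ^ (m - 1) * e (of_nat n * (\<i> * of_real t))) = of_real (\<Sum>n. of_nat n ^ (m - 1) * exp (- (2 * pi * t)) ^ n)"
      unfolding row by (intro suminf_of_real[OF s, symmetric])
    thus ?thesis using m by (simp add: psum_eq_sum)
  qed
  also have "(-2 * of_real pi * \<i>) ^ m / fact (m - 1) * of_real (psum m (2 * pi * t)) =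
     of_real ((2 * pi * t) ^ m / fact (m - 1) * psum m (2 * pi * t)) / (\<i> * of_real t) ^ m"
  proof -
    have "(-2 * of_real pi * \<i>) ^ m * (\<i> * of_real t) ^ m = complex_of_real (2 * pi * t) ^ m"
      unfolding power_mult_distrib[symmetric] by (simp add: mult_ac)
    moreover have "(\<i> * complex_of_real t) ^ m \<noteq> 0" using t by simp
    ultimately have "(-2 * of_real pi * \<i>) ^ m = complex_of_real (2 * pi * t) ^ m / (\<i> * of_real t) ^ m"
      by (simp add: nonzero_eq_divide_eq)
    thus ?thesis by simp
  qed
  finally show ?thesis .
qed

text \<open>Read backwards, the Lipschitz formula says that
  \<open>X ^ j * psum j X / fact (j - 1)\<close> is 1, from the term \<open>b = 0\<close>, plus an
  error of order \<open>t ^ j\<close> from the other integers. For \<open>j = 1\<close>, where that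
  sum is not absolutely convergent, the geometric series is evaluated directly.\<close>

lemma psum_power_tendsto:
  assumes j: "j \<ge> 1"
  shows "((\<lambda>X. X ^ j * psum j X / fact j) \<longlongrightarrow> 1 / real j) (at_right 0)"
proof (cases "j = 1")
  case True
  have "((\<lambda>X::real. X * (exp (- X) / (1 - exp (- X)))) \<longlongrightarrow> 1) (at_right 0)" by real_asymp
  moreover have "\<forall>\<^sub>F X in at_right 0. X * (exp (- X) / (1 - exp (- X))) = X ^ j * psum j X / fact j"
    using eventually_at_right_less[of 0]
  proof eventually_elim
    case (elim X)
    hence "psum 1 X = exp (- X) / (1 - exp (- X))" by (simp add: psum_def suminf_geometric field_simps)
    thus ?case using True by simp
  qed
  ultimately show ?thesis using True by (simp add: Lim_transform_eventually)
next
  case False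
  hence j2: "j \<ge> 2" using j by simp
  define h where "h b = 1 / (real_of_int \<bar>b\<bar>) ^ j" for b :: int
  have hs: "h summable_on (- {0})"
  proof (rule summable_on_comparison_test[where f = "\<lambda>b::int. 4 * (1 / (1 + \<bar>real_of_int b\<bar>)^2)"])
    show "(\<lambda>b::int. 4 * (1 / (1 + \<bar>real_of_int b\<bar>)^2)) summable_on (- {0})"
      by (intro summable_on_cmult_right summable_on_subset_banach[OF inverse_square_int_summable]) auto
    fix b :: int assume "b \<in> - {0}"
    hence b: "\<bar>real_of_int b\<bar> \<ge> 1" by auto
    have "(1 + \<bar>real_of_int b\<bar>)^2 \<le> (2 * \<bar>real_of_int b\<bar>)^2" using b by (intro power_mono) auto
    also have "... = 4 * \<bar>real_of_int b\<bar>^2" by (simp add: power_mult_distrib)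
    also have "... \<le> 4 * \<bar>real_of_int b\<bar>^j" using b j2 by (intro mult_left_mono power_increasing) auto
    finally show "h b \<le> 4 * (1 / (1 + \<bar>real_of_int b\<bar>)^2)"
      using b by (simp add: h_def divide_simps)
  qed (simp add: h_def)
  define K where "K = (\<Sum>\<^sub>\<infinity>b\<in>- {0}. h b)"
  have main: "norm ((2 * pi * t) ^ j / fact (j - 1) * psum j (2 * pi * t) - 1) \<le> K * t ^ j" if t: "t > 0" for t
  proof -
    let ?g = "\<lambda>b::int. 1 / (\<i> * of_real t + of_int b) ^ j"
    let ?p = "(2 * pi * t) ^ j / fact (j - 1) * psum j (2 * pi * t)"
    have nz: "(\<i> * complex_of_real t) ^ j \<noteq> 0" using t by simp
    note S = lipschitz_psum[OF t j2]
    have gh: "norm (?g b) \<le> h b" if "b \<in> - {0}" for b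
    proof -
      have "\<bar>real_of_int b\<bar> \<le> norm (\<i> * of_real t + of_int b)" using abs_Re_le_cmod[of "\<i> * of_real t + of_int b"] by simp
      moreover have "\<bar>real_of_int b\<bar> > 0" using that by simp
      ultimately show ?thesis by (simp add: h_def norm_divide norm_power frac_le power_mono)
    qed
    have ga: "(\<lambda>b. norm (?g b)) summable_on (- {0})"
      by (rule Infinite_Sum.abs_summable_on_comparison_test'[OF hs gh])
    have "infsum ?g UNIV = ?g 0 + infsum ?g (- {0})"
    proof -
      have "infsum ?g ({0} \<union> - {0}) = infsum ?g {0} + infsum ?g (- {0})"
        by (rule infsum_Un_disjoint) (use abs_summable_summable[OF ga] in auto)
      thus ?thesis by simp
    qed
    moreover have "?g 0 = 1 / (\<i> * of_real t) ^ j" by simp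
    ultimately have "of_real ?p / (\<i> * of_real t) ^ j = 1 / (\<i> * of_real t) ^ j + infsum ?g (- {0})"
      using infsumI[OF S] by (simp only:)
    moreover have "P - 1 = Z * T" if "P / Z = 1 / Z + T" "Z \<noteq> 0" for P Z T :: complex
      using that by (simp add: field_simps)
    ultimately have "of_real ?p - 1 = (\<i> * of_real t) ^ j * infsum ?g (- {0})" using nz by blast
    hence "norm (complex_of_real (?p - 1)) = t ^ j * norm (infsum ?g (- {0}))"
      using t by (simp only: of_real_diff of_real_1 norm_mult norm_power) simp
    also have "norm (infsum ?g (- {0})) \<le> (\<Sum>\<^sub>\<infinity>b\<in>- {0}. norm (?g b))" by (rule norm_infsum_bound[OF ga])
    also have "... \<le> K" unfolding K_def by (rule infsum_mono[OF ga hs gh])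
    finally show ?thesis unfolding norm_of_real using t by (simp add: mult.commute)
  qed
  have lim0: "((\<lambda>t. K * t ^ j) \<longlongrightarrow> 0) (at_right 0)"
  proof -
    have "isCont (\<lambda>t. K * t ^ j) 0" by (intro continuous_intros)
    hence "((\<lambda>t. K * t ^ j) \<longlongrightarrow> K * 0 ^ j) (at 0)" by (simp add: isCont_def)
    hence "((\<lambda>t. K * t ^ j) \<longlongrightarrow> 0) (at 0)" using j by (simp add: power_0_left)
    thus ?thesis by (rule tendsto_mono[OF at_le[OF subset_UNIV]])
  qed
  have "((\<lambda>t. (2 * pi * t) ^ j / fact (j - 1) * psum j (2 * pi * t) - 1) \<longlongrightarrow> 0) (at_right 0)"
    by (rule Lim_null_comparison[OF _ lim0])
       (use main in \<open>auto intro: eventually_mono[OF eventually_at_right_less[of 0]]\<close>)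
  moreover have "filterlim (\<lambda>X::real. X / (2 * pi)) (at_right 0) (at_right 0)" using pi_gt_zero by real_asymp
  ultimately have "((\<lambda>X. (2 * pi * (X / (2 * pi))) ^ j / fact (j - 1) * psum j (2 * pi * (X / (2 * pi))) - 1) \<longlongrightarrow> 0) (at_right 0)"
    by (rule filterlim_compose)
  hence "((\<lambda>X. X ^ j / fact (j - 1) * psum j X) \<longlongrightarrow> 1) (at_right 0)" by (simp add: LIM_zero_iff)
  hence "((\<lambda>X. (X ^ j / fact (j - 1) * psum j X) * (1 / real j)) \<longlongrightarrow> 1 * (1 / real j)) (at_right 0)"
    by (intro tendsto_intros)
  moreover have row: "(X ^ j / fact (j - 1) * psum j X) * (1 / real j) = X ^ j * psum j X / fact j" for X
  proof -
    have "(fact j :: real) = real j * fact (j - 1)" using j by (simp add: fact_reduce)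
    thus ?thesis by simp
  qed
  ultimately show ?thesis unfolding row by (simp only: mult_1)
qed

text \<open>The origin of the harmonic number: the term \<open>j = 0\<close> behaves like
  \<open>- ln X\<close>, and every \<open>j\<close> from 1 to \<open>k\<close> tends to
  \<open>1 / j\<close>.\<close>

lemma Phi_at_0: "((\<lambda>X. Phi (Suc k) X + ln X) \<longlongrightarrow> harm k) (at_right 0)"
proof -
  have "((\<lambda>X. (psum 0 X + ln X) + (\<Sum>j\<in>{1..k}. X ^ j * psum j X / fact j)) \<longlongrightarrow> 0 + (\<Sum>j\<in>{1..k}. 1 / real j)) (at_right 0)"
  proof (intro tendsto_add tendsto_sum psum_power_tendsto)
    have "((\<lambda>X::real. - ln (1 - exp (- X)) + ln X) \<longlongrightarrow> 0) (at_right 0)" by real_asymp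
    thus "((\<lambda>X. psum 0 X + ln X) \<longlongrightarrow> 0) (at_right 0)" by (simp add: psum_def)
  qed auto
  moreover have row: "Phi (Suc k) X + ln X = (psum 0 X + ln X) + (\<Sum>j\<in>{1..k}. X ^ j * psum j X / fact j)" for X
  proof -
    have "{..<Suc k} = insert 0 {1..k}" by auto
    thus ?thesis by (simp add: Phi_def)
  qed
  ultimately show ?thesis unfolding row harm_def inverse_eq_divide by (simp only: add_0)
qed

lemma Phi_at_top: "(Phi k \<longlongrightarrow> 0) at_top"
proof -
  have "((\<lambda>X. X ^ j * psum j X / fact j) \<longlongrightarrow> 0) at_top" for j
  proof -
    consider "j = 0" | "j = 1" | "j \<ge> 2" by linarith
    thus ?thesis
    proof cases
      case 1
      have "((\<lambda>X::real. - ln (1 - exp (- X))) \<longlongrightarrow> 0) at_top" by real_asymp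
      thus ?thesis using 1 by (simp add: psum_def)
    next
      case 2
      have "((\<lambda>X::real. X * (exp (- X) / (1 - exp (- X)))) \<longlongrightarrow> 0) at_top" by real_asymp
      moreover have "\<forall>\<^sub>F X in at_top. X * (exp (- X) / (1 - exp (- X))) = X ^ j * psum j X / fact j"
        using eventually_gt_at_top[of 0]
      proof eventually_elim
        case (elim X)
        hence "psum 1 X = exp (- X) / (1 - exp (- X))" by (simp add: psum_def suminf_geometric field_simps)
        thus ?case using 2 by simp
      qed
      ultimately show ?thesis by (rule Lim_transform_eventually)
    next
      case 3
      have s: "summable (\<lambda>n. real n ^ (j - 1) * exp (- X) ^ n)" if "X > 0" for X
        using npow_summable[of "exp (- X)" "j - 1"] that by simp
      have bound: "0 \<le> psum j X \<and> psum j X \<le> exp (1 - X) * psum j 1" if X: "X \<ge> 1" for X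
      proof
        show "0 \<le> psum j X" unfolding psum_eq_sum[OF 3] using X by (intro suminf_nonneg s) auto
        have "psum j X \<le> (\<Sum>n. exp (1 - X) * (real n ^ (j - 1) * exp (- 1) ^ n))"
          unfolding psum_eq_sum[OF 3]
        proof (rule suminf_le)
          fix n
          show "real n ^ (j - 1) * exp (- X) ^ n \<le> exp (1 - X) * (real n ^ (j - 1) * exp (- 1) ^ n)"
          proof (cases "n = 0")
            case False
            have "1 * (X - 1) \<le> real n * (X - 1)" using X False by (intro mult_right_mono) auto
            hence "exp (- (real n * X)) \<le> exp ((1 - X) + - real n)" by (simp add: algebra_simps)
            moreover have "exp (- X) ^ n = exp (- (real n * X))" "exp (- 1) ^ n = exp (- real n)"
              by (simp_all add: exp_of_nat_mult[symmetric])
            ultimately have "exp (- X) ^ n \<le> exp (1 - X) * exp (- 1) ^ n" by (simp only: exp_add)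
            hence "real n ^ (j - 1) * exp (- X) ^ n \<le> real n ^ (j - 1) * (exp (1 - X) * exp (- 1) ^ n)" by (rule mult_left_mono) simp
            thus ?thesis by (simp add: mult_ac)
          qed (use 3 in \<open>simp add: power_0_left\<close>)
        qed (use X s[of X] s[of 1] in \<open>auto intro: summable_mult\<close>)
        also have "... = exp (1 - X) * psum j 1" unfolding psum_eq_sum[OF 3] by (rule suminf_mult[OF s]) simp
        finally show "psum j X \<le> exp (1 - X) * psum j 1" .
      qed
      show ?thesis
      proof (rule Lim_null_comparison)
        show "((\<lambda>X. (exp 1 * psum j 1 / fact j) * (X ^ j / exp X)) \<longlongrightarrow> 0) at_top"
          by (intro tendsto_mult_right_zero tendsto_power_div_exp_0)
        show "\<forall>\<^sub>F X in at_top. norm (X ^ j * psum j X / fact j) \<le> (exp 1 * psum j 1 / fact j) * (X ^ j / exp X)"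
          using eventually_ge_at_top[of 1]
        proof eventually_elim
          case (elim X)
          have "X ^ j * psum j X / fact j \<le> X ^ j * (exp (1 - X) * psum j 1) / fact j"
            using bound[OF elim] elim by (intro divide_right_mono mult_left_mono) auto
          moreover have "X ^ j * psum j X / fact j \<ge> 0" using bound[OF elim] elim by simp
          ultimately show ?case by (simp add: exp_diff mult_ac)
        qed
      qed
    qed
  qed
  hence "((\<lambda>X. \<Sum>j<k. X ^ j * psum j X / fact j) \<longlongrightarrow> (\<Sum>j<k. 0)) at_top" by (intro tendsto_sum)
  thus ?thesis by (simp add: Phi_def[abs_def])
qed

text \<open>Normalised such that the sum of \<open>(\<i> t + b) powr (- k)\<close> over all integers
  \<open>b\<close> is \<open>lip k (2 pi t)\<close> times the term \<open>b = 0\<close>. It tends to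
  1 at 0 and to 0 at infinity.\<close>

definition lip :: "nat \<Rightarrow> real \<Rightarrow> real" where
  "lip k X = X ^ k / fact (k - 1) * psum k X"

lemma lip_has_sum:
  assumes t: "t > 0" and k: "even k" "k \<ge> 2" and s: "s = 1 \<or> s = -1"
  shows "((\<lambda>b::int. 1 / (\<i> * of_real (of_int s * t) + of_int b) ^ k) has_sum (of_real (lip k (2 * pi * t)) / (\<i> * of_real t) ^ k)) UNIV"
proof -
  note L = lipschitz_psum[OF t k(2), folded lip_def]
  from s show ?thesis
  proof
    assume s: "s = -1"
    have "((\<lambda>b::int. 1 / (\<i> * of_real (of_int s * t) + of_int b) ^ k) has_sum (of_real (lip k (2 * pi * t)) / (\<i> * of_real t) ^ k)) (uminus ` UNIV)"
    proof (subst has_sum_reindex)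
      have "(\<i> * of_real (of_int s * t) + of_int (- b)) ^ k = (\<i> * of_real t + of_int b) ^ k" for b :: int
      proof -
        have "\<i> * of_real (of_int s * t) + of_int (- b) = - (\<i> * of_real t + of_int b)" by (simp add: s)
        thus ?thesis by (simp only: power_minus_even[OF k(1)])
      qed
      thus "((\<lambda>b::int. 1 / (\<i> * of_real (of_int s * t) + of_int b) ^ k) \<circ> uminus has_sum (of_real (lip k (2 * pi * t)) / (\<i> * of_real t) ^ k)) UNIV"
        using L by (simp only: o_def)
    qed simp
    thus ?thesis by simp
  qed (use L in simp)
qed

text \<open>Exchanging the rows only exchanges the two factors of a term when \<open>k\<close> is even, so the
  matrices with \<open>ad = 0\<close> contribute as much as those with \<open>bc = 0\<close>.\<close>
definition row_swap :: "mat2 \<Rightarrow> mat2" where "row_swap = (\<lambda>(a, b, c, d). (c, d, - a, - b))"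

lemma axis_term_row_swap: "even k \<Longrightarrow> axis_term k (row_swap M) y = axis_term k M y"
proof (cases M)
  case (fields a b c d)
  assume k: "even k"
  have "(- of_int a * (\<i> * complex_of_real y) + - of_int b) ^ k = (of_int a * (\<i> * of_real y) + of_int b) ^ k"
    using power_minus_even[OF k, of "of_int a * (\<i> * complex_of_real y) + of_int b"] by simp
  thus ?thesis by (simp add: fields axis_term_def row_swap_def mult.commute)
qed

text \<open>The matrices with diagonal \<open>s * (l / d), s * d\<close> and at least one zero off
  the diagonal. The diagonal matrix is common to both families and is removed from the second, which
  is the source of the \<open>- 1\<close> below. Without this grouping the terms could not be
  integrated.\<close>

definition block :: "nat \<Rightarrow> int \<Rightarrow> nat \<Rightarrow> mat2 set" where
  "block l s d = range (\<lambda>b. (s * int (l div d), b, 0, s * int d)) \<union> (\<lambda>c. (s * int (l div d), 0, c, s * int d)) ` (- {0})"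

text \<open>The first family is a Lipschitz sum at \<open>t = (l / d) y\<close>. In the second,
  \<open>\<i> y\<close> is taken out of \<open>c \<i> y + s d\<close>, which gives a Lipschitz sum
  at \<open>t = d / y\<close> with the opposite sign. As \<open>y\<close> tends to 0 or to infinity
  one of the two \<open>lip\<close> values tends to 1 and the other to 0, so the numerator vanishes
  at both ends.\<close>

lemma block_has_sum:
  assumes l: "l > 0" and d: "d dvd l" and k: "even k" "k \<ge> 2" and s: "s = 1 \<or> s = -1" and y: "y > 0"
  shows "((\<lambda>M. axis_term k M y) has_sum
    (\<i> ^ k * of_real ((lip k (2 * pi * (real (l div d) * y)) + lip k (2 * pi * (real d / y)) - 1) / (real l ^ k * y)))) (block l s d)"
proof -
  let ?i = "\<lambda>y. \<i> * of_real y"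
  define a where "a = l div d"
  have ad: "a * d = l" "a > 0" "d > 0" using l d by (auto simp: a_def intro: Nat.gr0I)
  note ik = i_power_even(1)[OF k(1)] and i1 = i_power_even(2)[OF k(1)]
  have sk: "(of_int s :: complex) ^ k = 1" using s k(1) by auto
  have yk: "complex_of_real y ^ k = of_real y ^ (k - 1) * of_real y" using k(2) by (simp flip: power_Suc2)
  have lk: "(of_nat l :: complex) ^ k = of_nat a ^ k * of_nat d ^ k" unfolding ad(1)[symmetric] by (simp add: power_mult_distrib)
  let ?p = "lip k (2 * pi * (real a * y))" and ?q = "lip k (2 * pi * (real d / y))"
  have ay: "real a * y > 0" and dy: "real d / y > 0" using ad y by auto
  have nz: "complex_of_real y \<noteq> 0" "(of_nat a :: complex) \<noteq> 0" "(of_nat d :: complex) \<noteq> 0" using ad y by auto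
  have 1: "((\<lambda>M. axis_term k M y) has_sum (\<i> ^ k * of_real (?p / (real l ^ k * y)))) (range (\<lambda>b. (s * int a, b, 0, s * int d)))"
  proof (subst has_sum_reindex)
    have "((\<lambda>b::int. of_real y ^ (k - 1) / of_nat d ^ k * (1 / (\<i> * of_real (of_int s * (real a * y)) + of_int b) ^ k)) has_sum
        (of_real y ^ (k - 1) / of_nat d ^ k * (of_real ?p / (\<i> * of_real (real a * y)) ^ k))) UNIV"
      by (intro has_sum_cmult_right lip_has_sum ay k s)
    also have "of_real y ^ (k - 1) / of_nat d ^ k * (of_real ?p / (\<i> * of_real (real a * y)) ^ k) = \<i> ^ k * of_real (?p / (real l ^ k * y))"
    proof -
      have "of_real y ^ (k - 1) / of_nat d ^ k * (of_real ?p / (\<i> * of_real (real a * y)) ^ k)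
         = (1 / \<i> ^ k) * (of_real ?p / (of_nat l ^ k * of_real y))"
        unfolding lk using nz by (simp add: power_mult_distrib yk)
      thus ?thesis unfolding i1 by simp
    qed
    also have "(\<lambda>b::int. of_real y ^ (k - 1) / of_nat d ^ k * (1 / (\<i> * of_real (of_int s * (real a * y)) + of_int b) ^ k)) =
        (\<lambda>M. axis_term k M y) \<circ> (\<lambda>b. (s * int a, b, 0, s * int d))"
      using y sk by (auto simp: fun_eq_iff axis_term_def power_mult_distrib mult_ac)
    finally show "((\<lambda>M. axis_term k M y) \<circ> (\<lambda>b. (s * int a, b, 0, s * int d)) has_sum \<i> ^ k * of_real (?p / (real l ^ k * y))) UNIV" .
  qed (auto simp: inj_on_def)
  have 2: "((\<lambda>M. axis_term k M y) has_sum (\<i> ^ k * of_real ((?q - 1) / (real l ^ k * y)))) ((\<lambda>c. (s * int a, 0, c, s * int d)) ` (- {0}))"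
  proof (subst has_sum_reindex)
    have s': "- s = 1 \<or> - s = -1" using s by auto
    let ?g = "\<lambda>c::int. of_real y ^ (k - 1) / (\<i> * of_real (real a * y)) ^ k * (1 / (?i y) ^ k * (1 / (\<i> * of_real (of_int (- s) * (real d / y)) + of_int c) ^ k))"
    have G: "(?g has_sum (of_real y ^ (k - 1) / (\<i> * of_real (real a * y)) ^ k * (1 / (?i y) ^ k * (of_real ?q / (\<i> * of_real (real d / y)) ^ k)))) UNIV"
      by (intro has_sum_cmult_right lip_has_sum dy k s')
    have e1: "of_real y ^ (k - 1) / (\<i> * of_real (real a * y)) ^ k * (1 / (?i y) ^ k * (of_real ?q / (\<i> * of_real (real d / y)) ^ k))
        = \<i> ^ k * of_real (?q / (real l ^ k * y))"
    proof -
      have "of_real y ^ (k - 1) / (\<i> * of_real (real a * y)) ^ k * (1 / (?i y) ^ k * (of_real ?q / (\<i> * of_real (real d / y)) ^ k))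
         = (1 / \<i> ^ k) * (1 / \<i> ^ k) * (1 / \<i> ^ k) * (of_real ?q / (of_nat l ^ k * of_real y))"
        unfolding lk using nz by (simp add: power_mult_distrib power_divide yk)
      thus ?thesis unfolding i1 using ik by (simp add: mult.assoc)
    qed
    have e2: "?g 0 = \<i> ^ k * of_real (1 / (real l ^ k * y))"
    proof -
      have sk': "(of_int (- s) :: complex) ^ k = 1" using s k(1) by auto
      define u where "u = (of_int (- s) :: complex)"
      have e: "\<i> * of_real (of_int (- s) * (real d / y)) + of_int 0 = \<i> * u * (of_nat d / of_real y)"
        by (simp add: u_def)
      have "?g 0 = (1 / \<i> ^ k) * (1 / \<i> ^ k) * (1 / \<i> ^ k) * (1 / u ^ k) * (1 / (of_nat l ^ k * of_real y))"
        unfolding lk e using nz by (simp add: power_mult_distrib power_divide yk)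
      thus ?thesis unfolding i1 u_def sk' using ik by (simp add: mult.assoc)
    qed
    have "(?g has_sum (\<i> ^ k * of_real (?q / (real l ^ k * y)) - ?g 0)) (UNIV - {0})"
      using G unfolding e1 by (intro has_sum_Diff) (auto intro: has_sum_finiteI)
    also have "\<i> ^ k * of_real (?q / (real l ^ k * y)) - ?g 0 = \<i> ^ k * of_real ((?q - 1) / (real l ^ k * y))"
      unfolding e2 by (simp add: diff_divide_distrib right_diff_distrib)
    finally have H: "(?g has_sum (\<i> ^ k * of_real ((?q - 1) / (real l ^ k * y)))) (- {0})" by (simp add: Compl_eq_Diff_UNIV)
    have e3: "?g c = axis_term k (s * int a, 0, c, s * int d) y" for c
    proof -
      have "?i y * (\<i> * of_real (of_int (- s) * (real d / y)) + of_int c) = of_int c * (?i y) + of_int (s * int d)"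
        using nz by (simp add: field_simps)
      hence "1 / (?i y) ^ k * (1 / (\<i> * of_real (of_int (- s) * (real d / y)) + of_int c) ^ k) = 1 / (of_int c * (?i y) + of_int (s * int d)) ^ k"
        by (metis (no_types) power_mult_distrib times_divide_times_eq mult_1)
      moreover have "(of_int (s * int a) * (\<i> * complex_of_real y)) ^ k = (\<i> * of_real (real a * y)) ^ k"
        using sk by (simp add: power_mult_distrib)
      ultimately show ?thesis using y by (simp add: axis_term_def)
    qed
    show "((\<lambda>M. axis_term k M y) \<circ> (\<lambda>c. (s * int a, 0, c, s * int d)) has_sum \<i> ^ k * of_real ((?q - 1) / (real l ^ k * y))) (- {0})"
      using H unfolding e3 o_def .
  qed (auto simp: inj_on_def)
  have "((\<lambda>M. axis_term k M y) has_sum (\<i> ^ k * of_real (?p / (real l ^ k * y)) + \<i> ^ k * of_real ((?q - 1) / (real l ^ k * y)))) (block l s d)"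
    unfolding block_def a_def[symmetric] by (rule has_sum_Un_disjoint[OF 1 2]) auto
  also have "\<i> ^ k * of_real (?p / (real l ^ k * y)) + \<i> ^ k * of_real ((?q - 1) / (real l ^ k * y)) =
    \<i> ^ k * of_real ((?p + ?q - 1) / (real l ^ k * y))"
    unfolding distrib_left[symmetric] of_real_add[symmetric] add_divide_distrib[symmetric] by (simp add: algebra_simps)
  finally show ?thesis unfolding a_def .
qed

text \<open>A zero entry forces \<open>b c = 0\<close> with \<open>a d = l\<close>, or
  \<open>a d = 0\<close> with \<open>b c = - l\<close>, and never both as \<open>l > 0\<close>. The
  first alternative is the union of the blocks, sorted by \<open>|d|\<close> and the sign of
  \<open>d\<close>; the second is its image under \<open>row_swap\<close>.\<close>

lemma degenerate_mats_blocks: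
  assumes l: "l > 0"
  defines "Z \<equiv> \<Union>(s, d)\<in>{1, -1} \<times> {d. d dvd l}. block l s d"
  shows "degenerate_mats l = Z \<union> row_swap ` Z" and "Z \<inter> row_swap ` Z = {}"
    and "\<And>i j. i \<in> {1, -1} \<times> {d. d dvd l} \<Longrightarrow> j \<in> {1, -1} \<times> {d. d dvd l} \<Longrightarrow> i \<noteq> j \<Longrightarrow>
       (case i of (s, d) \<Rightarrow> block l s d) \<inter> (case j of (s, d) \<Rightarrow> block l s d) = {}"
proof -
  have Z: "Z = {(a, b, c, d). a * d = int l \<and> b * c = 0}"
  proof (rule set_eqI, rule iffI)
    fix M assume "M \<in> Z"
    then obtain s d where sd: "s = 1 \<or> s = -1" "d dvd l" "M \<in> block l s d" unfolding Z_def by auto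
    have "s * int (l div d) * (s * int d) = int l"
      using sd(1,2) by (auto simp flip: of_nat_mult)
    thus "M \<in> {(a, b, c, d). a * d = int l \<and> b * c = 0}" using sd(3) by (auto simp: block_def)
  next
    fix M :: mat2 assume "M \<in> {(a, b, c, d). a * d = int l \<and> b * c = 0}"
    then obtain a b c d where M: "M = (a, b, c, d)" "a * d = int l" "b * c = 0" by auto
    define s where "s = sgn d"
    define d' where "d' = nat \<bar>d\<bar>"
    have d0: "d \<noteq> 0" using M(2) l by auto
    have s: "s = 1 \<or> s = -1" using d0 by (auto simp: s_def sgn_if)
    have d: "d = s * int d'" by (simp add: s_def d'_def sgn_mult_abs)
    have "(s * a) * int d' = int l" using M(2) d by (simp add: mult_ac)
    moreover have "s * a > 0"
      using calculation l d0 by (metis d'_def of_nat_0_less_iff of_nat_0_le_iff zero_less_mult_pos2 zero_less_abs_iff zero_less_nat_eq)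
    ultimately have "int (nat (s * a) * d') = int l" by simp
    hence l': "l = nat (s * a) * d'" by linarith
    have d'0: "d' > 0" using d0 by (simp add: d'_def)
    have dv: "d' dvd l" and a': "l div d' = nat (s * a)" using d'0 by (auto simp: l')
    have "a = s * int (l div d')" using s \<open>s * a > 0\<close> unfolding a' by auto
    hence "M \<in> block l s d'" using M(3) d unfolding M(1) block_def by auto
    thus "M \<in> Z" unfolding Z_def using s dv by blast
  qed
  have "M \<in> row_swap ` Z \<longleftrightarrow> (case M of (a, b, c, d) \<Rightarrow> - (b * c) = int l \<and> a * d = 0)" for M
  proof (cases M)
    case (fields a b c d)
    have "M = row_swap (- c, - d, a, b)" by (simp add: fields row_swap_def)
    moreover have "inj row_swap" by (auto simp: inj_def row_swap_def)
    ultimately have "M \<in> row_swap ` Z \<longleftrightarrow> (- c, - d, a, b) \<in> Z" by (simp add: inj_image_mem_iff)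
    thus ?thesis by (auto simp: Z fields mult.commute)
  qed
  hence W: "row_swap ` Z = {(a, b, c, d). - (b * c) = int l \<and> a * d = 0}" by (intro set_eqI) (simp only: mem_Collect_eq)
  show "Z \<inter> row_swap ` Z = {}" unfolding W unfolding Z using l by auto
  show "degenerate_mats l = Z \<union> row_swap ` Z" unfolding W unfolding Z by auto
  fix i j :: "int \<times> nat" assume ij: "i \<in> {1, -1} \<times> {d. d dvd l}" "j \<in> {1, -1} \<times> {d. d dvd l}" "i \<noteq> j"
  obtain s d s' d' where e: "i = (s, d)" "j = (s', d')" by (cases i; cases j)
  have 0: "d > 0" "d' > 0" using ij l by (auto simp: e intro: Nat.gr0I)
  have "s * int d \<noteq> s' * int d'" using ij 0 unfolding e by auto
  thus "(case i of (s, d) \<Rightarrow> block l s d) \<inter> (case j of (s, d) \<Rightarrow> block l s d) = {}"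
    unfolding e by (auto simp: block_def)
qed

text \<open>The factor 4 comes from the two signs \<open>s\<close> and from the two arrangements of
  the rows, which contribute equally.\<close>

lemma degenerate_sum:
  assumes l: "l > 0" and k: "even k" "k \<ge> 2" and y: "y > 0"
  shows "((\<lambda>M. axis_term k M y) has_sum (\<i> ^ k * of_real (4 / real l ^ k *
     (\<Sum>d | d dvd l. (lip k (2 * pi * (real (l div d) * y)) + lip k (2 * pi * (real d / y)) - 1) / y)))) (degenerate_mats l)"
proof -
  let ?S = "\<lambda>r. \<Sum>d | d dvd l. \<i> ^ k * complex_of_real (r d / real l ^ k)"
  define r where "r d = (lip k (2 * pi * (real (l div d) * y)) + lip k (2 * pi * (real d / y)) - 1) / y" for d
  define I where "I = ({1, -1} :: int set) \<times> {d. d dvd l}"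
  define Z where "Z = (\<Union>(s, d)\<in>I. block l s d)"
  note D = degenerate_mats_blocks[OF l, folded I_def Z_def]
  have fI: "finite I" using l by (simp add: I_def)
  have "((\<lambda>M. axis_term k M y) has_sum (\<Sum>i\<in>I. case i of (s, d) \<Rightarrow> \<i> ^ k * of_real (r d / real l ^ k))) Z"
    unfolding Z_def
  proof (rule sum_has_sum[OF fI])
    fix i assume "i \<in> I"
    then obtain s d where i: "i = (s, d)" "s = 1 \<or> s = -1" "d dvd l" by (auto simp: I_def)
    show "((\<lambda>M. axis_term k M y) has_sum (case i of (s, d) \<Rightarrow> \<i> ^ k * of_real (r d / real l ^ k))) (case i of (s, d) \<Rightarrow> block l s d)"
      using block_has_sum[OF l i(3) k i(2) y] by (simp add: i(1) r_def mult.commute)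
  qed (rule D(3))
  also have "(\<Sum>i\<in>I. case i of (s, d) \<Rightarrow> \<i> ^ k * of_real (r d / real l ^ k)) = 2 * (?S r)"
    unfolding I_def by (simp add: sum.cartesian_product[symmetric])
  finally have S: "((\<lambda>M. axis_term k M y) has_sum (2 * (?S r))) Z" .
  have "inj_on row_swap Z" by (auto simp: inj_on_def row_swap_def)
  hence "((\<lambda>M. axis_term k M y) has_sum (2 * (?S r))) (row_swap ` Z)"
    using S by (subst has_sum_reindex) (simp_all add: o_def axis_term_row_swap[OF k(1)])
  from has_sum_Un_disjoint[OF S this D(2)]
  have "((\<lambda>M. axis_term k M y) has_sum (4 * (?S r))) (degenerate_mats l)"
    unfolding D(1) by simp
  also have "4 * (?S r) = \<i> ^ k * of_real (4 / real l ^ k * (\<Sum>d | d dvd l. r d))"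
    by (simp add: sum_distrib_left sum_divide_distrib mult_ac)
  finally show ?thesis unfolding r_def .
qed

lemma Phi_deriv_lip:
  assumes "k \<ge> 1" "X > 0"
  shows "(Phi k has_real_derivative - (lip k X / X)) (at X)"
  using Phi_deriv[OF assms(2), of "k - 1"] assms by (cases k) (simp_all add: lip_def)

lemma lip_isCont: "X > 0 \<Longrightarrow> isCont (lip k) X"
  unfolding lip_def[abs_def]
  by (intro continuous_intros DERIV_isCont[OF psum_deriv]) auto

text \<open>For each divisor \<open>d\<close> a primitive is \<open>Phi\<close> at
  \<open>2 pi d / y\<close> minus \<open>Phi\<close> at \<open>2 pi (l / d) y\<close> minus
  \<open>ln y\<close>. At each end one argument tends to infinity and contributes nothing, while the
  other tends to 0 and its logarithm cancels \<open>ln y\<close>. The two limits differ by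
  \<open>2 * harm (k - 1) - ln (2 pi d) - ln (2 pi l / d)\<close>, which no longer depends on
  \<open>d\<close>.\<close>

lemma degenerate_integral:
  assumes l: "l > 0" and k: "even k" "k \<ge> 2"
    and int: "integrable lborel (\<lambda>y. \<Sum>\<^sub>\<infinity>M\<in>degenerate_mats l. axis_term k M y)"
  shows "(LBINT y. (\<Sum>\<^sub>\<infinity>M\<in>degenerate_mats l. axis_term k M y)) =
     \<i> ^ k * of_real (4 / real l ^ k * (real (divisor_count l) * (2 * harm (k - 1) - 2 * ln (2 * pi) - ln (real l))))"
proof -
  let ?X = "\<lambda>d y. 2 * pi * (real d / y)"
  let ?Z = "degenerate_mats l"
  let ?D = "{d. d dvd l}"
  define r where "r y = (\<Sum>d\<in>?D. (lip k (2 * pi * (real (l div d) * y)) + lip k (?X d y) - 1) / y)" for y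
  define R where "R y = (\<Sum>d\<in>?D. Phi k (?X d y) - Phi k (2 * pi * (real (l div d) * y)) - ln y)" for y
  define c where "c = \<i> ^ k * complex_of_real (4 / real l ^ k)"
  have c0: "c \<noteq> 0" using l by (simp add: c_def)
  have dd: "d > 0" "l div d > 0" if "d \<in> ?D" for d using that l by (auto intro: Nat.gr0I)
  have A: "(\<Sum>\<^sub>\<infinity>M\<in>?Z. axis_term k M y) = c * of_real (ipos y *\<^sub>R r y)" for y
  proof (cases "y > 0")
    case True
    show ?thesis using infsumI[OF degenerate_sum[OF l k True]] True by (simp add: r_def c_def)
  qed (simp add: axis_term_def)
  have k1: "k \<ge> 1" using k by simp
  have ri: "integrable lborel (\<lambda>y. ipos y *\<^sub>R r y)"
  proof -
    have "integrable lborel (\<lambda>y. (1 / c) * (c * complex_of_real (ipos y *\<^sub>R r y)))"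
      using int unfolding A by (rule integrable_mult_right)
    hence "integrable lborel (\<lambda>y. complex_of_real (ipos y *\<^sub>R r y))"
      using c0 by (simp only: mult.assoc[symmetric]) simp
    from integrable_Re[OF this] show ?thesis by simp
  qed
  have deriv: "(R has_vector_derivative r y) (at y)" if y: "y > 0" for y
  proof -
    have "(R has_real_derivative r y) (at y)" unfolding R_def r_def
    proof (rule DERIV_sum)
      fix d assume d: "d \<in> ?D"
      let ?a = "real (l div d)"
      have p: "?X d y > 0" "2 * pi * (?a * y) > 0" using dd[OF d] y by auto
      have 1: "((\<lambda>y. ?X d y) has_real_derivative - (?X d y) / y) (at y)"
        using y by (auto intro!: derivative_eq_intros simp: power2_eq_square)
      have 2: "((\<lambda>y. 2 * pi * (?a * y)) has_real_derivative 2 * pi * ?a) (at y)"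
        by (auto intro!: derivative_eq_intros)
      have 3: "(ln has_real_derivative 1 / y) (at y)" using y by (auto intro!: derivative_eq_intros)
      have "((\<lambda>y. Phi k (?X d y) - Phi k (2 * pi * (?a * y)) - ln y) has_real_derivative
        - (lip k (?X d y) / (?X d y)) * (- (?X d y) / y)
        - (- (lip k (2 * pi * (?a * y)) / (2 * pi * (?a * y)))) * (2 * pi * ?a) - 1 / y) (at y)"
        by (intro DERIV_diff DERIV_chain2[OF Phi_deriv_lip[OF k1 p(1)] 1] DERIV_chain2[OF Phi_deriv_lip[OF k1 p(2)] 2] 3)
      also have "- (lip k (?X d y) / (?X d y)) * (- (?X d y) / y)
        - (- (lip k (2 * pi * (?a * y)) / (2 * pi * (?a * y)))) * (2 * pi * ?a) - 1 / y
        = (lip k (2 * pi * (?a * y)) + lip k (?X d y) - 1) / y"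
      proof -
        have gen: "- (P / X) * (- X / y) - (- (Q / (2 * pi * (?a * y)))) * (2 * pi * ?a) - 1 / y = (Q + P - 1) / y" if "X \<noteq> 0" for P X Q
          using that y dd[OF d] by (simp add: field_simps)
        show ?thesis by (rule gen[OF less_imp_neq[OF p(1), symmetric]])
      qed
      finally show "((\<lambda>y. Phi k (?X d y) - Phi k (2 * pi * (?a * y)) - ln y) has_real_derivative
          (lip k (2 * pi * (?a * y)) + lip k (?X d y) - 1) / y) (at y)" .
    qed
    thus ?thesis by (simp add: has_real_derivative_iff_has_vector_derivative)
  qed
  have cont: "isCont r y" if y: "y > 0" for y
    unfolding r_def[abs_def]
  proof (rule continuous_sum)
    fix d assume d: "d \<in> ?D"
    let ?a = "real (l div d)"
    have p: "?X d y > 0" "2 * pi * (?a * y) > 0" using dd[OF d] y by auto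
    have "isCont (\<lambda>y. lip k (2 * pi * (?a * y))) y"
      by (rule isCont_o2[OF _ lip_isCont]) (use p in \<open>auto intro!: continuous_intros\<close>)
    moreover have "isCont (\<lambda>y. lip k (?X d y)) y"
      by (rule isCont_o2[OF _ lip_isCont]) (use p y in \<open>auto intro!: continuous_intros\<close>)
    ultimately show "isCont (\<lambda>y. (lip k (2 * pi * (?a * y)) + lip k (?X d y) - 1) / y) y"
      using y by (intro continuous_intros) auto
  qed
  have P0: "((\<lambda>X. Phi k X + ln X) \<longlongrightarrow> harm (k - 1)) (at_right 0)" using Phi_at_0[of "k - 1"] k1 by simp
  have top: "(R \<longlongrightarrow> (\<Sum>d\<in>?D. harm (k - 1) - ln (2 * pi * real d))) at_top"
    unfolding R_def[abs_def]
  proof (rule tendsto_sum)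
    fix d assume d: "d \<in> ?D"
    let ?a = "real (l div d)"
    have p: "real d > 0" "?a > 0" using dd[OF d] by auto
    have f: "filterlim (\<lambda>y. 2 * pi * (x / y)) (at_right 0) at_top" "filterlim (\<lambda>y. 2 * pi * (x * y)) at_top at_top" if "x > 0" for x
      using that pi_gt_zero by real_asymp+
    note f1 = f(1)[OF p(1)] and f2 = f(2)[OF p(2)]
    have "((\<lambda>y. (Phi k (?X d y) + ln (?X d y)) - Phi k (2 * pi * (?a * y)) - ln (2 * pi * real d)) \<longlongrightarrow> harm (k - 1) - 0 - ln (2 * pi * real d)) at_top"
      by (intro tendsto_diff tendsto_const filterlim_compose[OF P0 f1] filterlim_compose[OF Phi_at_top f2])
    moreover have "\<forall>\<^sub>F y in at_top. (Phi k (?X d y) + ln (?X d y)) - Phi k (2 * pi * (?a * y)) - ln (2 * pi * real d)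
        = Phi k (?X d y) - Phi k (2 * pi * (?a * y)) - ln y"
      using eventually_gt_at_top[of 0]
    proof eventually_elim
      case (elim y)
      have "ln (?X d y) = ln (2 * pi * real d) - ln y"
        using elim p ln_div[of "2 * pi * real d" y] by simp
      thus ?case by simp
    qed
    ultimately show "((\<lambda>y. Phi k (?X d y) - Phi k (2 * pi * (?a * y)) - ln y) \<longlongrightarrow> harm (k - 1) - ln (2 * pi * real d)) at_top"
      by (simp add: Lim_transform_eventually)
  qed
  have bot: "(R \<longlongrightarrow> (\<Sum>d\<in>?D. ln (2 * pi * real (l div d)) - harm (k - 1))) (at_right 0)"
    unfolding R_def[abs_def]
  proof (rule tendsto_sum)
    fix d assume d: "d \<in> ?D"
    let ?a = "real (l div d)"
    have p: "real d > 0" "?a > 0" using dd[OF d] by auto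
    have f: "filterlim (\<lambda>y. 2 * pi * (x / y)) at_top (at_right 0)" "filterlim (\<lambda>y. 2 * pi * (x * y)) (at_right 0) (at_right 0)" if "x > 0" for x
      using that pi_gt_zero by real_asymp+
    note f1 = f(1)[OF p(1)] and f2 = f(2)[OF p(2)]
    have "((\<lambda>y. Phi k (?X d y) - (Phi k (2 * pi * (?a * y)) + ln (2 * pi * (?a * y))) + ln (2 * pi * ?a)) \<longlongrightarrow> 0 - harm (k - 1) + ln (2 * pi * ?a)) (at_right 0)"
      by (intro tendsto_add tendsto_diff tendsto_const filterlim_compose[OF P0 f2] filterlim_compose[OF Phi_at_top f1])
    moreover have "\<forall>\<^sub>F y in at_right 0. Phi k (?X d y) - (Phi k (2 * pi * (?a * y)) + ln (2 * pi * (?a * y))) + ln (2 * pi * ?a)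
        = Phi k (?X d y) - Phi k (2 * pi * (?a * y)) - ln y"
      using eventually_at_right_less[of 0]
    proof eventually_elim
      case (elim y)
      have "ln (2 * pi * (?a * y)) = ln (2 * pi * ?a) + ln y"
        using elim p ln_mult[of "2 * pi * ?a" y] by (simp add: mult.assoc)
      thus ?case by simp
    qed
    ultimately show "((\<lambda>y. Phi k (?X d y) - Phi k (2 * pi * (?a * y)) - ln y) \<longlongrightarrow> ln (2 * pi * ?a) - harm (k - 1)) (at_right 0)"
      by (simp add: Lim_transform_eventually)
  qed
  have "(LBINT y. ipos y *\<^sub>R r y) = (\<Sum>d\<in>?D. harm (k - 1) - ln (2 * pi * real d)) - (\<Sum>d\<in>?D. ln (2 * pi * real (l div d)) - harm (k - 1))"
    by (rule integral_FTC_pos[OF deriv cont ri bot top])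
  also have "... = (\<Sum>d\<in>?D. 2 * harm (k - 1) - 2 * ln (2 * pi) - ln (real l))"
    unfolding sum_subtractf[symmetric]
  proof (rule sum.cong)
    fix d assume d: "d \<in> ?D"
    have l': "real l = real (l div d) * real d" using d by (simp flip: of_nat_mult)
    have p: "real d > 0" "real (l div d) > 0" using dd[OF d] by auto
    have "ln (real l) = ln (real (l div d)) + ln (real d)" unfolding l' using p by (simp add: ln_mult)
    moreover have "ln (2 * pi * real d) = ln (2 * pi) + ln (real d)" using p by (intro ln_mult_pos) auto
    moreover have "ln (2 * pi * real (l div d)) = ln (2 * pi) + ln (real (l div d))" using p by (intro ln_mult_pos) auto
    ultimately show "harm (k - 1) - ln (2 * pi * real d) - (ln (2 * pi * real (l div d)) - harm (k - 1)) = 2 * harm (k - 1) - 2 * ln (2 * pi) - ln (real l)"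
      by linarith
  qed simp
  also have "... = real (divisor_count l) * (2 * harm (k - 1) - 2 * ln (2 * pi) - ln (real l))"
    by (simp add: divisor_count_def)
  finally have I: "(LBINT y. ipos y *\<^sub>R r y) = real (divisor_count l) * (2 * harm (k - 1) - 2 * ln (2 * pi) - ln (real l))" .
  have "(LBINT y. (\<Sum>\<^sub>\<infinity>M\<in>?Z. axis_term k M y)) = c * (LBINT y. of_real (ipos y *\<^sub>R r y))"
    unfolding A by (rule integral_mult_right_zero)
  also have "... = c * of_real (LBINT y. ipos y *\<^sub>R r y)" by (simp only: integral_complex_of_real)
  finally show ?thesis unfolding I c_def by (simp only: mult.assoc of_real_mult)
qed

section \<open>The moment as main term plus generic remainder\<close>

lemma moment_eq:
  assumes k: "even k" "k \<ge> 5" and l: "l > 0"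
  shows "(\<Sum>f\<in>primitive_forms (2*k). harmonic_weight (2*k) f * hecke_coeff (2*k) f l * (L_function (2*k) f (1/2))^2)
    = of_real (2 * real (divisor_count l) / sqrt (real l) * (2 * harm (k - 1) - 2 * ln (2 * pi) - ln (real l)))
      + of_real (real l powr (real k - 1/2)) * \<i> ^ k / 2 *
        (LBINT y. (\<Sum>\<^sub>\<infinity>M\<in>generic_mats l. axis_term k M y))"
    (is "?S = _ + of_real ?w * \<i> ^ k / 2 * (LBINT y. ?B y)")
proof -
  let ?A = "\<lambda>y. \<Sum>\<^sub>\<infinity>M\<in>degenerate_mats l. axis_term k M y"
  let ?g = "\<lambda>y. ray k (half_sum k (int l)) y"
  have k4: "k \<ge> 4" "k \<ge> 2" using k by auto
  note M = moment_eq_integral[OF k(2,1) l]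
  have Bi: "integrable lborel ?B"
  proof -
    obtain C :: real where C: "\<forall>k l. even k \<longrightarrow> k \<ge> 4 \<longrightarrow> l > 0 \<longrightarrow>
      integrable lborel (\<lambda>y. \<Sum>\<^sub>\<infinity>M\<in>generic_mats l. axis_term k M y)"
      using generic_terms_bound[of "1/3"] by (smt (verit) zero_less_divide_1_iff)
    thus ?thesis using k k4 l by blast
  qed
  have split: "?g y = ?A y + ?B y" for y
  proof -
    have "?g y = (\<Sum>\<^sub>\<infinity>M\<in>mats (int l). axis_term k M y)"
    proof (cases "y > 0")
      case True
      thus ?thesis unfolding half_sum_def axis_term_def
        by (simp only: infsum_scaleR_right infsum_cmult_left')
    qed (simp add: axis_term_def)
    also have "mats (int l) = degenerate_mats l \<union> generic_mats l" by blast
    also have "infsum (\<lambda>M. axis_term k M y) ... = ?A y + ?B y"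
      by (rule infsum_Un_disjoint) (use l k4 in \<open>auto intro!: abs_summable_summable[OF axis_term_abs_summable]\<close>)
    finally show ?thesis .
  qed
  \<comment> \<open>The degenerate part is integrable as the difference of the full integrand and
    the generic part, both already known to be integrable.\<close>
  have Ai: "integrable lborel ?A"
  proof -
    have "integrable lborel (\<lambda>y. ?g y - ?B y)" by (rule Bochner_Integration.integrable_diff[OF M(1) Bi])
    thus ?thesis unfolding split by simp
  qed
  have "(LBINT y. ?g y) = (LBINT y. ?A y) + (LBINT y. ?B y)"
    unfolding split by (rule Bochner_Integration.integral_add[OF Ai Bi])
  also have "(LBINT y. ?A y) = \<i> ^ k * of_real (4 / real l ^ k * (real (divisor_count l) * (2 * harm (k - 1) - 2 * ln (2 * pi) - ln (real l))))"
    by (rule degenerate_integral[OF l k(1) k4(2) Ai])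
  finally have I: "(LBINT y. ?g y) = \<i> ^ k * of_real (4 / real l ^ k * (real (divisor_count l) * (2 * harm (k - 1) - 2 * ln (2 * pi) - ln (real l)))) + (LBINT y. ?B y)" .
  note ik = i_power_even(1)[OF k(1)]
  have w: "?w * (4 / real l ^ k) / 2 = 2 / sqrt (real l)"
    using l by (simp add: powr_diff powr_realpow powr_half_sqrt)
  have "?S = of_real ?w * \<i> ^ k / 2 * (LBINT y. ?g y)" by (rule M(2))
  also have "... = (\<i> ^ k * \<i> ^ k) * of_real (?w * (4 / real l ^ k) / 2 * (real (divisor_count l) * (2 * harm (k - 1) - 2 * ln (2 * pi) - ln (real l))))
      + of_real ?w * \<i> ^ k / 2 * (LBINT y. ?B y)"
    unfolding I by (simp add: algebra_simps)
  finally show ?thesis unfolding ik w by simp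
qed

theorem theorem6p4:
  fixes \<epsilon> C :: real
  assumes "\<epsilon> > 0" and "C > 0"
  shows "\<exists>K::real. \<forall>(k::nat) (l::nat).
    1 \<le> l \<and> 12 \<le> 2 * k \<and> even k \<and> real l \<le> C * (real k)\<^sup>2 \<longrightarrow>
    norm ((\<Sum>f\<in>primitive_forms (2 * k).
             harmonic_weight (2 * k) f * hecke_coeff (2 * k) f l * (L_function (2 * k) f (1 / 2))\<^sup>2)
          - complex_of_real
              (2 * real (divisor_count l) / sqrt (real l) *
                (2 * ln (real k) - ln (real l) - 2 * ln (2 * pi) + 2 * euler_mascheroni)))
      \<le> K * (real l powr (1 / 2 + \<epsilon>) / sqrt (real k))"
proof -
  let ?H = "\<lambda>k l. 2 * harm (k - 1) - 2 * ln (2 * pi) - ln (real l)"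
  let ?L = "\<lambda>k l. 2 * ln (real k) - ln (real l) - 2 * ln (2 * pi) + 2 * euler_mascheroni"
  \<comment> \<open>The generic part loses \<open>3 * \<delta>\<close> in the exponent of
    \<open>l\<close>, which must not exceed \<open>\<epsilon>\<close>; the cap 1/3 is the one
    required by \<open>weight_bound\<close>.\<close>
  define \<delta> where "\<delta> = min (\<epsilon> / 3) (1 / 3)"
  have \<delta>: "\<delta> > 0" "\<delta> \<le> 1/3" "3 * \<delta> \<le> \<epsilon>" using assms by (auto simp: \<delta>_def)
  obtain B where B: "B \<ge> 0" "\<And>k l. even k \<Longrightarrow> k \<ge> 4 \<Longrightarrow> l > 0 \<Longrightarrow>
      integrable lborel (\<lambda>y. \<Sum>\<^sub>\<infinity>M\<in>generic_mats l. axis_term k M y) \<and>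
      norm (LBINT y. (\<Sum>\<^sub>\<infinity>M\<in>generic_mats l. axis_term k M y))
        \<le> B * (real l powr (1 - real k + 3*\<delta>) / sqrt (real k))" using generic_terms_bound[OF \<delta>(1,2)] by blast
  obtain D where D: "D \<ge> 1" "\<And>n. n > 0 \<Longrightarrow> real (divisor_count n) \<le> D * real n powr \<delta>"
    using divisor_bound[OF \<delta>(1)] by blast
  show ?thesis
  \<comment> \<open>\<open>B / 2\<close> bounds the generic part, whose prefactor contains 1/2, and
    \<open>4 * D\<close> pays for replacing the harmonic number: a factor 2 in front of the divisor
    count and a factor 2 at \<open>harm (k - 1)\<close>.\<close>
  proof (intro exI[of _ "B / 2 + 4 * D"] allI impI)
    fix k l :: nat assume H: "1 \<le> l \<and> 12 \<le> 2 * k \<and> even k \<and> real l \<le> C * (real k)\<^sup>2"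
    hence k: "even k" "k \<ge> 5" "k \<ge> 4" "k \<ge> 6" and l: "l > 0" by auto
    let ?X = "real l powr (1 / 2 + \<epsilon>) / sqrt (real k)"
    let ?S = "\<Sum>f\<in>primitive_forms (2 * k). harmonic_weight (2 * k) f * hecke_coeff (2 * k) f l * (L_function (2 * k) f (1 / 2))\<^sup>2"
    let ?m = "2 * real (divisor_count l) / sqrt (real l)"
    define J where "J = (LBINT y. (\<Sum>\<^sub>\<infinity>M\<in>generic_mats l. axis_term k M y))"
    define E where "E = complex_of_real (real l powr (real k - 1/2)) * \<i> ^ k / 2 * J"
    define h where "h = harm (k - 1) - ln (real k) - (euler_mascheroni :: real)"
    have S: "?S = of_real (?m * (?H k l)) + E"
      unfolding E_def J_def by (rule moment_eq[OF k(1,2) l])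
    have "?S - complex_of_real (?m * (?L k l)) =
        of_real (?m * (?H k l) - ?m * (?L k l)) + E"
      unfolding S by simp
    also have "?m * (?H k l) - ?m * (?L k l)
        = ?m * (2 * h)" unfolding h_def right_diff_distrib[symmetric] by (simp add: algebra_simps)
    finally have N: "norm (?S - complex_of_real (?m * (?L k l)))
        \<le> norm (complex_of_real (?m * (2 * h))) + norm E" by (simp only: norm_triangle_ineq)
    have M: "norm (complex_of_real (?m * (2 * h))) \<le> 4 * D * ?X"
    proof -
      \<comment> \<open>The two-sided bounds for Euler's constant, taken at \<open>k - 2\<close> so
        that \<open>harm (k - 1)\<close> meets \<open>ln k\<close>, give
        \<open>|h| <= 1 / (2 * (k - 1))\<close>; this is weakened to the shape of the error
        term.\<close>
      have hk: "\<bar>h\<bar> \<le> 1 / sqrt (real k)"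
      proof -
        have n: "Suc (k - 2) = k - 1" "k - 2 + 2 = k" "k - 2 + 1 = k - 1" using k by auto
        have "euler_mascheroni \<ge> harm (k - 1) - ln (real k) + 1 / real (2 * k)"
          "euler_mascheroni \<le> harm (k - 1) - ln (real k) + 1 / real (2 * (k - 1))"
          using euler_mascheroni_lower[of "k - 2"] euler_mascheroni_upper[of "k - 2"] unfolding n by auto
        hence "\<bar>h\<bar> \<le> 1 / real (2 * (k - 1))" unfolding h_def by (smt (verit) of_nat_0_le_iff zero_le_divide_1_iff)
        also have "... \<le> 1 / real k" using k by (intro divide_left_mono) auto
        also have "... \<le> 1 / sqrt (real k)"
        proof (rule divide_left_mono)
          have "sqrt (real k) * 1 \<le> sqrt (real k) * sqrt (real k)" using k by (intro mult_left_mono) auto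
          thus "sqrt (real k) \<le> real k" by simp
        qed (use k in auto)
        finally show ?thesis .
      qed
      have "real (divisor_count l) / sqrt (real l) \<le> real (divisor_count l) / 1"
        using l by (intro divide_left_mono) auto
      also have "... \<le> D * real l powr \<delta>" using D(2)[OF l] by simp
      also have "... \<le> D * real l powr (1 / 2 + \<epsilon>)" using l \<delta> D(1) by (intro mult_left_mono powr_mono) auto
      finally have t: "real (divisor_count l) / sqrt (real l) \<le> D * real l powr (1 / 2 + \<epsilon>)" .
      have "norm (complex_of_real (?m * (2 * h))) = 4 * (real (divisor_count l) / sqrt (real l)) * \<bar>h\<bar>"
        by (simp only: norm_of_real abs_mult) simp
      also have "... \<le> 4 * (D * real l powr (1 / 2 + \<epsilon>)) * (1 / sqrt (real k))"
        using t hk D(1) by (intro mult_mono) auto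
      finally show ?thesis by simp
    qed
    have E: "norm E \<le> B / 2 * ?X"
    proof -
      have "norm E = real l powr (real k - 1/2) / 2 * norm J" by (simp add: E_def norm_mult norm_power norm_divide)
      also have "... \<le> real l powr (real k - 1/2) / 2 * (B * (real l powr (1 - real k + 3*\<delta>) / sqrt (real k)))"
        unfolding J_def using B(2)[OF k(1,3) l] by (intro mult_left_mono) auto
      also have "... = B / 2 * ((real l powr (real k - 1/2) * real l powr (1 - real k + 3*\<delta>)) / sqrt (real k))" by simp
      also have "real l powr (real k - 1/2) * real l powr (1 - real k + 3*\<delta>) = real l powr (1 / 2 + 3 * \<delta>)"
        unfolding powr_add[symmetric] by (rule arg_cong[where f = "\<lambda>x. real l powr x"]) simp
      also have "B / 2 * (real l powr (1 / 2 + 3 * \<delta>) / sqrt (real k)) \<le> B / 2 * ?X"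
        using l \<delta> B(1) by (intro mult_left_mono divide_right_mono powr_mono) auto
      finally show ?thesis .
    qed
    have "(B / 2 + 4 * D) * ?X = 4 * D * ?X + B / 2 * ?X" by (simp only: distrib_right add.commute)
    thus "norm (?S - complex_of_real (?m * (?L k l)))
        \<le> (B / 2 + 4 * D) * ?X"
      using N M E by linarith
  qed
qed

end
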